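(* Let $T>0$, $s>0$, $d\ge1$, let $p\in L^\infty(\mathbb{R}^d)$ be non-negative and let $u_0\in H^s(\mathbb{R}^d)$. Consider the Cauchy problem $$i u_t(t,x)+(-\Delta)^s u(t,x)+p(x)u(t,x)=0,\quad (t,x)\in(0,T)\times\mathbb{R}^d,\qquad u(0,x)=u_0(x).\qquad ( * )$$ Let $(u_\varepsilon)_{\varepsilon\in(0,1]}$ be a very weak solution of $( * )$. Then, for any regularising families $(p_\varepsilon)_\varepsilon$ of the coefficient $p$ and $(u_{0,\varepsilon})_\varepsilon$ of the Cauchy data $u_0$, the net $(u_\varepsilon)_\varepsilon$ converges in $L^2$ as $\varepsilon\to0$ to the unique classical solution $u\in C([0,T];H^s)$ of $( * )$; that is, $\|u_\varepsilon(t,\cdot)-u(t,\cdot)\|_{L^2(\mathbb{R}^d)}\to 0$ as $\varepsilon\to 0$ for $t\in[0,T]$.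
   Context: $(-\Delta)^s$ is the fractional Laplacian on $\mathbb{R}^d$, i.e. the Fourier multiplier with symbol $|\xi|^{2s}$; $H^s(\mathbb{R}^d)=\{u\in L^2(\mathbb{R}^d):\|u\|_{H^s}:=\|u\|_{L^2}+\|(-\Delta)^{s/2}u\|_{L^2}<\infty\}$. Functions $u$ are complex-valued. Equations are understood in the sense of distributions on $(0,T)\times\mathbb{R}^d$; the classical solution is the unique solution of $( * )$ in $C([0,T];H^s)$. Regularising families. A Friedrichs mollifier is a function $\psi\in C_0^\infty(\mathbb{R}^d)$ with $\psi\ge0$ and $\int\psi=1$; put $\psi_\varepsilon(x)=\varepsilon^{-d}\psi(x/\varepsilon)$ for $\varepsilon\in(0,1]$. Regularising families of $p$ and $u_0$ are $p_\varepsilon=p*\psi_\varepsilon$ and $u_{0,\varepsilon}=u_0*\phi_\varepsilon$ with $\psi,\phi$ Friedrichs mollifiers (not necessarily distinct). Very weak solution. The very weak solution of $( * )$ associated with the regularising families $(p_\varepsilon)$, $(u_{0,\varepsilon})$ is the net $(u_\varepsilon)_{\varepsilon\in(0,1]}$ in $C([0,T];H^s)$ such that for each $\varepsilon\in(0,1]$ $$i\partial_t u_\varepsilon(t,x)+(-\Delta)^s u_\varepsilon(t,x)+p_\varepsilon(x)u_\varepsilon(t,x)=0,\qquad u_\varepsilon(0,x)=u_{0,\varepsilon}(x),$$ with $(u_\varepsilon)$ moderate: there are $N\in\mathbb{N}_0$, $c>0$ with $\|u_\varepsilon(t,\cdot)\|_{H^s}\le c\varepsilon^{-N}$ for all $t\in[0,T]$,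 $\varepsilon\in(0,1]$. *)

theory Defs
  imports "HOL-Analysis.Analysis"
begin

text \<open>
  The space \<open>\<real>\<^sup>d\<close> is a type of class \<open>euclidean_space\<close>, with \<open>d = DIM('a) \<ge> 1\<close>.
  Elements of \<open>L\<^sup>2\<close>, \<open>L\<^sup>\<infinity>\<close> and \<open>H\<^sup>s\<close> are represented by Borel measurable functions; the notions
  applied to them below do not depend on the representative, and equality of such elements is
  equality almost everywhere.
\<close>

definition L2 :: "('a::euclidean_space \<Rightarrow> complex) set" where
  "L2 = {f \<in> borel_measurable lborel. integrable lborel (\<lambda>x. (cmod (f x))\<^sup>2)}"

definition L2_norm :: "('a::euclidean_space \<Rightarrow> complex) \<Rightarrow> real" where
  "L2_norm f = sqrt (LINT x|lborel. (cmod (f x))\<^sup>2)"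

definition Linfty :: "('a::euclidean_space \<Rightarrow> real) set" where
  "Linfty = {f \<in> borel_measurable lborel. \<exists>C. AE x in lborel. \<bar>f x\<bar> \<le> C}"

text \<open>The unitary normalisation, for which the Laplacian has the symbol \<open>- |\<xi>|\<^sup>2\<close>.\<close>

definition fourier :: "('a::euclidean_space \<Rightarrow> complex) \<Rightarrow> 'a \<Rightarrow> complex" where
  "fourier f \<xi> = of_real ((2 * pi) powr (- real DIM('a) / 2)) * (LINT x|lborel. cis (- (x \<bullet> \<xi>)) * f x)"

text \<open>
  \<open>g\<close> is the Fourier-Plancherel transform of \<open>f\<close>, i.e. the \<open>L\<^sup>2\<close> limit of the transforms of the
  truncations of \<open>f\<close> to balls (which are integrable).
\<close>

definition has_L2_fourier ::
    "('a::euclidean_space \<Rightarrow> complex) \<Rightarrow> ('a \<Rightarrow> complex) \<Rightarrow> bool" where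
  "has_L2_fourier f g \<longleftrightarrow> f \<in> L2 \<and> g \<in> L2 \<and>
     ((\<lambda>R. L2_norm (\<lambda>\<xi>. fourier (\<lambda>x. indicator (cball 0 R) x *\<^sub>R f x) \<xi> - g \<xi>)) \<longlongrightarrow> 0) at_top"

definition has_fourier_multiplier ::
    "('a::euclidean_space \<Rightarrow> real) \<Rightarrow> ('a \<Rightarrow> complex) \<Rightarrow> ('a \<Rightarrow> complex) \<Rightarrow> bool" where
  "has_fourier_multiplier m f h \<longleftrightarrow>
     (\<exists>F H. has_L2_fourier f F \<and> has_L2_fourier h H \<and> (AE \<xi> in lborel. H \<xi> = of_real (m \<xi>) * F \<xi>))"

text \<open>
  \<open>has_frac_laplacian r f h\<close>: \<open>f\<close> lies in the \<open>L\<^sup>2\<close> domain of \<open>(-\<Delta>)\<^sup>r\<close> and \<open>(-\<Delta>)\<^sup>r f = h\<close>.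
  On this domain \<open>frac_laplacian\<close> chooses a representative of the class \<open>(-\<Delta>)\<^sup>r f\<close>;
  elsewhere it is meaningless.
\<close>

definition has_frac_laplacian ::
    "real \<Rightarrow> ('a::euclidean_space \<Rightarrow> complex) \<Rightarrow> ('a \<Rightarrow> complex) \<Rightarrow> bool" where
  "has_frac_laplacian r = has_fourier_multiplier (\<lambda>\<xi>. norm \<xi> powr (2 * r))"

definition frac_laplacian ::
    "real \<Rightarrow> ('a::euclidean_space \<Rightarrow> complex) \<Rightarrow> ('a \<Rightarrow> complex)" where
  "frac_laplacian r f = (SOME h. has_frac_laplacian r f h)"

definition sobolev :: "real \<Rightarrow> ('a::euclidean_space \<Rightarrow> complex) set" where
  "sobolev s = {u \<in> L2. \<exists>h. has_frac_laplacian (s / 2) u h}"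

definition sobolev_norm :: "real \<Rightarrow> ('a::euclidean_space \<Rightarrow> complex) \<Rightarrow> real" where
  "sobolev_norm s u = L2_norm u + L2_norm (frac_laplacian (s / 2) u)"

definition continuous_sobolev ::
    "real \<Rightarrow> real \<Rightarrow> (real \<Rightarrow> 'a::euclidean_space \<Rightarrow> complex) \<Rightarrow> bool" where
  "continuous_sobolev T s u \<longleftrightarrow>
     (\<forall>t\<in>{0..T}. u t \<in> sobolev s) \<and>
     (\<forall>t\<^sub>0\<in>{0..T}. ((\<lambda>t. sobolev_norm s (\<lambda>x. u t x - u t\<^sub>0 x)) \<longlongrightarrow> 0) (at t\<^sub>0 within {0..T}))"

text \<open>\<open>Ck k f\<close>: \<open>f\<close> is \<open>k\<close> times continuously differentiable on the whole space.\<close>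

primrec Ck :: "nat \<Rightarrow> ('a::euclidean_space \<Rightarrow> 'b::real_normed_vector) \<Rightarrow> bool" where
  "Ck 0 f \<longleftrightarrow> continuous_on UNIV f"
| "Ck (Suc k) f \<longleftrightarrow> (\<forall>x. f differentiable (at x)) \<and>
     (\<forall>v. Ck k (\<lambda>x. frechet_derivative f (at x) v))"

definition test_function ::
    "'a::euclidean_space set \<Rightarrow> ('a \<Rightarrow> 'b::real_normed_vector) \<Rightarrow> bool" where
  "test_function \<Omega> \<phi> \<longleftrightarrow> (\<forall>k. Ck k \<phi>) \<and>
     compact (closure {x. \<phi> x \<noteq> 0}) \<and> closure {x. \<phi> x \<noteq> 0} \<subseteq> \<Omega>"

definition friedrichs_mollifier :: "('a::euclidean_space \<Rightarrow> real) \<Rightarrow> bool" where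
  "friedrichs_mollifier \<psi> \<longleftrightarrow>
     test_function UNIV \<psi> \<and> (\<forall>x. 0 \<le> \<psi> x) \<and> (LINT x|lborel. \<psi> x) = 1"

definition rescaled :: "('a::euclidean_space \<Rightarrow> real) \<Rightarrow> real \<Rightarrow> 'a \<Rightarrow> real" where
  "rescaled \<psi> \<epsilon> x = \<psi> (x /\<^sub>R \<epsilon>) / \<epsilon> ^ DIM('a)"

definition convolve ::
    "('a::euclidean_space \<Rightarrow> 'b::{banach, second_countable_topology}) \<Rightarrow> ('a \<Rightarrow> real) \<Rightarrow> 'a \<Rightarrow> 'b" where
  "convolve f \<psi> x = (LINT y|lborel. \<psi> (x - y) *\<^sub>R f y)"

definition regularising_family ::
    "('a::euclidean_space \<Rightarrow> 'b::{banach, second_countable_topology}) \<Rightarrow> (real \<Rightarrow> 'a \<Rightarrow> 'b) \<Rightarrow> bool" where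
  "regularising_family f F \<longleftrightarrow>
     (\<exists>\<psi>. friedrichs_mollifier \<psi> \<and> (\<forall>\<epsilon>\<in>{0<..1}. F \<epsilon> = convolve f (rescaled \<psi> \<epsilon>)))"

text \<open>
  The equation \<open>i u\<^sub>t + (-\<Delta>)\<^sup>s u + p u = 0\<close> in the sense of distributions on \<open>(0,T) \<times> \<real>\<^sup>d\<close>.
  Derivatives of distributions are defined by transposition, with
  \<open>\<langle>i u\<^sub>t, \<phi>\<rangle> = \<langle>u, - i \<phi>\<^sub>t\<rangle>\<close> and, the symbol being even, \<open>\<langle>(-\<Delta>)\<^sup>s u, \<phi>\<rangle> = \<langle>u, (-\<Delta>)\<^sup>s \<phi>\<rangle>\<close>, where
  \<open>(-\<Delta>)\<^sup>s\<close> acts on the test function in the space variable. The space-time integral is written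
  as an iterated one because \<open>u t\<close> is only a representative of a class for each \<open>t\<close>, so that \<open>u\<close>
  need not be jointly measurable; for \<open>u \<in> C([0,T]; L\<^sup>2)\<close> the inner integral is continuous in \<open>t\<close>.
\<close>

definition schroedinger_distributional ::
    "real \<Rightarrow> real \<Rightarrow> ('a::euclidean_space \<Rightarrow> real) \<Rightarrow> (real \<Rightarrow> 'a \<Rightarrow> complex) \<Rightarrow> bool" where
  "schroedinger_distributional T s p u \<longleftrightarrow>
     (\<forall>\<phi> :: real \<times> 'a \<Rightarrow> complex. test_function ({0<..<T} \<times> UNIV) \<phi> \<longrightarrow>
        (LINT t:{0<..<T}|lborel. (LINT x|lborel.
           u t x * (- \<i> * vector_derivative (\<lambda>\<tau>. \<phi> (\<tau>, x)) (at t)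
                    + frac_laplacian s (\<lambda>y. \<phi> (t, y)) x
                    + of_real (p x) * \<phi> (t, x)))) = 0)"

definition classical_solution ::
    "real \<Rightarrow> real \<Rightarrow> ('a::euclidean_space \<Rightarrow> real) \<Rightarrow> ('a \<Rightarrow> complex) \<Rightarrow> (real \<Rightarrow> 'a \<Rightarrow> complex) \<Rightarrow> bool" where
  "classical_solution T s p u\<^sub>0 u \<longleftrightarrow>
     continuous_sobolev T s u \<and> schroedinger_distributional T s p u \<and>
     (AE x in lborel. u 0 x = u\<^sub>0 x)"

definition moderate ::
    "real \<Rightarrow> real \<Rightarrow> (real \<Rightarrow> real \<Rightarrow> 'a::euclidean_space \<Rightarrow> complex) \<Rightarrow> bool" where
  "moderate T s U \<longleftrightarrow>
     (\<exists>(N::nat) c. 0 < c \<and> (\<forall>t\<in>{0..T}. \<forall>\<epsilon>\<in>{0<..1}. sobolev_norm s (U \<epsilon> t) \<le> c * inverse (\<epsilon> ^ N)))"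

definition very_weak_solution ::
    "real \<Rightarrow> real \<Rightarrow> (real \<Rightarrow> 'a::euclidean_space \<Rightarrow> real) \<Rightarrow> (real \<Rightarrow> 'a \<Rightarrow> complex) \<Rightarrow>
     (real \<Rightarrow> real \<Rightarrow> 'a \<Rightarrow> complex) \<Rightarrow> bool" where
  "very_weak_solution T s P U\<^sub>0 U \<longleftrightarrow>
     (\<forall>\<epsilon>\<in>{0<..1}. classical_solution T s (P \<epsilon>) (U\<^sub>0 \<epsilon>) (U \<epsilon>)) \<and> moderate T s U"

end

theory Submission
  imports Defs "HOL-Probability.Characteristic_Functions"
begin

text \<open>
  On the Fourier side the equation reads \<open>u' = \<i> (m u + V u)\<close> with the real multiplier
  \<open>m(\<xi>) = |\<xi>|\<^sup>2\<^sup>s\<close> and the bounded symmetric operator \<open>V = FT \<circ> p \<circ> FT\<^sup>-\<^sup>1\<close>. The terms \<open>\<i> m u\<close> and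
  \<open>\<i> V u\<close> are orthogonal to \<open>u\<close> in the real Hilbert space \<open>L\<^sup>2\<close>, so the norm is conserved. If \<open>u\<close> solves
  the equation with \<open>V\<close> and \<open>x\<^sub>k\<close> the one with \<open>V\<^sub>k\<close>, then \<open>w = x\<^sub>k - u\<close> solves
  \<open>w' = \<i> (m w + V\<^sub>k w + (V\<^sub>k - V) u)\<close>; only the last term changes the norm of \<open>w\<close>, and
  \<open>|w(t)|\<^sup>2 \<le> |w(0)|\<^sup>2 + 2 sup |w| \<integral> |(V\<^sub>k - V) u|\<close>, the integral being over \<open>[0,t]\<close>.
  Hence strong convergence of the potentials and convergence of the data suffice
  (\<open>perturbation_tendsto\<close>). Mollified data converge in \<open>L\<^sup>2\<close> (\<open>approximate_identity\<close>). Mollifications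
  of a merely bounded potential in general do not converge uniformly, but the multiplication operators
  converge strongly (\<open>mollified_mult_tendsto\<close>). Together these facts give the asserted convergence.

  The unbounded symbol is handled by the cut-offs \<open>P n\<close> to the set where \<open>m \<le> n\<close>. There the
  generator is bounded and the equation an ordinary differential equation in a Hilbert space;
  \<open>weak_solution\<close> requires it for every cut-off, and the energy identity \<open>weak_solution_energy\<close> follows by
  letting \<open>n\<close> tend to infinity. Solutions exist because the substitution \<open>u = e\<^sup>i\<^sup>t\<^sup>m v\<close> removes the unbounded
  term, leaving an equation that Picard iteration solves (\<open>weak_solution_exists\<close>). That they stay in
  \<open>H\<^sup>s\<close>, the domain of the square root of \<open>m\<close>, is seen on Galerkin approximations, whose energy is conserved
  and bounds that norm uniformly (\<open>solution_bounds\<close>); continuity in \<open>H\<^sup>s\<close> follows by interpolation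
  for regular data and by uniform approximation in general (\<open>evolution_exists\<close>).

  It remains to translate. The Fourier--Plancherel transform is shown to be unitary by Gaussian
  regularisation (\<open>plancherel_L1_L2\<close>). A distributional solution, tested with products
  \<open>\<theta>(t) \<kappa>(x)\<close>, satisfies by the lemma of du Bois-Reymond the equation integrated in time and paired
  with any test function in space (\<open>schroedinger_tested\<close>); as these are sufficiently dense
  (\<open>orthogonal_to_weighted_test_functions\<close>), the cut-off equations hold
  (\<open>classical_imp_weak_solution\<close>). This also gives uniqueness of the classical solution. Conversely,
  integration by parts in time in the cut-off equations and a passage to the limit give the
  distributional equation (\<open>weak_solution_imp_distributional\<close>), hence existence.
\<close>

section \<open>The Hilbert space of square-integrable functions\<close>

lemma borel_measurable_cnj [measurable (raw)]:
  "f \<in> borel_measurable M \<Longrightarrow> (\<lambda>x. cnj (f x)) \<in> borel_measurable M"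
  by (rule borel_measurable_continuous_on[of cnj]) (intro continuous_intros)

lemma L2_measurable [measurable_dest, simp]: "f \<in> L2 \<Longrightarrow> f \<in> borel_measurable borel"
  by (simp add: L2_def)

lemma L2_integrable: "f \<in> L2 \<Longrightarrow> integrable lborel (\<lambda>x. (cmod (f x))\<^sup>2)"
  unfolding L2_def by blast

lemma L2I:
  assumes "f \<in> borel_measurable lborel" "integrable lborel (\<lambda>x. (cmod (f x))\<^sup>2)"
  shows "f \<in> L2"
  using assms unfolding L2_def by blast

lemma L2_boundI:
  assumes [measurable]: "f \<in> borel_measurable lborel"
    and "integrable lborel w" and "AE x in lborel. (cmod (f x))\<^sup>2 \<le> w x"
  shows "f \<in> L2"
proof (rule L2I)
  show "integrable lborel (\<lambda>x. (cmod (f x))\<^sup>2)"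
    by (rule Bochner_Integration.integrable_bound[OF assms(2)]) (use assms(3) in auto)
qed fact

lemma cmod_add_power2_le: "(cmod (a + b))\<^sup>2 \<le> 2 * (cmod a)\<^sup>2 + 2 * (cmod b)\<^sup>2"
proof -
  have "(cmod (a + b))\<^sup>2 \<le> (cmod a + cmod b)\<^sup>2"
    by (intro power_mono norm_triangle_ineq) auto
  also have "\<dots> \<le> 2 * (cmod a)\<^sup>2 + 2 * (cmod b)\<^sup>2"
    using sum_squares_bound[of "cmod a" "cmod b"] by (simp add: power2_sum)
  finally show ?thesis .
qed

lemma cmod_mult_le: "cmod (a * b) \<le> (cmod a)\<^sup>2 + (cmod b)\<^sup>2"
proof -
  have "0 \<le> cmod a * cmod b" by simp
  then show ?thesis
    using sum_squares_bound[of "cmod a" "cmod b"] unfolding norm_mult mult.assoc by linarith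
qed

lemma L2_add:
  assumes "f \<in> L2" "g \<in> L2"
  shows "(\<lambda>x. f x + g x) \<in> L2"
proof (rule L2_boundI)
  show "integrable lborel (\<lambda>x. 2 * (cmod (f x))\<^sup>2 + 2 * (cmod (g x))\<^sup>2)"
    using assms by (auto intro!: Bochner_Integration.integrable_add simp: L2_integrable)
qed (use assms in \<open>auto simp: cmod_add_power2_le\<close>)

definition ess_bounded :: "('a::euclidean_space \<Rightarrow> complex) \<Rightarrow> bool" where
  "ess_bounded m \<longleftrightarrow> m \<in> borel_measurable lborel \<and> (\<exists>C. AE x in lborel. cmod (m x) \<le> C)"

lemma ess_boundedD [measurable_dest, simp]: "ess_bounded m \<Longrightarrow> m \<in> borel_measurable borel"
  by (simp add: ess_bounded_def)

lemma ess_boundedI: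
  "m \<in> borel_measurable lborel \<Longrightarrow> (\<And>x. cmod (m x) \<le> C) \<Longrightarrow> ess_bounded m"
  unfolding ess_bounded_def by auto

lemma ess_bounded_const [simp]: "ess_bounded (\<lambda>_. c)"
  by (rule ess_boundedI[of _ "cmod c"]) auto

lemma ess_bounded_mult [intro]:
  assumes "ess_bounded m" "ess_bounded n" shows "ess_bounded (\<lambda>x. m x * n x)"
proof -
  obtain C D where "AE x in lborel. cmod (m x) \<le> C" "AE x in lborel. cmod (n x) \<le> D"
    using assms unfolding ess_bounded_def by auto
  then have "AE x in lborel. cmod (m x * n x) \<le> \<bar>C\<bar> * \<bar>D\<bar>"
    by eventually_elim (auto simp: norm_mult intro!: mult_mono)
  then show ?thesis using assms unfolding ess_bounded_def by (auto intro: ess_boundedD)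
qed

lemma ess_bounded_cnj [intro]: "ess_bounded m \<Longrightarrow> ess_bounded (\<lambda>x. cnj (m x))"
  unfolding ess_bounded_def by auto

lemma ess_bounded_diff [intro]:
  assumes "ess_bounded m" "ess_bounded n" shows "ess_bounded (\<lambda>x. m x - n x)"
proof -
  obtain C D where "AE x in lborel. cmod (m x) \<le> C" "AE x in lborel. cmod (n x) \<le> D"
    using assms unfolding ess_bounded_def by auto
  then have "AE x in lborel. cmod (m x - n x) \<le> C + D"
    by eventually_elim (metis add_mono norm_triangle_ineq4 order_trans)
  then show ?thesis using assms unfolding ess_bounded_def by (auto intro: ess_boundedD)
qed

lemma L2_mult:
  assumes "ess_bounded m" "f \<in> L2"
  shows "(\<lambda>x. m x * f x) \<in> L2"
proof -
  obtain C where C: "AE x in lborel. cmod (m x) \<le> C"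
    using assms unfolding ess_bounded_def by auto
  show ?thesis
  proof (rule L2_boundI)
    show "integrable lborel (\<lambda>x. C\<^sup>2 * (cmod (f x))\<^sup>2)"
      using assms by (auto simp: L2_integrable)
    show "AE x in lborel. (cmod (m x * f x))\<^sup>2 \<le> C\<^sup>2 * (cmod (f x))\<^sup>2"
      using C
    proof eventually_elim
      case (elim x)
      then have "(cmod (m x))\<^sup>2 \<le> C\<^sup>2" by (intro power_mono) auto
      then show ?case by (simp add: norm_mult power_mult_distrib mult_right_mono)
    qed
  qed (use assms in auto)
qed

lemma L2_scale: "f \<in> L2 \<Longrightarrow> (\<lambda>x. c * f x) \<in> L2"
  using L2_mult[of "\<lambda>_. c" f] by simp

lemma L2_scaleR: "f \<in> L2 \<Longrightarrow> (\<lambda>x. c *\<^sub>R f x) \<in> L2"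
  using L2_scale[of f "of_real c"] by (simp add: scaleR_conv_of_real)

lemma L2_minus: "f \<in> L2 \<Longrightarrow> (\<lambda>x. - f x) \<in> L2"
  using L2_scale[of f "-1"] by simp

lemma L2_diff: "f \<in> L2 \<Longrightarrow> g \<in> L2 \<Longrightarrow> (\<lambda>x. f x - g x) \<in> L2"
  using L2_add[OF _ L2_minus, of f g] by simp

lemma L2_cnj: "f \<in> L2 \<Longrightarrow> (\<lambda>x. cnj (f x)) \<in> L2"
  unfolding L2_def by auto

lemma L2_zero [simp]: "(\<lambda>_. 0) \<in> L2"
  unfolding L2_def by auto

lemma L2_cong_AE:
  assumes "f \<in> L2" "g \<in> borel_measurable lborel" "AE x in lborel. f x = g x"
  shows "g \<in> L2"
  by (rule L2_boundI[OF assms(2) L2_integrable[OF assms(1)]]) (use assms(3) in auto)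

lemma L2_mult_integrable:
  assumes "f \<in> L2" "g \<in> L2"
  shows "integrable lborel (\<lambda>x. f x * g x)"
  by (rule Bochner_Integration.integrable_bound
        [OF Bochner_Integration.integrable_add[OF L2_integrable[OF assms(1)] L2_integrable[OF assms(2)]]])
     (use assms cmod_mult_le in auto)

definition L2_eq :: "('a::euclidean_space \<Rightarrow> complex) \<Rightarrow> ('a \<Rightarrow> complex) \<Rightarrow> bool" where
  "L2_eq f g \<longleftrightarrow> f \<in> L2 \<and> g \<in> L2 \<and> (AE x in lborel. f x = g x)"

text \<open>The equivalence is partial: it is reflexive on square-integrable functions only. Since \<open>rep_ltwo\<close>
  picks an arbitrary representative, identities between representatives hold almost everywhere, and
  the proofs below combine such identities pointwise outside a null set.\<close>

quotient_type (overloaded) 'a ltwo = "'a::euclidean_space \<Rightarrow> complex" / partial: L2_eq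
proof (rule part_equivpI)
  show "\<exists>f. L2_eq f f" by (rule exI[of _ "\<lambda>_. 0"]) (simp add: L2_eq_def)
  show "symp L2_eq" by (rule sympI) (auto simp: L2_eq_def)
  show "transp L2_eq"
  proof (rule transpI)
    fix f g h
    assume "L2_eq f g" "L2_eq g h"
    moreover from this have "AE x in lborel. f x = g x" "AE x in lborel. g x = h x"
      by (auto simp: L2_eq_def)
    then have "AE x in lborel. f x = h x" by eventually_elim simp
    ultimately show "L2_eq f h" by (simp add: L2_eq_def)
  qed
qed

lemma rep_L2 [simp]: "rep_ltwo f \<in> L2"
  using Quotient3_rep_reflp[OF Quotient3_ltwo, of f] unfolding L2_eq_def by blast

lemma rep_measurable [measurable]: "rep_ltwo f \<in> borel_measurable borel"
  by (rule L2_measurable) simp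

lemma abs_rep [simp]: "abs_ltwo (rep_ltwo f) = f"
  by (rule Quotient3_abs_rep[OF Quotient3_ltwo])

lemma abs_eq_iff: "f \<in> L2 \<Longrightarrow> g \<in> L2 \<Longrightarrow> abs_ltwo f = abs_ltwo g \<longleftrightarrow> (AE x in lborel. f x = g x)"
  using Quotient3_rel[OF Quotient3_ltwo, of f g] by (auto simp: L2_eq_def)

lemma rep_abs: "f \<in> L2 \<Longrightarrow> AE x in lborel. rep_ltwo (abs_ltwo f) x = f x"
  using Quotient3_rep_abs[OF Quotient3_ltwo, of f] by (simp add: L2_eq_def)

lemma ltwo_eqI: "(AE x in lborel. rep_ltwo f x = rep_ltwo g x) \<Longrightarrow> f = g"
  using abs_eq_iff[of "rep_ltwo f" "rep_ltwo g"] by simp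

text \<open>The space becomes a real inner product space, with the real part of the complex inner product. The
  complex structure is carried by the isometry \<open>f \<mapsto> \<i> f\<close>, and the complex inner product can be
  recovered from \<open>inner f g\<close> and \<open>inner f (\<i> g)\<close>.\<close>

instantiation ltwo :: (euclidean_space) real_inner
begin

definition zero_ltwo :: "'a ltwo" where "zero_ltwo = abs_ltwo (\<lambda>_. 0)"
definition "plus_ltwo f g = abs_ltwo (\<lambda>x. rep_ltwo f x + rep_ltwo g x)"
definition "uminus_ltwo f = abs_ltwo (\<lambda>x. - rep_ltwo f x)"
definition "minus_ltwo f g = abs_ltwo (\<lambda>x. rep_ltwo f x - rep_ltwo g x)"
definition "scaleR_ltwo (c :: real) (f :: 'a ltwo) = abs_ltwo (\<lambda>x. c *\<^sub>R rep_ltwo f x)"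
definition "inner_ltwo f g = (LINT x|lborel. Re (rep_ltwo f x * cnj (rep_ltwo g x)))"
definition "norm_ltwo (f :: 'a ltwo) = sqrt (inner f f)"
definition "sgn_ltwo (f :: 'a ltwo) = scaleR (inverse (norm f)) f"
definition "dist_ltwo (f :: 'a ltwo) g = norm (f - g)"
definition "uniformity_ltwo = (INF e\<in>{0<..}. principal {(x :: 'a ltwo, y). dist x y < e})"
definition "open_ltwo (U :: 'a ltwo set) \<longleftrightarrow>
  (\<forall>x\<in>U. eventually (\<lambda>(x', y). x' = x \<longrightarrow> y \<in> U) uniformity)"

lemma rep_zero: "AE x in lborel. rep_ltwo 0 x = 0"
  unfolding zero_ltwo_def by (rule rep_abs) simp

lemma rep_add: "AE x in lborel. rep_ltwo (f + g) x = rep_ltwo f x + rep_ltwo g x"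
  unfolding plus_ltwo_def by (rule rep_abs) (simp add: L2_add)

lemma rep_uminus: "AE x in lborel. rep_ltwo (- f) x = - rep_ltwo f x"
  unfolding uminus_ltwo_def by (rule rep_abs) (simp add: L2_minus)

lemma rep_diff: "AE x in lborel. rep_ltwo (f - g) x = rep_ltwo f x - rep_ltwo g x"
  unfolding minus_ltwo_def by (rule rep_abs) (simp add: L2_diff)

lemma rep_scaleR: "AE x in lborel. rep_ltwo (c *\<^sub>R f) x = c *\<^sub>R rep_ltwo f x"
  unfolding scaleR_ltwo_def by (rule rep_abs) (simp add: L2_scaleR)

lemma inner_integrable: "integrable lborel (\<lambda>x. Re (rep_ltwo f x * cnj (rep_ltwo g x)))"
  by (intro integrable_Re L2_mult_integrable L2_cnj rep_L2)

lemma inner_cong_AE: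
  assumes "AE x in lborel. rep_ltwo f x = F x" "AE x in lborel. rep_ltwo g x = G x"
    and [measurable]: "F \<in> borel_measurable lborel" "G \<in> borel_measurable lborel"
  shows "inner f g = (LINT x|lborel. Re (F x * cnj (G x)))"
  unfolding inner_ltwo_def
proof (rule integral_cong_AE)
  show "AE x in lborel. Re (rep_ltwo f x * cnj (rep_ltwo g x)) = Re (F x * cnj (G x))"
    using assms(1,2) by eventually_elim simp
qed auto

instance
proof
  fix f g h :: "'a ltwo" and a b :: real
  show "f + g + h = f + (g + h)"
    by (rule ltwo_eqI) (use rep_add[of "f+g" h] rep_add[of f g] rep_add[of f "g+h"] rep_add[of g h] in
        \<open>eventually_elim, simp\<close>)
  show "f + g = g + f"
    by (rule ltwo_eqI) (use rep_add[of g f] rep_add[of f g] in \<open>eventually_elim, simp\<close>)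
  show "0 + f = f"
    by (rule ltwo_eqI) (use rep_add[of 0 f] rep_zero in \<open>eventually_elim, simp\<close>)
  show "- f + f = 0"
    by (rule ltwo_eqI) (use rep_add[of "-f" f] rep_uminus[of f] rep_zero in \<open>eventually_elim, simp\<close>)
  show "f - g = f + - g"
    by (rule ltwo_eqI) (use rep_add[of f "-g"] rep_uminus[of g] rep_diff[of f g] in \<open>eventually_elim, simp\<close>)
  show "a *\<^sub>R (f + g) = a *\<^sub>R f + a *\<^sub>R g"
    by (rule ltwo_eqI)
       (use rep_add[of f g] rep_scaleR[of a "f+g"] rep_add[of "a *\<^sub>R f" "a *\<^sub>R g"] rep_scaleR[of a f] rep_scaleR[of a g]
        in \<open>eventually_elim, simp add: scaleR_add_right\<close>)
  show "(a + b) *\<^sub>R f = a *\<^sub>R f + b *\<^sub>R f"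
    by (rule ltwo_eqI)
       (use rep_scaleR[of "a+b" f] rep_add[of "a *\<^sub>R f" "b *\<^sub>R f"] rep_scaleR[of a f] rep_scaleR[of b f]
        in \<open>eventually_elim, simp add: scaleR_add_left\<close>)
  show "a *\<^sub>R b *\<^sub>R f = (a * b) *\<^sub>R f"
    by (rule ltwo_eqI)
       (use rep_scaleR[of a "b *\<^sub>R f"] rep_scaleR[of b f] rep_scaleR[of "a*b" f] in \<open>eventually_elim, simp\<close>)
  show "1 *\<^sub>R f = f"
    by (rule ltwo_eqI) (use rep_scaleR[of 1 f] in \<open>eventually_elim, simp\<close>)
  show "inner f g = inner g f"
    unfolding inner_ltwo_def by (simp add: mult.commute)
  show "inner (f + g) h = inner f h + inner g h"
  proof -
    have "inner (f + g) h
        = (LINT x|lborel. Re ((rep_ltwo f x + rep_ltwo g x) * cnj (rep_ltwo h x)))"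
      by (rule inner_cong_AE) (use rep_add in auto)
    also have "\<dots> = (LINT x|lborel. Re (rep_ltwo f x * cnj (rep_ltwo h x)) + Re (rep_ltwo g x * cnj (rep_ltwo h x)))"
      by (simp add: algebra_simps)
    also have "\<dots> = inner f h + inner g h"
      unfolding inner_ltwo_def by (rule Bochner_Integration.integral_add) (rule inner_integrable)+
    finally show ?thesis .
  qed
  show "inner (a *\<^sub>R f) g = a * inner f g"
  proof -
    have "inner (a *\<^sub>R f) g = (LINT x|lborel. Re ((a *\<^sub>R rep_ltwo f x) * cnj (rep_ltwo g x)))"
      by (rule inner_cong_AE) (use rep_scaleR in auto)
    also have "\<dots> = a * inner f g"
      unfolding inner_ltwo_def by (subst integral_mult_right_zero[symmetric]) (simp add: algebra_simps)
    finally show ?thesis .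
  qed
  have eq: "Re (z * cnj z) = (cmod z)\<^sup>2" for z
    by (metis Re_complex_of_real complex_norm_square)
  show "0 \<le> inner f f"
    unfolding inner_ltwo_def eq by (intro integral_nonneg_AE) auto
  show "inner f f = 0 \<longleftrightarrow> f = 0"
  proof
    assume "inner f f = 0"
    then have "(LINT x|lborel. (cmod (rep_ltwo f x))\<^sup>2) = 0"
      unfolding inner_ltwo_def eq .
    then have ae: "AE x in lborel. (cmod (rep_ltwo f x))\<^sup>2 = 0"
      by (subst (asm) integral_nonneg_eq_0_iff_AE) (auto simp: L2_integrable)
    then show "f = 0"
      by (intro ltwo_eqI) (use rep_zero ae in \<open>eventually_elim, simp\<close>)
  next
    assume "f = 0"
    then have "inner f f = (LINT x|lborel. Re ((\<lambda>_::'a. 0) x * cnj 0))"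
      by (intro inner_cong_AE) (use rep_zero in auto)
    then show "inner f f = 0" by simp
  qed
  show "norm f = sqrt (inner f f)" by (rule norm_ltwo_def)
  show "sgn f = scaleR (inverse (norm f)) f" by (rule sgn_ltwo_def)
  show "dist f g = norm (f - g)" by (rule dist_ltwo_def)
  show "(uniformity :: ('a ltwo \<times> 'a ltwo) filter) = (INF e\<in>{0<..}. principal {(x, y). dist x y < e})"
    by (rule uniformity_ltwo_def)
  fix U :: "'a ltwo set"
  show "open U = (\<forall>x\<in>U. \<forall>\<^sub>F (x', y) in uniformity. x' = x \<longrightarrow> y \<in> U)"
    by (rule open_ltwo_def)
qed

end

lemma mult_cnj_Re: "Re (z * cnj z) = (cmod z)\<^sup>2"
  by (metis Re_complex_of_real complex_norm_square)

lemma norm_ltwo_L2_norm: "norm f = L2_norm (rep_ltwo f)"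
  unfolding norm_eq_sqrt_inner inner_ltwo_def L2_norm_def mult_cnj_Re ..

lemma L2_norm_cong_AE:
  assumes "AE x in lborel. f x = g x"
    and [measurable]: "f \<in> borel_measurable lborel" "g \<in> borel_measurable lborel"
  shows "L2_norm f = L2_norm g"
  unfolding L2_norm_def by (rule arg_cong[of _ _ sqrt], rule integral_cong_AE) (use assms in auto)

lemma norm_abs: "f \<in> L2 \<Longrightarrow> norm (abs_ltwo f) = L2_norm f"
  unfolding norm_ltwo_L2_norm by (rule L2_norm_cong_AE) (auto simp: rep_abs)

lemma inner_abs:
  assumes "f \<in> L2" "g \<in> L2"
  shows "inner (abs_ltwo f) (abs_ltwo g) = Re (LINT x|lborel. f x * cnj (g x))"
proof -
  have "inner (abs_ltwo f) (abs_ltwo g) = (LINT x|lborel. Re (f x * cnj (g x)))"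
    by (rule inner_cong_AE) (use assms in \<open>auto simp: rep_abs\<close>)
  also have "\<dots> = Re (LINT x|lborel. f x * cnj (g x))"
    by (rule integral_Re) (intro L2_mult_integrable L2_cnj assms)
  finally show ?thesis .
qed

lemma norm_ltwo_power2: "(norm f)\<^sup>2 = (LINT x|lborel. (cmod (rep_ltwo f x))\<^sup>2)"
  unfolding norm_ltwo_L2_norm L2_norm_def by (intro real_sqrt_pow2 integral_nonneg_AE) auto

lemma abs_add: "f \<in> L2 \<Longrightarrow> g \<in> L2 \<Longrightarrow> abs_ltwo f + abs_ltwo g = abs_ltwo (\<lambda>x. f x + g x)"
  unfolding plus_ltwo_def using rep_abs[of f] rep_abs[of g]
  by (subst abs_eq_iff) (auto simp: L2_add elim: eventually_elim2)

lemma abs_diff: "f \<in> L2 \<Longrightarrow> g \<in> L2 \<Longrightarrow> abs_ltwo f - abs_ltwo g = abs_ltwo (\<lambda>x. f x - g x)"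
  unfolding minus_ltwo_def using rep_abs[of f] rep_abs[of g]
  by (subst abs_eq_iff) (auto simp: L2_diff elim: eventually_elim2)

lemma abs_scaleR: "f \<in> L2 \<Longrightarrow> c *\<^sub>R abs_ltwo f = abs_ltwo (\<lambda>x. c *\<^sub>R f x)"
  unfolding scaleR_ltwo_def using rep_abs[of f]
  by (subst abs_eq_iff) (auto simp: L2_scaleR)

lemma norm_abs_diff:
  "f \<in> L2 \<Longrightarrow> g \<in> L2 \<Longrightarrow> norm (abs_ltwo f - abs_ltwo g) = L2_norm (\<lambda>x. f x - g x)"
  by (simp add: abs_diff norm_abs L2_diff)

lemma L2_norm_nonneg [simp]: "0 \<le> L2_norm f"
  unfolding L2_norm_def by (intro real_sqrt_ge_zero integral_nonneg_AE) auto

lemma L2_norm_power2: "(L2_norm f)\<^sup>2 = (LINT x|lborel. (cmod (f x))\<^sup>2)"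
  unfolding L2_norm_def by (intro real_sqrt_pow2 integral_nonneg_AE) auto

lemma tendsto_zero_power2D: "((\<lambda>x. (f x :: real)\<^sup>2) \<longlongrightarrow> 0) F \<Longrightarrow> (f \<longlongrightarrow> 0) F"
  using tendsto_real_sqrt[of "\<lambda>x. (f x)\<^sup>2" 0 F] by (simp add: tendsto_rabs_zero_iff)

text \<open>The form of dominated convergence that serves for truncations, cut-offs, difference quotients and
  translations alike: the majorant bounds the squared error.\<close>

lemma L2_norm_tendsto_dominated:
  fixes F :: "nat \<Rightarrow> 'a::euclidean_space \<Rightarrow> complex"
  assumes [measurable]: "\<And>n. F n \<in> borel_measurable borel" "h \<in> borel_measurable borel"
    and w: "integrable lborel w"
    and bound: "\<And>n. AE x in lborel. (cmod (F n x - h x))\<^sup>2 \<le> w x"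
    and lim: "AE x in lborel. (\<lambda>n. F n x) \<longlonglongrightarrow> h x"
  shows "(\<lambda>n. L2_norm (\<lambda>x. F n x - h x)) \<longlonglongrightarrow> 0"
proof (rule tendsto_zero_power2D)
  have "(\<lambda>n. LINT x|lborel. (cmod (F n x - h x))\<^sup>2) \<longlonglongrightarrow> (LINT (x::'a)|lborel. 0)"
  proof (rule integral_dominated_convergence[OF _ _ w])
    show "AE x in lborel. (\<lambda>n. (cmod (F n x - h x))\<^sup>2) \<longlonglongrightarrow> 0"
      using lim
    proof eventually_elim
      case (elim x)
      then have "(\<lambda>n. (cmod (F n x - h x))\<^sup>2) \<longlonglongrightarrow> (cmod (h x - h x))\<^sup>2"
        by (intro tendsto_intros)
      then show ?case by simp
    qed
    show "AE x in lborel. norm ((cmod (F n x - h x))\<^sup>2) \<le> w x" for n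
      using bound[of n] by auto
  qed measurable
  then show "(\<lambda>n. (L2_norm (\<lambda>x. F n x - h x))\<^sup>2) \<longlonglongrightarrow> 0"
    by (simp add: L2_norm_power2)
qed

lemma abs_tendsto_iff:
  assumes "\<And>n. F n \<in> L2" "h \<in> L2"
  shows "((\<lambda>n. abs_ltwo (F n)) \<longlongrightarrow> abs_ltwo h) A \<longleftrightarrow> ((\<lambda>n. L2_norm (\<lambda>x. F n x - h x)) \<longlongrightarrow> 0) A"
  by (subst Lim_null, subst tendsto_norm_zero_iff[symmetric]) (simp add: norm_abs_diff assms)

lemma nn_integral_norm_diff:
  "(\<integral>\<^sup>+x. ennreal ((cmod (rep_ltwo f x - rep_ltwo g x))\<^sup>2) \<partial>lborel) = ennreal ((norm (f - g))\<^sup>2)"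
proof -
  have "(\<integral>\<^sup>+x. ennreal ((cmod (rep_ltwo f x - rep_ltwo g x))\<^sup>2) \<partial>lborel)
      = (\<integral>\<^sup>+x. ennreal ((cmod (rep_ltwo (f - g) x))\<^sup>2) \<partial>lborel)"
    by (rule nn_integral_cong_AE) (use rep_diff[of f g] in auto)
  also have "\<dots> = ennreal ((norm (f - g))\<^sup>2)"
    unfolding norm_ltwo_power2 by (rule nn_integral_eq_integral) (auto simp: L2_integrable)
  finally show ?thesis .
qed

text \<open>The heart of the Riesz--Fischer theorem: \<open>\<Sum>n. 2\<^sup>n |f\<^sub>n\<^sub>+\<^sub>1 - f\<^sub>n|\<^sup>2\<close> has finite integral, so that almost
  everywhere the increments are dominated by a geometric series.\<close>

lemma geometric_increments_imp_AE_convergent: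
  fixes Y :: "nat \<Rightarrow> 'a::euclidean_space ltwo"
  assumes Y: "\<And>n. norm (Y (Suc n) - Y n) \<le> (1/2)^n"
  shows "AE x in lborel. convergent (\<lambda>n. rep_ltwo (Y n) x)"
proof -
  define d where "d n x = cmod (rep_ltwo (Y (Suc n)) x - rep_ltwo (Y n) x)" for n x
  have [measurable]: "d n \<in> borel_measurable borel" for n unfolding d_def by measurable
  \<comment> \<open>The weight \<open>2\<^sup>n\<close> turns \<open>L\<^sup>2\<close> bounds of order \<open>4\<^sup>-\<^sup>n\<close> for the squares into a pointwise geometric
    bound and still leaves a convergent series.\<close>
  have "(\<integral>\<^sup>+x. (\<Sum>n. ennreal (2^n * (d n x)\<^sup>2)) \<partial>lborel) = (\<Sum>n. \<integral>\<^sup>+x. ennreal (2^n * (d n x)\<^sup>2) \<partial>lborel)"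
    by (rule nn_integral_suminf) measurable
  also have "\<dots> = (\<Sum>n. ennreal (2^n) * ennreal ((norm (Y (Suc n) - Y n))\<^sup>2))"
    by (intro suminf_cong) (simp add: d_def ennreal_mult nn_integral_cmult nn_integral_norm_diff)
  also have "\<dots> \<le> (\<Sum>n. ennreal ((1/2)^n))"
  proof (intro suminf_le)
    fix n
    have "2^n * (norm (Y (Suc n) - Y n))\<^sup>2 \<le> 2^n * ((1/2)^n)\<^sup>2"
      by (intro mult_left_mono power_mono Y) auto
    also have "\<dots> = (1/2)^n"
      by (simp add: power2_eq_square power_one_over field_simps)
    finally show "ennreal (2^n) * ennreal ((norm (Y (Suc n) - Y n))\<^sup>2) \<le> ennreal ((1/2)^n)"
      by (simp add: ennreal_mult[symmetric] ennreal_leI)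
  qed auto
  also have "\<dots> = ennreal (\<Sum>n. (1/2)^n)"
    by (rule suminf_ennreal2) (auto intro: summable_geometric)
  finally have "(\<integral>\<^sup>+x. (\<Sum>n. ennreal (2^n * (d n x)\<^sup>2)) \<partial>lborel) \<noteq> \<infinity>"
    by (metis ennreal_less_top infinity_ennreal_def not_le top.not_eq_extremum)
  then have "AE x in lborel. (\<Sum>n. ennreal (2^n * (d n x)\<^sup>2)) \<noteq> \<infinity>"
    by (intro nn_integral_PInf_AE) measurable
  then show ?thesis
  proof eventually_elim
    case (elim x)
    have sm: "summable (\<lambda>n. 2^n * (d n x)\<^sup>2)"
      by (rule summable_suminf_not_top) (use elim in auto)
    then obtain K where K: "\<And>n. norm (2^n * (d n x)\<^sup>2) \<le> K"
      using summable_imp_Bseq[OF sm] unfolding Bseq_def by blast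
    have d_le: "d n x \<le> sqrt K * (1 / sqrt 2)^n" for n
    proof -
      have "(d n x)\<^sup>2 \<le> K / 2^n" using K[of n] by (simp add: field_simps)
      then have "d n x \<le> sqrt (K / 2^n)" by (rule real_le_rsqrt)
      also have "\<dots> = sqrt K * (1 / sqrt 2)^n"
        by (simp add: real_sqrt_divide real_sqrt_power power_one_over)
      finally show ?thesis .
    qed
    have "summable (\<lambda>n. sqrt K * (1 / sqrt 2)^n)"
      by (intro summable_mult summable_geometric) auto
    then have "summable (\<lambda>n. rep_ltwo (Y (Suc n)) x - rep_ltwo (Y n) x)"
      by (rule summable_comparison_test') (use d_le in \<open>auto simp: d_def\<close>)
    then have "convergent (\<lambda>n. \<Sum>i<n. rep_ltwo (Y (Suc i)) x - rep_ltwo (Y i) x)"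
      by (simp add: summable_iff_convergent)
    then have "convergent (\<lambda>n. rep_ltwo (Y n) x - rep_ltwo (Y 0) x)"
      using sum_lessThan_telescope[of "\<lambda>n. rep_ltwo (Y n) x"] by simp
    then have "convergent (\<lambda>n. (rep_ltwo (Y n) x - rep_ltwo (Y 0) x) + rep_ltwo (Y 0) x)"
      by (rule convergent_add) (rule convergent_const)
    then show ?case by simp
  qed
qed

text \<open>A subsequence with small increments has a pointwise limit, which Fatou's lemma identifies as the
  limit in norm; a Cauchy sequence converges with its subsequence.\<close>

instance ltwo :: (euclidean_space) banach
proof
  fix X :: "nat \<Rightarrow> 'a ltwo"
  assume "Cauchy X"
  then have "\<forall>n. \<exists>N. \<forall>m\<ge>N. \<forall>k\<ge>N. norm (X m - X k) < (1/2)^n"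
    unfolding Cauchy_iff by simp
  then obtain N where N: "\<And>n m k. m \<ge> N n \<Longrightarrow> k \<ge> N n \<Longrightarrow> norm (X m - X k) < (1/2)^n"
    by metis
  \<comment> \<open>Partial sums make the indices \<open>N n\<close> monotone: \<open>r m\<close> is at least \<open>N n\<close> for every \<open>n \<le> m\<close>.\<close>
  define r where "r n = (\<Sum>k\<le>n. N k)" for n
  have r_N: "r m \<ge> N n" if "m \<ge> n" for n m
    unfolding r_def by (rule member_le_sum[of n "{..m}" N]) (use that in auto)
  define Y where "Y n = X (r n)" for n
  have Y: "norm (Y m - Y k) < (1/2)^n" if "m \<ge> n" "k \<ge> n" for n m k
    unfolding Y_def by (intro N r_N that)
  define F where "F x = lim (\<lambda>n. rep_ltwo (Y n) x)" for x
  have [measurable]: "F \<in> borel_measurable borel" unfolding F_def by measurable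
  have "AE x in lborel. convergent (\<lambda>n. rep_ltwo (Y n) x)"
    by (rule geometric_increments_imp_AE_convergent, rule less_imp_le, rule Y) auto
  then have lim: "AE x in lborel. (\<lambda>n. rep_ltwo (Y n) x) \<longlonglongrightarrow> F x"
    by eventually_elim (simp add: F_def convergent_LIMSEQ_iff)
  have Fatou: "(\<integral>\<^sup>+x. ennreal ((cmod (rep_ltwo (Y n) x - F x))\<^sup>2) \<partial>lborel) \<le> ennreal (((1/2)^n)\<^sup>2)" for n
  proof -
    have "(\<integral>\<^sup>+x. ennreal ((cmod (rep_ltwo (Y n) x - F x))\<^sup>2) \<partial>lborel)
        = (\<integral>\<^sup>+x. liminf (\<lambda>m. ennreal ((cmod (rep_ltwo (Y n) x - rep_ltwo (Y m) x))\<^sup>2)) \<partial>lborel)"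
    proof (rule nn_integral_cong_AE, use lim in eventually_elim)
      case (elim x)
      then have "(\<lambda>m. ennreal ((cmod (rep_ltwo (Y n) x - rep_ltwo (Y m) x))\<^sup>2))
          \<longlonglongrightarrow> ennreal ((cmod (rep_ltwo (Y n) x - F x))\<^sup>2)"
        by (intro tendsto_intros)
      from lim_imp_Liminf[OF sequentially_bot this] show ?case ..
    qed
    also have "\<dots> \<le> liminf (\<lambda>m. \<integral>\<^sup>+x. ennreal ((cmod (rep_ltwo (Y n) x - rep_ltwo (Y m) x))\<^sup>2) \<partial>lborel)"
      by (rule nn_integral_liminf) measurable
    also have "\<dots> \<le> limsup (\<lambda>m. \<integral>\<^sup>+x. ennreal ((cmod (rep_ltwo (Y n) x - rep_ltwo (Y m) x))\<^sup>2) \<partial>lborel)"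
      by (rule Liminf_le_Limsup) simp
    also have "\<dots> \<le> ennreal (((1/2)^n)\<^sup>2)"
    proof (rule Limsup_bounded, rule eventually_sequentiallyI[of n])
      fix m assume "n \<le> m"
      then show "(\<integral>\<^sup>+x. ennreal ((cmod (rep_ltwo (Y n) x - rep_ltwo (Y m) x))\<^sup>2) \<partial>lborel) \<le> ennreal (((1/2)^n)\<^sup>2)"
        unfolding nn_integral_norm_diff using Y[of n n m] by (intro ennreal_leI power_mono) auto
    qed
    finally show ?thesis .
  qed
  have diff_L2: "(\<lambda>x. rep_ltwo (Y n) x - F x) \<in> L2" for n
  proof (rule L2I)
    show "integrable lborel (\<lambda>x. (cmod (rep_ltwo (Y n) x - F x))\<^sup>2)"
      using order_le_less_trans[OF Fatou[of n]] by (intro integrableI_bounded) auto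
  qed measurable
  have F_L2: "F \<in> L2"
    using L2_diff[OF rep_L2 diff_L2[of 0], of "Y 0"] by simp
  have Y_F: "norm (Y n - abs_ltwo F) \<le> (1/2)^n" for n
  proof -
    have "ennreal ((norm (Y n - abs_ltwo F))\<^sup>2)
        = (\<integral>\<^sup>+x. ennreal ((cmod (rep_ltwo (Y n) x - F x))\<^sup>2) \<partial>lborel)"
      unfolding nn_integral_norm_diff[symmetric]
      by (rule nn_integral_cong_AE) (use rep_abs[OF F_L2] in auto)
    then have "ennreal ((norm (Y n - abs_ltwo F))\<^sup>2) \<le> ennreal (((1/2)^n)\<^sup>2)"
      using Fatou[of n] by simp
    then show ?thesis by (simp add: ennreal_le_iff power2_le_iff_abs_le)
  qed
  have "X \<longlonglongrightarrow> abs_ltwo F"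
  proof (rule metric_LIMSEQ_I)
    fix e :: real assume "0 < e"
    then obtain n where n: "(1/2::real)^n < e / 2"
      using real_arch_pow_inv[of "e/2" "1/2"] by auto
    have "dist (X m) (abs_ltwo F) < e" if "m \<ge> N n" for m
    proof -
      have "norm (X m - Y n) < (1/2)^n" unfolding Y_def by (intro N that r_N) auto
      then have "norm (X m - abs_ltwo F) < (1/2)^n + (1/2)^n"
        using norm_triangle_ineq[of "X m - Y n" "Y n - abs_ltwo F"] Y_F[of n] by simp
      then show ?thesis using n by (simp add: dist_norm)
    qed
    then show "\<exists>no. \<forall>n\<ge>no. dist (X n) (abs_ltwo F) < e" by blast
  qed
  then show "convergent X" by (auto simp: convergent_def)
qed

subsection \<open>Multiplication operators\<close>

definition mult_op :: "('a::euclidean_space \<Rightarrow> complex) \<Rightarrow> 'a ltwo \<Rightarrow> 'a ltwo" where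
  "mult_op m f = abs_ltwo (\<lambda>x. m x * rep_ltwo f x)"

lemma rep_mult: "ess_bounded m \<Longrightarrow> AE x in lborel. rep_ltwo (mult_op m f) x = m x * rep_ltwo f x"
  unfolding mult_op_def by (rule rep_abs) (simp add: L2_mult)

lemma mult_abs:
  assumes "ess_bounded m" "f \<in> L2" shows "mult_op m (abs_ltwo f) = abs_ltwo (\<lambda>x. m x * f x)"
  unfolding mult_op_def using rep_abs[OF assms(2)] assms
  by (subst abs_eq_iff) (auto simp: L2_mult)

lemma mult_mult:
  assumes "ess_bounded m" "ess_bounded n"
  shows "mult_op m (mult_op n f) = mult_op (\<lambda>x. m x * n x) f"
  by (rule ltwo_eqI)
     (use rep_mult[OF assms(1), of "mult_op n f"] rep_mult[OF assms(2), of f] rep_mult[OF ess_bounded_mult[OF assms], of f]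
      in \<open>eventually_elim, simp\<close>)

lemma mult_commute:
  "ess_bounded m \<Longrightarrow> ess_bounded n \<Longrightarrow> mult_op m (mult_op n f) = mult_op n (mult_op m f)"
  by (simp add: mult_mult mult.commute)

lemma mult_one [simp]: "mult_op (\<lambda>_. 1) f = f"
  by (simp add: mult_op_def)

lemma mult_diff_left:
  assumes "ess_bounded m" "ess_bounded n"
  shows "mult_op (\<lambda>x. m x - n x) f = mult_op m f - mult_op n f"
  by (rule ltwo_eqI)
     (use rep_mult[OF assms(1), of f] rep_mult[OF assms(2), of f] rep_mult[OF ess_bounded_diff[OF assms], of f]
        rep_diff[of "mult_op m f" "mult_op n f"] in \<open>eventually_elim, simp add: left_diff_distrib\<close>)

lemma norm_mono_AE:
  assumes "AE x in lborel. cmod (rep_ltwo f x) \<le> cmod (rep_ltwo g x)"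
  shows "norm f \<le> norm g"
proof -
  have "(norm f)\<^sup>2 \<le> (norm g)\<^sup>2"
    unfolding norm_ltwo_power2
    by (rule integral_mono_AE) (use assms in \<open>auto simp: L2_integrable intro: power_mono\<close>)
  then show ?thesis by (simp add: power2_le_iff_abs_le)
qed

lemma norm_mult_le:
  assumes "ess_bounded m" "AE x in lborel. cmod (m x) \<le> C" "0 \<le> C"
  shows "norm (mult_op m f) \<le> C * norm f"
proof -
  have "norm (mult_op m f) \<le> norm (C *\<^sub>R f)"
    by (rule norm_mono_AE)
       (use rep_mult[OF assms(1), of f] rep_scaleR[of C f] assms(2) in
        \<open>eventually_elim, use assms(3) in \<open>auto simp: norm_mult intro!: mult_right_mono\<close>\<close>)
  then show ?thesis using assms(3) by simp
qed

lemma norm_mult_unimodular: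
  assumes "ess_bounded m" "\<And>x. cmod (m x) = 1"
  shows "norm (mult_op m f) = norm f"
  by (intro antisym norm_mono_AE; use rep_mult[OF assms(1), of f] in eventually_elim)
     (auto simp: assms(2) norm_mult)

lemma bounded_linear_mult:
  assumes m: "ess_bounded m" shows "bounded_linear (mult_op m)"
proof -
  obtain C where "AE x in lborel. cmod (m x) \<le> C"
    using m unfolding ess_bounded_def by auto
  then have C: "AE x in lborel. cmod (m x) \<le> \<bar>C\<bar>" by eventually_elim simp
  show ?thesis
  proof (rule bounded_linear_intro[of _ "\<bar>C\<bar>"])
    fix f g :: "'a ltwo" and a :: real
    show "mult_op m (f + g) = mult_op m f + mult_op m g"
      by (rule ltwo_eqI)
         (use rep_mult[OF m, of f] rep_mult[OF m, of g] rep_mult[OF m, of "f + g"] rep_add[of f g]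
            rep_add[of "mult_op m f" "mult_op m g"] in \<open>eventually_elim, simp add: algebra_simps\<close>)
    show "mult_op m (a *\<^sub>R f) = a *\<^sub>R mult_op m f"
      by (rule ltwo_eqI)
         (use rep_mult[OF m, of f] rep_mult[OF m, of "a *\<^sub>R f"] rep_scaleR[of a f]
            rep_scaleR[of a "mult_op m f"] in \<open>eventually_elim, simp add: algebra_simps\<close>)
    show "norm (mult_op m f) \<le> norm f * \<bar>C\<bar>"
      using norm_mult_le[OF m C, of f] by (simp add: mult.commute)
  qed
qed

lemma inner_mult_left:
  assumes m: "ess_bounded m"
  shows "inner (mult_op m f) g = inner f (mult_op (\<lambda>x. cnj (m x)) g)"
proof -
  have "inner (mult_op m f) g = (LINT x|lborel. Re ((m x * rep_ltwo f x) * cnj (rep_ltwo g x)))"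
    by (rule inner_cong_AE) (use rep_mult[OF m, of f] m in auto)
  also have "\<dots> = (LINT x|lborel. Re (rep_ltwo f x * cnj (cnj (m x) * rep_ltwo g x)))"
    by (simp add: algebra_simps)
  also have "\<dots> = inner f (mult_op (\<lambda>x. cnj (m x)) g)"
    by (rule inner_cong_AE[symmetric]) (use rep_mult[OF ess_bounded_cnj[OF m], of g] m in auto)
  finally show ?thesis .
qed

lemma inner_mult_real:
  assumes "ess_bounded (\<lambda>x. complex_of_real (m x))"
  shows "inner (mult_op (\<lambda>x. of_real (m x)) f) g = inner f (mult_op (\<lambda>x. of_real (m x)) g)"
  using inner_mult_left[OF assms] by simp

text \<open>Bounded almost everywhere convergence of the multipliers gives strong convergence of the operators,
  whereas convergence in operator norm would require uniform convergence.\<close>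

lemma mult_tendsto:
  assumes eb: "\<And>n. ess_bounded (m n)" "ess_bounded m'"
    and C: "\<And>n. AE x in lborel. cmod (m n x - m' x) \<le> C"
    and lim: "AE x in lborel. (\<lambda>n::nat. m n x) \<longlonglongrightarrow> m' x"
  shows "(\<lambda>n. mult_op (m n) f) \<longlonglongrightarrow> mult_op m' f"
  unfolding mult_op_def
proof (subst abs_tendsto_iff)
  show "(\<lambda>n. L2_norm (\<lambda>x. m n x * rep_ltwo f x - m' x * rep_ltwo f x)) \<longlonglongrightarrow> 0"
  proof (rule L2_norm_tendsto_dominated)
    show "integrable lborel (\<lambda>x. C\<^sup>2 * (cmod (rep_ltwo f x))\<^sup>2)"
      by (simp add: L2_integrable)
    show "AE x in lborel. (cmod (m n x * rep_ltwo f x - m' x * rep_ltwo f x))\<^sup>2 \<le> C\<^sup>2 * (cmod (rep_ltwo f x))\<^sup>2" for n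
      using C[of n]
    proof eventually_elim
      case (elim x)
      then have "(cmod (m n x - m' x))\<^sup>2 \<le> C\<^sup>2" by (intro power_mono) auto
      then show ?case
        by (simp flip: left_diff_distrib add: norm_mult power_mult_distrib mult_right_mono)
    qed
    show "AE x in lborel. (\<lambda>n. m n x * rep_ltwo f x) \<longlonglongrightarrow> m' x * rep_ltwo f x"
      using lim by eventually_elim (intro tendsto_intros)
  qed (use eb in measurable)
qed (auto simp: L2_mult eb)

section \<open>Translations and approximate identities\<close>

lemma nn_integral_affine:
  fixes f :: "'a::euclidean_space \<Rightarrow> ennreal"
  assumes [measurable]: "f \<in> borel_measurable borel" and "c \<noteq> 0"
  shows "(\<integral>\<^sup>+x. f x \<partial>lborel) = \<bar>c\<bar>^DIM('a) * (\<integral>\<^sup>+x. f (t + c *\<^sub>R x) \<partial>lborel)"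
  by (subst lborel_affine[OF assms(2), of t])
     (simp add: nn_integral_density nn_integral_distr nn_integral_cmult ennreal_power)

lemma integral_affine:
  fixes f :: "'a::euclidean_space \<Rightarrow> 'b::{banach, second_countable_topology}"
  assumes [measurable]: "f \<in> borel_measurable borel" and "c \<noteq> 0"
  shows "(LINT x|lborel. f x) = \<bar>c\<bar>^DIM('a) *\<^sub>R (LINT x|lborel. f (t + c *\<^sub>R x))"
  by (subst lborel_affine[OF assms(2), of t]) (simp add: integral_density integral_distr)

lemma integrable_affine:
  fixes f :: "'a::euclidean_space \<Rightarrow> 'b::{banach, second_countable_topology}"
  assumes [measurable]: "f \<in> borel_measurable borel" and "c \<noteq> 0"
  shows "integrable lborel (\<lambda>x. f (t + c *\<^sub>R x)) \<longleftrightarrow> integrable lborel f"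
  unfolding integrable_iff_bounded
  using nn_integral_affine[of "\<lambda>x. ennreal (norm (f x))" c t] assms(2)
  by (auto simp: ennreal_mult_less_top ennreal_mult_eq_top_iff ennreal_power simp flip: less_top)

lemma L2_translate:
  assumes "f \<in> L2" shows "(\<lambda>x. f (x - y)) \<in> L2" "L2_norm (\<lambda>x. f (x - y)) = L2_norm f"
proof -
  have [measurable]: "f \<in> borel_measurable borel" using assms by simp
  have "integrable lborel (\<lambda>x. (cmod (f (- y + 1 *\<^sub>R x)))\<^sup>2)"
    by (subst integrable_affine) (use L2_integrable[OF assms] in auto)
  then show "(\<lambda>x. f (x - y)) \<in> L2" by (intro L2I) auto
  show "L2_norm (\<lambda>x. f (x - y)) = L2_norm f"
    using integral_affine[of "\<lambda>x. (cmod (f x))\<^sup>2" 1 "- y"] by (simp add: L2_norm_def)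
qed

lemma LIMSEQ_zero_less:
  assumes "f \<longlonglongrightarrow> (0::real)" "0 < e"
  obtains N where "\<And>n. n \<ge> N \<Longrightarrow> f n < e"
  using order_tendstoD(2)[OF assms] unfolding eventually_sequentially by blast

lemma L2_norm_triangle:
  assumes "f \<in> L2" "g \<in> L2"
  shows "L2_norm (\<lambda>x. f x + g x) \<le> L2_norm f + L2_norm g"
  using norm_triangle_ineq[of "abs_ltwo f" "abs_ltwo g"] by (simp add: abs_add norm_abs L2_add assms)

lemma L2_norm_diff_le:
  assumes "f \<in> L2" "g \<in> L2"
  shows "L2_norm (\<lambda>x. f x - g x) \<le> L2_norm f + L2_norm g"
  using norm_triangle_ineq4[of "abs_ltwo f" "abs_ltwo g"] by (simp add: abs_diff norm_abs L2_diff assms)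

lemma integrable_indicator_cball: "integrable lborel (\<lambda>x. c * indicator (cball (0::'a::euclidean_space) R) x :: real)"
  using emeasure_lborel_cball_finite[of 0 R] by (auto simp: less_top)

lemma L2_compact_support:
  assumes [measurable]: "g \<in> borel_measurable borel"
    and B: "\<And>x. cmod (g x) \<le> B" and supp: "\<And>x. norm x > R \<Longrightarrow> g x = 0"
  shows "g \<in> L2"
proof (rule L2_boundI)
  show "integrable lborel (\<lambda>x. B\<^sup>2 * indicator (cball 0 R) x)" by (rule integrable_indicator_cball)
  show "AE x in lborel. (cmod (g x))\<^sup>2 \<le> B\<^sup>2 * indicator (cball 0 R) x"
    by (rule AE_I2) (use B supp in \<open>auto simp: indicator_def intro: power_mono\<close>)
qed simp

lemma continuous_compact_support_bounded:
  fixes g :: "'a::euclidean_space \<Rightarrow> complex"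
  assumes "continuous_on UNIV g" "\<And>x. norm x > R \<Longrightarrow> g x = 0"
  obtains B where "0 \<le> B" "\<And>x. cmod (g x) \<le> B"
proof -
  have "compact (g ` cball 0 R)"
    using assms(1) by (intro compact_continuous_image compact_cball) (auto intro: continuous_on_subset)
  then obtain B where "\<And>z. z \<in> g ` cball 0 R \<Longrightarrow> cmod z \<le> B"
    by (meson bounded_iff compact_imp_bounded)
  then have "cmod (g x) \<le> \<bar>B\<bar>" for x
  proof (cases "norm x > R")
    case False
    then have "g x \<in> g ` cball 0 R" by auto
    then show ?thesis using \<open>\<And>z. z \<in> g ` cball 0 R \<Longrightarrow> cmod z \<le> B\<close> by fastforce
  qed (simp add: assms(2))
  then show ?thesis using that[of "\<bar>B\<bar>"] by auto
qed

text \<open>A measurable function is an almost everywhere limit of continuous ones. Clipping their values and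
  multiplying by a cut-off keeps them continuous and makes the convergence dominated.\<close>

lemma bounded_support_approx_continuous:
  fixes h :: "'a::euclidean_space \<Rightarrow> complex"
  assumes h: "h \<in> borel_measurable borel" and R: "0 < R"
    and bd: "\<And>x. cmod (h x) \<le> R" and supp: "\<And>x. norm x > R \<Longrightarrow> h x = 0" and "0 < e"
  shows "\<exists>g. continuous_on UNIV g \<and> (\<forall>x. norm x > R + 1 \<longrightarrow> g x = 0) \<and> L2_norm (\<lambda>x. g x - h x) < e"
proof -
  have "h \<in> borel_measurable lebesgue" using h by (simp add: measurable_completion)
  then have "h measurable_on UNIV" by (intro lebesgue_measurable_imp_measurable_on) auto
  then obtain N G where N: "negligible N" and G: "\<And>n. continuous_on UNIV (G n)"
    and lim: "\<And>x. x \<notin> N \<Longrightarrow> (\<lambda>n. G n x) \<longlonglongrightarrow> h x"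
    unfolding measurable_on_def by auto
  define clip where "clip z = (R / max R (cmod z)) *\<^sub>R z" for z
  define \<eta> where "\<eta> x = max 0 (min 1 (R + 1 - norm x))" for x :: 'a
  have clip_le: "cmod (clip z) \<le> R" for z
    using R by (auto simp: clip_def divide_simps max_def)
  have clip_id: "clip z = z" if "cmod z \<le> R" for z
    using that R by (auto simp: clip_def max_def)
  have clip_0: "clip 0 = 0" by (simp add: clip_def)
  have cont_clip: "continuous_on UNIV clip"
    unfolding clip_def using R by (intro continuous_intros) auto
  define F where "F n x = \<eta> x *\<^sub>R clip (G n x)" for n x
  have F_cont: "continuous_on UNIV (F n)" for n
    unfolding F_def \<eta>_def
    by (intro continuous_intros continuous_on_compose2[OF cont_clip] G) auto
  then have [measurable]: "F n \<in> borel_measurable borel" for n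
    by (rule borel_measurable_continuous_onI)
  have F_supp: "F n x = 0" if "norm x > R + 1" for n x
    using that by (simp add: F_def \<eta>_def)
  have F_le: "cmod (F n x) \<le> R" for n x
    using clip_le[of "G n x"] R mult_mono[of "\<bar>\<eta> x\<bar>" 1 "cmod (clip (G n x))" R]
    by (auto simp: F_def \<eta>_def)
  have "(\<lambda>n. L2_norm (\<lambda>x. F n x - h x)) \<longlonglongrightarrow> 0"
  proof (rule L2_norm_tendsto_dominated)
    show "integrable lborel (\<lambda>x. (2*R)\<^sup>2 * indicator (cball (0::'a) (R + 1)) x)"
      by (rule integrable_indicator_cball)
    show "AE x in lborel. (cmod (F n x - h x))\<^sup>2 \<le> (2*R)\<^sup>2 * indicator (cball 0 (R+1)) x" for n
    proof (rule AE_I2)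
      fix x
      have "cmod (F n x - h x) \<le> 2 * R"
        using norm_triangle_ineq4[of "F n x" "h x"] F_le[of n x] bd[of x] by linarith
      then have "(cmod (F n x - h x))\<^sup>2 \<le> (2*R)\<^sup>2" by (rule power_mono) auto
      then show "(cmod (F n x - h x))\<^sup>2 \<le> (2*R)\<^sup>2 * indicator (cball 0 (R+1)) x"
        using F_supp[of x n] supp[of x] by (auto simp: indicator_def)
    qed
    have "AE x in lebesgue. x \<notin> N"
      using N by (simp add: AE_iff_null negligible_iff_null_sets null_sets_def)
    then have "AE x in lebesgue. (\<lambda>n. F n x) \<longlonglongrightarrow> h x"
    proof eventually_elim
      case (elim x)
      have "(\<lambda>n. F n x) \<longlonglongrightarrow> \<eta> x *\<^sub>R clip (h x)"
        unfolding F_def using lim[OF elim] cont_clip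
        by (intro tendsto_intros isCont_tendsto_compose[of _ clip])
           (auto simp: continuous_on_eq_continuous_at)
      moreover have "\<eta> x *\<^sub>R clip (h x) = h x"
        using supp[of x] by (cases "norm x > R") (auto simp: clip_id[OF bd] \<eta>_def clip_0)
      ultimately show ?case by simp
    qed
    then show "AE x in lborel. (\<lambda>n. F n x) \<longlonglongrightarrow> h x"
      by (simp add: AE_completion_iff)
  qed (use h in measurable)
  then obtain n where "L2_norm (\<lambda>x. F n x - h x) < e"
    using \<open>0 < e\<close> by (elim LIMSEQ_zero_less) auto
  then show ?thesis using F_cont F_supp by blast
qed

text \<open>Truncation in size and in space reduces the density of continuous functions of compact support to
  bounded functions of bounded support.\<close>

lemma L2_approx_continuous:
  assumes f: "f \<in> L2" and e: "0 < (e::real)"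
  obtains g R where "continuous_on UNIV g" "\<And>x. norm x > R \<Longrightarrow> g x = 0" "g \<in> L2"
    "L2_norm (\<lambda>x. f x - g x) < e"
proof -
  have [measurable]: "f \<in> borel_measurable borel" using f by simp
  define h where "h n x = (if norm x \<le> real n \<and> cmod (f x) \<le> real n then f x else 0)" for n :: nat and x
  have [measurable]: "h n \<in> borel_measurable borel" for n unfolding h_def by measurable
  have h_L2: "h n \<in> L2" for n
    by (rule L2_compact_support[of _ "real n" "real n"]) (auto simp: h_def)
  have "(\<lambda>n. L2_norm (\<lambda>x. h n x - f x)) \<longlonglongrightarrow> 0"
  proof (rule L2_norm_tendsto_dominated[OF _ _ L2_integrable[OF f]])
    show "AE x in lborel. (cmod (h n x - f x))\<^sup>2 \<le> (cmod (f x))\<^sup>2" for n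
      by (auto simp: h_def)
    show "AE x in lborel. (\<lambda>n. h n x) \<longlonglongrightarrow> f x"
    proof (rule AE_I2)
      fix x
      obtain k :: nat where k: "norm x + cmod (f x) \<le> real k" using real_arch_simple by blast
      have "h n x = f x" if "n \<ge> k" for n
      proof -
        have "norm x + cmod (f x) \<le> real n" using k that by linarith
        then have "norm x \<le> real n" "cmod (f x) \<le> real n"
          using norm_ge_zero[of x] norm_ge_zero[of "f x"] by linarith+
        then show ?thesis by (simp add: h_def)
      qed
      then show "(\<lambda>n. h n x) \<longlonglongrightarrow> f x"
        by (intro tendsto_eventually eventually_sequentiallyI[of k])
    qed
  qed measurable
  then obtain n0 where n0: "\<And>n. n \<ge> n0 \<Longrightarrow> L2_norm (\<lambda>x. h n x - f x) < e / 2"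
    using e by (elim LIMSEQ_zero_less[of _ "e/2"]) auto
  define n where "n = Suc n0"
  have n: "L2_norm (\<lambda>x. h n x - f x) < e / 2" by (rule n0) (simp add: n_def)
  have "cmod (h n x) \<le> real n" "norm x > real n \<Longrightarrow> h n x = 0" for x
    by (auto simp: h_def)
  then obtain g where g: "continuous_on UNIV g" "\<And>x. norm x > real n + 1 \<Longrightarrow> g x = 0"
      "L2_norm (\<lambda>x. g x - h n x) < e / 2"
    using bounded_support_approx_continuous[of "h n" "real n" "e/2"] e
    by (auto simp: n_def)
  obtain B where B: "\<And>x. cmod (g x) \<le> B"
    using continuous_compact_support_bounded[of g "real n + 1"] g by metis
  have gL2: "g \<in> L2"
    by (rule L2_compact_support[OF borel_measurable_continuous_onI[OF g(1)] B g(2)])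
  have "L2_norm (\<lambda>x. f x - g x) = norm (abs_ltwo f - abs_ltwo g)"
    by (simp add: norm_abs_diff f gL2)
  also have "\<dots> \<le> norm (abs_ltwo (h n) - abs_ltwo f) + norm (abs_ltwo g - abs_ltwo (h n))"
    using norm_triangle_ineq[of "abs_ltwo f - abs_ltwo (h n)" "abs_ltwo (h n) - abs_ltwo g"]
    by (simp add: norm_minus_commute)
  also have "\<dots> < e"
    using n g(3) by (simp add: norm_abs_diff f gL2 h_L2)
  finally show ?thesis using that[of g "real n + 1"] g gL2 by blast
qed

lemma translation_tendsto_continuous:
  fixes g :: "'a::euclidean_space \<Rightarrow> complex"
  assumes g: "continuous_on UNIV g" and supp: "\<And>x. norm x > R \<Longrightarrow> g x = 0"
    and Y: "Y \<longlonglongrightarrow> 0" "\<And>n. norm (Y n) \<le> 1"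
  shows "(\<lambda>n. L2_norm (\<lambda>x. g (x - Y n) - g x)) \<longlonglongrightarrow> 0"
proof -
  have [measurable]: "g \<in> borel_measurable borel" using g by (rule borel_measurable_continuous_onI)
  obtain B where B: "0 \<le> B" "\<And>x. cmod (g x) \<le> B"
    using continuous_compact_support_bounded[of g R] g supp by metis
  show ?thesis
  proof (rule L2_norm_tendsto_dominated)
    show "integrable lborel (\<lambda>x. (2*B)\<^sup>2 * indicator (cball (0::'a) (R + 1)) x)"
      by (rule integrable_indicator_cball)
    show "AE x in lborel. (cmod (g (x - Y n) - g x))\<^sup>2 \<le> (2*B)\<^sup>2 * indicator (cball 0 (R+1)) x" for n
    proof (rule AE_I2)
      fix x
      have "cmod (g (x - Y n) - g x) \<le> 2 * B"
        using norm_triangle_ineq4[of "g (x - Y n)" "g x"] B(2)[of x] B(2)[of "x - Y n"] by linarith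
      then have "(cmod (g (x - Y n) - g x))\<^sup>2 \<le> (2*B)\<^sup>2" by (rule power_mono) auto
      moreover have "g (x - Y n) - g x = 0" if "norm x > R + 1"
      proof -
        have "norm (x - Y n) > R" using norm_triangle_ineq2[of x "Y n"] Y(2)[of n] that by linarith
        then show ?thesis using supp that by simp
      qed
      ultimately show "(cmod (g (x - Y n) - g x))\<^sup>2 \<le> (2*B)\<^sup>2 * indicator (cball 0 (R+1)) x"
        by (cases "norm x > R + 1") (auto simp: indicator_def)
    qed
    have "(\<lambda>n. g (x - Y n)) \<longlonglongrightarrow> g (x - 0)" for x
      using g by (intro isCont_tendsto_compose[of _ g] tendsto_intros Y) (auto simp: continuous_on_eq_continuous_at)
    then show "AE x in lborel. (\<lambda>n. g (x - Y n)) \<longlonglongrightarrow> g x" by simp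
  qed measurable
qed

text \<open>Translations are isometries, so their strong continuity passes from the dense class of continuous
  functions of compact support to all of \<open>L\<^sup>2\<close>.\<close>

lemma L2_translation_tendsto:
  assumes f: "f \<in> L2" and Y: "Y \<longlonglongrightarrow> 0"
  shows "(\<lambda>n. L2_norm (\<lambda>x. f (x - Y n) - f x)) \<longlonglongrightarrow> 0"
proof (rule LIMSEQ_I)
  fix e :: real assume e: "0 < e"
  obtain g R where g: "continuous_on UNIV g" "\<And>x. norm x > R \<Longrightarrow> g x = 0" "g \<in> L2"
    and fg: "L2_norm (\<lambda>x. f x - g x) < e / 3"
    using L2_approx_continuous[OF f, of "e/3"] e by auto
  obtain N0 where N0: "\<And>n. n \<ge> N0 \<Longrightarrow> norm (Y n) < 1"
    using LIMSEQ_D[OF Y, of 1] by auto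
  have "(\<lambda>n. L2_norm (\<lambda>x. g (x - Y (n + N0)) - g x)) \<longlonglongrightarrow> 0"
    using N0 by (intro translation_tendsto_continuous[OF g(1,2)] LIMSEQ_ignore_initial_segment Y) (auto intro: less_imp_le)
  then obtain N where N: "\<And>n. n \<ge> N \<Longrightarrow> L2_norm (\<lambda>x. g (x - Y (n + N0)) - g x) < e / 3"
    using e by (elim LIMSEQ_zero_less[of _ "e/3"]) auto
  show "\<exists>no. \<forall>n\<ge>no. norm (L2_norm (\<lambda>x. f (x - Y n) - f x) - 0) < e"
  proof (intro exI[of _ "N + N0"] allI impI)
    fix n assume n: "N + N0 \<le> n"
    have 1: "L2_norm (\<lambda>x. g (x - Y n) - g x) < e / 3"
      using N[of "n - N0"] n by simp
    have d: "(\<lambda>x. f x - g x) \<in> L2" by (intro L2_diff f g)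
    have t: "(\<lambda>x. f (x - Y n) - g (x - Y n)) \<in> L2" "L2_norm (\<lambda>x. f (x - Y n) - g (x - Y n)) < e / 3"
      using L2_translate[OF d, of "Y n"] fg by auto
    have gt: "(\<lambda>x. g (x - Y n) - g x) \<in> L2" by (intro L2_diff L2_translate g)
    have "L2_norm (\<lambda>x. f (x - Y n) - f x)
        = L2_norm (\<lambda>x. ((f (x - Y n) - g (x - Y n)) + (g (x - Y n) - g x)) - (f x - g x))"
      by simp
    also have "\<dots> \<le> L2_norm (\<lambda>x. (f (x - Y n) - g (x - Y n)) + (g (x - Y n) - g x)) + L2_norm (\<lambda>x. f x - g x)"
      by (intro L2_norm_diff_le L2_add t gt d)
    also have "\<dots> \<le> L2_norm (\<lambda>x. f (x - Y n) - g (x - Y n)) + L2_norm (\<lambda>x. g (x - Y n) - g x) + L2_norm (\<lambda>x. f x - g x)"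
      using L2_norm_triangle[OF t(1) gt] by simp
    also have "\<dots> < e" using 1 t(2) fg by linarith
    finally show "norm (L2_norm (\<lambda>x. f (x - Y n) - f x) - 0) < e" by simp
  qed
qed

lemma convolve_rescaled:
  fixes f :: "'a::euclidean_space \<Rightarrow> 'b::{banach, second_countable_topology}"
  assumes [measurable]: "f \<in> borel_measurable borel" "k \<in> borel_measurable borel" and "0 < \<epsilon>"
  shows "convolve f (rescaled k \<epsilon>) x = (LINT z|lborel. k z *\<^sub>R f (x - \<epsilon> *\<^sub>R z))"
proof -
  have "convolve f (rescaled k \<epsilon>) x
      = \<bar>- \<epsilon>\<bar>^DIM('a) *\<^sub>R (LINT z|lborel. (k ((x - (x + (- \<epsilon>) *\<^sub>R z)) /\<^sub>R \<epsilon>) / \<epsilon>^DIM('a)) *\<^sub>R f (x + (- \<epsilon>) *\<^sub>R z))"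
    unfolding convolve_def rescaled_def
    by (rule integral_affine) (use assms(3) in auto)
  also have "\<dots> = \<bar>- \<epsilon>\<bar>^DIM('a) *\<^sub>R (LINT z|lborel. (1 / \<epsilon>^DIM('a)) *\<^sub>R k z *\<^sub>R f (x - \<epsilon> *\<^sub>R z))"
    using assms(3) by simp
  also have "\<dots> = (LINT z|lborel. k z *\<^sub>R f (x - \<epsilon> *\<^sub>R z))"
    unfolding integral_scaleR_right using assms(3) by simp
  finally show ?thesis .
qed

text \<open>Jensen's inequality for the square and a probability density.\<close>

lemma power2_norm_integral_le:
  fixes Z :: "'a \<Rightarrow> complex"
  assumes [measurable]: "k \<in> borel_measurable M" "Z \<in> borel_measurable M"
    and k: "\<And>x. 0 \<le> k x" "integrable M k" "(LINT x|M. k x) = 1"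
    and Z: "integrable M (\<lambda>x. k x * (cmod (Z x))\<^sup>2)"
  shows "integrable M (\<lambda>x. k x *\<^sub>R Z x)"
    and "(cmod (LINT x|M. k x *\<^sub>R Z x))\<^sup>2 \<le> (LINT x|M. k x * (cmod (Z x))\<^sup>2)"
proof -
  have le: "k x * cmod (Z x) \<le> k x + k x * (cmod (Z x))\<^sup>2" for x
  proof -
    have "cmod (Z x) \<le> 1 + (cmod (Z x))\<^sup>2"
      using sum_squares_bound[of 1 "cmod (Z x)"] norm_ge_zero[of "Z x"] unfolding power_one by linarith
    from mult_left_mono[OF this k(1)[of x]] show ?thesis by (simp add: algebra_simps)
  qed
  show int: "integrable M (\<lambda>x. k x *\<^sub>R Z x)"
    by (rule Bochner_Integration.integrable_bound[OF Bochner_Integration.integrable_add[OF k(2) Z]])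
       (use k(1) le in auto)
  then have int': "integrable M (\<lambda>x. k x * cmod (Z x))"
    using integrable_norm[OF int] k(1) by simp
  \<comment> \<open>The variance around the mean \<open>c\<close> of \<open>|Z|\<close> is nonnegative.\<close>
  define c where "c = (LINT x|M. k x * cmod (Z x))"
  have "0 \<le> (LINT x|M. k x * (cmod (Z x) - c)\<^sup>2)"
    by (intro integral_nonneg_AE) (use k(1) in auto)
  also have "\<dots> = (LINT x|M. k x * (cmod (Z x))\<^sup>2 - 2 * c * (k x * cmod (Z x)) + c\<^sup>2 * k x)"
    by (intro Bochner_Integration.integral_cong) (auto simp: power2_diff algebra_simps)
  also have "\<dots> = (LINT x|M. k x * (cmod (Z x))\<^sup>2) - 2 * c * c + c\<^sup>2"
    using Z int' k by (simp add: c_def)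
  finally have c: "c\<^sup>2 \<le> (LINT x|M. k x * (cmod (Z x))\<^sup>2)"
    by (simp add: power2_eq_square)
  have "cmod (LINT x|M. k x *\<^sub>R Z x) \<le> c"
    using integral_norm_bound[of M "\<lambda>x. k x *\<^sub>R Z x"] k(1) by (simp add: c_def)
  then show "(cmod (LINT x|M. k x *\<^sub>R Z x))\<^sup>2 \<le> (LINT x|M. k x * (cmod (Z x))\<^sup>2)"
    using power_mono[OF _ norm_ge_zero, of "LINT x|M. k x *\<^sub>R Z x" c 2] c by linarith
qed

text \<open>By Jensen's inequality and Tonelli's theorem, the distance of an average of translates from
  the function itself is at most the averaged distance of the translates.\<close>

lemma convolve_rescaled_L2:
  fixes f :: "'a::euclidean_space \<Rightarrow> complex"
  assumes f: "f \<in> L2" and k[measurable]: "k \<in> borel_measurable borel"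
    and k1: "\<And>x. 0 \<le> k x" "integrable lborel k" "(LINT x|lborel. k x) = 1" and \<epsilon>: "0 < \<epsilon>"
  shows "convolve f (rescaled k \<epsilon>) \<in> L2" (is ?L)
    and "(L2_norm (\<lambda>x. convolve f (rescaled k \<epsilon>) x - f x))\<^sup>2
      \<le> (LINT z|lborel. k z * (L2_norm (\<lambda>x. f (x - \<epsilon> *\<^sub>R z) - f x))\<^sup>2)" (is "_ \<le> ?R")
proof -
  have [measurable]: "f \<in> borel_measurable borel" using f by simp
  define D where "D x z = f (x - \<epsilon> *\<^sub>R z) - f x" for x z
  have D_meas[measurable]: "(\<lambda>(x, z). D x z) \<in> borel_measurable (borel \<Otimes>\<^sub>M borel)"
    unfolding D_def by measurable
  define G where "G x = convolve f (rescaled k \<epsilon>) x - f x" for x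
  have conv: "convolve f (rescaled k \<epsilon>) = (\<lambda>x. LINT z|lborel. k z *\<^sub>R f (x - \<epsilon> *\<^sub>R z))"
    by (rule ext, rule convolve_rescaled) (use \<epsilon> in auto)
  have [measurable]: "convolve f (rescaled k \<epsilon>) \<in> borel_measurable borel"
    unfolding conv by measurable
  then have [measurable]: "G \<in> borel_measurable borel" unfolding G_def by measurable
  have DL2: "(\<lambda>x. D x z) \<in> L2" for z
    unfolding D_def by (intro L2_diff L2_translate f)
  define N where "N z = (L2_norm (\<lambda>x. D x z))\<^sup>2" for z
  have N_eq: "N z = (LINT x|lborel. (cmod (D x z))\<^sup>2)" for z
    unfolding N_def by (rule L2_norm_power2)
  have [measurable]: "N \<in> borel_measurable borel" unfolding N_eq by measurable
  have N_le: "N z \<le> (2 * L2_norm f)\<^sup>2" for z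
    unfolding N_def D_def using L2_norm_diff_le[OF L2_translate(1)[OF f] f, of "\<epsilon> *\<^sub>R z"] L2_translate(2)[OF f]
    by (intro power_mono) auto
  have kN: "integrable lborel (\<lambda>z. k z * N z)"
  proof (rule Bochner_Integration.integrable_bound)
    show "integrable lborel (\<lambda>z. k z * (2 * L2_norm f)\<^sup>2)" using k1 by auto
    show "AE z in lborel. norm (k z * N z) \<le> norm (k z * (2 * L2_norm f)\<^sup>2)"
      using k1(1) N_le by (auto simp: abs_mult N_def intro!: mult_mono)
  qed measurable
  have "(\<integral>\<^sup>+x. \<integral>\<^sup>+z. ennreal (k z * (cmod (D x z))\<^sup>2) \<partial>lborel \<partial>lborel)
      = (\<integral>\<^sup>+z. \<integral>\<^sup>+x. ennreal (k z * (cmod (D x z))\<^sup>2) \<partial>lborel \<partial>lborel)"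
    by (rule lborel_pair.Fubini'[symmetric]) (simp add: split_beta', measurable)
  also have "\<dots> = (\<integral>\<^sup>+z. ennreal (k z * N z) \<partial>lborel)"
  proof (intro nn_integral_cong)
    fix z
    show "(\<integral>\<^sup>+x. ennreal (k z * (cmod (D x z))\<^sup>2) \<partial>lborel) = ennreal (k z * N z)"
      using k1(1)[of z] L2_integrable[OF DL2[of z]]
      by (subst nn_integral_eq_integral) (auto simp: N_eq)
  qed
  also have "\<dots> = ennreal (LINT z|lborel. k z * N z)"
    using kN k1(1) by (intro nn_integral_eq_integral) (auto simp: N_def)
  finally have Ton: "(\<integral>\<^sup>+x. \<integral>\<^sup>+z. ennreal (k z * (cmod (D x z))\<^sup>2) \<partial>lborel \<partial>lborel) = ennreal (LINT z|lborel. k z * N z)" .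
  have "AE x in lborel. (\<integral>\<^sup>+z. ennreal (k z * (cmod (D x z))\<^sup>2) \<partial>lborel) \<noteq> \<infinity>"
    by (rule nn_integral_PInf_AE) (use Ton in auto)
  then have le: "AE x in lborel. ennreal ((cmod (G x))\<^sup>2) \<le> (\<integral>\<^sup>+z. ennreal (k z * (cmod (D x z))\<^sup>2) \<partial>lborel)"
  proof eventually_elim
    case (elim x)
    have int: "integrable lborel (\<lambda>z. k z * (cmod (D x z))\<^sup>2)"
      by (rule integrableI_nonneg) (use elim k1(1) in \<open>auto simp: less_top\<close>)
    have "D x \<in> borel_measurable lborel" by measurable
    note J = power2_norm_integral_le[OF _ this k1 int]
    have kD: "integrable lborel (\<lambda>z. k z *\<^sub>R D x z)" using J(1) by simp
    have "G x = (LINT z|lborel. k z *\<^sub>R D x z)"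
    proof -
      have "(LINT z|lborel. k z *\<^sub>R f (x - \<epsilon> *\<^sub>R z)) = (LINT z|lborel. k z *\<^sub>R D x z + k z *\<^sub>R f x)"
        by (simp add: D_def algebra_simps)
      also have "\<dots> = (LINT z|lborel. k z *\<^sub>R D x z) + f x"
        using kD k1 by (simp add: integral_scaleR_left)
      finally show ?thesis by (simp add: G_def conv)
    qed
    then have "(cmod (G x))\<^sup>2 \<le> (LINT z|lborel. k z * (cmod (D x z))\<^sup>2)"
      using J(2) by simp
    then show ?case
      by (subst nn_integral_eq_integral[OF int]) (use k1(1) in \<open>auto intro: ennreal_leI\<close>)
  qed
  have G: "(\<integral>\<^sup>+x. ennreal ((cmod (G x))\<^sup>2) \<partial>lborel) \<le> ennreal (LINT z|lborel. k z * N z)"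
    unfolding Ton[symmetric] by (rule nn_integral_mono_AE) (use le in simp)
  have GL2: "G \<in> L2"
    by (rule L2I) (auto intro!: integrableI_nonneg order_le_less_trans[OF G])
  show ?L
    using L2_add[OF GL2 f] by (simp add: G_def)
  have "ennreal ((L2_norm G)\<^sup>2) \<le> ennreal (LINT z|lborel. k z * N z)"
    using G unfolding L2_norm_power2
    by (subst (asm) nn_integral_eq_integral) (auto simp: L2_integrable[OF GL2])
  then show "(L2_norm (\<lambda>x. convolve f (rescaled k \<epsilon>) x - f x))\<^sup>2 \<le> ?R"
    unfolding G_def[abs_def] N_def D_def
    by (subst (asm) ennreal_le_iff) (auto intro!: integral_nonneg_AE simp: k1(1))
qed

text \<open>In the averaged estimate the integrand tends to zero pointwise by continuity of translations, and it
  is dominated by a multiple of the kernel.\<close>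

lemma approximate_identity:
  fixes f :: "'a::euclidean_space \<Rightarrow> complex"
  assumes f: "f \<in> L2" and k[measurable]: "k \<in> borel_measurable borel"
    and k1: "\<And>x. 0 \<le> k x" "integrable lborel k" "(LINT x|lborel. k x) = 1"
  shows "((\<lambda>\<epsilon>. L2_norm (\<lambda>x. convolve f (rescaled k \<epsilon>) x - f x)) \<longlongrightarrow> 0) (at_right 0)"
  unfolding tendsto_at_iff_sequentially
proof (intro allI impI)
  fix E :: "nat \<Rightarrow> real"
  assume E: "\<forall>i. E i \<in> {0<..} - {0}" and E0: "E \<longlonglongrightarrow> 0"
  have [measurable]: "f \<in> borel_measurable borel" using f by simp
  define N where "N n z = (L2_norm (\<lambda>x. f (x - E n *\<^sub>R z) - f x))\<^sup>2" for n z
  have [measurable]: "N n \<in> borel_measurable borel" for n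
    unfolding N_def L2_norm_power2 by measurable
  have N_le: "N n z \<le> (2 * L2_norm f)\<^sup>2" for n z
    unfolding N_def using L2_norm_diff_le[OF L2_translate(1)[OF f] f, of "E n *\<^sub>R z"] L2_translate(2)[OF f]
    by (intro power_mono) auto
  have "(\<lambda>n. LINT z|lborel. k z * N n z) \<longlonglongrightarrow> (LINT (z::'a)|lborel. 0)"
  proof (rule integral_dominated_convergence)
    show "integrable lborel (\<lambda>z. k z * (2 * L2_norm f)\<^sup>2)" using k1 by auto
    show "AE z in lborel. norm (k z * N n z) \<le> k z * (2 * L2_norm f)\<^sup>2" for n
      using k1(1) N_le by (auto simp: abs_mult N_def intro!: mult_mono)
    have "(\<lambda>n. N n z) \<longlonglongrightarrow> 0" for z
    proof -
      have "(\<lambda>n. E n *\<^sub>R z) \<longlonglongrightarrow> 0 *\<^sub>R z" by (intro tendsto_intros E0)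
      then have "(\<lambda>n. L2_norm (\<lambda>x. f (x - E n *\<^sub>R z) - f x)) \<longlonglongrightarrow> 0"
        by (intro L2_translation_tendsto f) simp
      from tendsto_power[OF this, of 2] show ?thesis by (simp add: N_def)
    qed
    then show "AE z in lborel. (\<lambda>n. k z * N n z) \<longlonglongrightarrow> 0"
      by (intro AE_I2 tendsto_mult_right_zero)
  qed measurable
  then have lim: "(\<lambda>n. LINT z|lborel. k z * N n z) \<longlonglongrightarrow> 0" by simp
  have "(\<lambda>n. (L2_norm (\<lambda>x. convolve f (rescaled k (E n)) x - f x))\<^sup>2) \<longlonglongrightarrow> 0"
  proof (rule tendsto_sandwich[OF _ _ tendsto_const lim])
    show "\<forall>\<^sub>F n in sequentially. (L2_norm (\<lambda>x. convolve f (rescaled k (E n)) x - f x))\<^sup>2 \<le> (LINT z|lborel. k z * N n z)"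
      unfolding N_def using convolve_rescaled_L2(2)[OF f k k1] E by simp
  qed auto
  then show "((\<lambda>\<epsilon>. L2_norm (\<lambda>x. convolve f (rescaled k \<epsilon>) x - f x)) \<circ> E) \<longlonglongrightarrow> 0"
    unfolding o_def by (rule tendsto_zero_power2D)
qed

section \<open>The Fourier--Plancherel transform\<close>

abbreviation fourier_const :: "'a::euclidean_space itself \<Rightarrow> real" where
  "fourier_const _ \<equiv> (2 * pi) powr (- real DIM('a) / 2)"

definition gauss :: "'a::euclidean_space \<Rightarrow> real" where
  "gauss x = fourier_const TYPE('a) * exp (- (norm x)\<^sup>2 / 2)"

lemma gauss_measurable [measurable]: "gauss \<in> borel_measurable borel"
  unfolding gauss_def by measurable

lemma gauss_nonneg: "0 \<le> gauss x"
  by (simp add: gauss_def)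

lemma fourier_const_power: "fourier_const TYPE('a::euclidean_space) = (1 / sqrt (2 * pi)) ^ DIM('a)"
proof -
  have "(2 * pi) powr (- real DIM('a) / 2) = ((2 * pi) powr (- 1 / 2)) powr (real DIM('a))"
    by (simp add: powr_powr)
  also have "\<dots> = ((2 * pi) powr (- 1 / 2)) ^ DIM('a)" by (simp add: powr_realpow)
  also have "(2 * pi) powr (- 1 / 2) = 1 / sqrt (2 * pi)"
    by (simp add: powr_minus powr_half_sqrt divide_simps flip: minus_divide_left)
  finally show ?thesis .
qed

lemma cis_sum: "finite A \<Longrightarrow> cis (\<Sum>b\<in>A. f b) = (\<Prod>b\<in>A. cis (f b))"
  by (induction A rule: finite_induct) (auto simp: cis_mult[symmetric])

lemma cis_measurable [measurable (raw)]:
  "f \<in> borel_measurable M \<Longrightarrow> (\<lambda>x. cis (f x)) \<in> borel_measurable M"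
  by (rule borel_measurable_continuous_on[of cis]) (intro continuous_intros)

lemma std_normal_fourier:
  "(LINT t|lborel. cis (- (t * a)) * of_real (std_normal_density t)) = of_real (exp (- a\<^sup>2 / 2))"
proof -
  have "of_real (exp (- a\<^sup>2 / 2)) = char std_normal_distribution (- a)"
    by (simp add: char_std_normal_distribution)
  also have "\<dots> = (LINT t|lborel. std_normal_density t *\<^sub>R iexp (- a * t))"
    unfolding char_def by (subst integral_density) auto
  also have "\<dots> = (LINT t|lborel. cis (- (t * a)) * of_real (std_normal_density t))"
    by (intro Bochner_Integration.integral_cong)
       (auto simp: cis_conv_exp scaleR_conv_of_real mult.commute)
  finally show ?thesis ..
qed

text \<open>The Gaussian and the characters factor over the coordinates, so that the product measure reduces the
  transform to the one-dimensional characteristic function of the normal distribution.\<close>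

lemma gauss_fourier:
  fixes y :: "'a::euclidean_space"
  shows "integrable lborel (\<lambda>x::'a. cis (- (x \<bullet> y)) * of_real (gauss x))" (is ?I)
    and "(LINT x|lborel. cis (- (x \<bullet> y)) * of_real (gauss x)) = of_real (exp (- (norm y)\<^sup>2 / 2))" (is ?E)
proof -
  interpret product_sigma_finite "\<lambda>_::'a. lborel :: real measure" ..
  define T where "T = (\<lambda>f::'a \<Rightarrow> real. \<Sum>b\<in>Basis. f b *\<^sub>R b)"
  have T[measurable]: "T \<in> measurable (\<Pi>\<^sub>M b\<in>Basis. lborel) borel"
    unfolding T_def by measurable
  define h where "h = (\<lambda>(b::'a) t. cis (- (t * (y \<bullet> b))) * complex_of_real (std_normal_density t))"
  have norm_T: "(norm (T f))\<^sup>2 = (\<Sum>b\<in>Basis. (f b)\<^sup>2)" for f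
    unfolding power2_norm_eq_inner T_def
    by (simp add: inner_sum_left inner_sum_right inner_Basis if_distrib power2_eq_square cong: if_cong)
  have inner_T: "T f \<bullet> y = (\<Sum>b\<in>Basis. f b * (y \<bullet> b))" for f
    unfolding T_def inner_sum_left inner_scaleR_left by (simp only: inner_commute)
  have fac: "cis (- (T f \<bullet> y)) * of_real (gauss (T f)) = (\<Prod>b\<in>Basis. h b (f b))" for f
    unfolding inner_T gauss_def norm_T h_def fourier_const_power
    by (simp add: cis_sum sum_negf[symmetric] exp_sum sum_divide_distrib prod.distrib std_normal_density_def
        power_divide prod_dividef)
  have h_int: "integrable lborel (h b)" for b
  proof -
    have "integrable lborel (\<lambda>t. complex_of_real (std_normal_density t))"
      using integrable_normal_density[of 1 0] by simp
    then show ?thesis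
      by (rule Bochner_Integration.integrable_bound) (auto simp: h_def norm_mult)
  qed
  have "integrable (\<Pi>\<^sub>M b\<in>Basis. lborel) (\<lambda>f. \<Prod>b\<in>Basis. h b (f b))"
    by (rule product_integrable_prod) (auto simp: h_int)
  then show ?I
    by (subst lborel_eq, fold T_def) (subst integrable_distr_eq, auto simp: fac)
  have "(LINT x|lborel. cis (- (x \<bullet> y)) * of_real (gauss x))
      = (LINT f|(\<Pi>\<^sub>M b\<in>Basis. lborel). cis (- (T f \<bullet> y)) * of_real (gauss (T f)))"
    by (subst lborel_eq, fold T_def) (subst integral_distr, auto)
  also have "\<dots> = (\<Prod>b\<in>Basis. LINT t|lborel. h b t)"
    unfolding fac by (rule product_integral_prod) (auto simp: h_int)
  also have "\<dots> = (\<Prod>b\<in>Basis. of_real (exp (- (y \<bullet> b)\<^sup>2 / 2)))"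
    unfolding h_def std_normal_fourier ..
  also have "\<dots> = of_real (exp (\<Sum>b\<in>Basis. - (y \<bullet> b)\<^sup>2 / 2))"
    by (simp add: exp_sum)
  also have "(\<Sum>b\<in>Basis. - (y \<bullet> b)\<^sup>2 / 2) = - (norm y)\<^sup>2 / 2"
    unfolding power2_norm_eq_inner
    by (simp add: sum_negf sum_divide_distrib[symmetric] euclidean_inner[of y y] power2_eq_square)
  finally show ?E .
qed

lemma gauss_integrable: "integrable lborel (gauss :: 'a::euclidean_space \<Rightarrow> real)"
  and gauss_integral: "(LINT x|lborel. gauss (x::'a)) = 1"
proof -
  have i: "integrable lborel (\<lambda>x::'a. complex_of_real (gauss x))"
    using gauss_fourier(1)[of "0::'a"] by simp
  from integrable_Re[OF this] show "integrable lborel (gauss :: 'a \<Rightarrow> real)" by simp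
  have "complex_of_real (LINT x|lborel. gauss (x::'a)) = 1"
    using gauss_fourier(2)[of "0::'a"] i by simp
  then show "(LINT x|lborel. gauss (x::'a)) = 1" by (simp only: of_real_eq_1_iff)
qed

lemma fourier_measurable [measurable (raw)]:
  assumes [measurable]: "f \<in> borel_measurable borel"
  shows "fourier f \<in> borel_measurable borel"
  unfolding fourier_def by measurable

lemma integrable_cis_mult:
  assumes "integrable lborel f" and [measurable]: "g \<in> borel_measurable borel"
  shows "integrable lborel (\<lambda>x. cis (g x) * f x)"
proof -
  have [measurable]: "f \<in> borel_measurable borel" using borel_measurable_integrable[OF assms(1)] by simp
  show ?thesis
    by (rule Bochner_Integration.integrable_bound[OF assms(1)]) (auto simp: norm_mult)
qed

lemma fourier_bounded:
  fixes f :: "'a::euclidean_space \<Rightarrow> complex"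
  assumes "integrable lborel f"
  shows "cmod (fourier f \<xi>) \<le> fourier_const TYPE('a) * (LINT x|lborel. cmod (f x))"
proof -
  have "cmod (LINT x|lborel. cis (- (x \<bullet> \<xi>)) * f x) \<le> (LINT x|lborel. cmod (cis (- (x \<bullet> \<xi>)) * f x))"
    by (rule integral_norm_bound)
  then show ?thesis
    unfolding fourier_def by (auto simp: norm_mult intro!: mult_left_mono)
qed

text \<open>For integrable \<open>a\<close> and \<open>b\<close> a bounded kernel makes \<open>a(x) K(x,y) b(y)\<close> integrable on the product. The
  characters are kernels of this kind.\<close>

lemma Fubini_kernel:
  fixes a b :: "'a::euclidean_space \<Rightarrow> complex"
  assumes a: "integrable lborel a" and b: "integrable lborel b"
    and K[measurable]: "(\<lambda>(x, y). K x y) \<in> borel_measurable (borel \<Otimes>\<^sub>M borel)"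
    and C: "\<And>x y. cmod (K x y) \<le> C"
  shows "(LINT x|lborel. a x * (LINT y|lborel. K x y * b y)) = (LINT y|lborel. b y * (LINT x|lborel. K x y * a x))"
proof -
  have [measurable]: "a \<in> borel_measurable borel" "b \<in> borel_measurable borel"
    using borel_measurable_integrable[OF a] borel_measurable_integrable[OF b] by simp_all
  have C0: "0 \<le> C" using order_trans[OF norm_ge_zero C] .
  have Kb: "integrable lborel (\<lambda>y. K x y * b y)" for x
  proof (rule Bochner_Integration.integrable_bound)
    show "integrable lborel (\<lambda>y. complex_of_real C * b y)" using b by simp
    show "AE y in lborel. norm (K x y * b y) \<le> norm (of_real C * b y)"
      using C C0 by (auto simp: norm_mult intro!: mult_right_mono)
  qed measurable
  have "integrable (lborel \<Otimes>\<^sub>M lborel) (\<lambda>(x, y). a x * (K x y * b y))"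
  proof (rule lborel_pair.Fubini_integrable)
    show "integrable lborel (\<lambda>x. LINT y|lborel. norm (case (x, y) of (x, y) \<Rightarrow> a x * (K x y * b y)))"
    proof (rule Bochner_Integration.integrable_bound)
      show "integrable lborel (\<lambda>x. (C * (LINT y|lborel. cmod (b y))) *\<^sub>R a x)" using a by simp
      show "AE x in lborel. norm (LINT y|lborel. norm (case (x, y) of (x, y) \<Rightarrow> a x * (K x y * b y)))
          \<le> norm ((C * (LINT y|lborel. cmod (b y))) *\<^sub>R a x)"
      proof (rule AE_I2)
        fix x
        have "(LINT y|lborel. cmod (K x y * b y)) \<le> (LINT y|lborel. C * cmod (b y))"
          using integrable_norm[OF Kb[of x]] integrable_norm[OF b] C C0
          by (intro integral_mono) (auto simp: norm_mult intro!: mult_right_mono)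
        then have "cmod (a x) * (LINT y|lborel. cmod (K x y * b y)) \<le> cmod (a x) * (C * (LINT y|lborel. cmod (b y)))"
          by (intro mult_left_mono) auto
        moreover have "0 \<le> (LINT y|lborel. cmod (b y))" by (intro integral_nonneg_AE) auto
        moreover have "0 \<le> (LINT y|lborel. cmod (K x y * b y))" by (intro integral_nonneg_AE) auto
        ultimately show "norm (LINT y|lborel. norm (case (x, y) of (x, y) \<Rightarrow> a x * (K x y * b y)))
          \<le> norm ((C * (LINT y|lborel. cmod (b y))) *\<^sub>R a x)"
          using C0 by (simp add: norm_mult[of "a x"] abs_mult mult.commute)
      qed
    qed measurable
    show "AE x in lborel. integrable lborel (\<lambda>y. case (x, y) of (x, y) \<Rightarrow> a x * (K x y * b y))"
      using Kb by auto
  qed measurable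
  then have "(LINT y|lborel. LINT x|lborel. a x * (K x y * b y)) = (LINT x|lborel. LINT y|lborel. a x * (K x y * b y))"
    by (rule lborel_pair.Fubini_integral)
  moreover have "(LINT y|lborel. LINT x|lborel. a x * (K x y * b y)) = (LINT y|lborel. b y * (LINT x|lborel. K x y * a x))"
    by (simp flip: integral_mult_right_zero add: algebra_simps)
  ultimately show ?thesis by (simp flip: integral_mult_right_zero)
qed

lemma fourier_multiplication_formula:
  fixes f g :: "'a::euclidean_space \<Rightarrow> complex"
  assumes "integrable lborel f" "integrable lborel g"
  shows "(LINT x|lborel. fourier f x * g x) = (LINT x|lborel. f x * fourier g x)"
proof -
  have "(LINT x|lborel. g x * (LINT y|lborel. cis (- (y \<bullet> x)) * f y)) = (LINT y|lborel. f y * (LINT x|lborel. cis (- (y \<bullet> x)) * g x))"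
    by (rule Fubini_kernel[OF assms(2,1), where C = 1]) auto
  moreover define I where "I h x = (LINT y|lborel. cis (- (y \<bullet> x)) * h y)" for h :: "'a \<Rightarrow> complex" and x
  ultimately have "(LINT x|lborel. g x * I f x) = (LINT x|lborel. f x * I g x)"
    by (simp add: inner_commute)
  then have "of_real (fourier_const TYPE('a)) * (LINT x|lborel. g x * I f x)
      = of_real (fourier_const TYPE('a)) * (LINT x|lborel. f x * I g x)" by simp
  then show ?thesis
    unfolding integral_mult_right_zero[symmetric] fourier_def I_def[symmetric]
    by (simp add: mult_ac)
qed

lemma gauss_rescaled_fourier:
  fixes z :: "'a::euclidean_space"
  assumes "0 < \<epsilon>"
  shows "of_real (fourier_const TYPE('a)) * (LINT \<xi>|lborel. cis (- (z \<bullet> \<xi>)) * of_real (gauss (\<epsilon> *\<^sub>R \<xi>))) = of_real (rescaled gauss \<epsilon> z)"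
proof -
  define F where "F \<eta> = cis (- ((z /\<^sub>R \<epsilon>) \<bullet> \<eta>)) * complex_of_real (gauss \<eta>)" for \<eta> :: 'a
  have [measurable]: "F \<in> borel_measurable borel" unfolding F_def by measurable
  have "of_real (exp (- (norm (z /\<^sub>R \<epsilon>))\<^sup>2 / 2)) = (LINT \<eta>|lborel. F \<eta>)"
    using gauss_fourier(2)[of "z /\<^sub>R \<epsilon>"] by (simp add: F_def inner_commute)
  also have "\<dots> = \<bar>\<epsilon>\<bar>^DIM('a) *\<^sub>R (LINT \<xi>|lborel. F (0 + \<epsilon> *\<^sub>R \<xi>))"
    by (rule integral_affine) (use assms in auto)
  also have "(\<lambda>\<xi>. F (0 + \<epsilon> *\<^sub>R \<xi>)) = (\<lambda>\<xi>. cis (- (z \<bullet> \<xi>)) * of_real (gauss (\<epsilon> *\<^sub>R \<xi>)))"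
    using assms by (simp add: F_def field_simps)
  finally have "(LINT \<xi>|lborel. cis (- (z \<bullet> \<xi>)) * of_real (gauss (\<epsilon> *\<^sub>R \<xi>)))
      = of_real (exp (- (norm (z /\<^sub>R \<epsilon>))\<^sup>2 / 2) / \<epsilon>^DIM('a))"
    using assms by (simp add: scaleR_conv_of_real field_simps)
  then show ?thesis by (simp add: rescaled_def gauss_def)
qed

text \<open>The Gaussian-weighted energy of the transform is the pairing of \<open>f\<close> with a Gaussian regularisation
  of itself, because the weight is itself a transform. Letting the width tend to zero gives
  Plancherel's identity: monotone convergence on the left, the approximate identity on the right.\<close>

lemma fourier_gauss_energy:
  fixes f :: "'a::euclidean_space \<Rightarrow> complex"
  assumes f: "integrable lborel f" and \<epsilon>: "0 < \<epsilon>"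
  shows "(LINT \<xi>|lborel. exp (- \<epsilon>\<^sup>2 * (norm \<xi>)\<^sup>2 / 2) * (cmod (fourier f \<xi>))\<^sup>2)
       = Re (LINT y|lborel. convolve f (rescaled gauss \<epsilon>) y * cnj (f y))"
proof -
  have [measurable]: "f \<in> borel_measurable borel" using borel_measurable_integrable[OF f] by simp
  let ?c = "complex_of_real (fourier_const TYPE('a))"
  have c0: "fourier_const TYPE('a) > 0" by simp
  define g where "g \<xi> = complex_of_real (gauss (\<epsilon> *\<^sub>R \<xi>))" for \<xi> :: 'a
  have [measurable]: "g \<in> borel_measurable borel" unfolding g_def by measurable
  have g_int: "integrable lborel g"
    using integrable_affine[of "gauss :: 'a \<Rightarrow> real" \<epsilon> 0] gauss_integrable[where 'a='a] \<epsilon> by (simp add: g_def[abs_def])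
  have gf_int: "integrable lborel (\<lambda>\<xi>. g \<xi> * fourier f \<xi>)"
  proof (rule Bochner_Integration.integrable_bound)
    show "integrable lborel (\<lambda>\<xi>. (fourier_const TYPE('a) * (LINT x|lborel. cmod (f x))) *\<^sub>R g \<xi>)"
      using g_int by simp
    show "AE \<xi> in lborel. norm (g \<xi> * fourier f \<xi>) \<le> norm ((fourier_const TYPE('a) * (LINT x|lborel. cmod (f x))) *\<^sub>R g \<xi>)"
      using fourier_bounded[OF f] by (auto simp: norm_mult mult.commute intro!: mult_left_mono order_trans[OF _ abs_ge_self])
  qed measurable
  have inner: "(LINT \<xi>|lborel. cis (y \<bullet> \<xi>) * (g \<xi> * fourier f \<xi>)) = convolve f (rescaled gauss \<epsilon>) y" for y
  proof -
    have cg: "integrable lborel (\<lambda>\<xi>. cis (y \<bullet> \<xi>) * g \<xi>)" by (intro integrable_cis_mult g_int) measurable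
    have "(LINT \<xi>|lborel. cis (y \<bullet> \<xi>) * (g \<xi> * fourier f \<xi>))
        = ?c * (LINT \<xi>|lborel. (cis (y \<bullet> \<xi>) * g \<xi>) * (LINT x|lborel. cis (- (x \<bullet> \<xi>)) * f x))"
    proof -
      define I where "I \<xi> = (LINT x|lborel. cis (- (x \<bullet> \<xi>)) * f x)" for \<xi>
      show ?thesis
        unfolding fourier_def I_def[symmetric]
        by (subst integral_mult_right_zero[symmetric]) (simp add: mult_ac)
    qed
    also have "\<dots> = ?c * (LINT x|lborel. f x * (LINT \<xi>|lborel. cis (- (x \<bullet> \<xi>)) * (cis (y \<bullet> \<xi>) * g \<xi>)))"
      by (subst Fubini_kernel[OF cg f, where C = 1]) auto
    also have "\<dots> = (LINT x|lborel. f x * (?c * (LINT \<xi>|lborel. cis (- ((x - y) \<bullet> \<xi>)) * g \<xi>)))"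
    proof -
      have *: "cis (- (x \<bullet> \<xi>)) * (cis (y \<bullet> \<xi>) * g \<xi>) = cis (- ((x - y) \<bullet> \<xi>)) * g \<xi>" for x \<xi>
        unfolding mult.assoc[symmetric] cis_mult by (simp add: inner_diff_left)
      show ?thesis
        unfolding * by (subst integral_mult_right_zero[symmetric]) (simp only: mult_ac)
    qed
    also have "\<dots> = (LINT x|lborel. f x * of_real (rescaled gauss \<epsilon> (x - y)))"
      unfolding g_def gauss_rescaled_fourier[OF \<epsilon>] ..
    also have "\<dots> = convolve f (rescaled gauss \<epsilon>) y"
      unfolding convolve_def rescaled_def gauss_def
      by (simp add: norm_minus_commute scaleR_conv_of_real mult.commute)
    finally show ?thesis .
  qed
  have cf: "integrable lborel (\<lambda>y. cnj (f y))" using f by simp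
  have cnj_four: "cnj (fourier f \<xi>) = ?c * (LINT y|lborel. cis (y \<bullet> \<xi>) * cnj (f y))" for \<xi>
  proof -
    have "cnj (LINT x|lborel. cis (- (x \<bullet> \<xi>)) * f x) = (LINT x|lborel. cnj (cis (- (x \<bullet> \<xi>)) * f x))"
      by (rule Bochner_Integration.integral_cnj[symmetric])
    also have "\<dots> = (LINT y|lborel. cis (y \<bullet> \<xi>) * cnj (f y))"
      by (rule Bochner_Integration.integral_cong) (auto simp: cis_cnj)
    finally show ?thesis by (simp add: fourier_def)
  qed
  have "(LINT \<xi>|lborel. (g \<xi> * fourier f \<xi>) * cnj (fourier f \<xi>))
      = ?c * (LINT \<xi>|lborel. (g \<xi> * fourier f \<xi>) * (LINT y|lborel. cis (y \<bullet> \<xi>) * cnj (f y)))"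
    unfolding cnj_four by (subst integral_mult_right_zero[symmetric]) (simp only: mult_ac)
  also have "\<dots> = ?c * (LINT y|lborel. cnj (f y) * (LINT \<xi>|lborel. cis (y \<bullet> \<xi>) * (g \<xi> * fourier f \<xi>)))"
    by (subst Fubini_kernel[OF gf_int cf, where C = 1]) auto
  also have "\<dots> = ?c * (LINT y|lborel. convolve f (rescaled gauss \<epsilon>) y * cnj (f y))"
    unfolding inner by (simp add: mult.commute)
  finally have *: "(LINT \<xi>|lborel. (g \<xi> * fourier f \<xi>) * cnj (fourier f \<xi>))
      = ?c * (LINT y|lborel. convolve f (rescaled gauss \<epsilon>) y * cnj (f y))" .
  have "(LINT \<xi>|lborel. (g \<xi> * fourier f \<xi>) * cnj (fourier f \<xi>))
      = (LINT \<xi>|lborel. complex_of_real (fourier_const TYPE('a) * (exp (- \<epsilon>\<^sup>2 * (norm \<xi>)\<^sup>2 / 2) * (cmod (fourier f \<xi>))\<^sup>2)))"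
    by (intro Bochner_Integration.integral_cong refl)
       (simp add: g_def gauss_def complex_norm_square[symmetric] power_mult_distrib mult.assoc)
  also have "\<dots> = ?c * of_real (LINT \<xi>|lborel. exp (- \<epsilon>\<^sup>2 * (norm \<xi>)\<^sup>2 / 2) * (cmod (fourier f \<xi>))\<^sup>2)"
    by (subst integral_complex_of_real) simp
  finally have "complex_of_real (LINT \<xi>|lborel. exp (- \<epsilon>\<^sup>2 * (norm \<xi>)\<^sup>2 / 2) * (cmod (fourier f \<xi>))\<^sup>2)
      = (LINT y|lborel. convolve f (rescaled gauss \<epsilon>) y * cnj (f y))"
    unfolding * using c0 by simp
  from arg_cong[OF this, of Re] show ?thesis unfolding Re_complex_of_real .
qed

theorem plancherel_L1_L2:
  fixes f :: "'a::euclidean_space \<Rightarrow> complex"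
  assumes f1: "integrable lborel f" and f2: "f \<in> L2"
  shows "fourier f \<in> L2" and "L2_norm (fourier f) = L2_norm f"
proof -
  have [measurable]: "f \<in> borel_measurable borel" using f2 by simp
  define E where "E n = 1 / real (Suc n)" for n
  have E: "0 < E n" for n by (simp add: E_def)
  have E0: "E \<longlonglongrightarrow> 0" unfolding E_def by (rule LIMSEQ_Suc[OF lim_1_over_n])
  define w where "w n \<xi> = exp (- (E n)\<^sup>2 * (norm \<xi>)\<^sup>2 / 2) * (cmod (fourier f \<xi>))\<^sup>2" for n and \<xi> :: 'a
  have w_int: "integrable lborel (w n)" for n
  proof (rule Bochner_Integration.integrable_bound)
    let ?C = "(fourier_const TYPE('a) * (LINT x|lborel. cmod (f x)))\<^sup>2"
    show "integrable lborel (\<lambda>\<xi>::'a. (?C / fourier_const TYPE('a)) * gauss (0 + E n *\<^sub>R \<xi>))"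
      using E[of n] by (intro integrable_mult_right, subst integrable_affine) (auto simp: gauss_integrable)
    show "AE \<xi> in lborel. norm (w n \<xi>) \<le> norm (?C / fourier_const TYPE('a) * gauss (0 + E n *\<^sub>R \<xi>))"
    proof (rule AE_I2)
      fix \<xi> :: 'a
      have "(cmod (fourier f \<xi>))\<^sup>2 \<le> ?C" by (intro power_mono fourier_bounded f1) auto
      then show "norm (w n \<xi>) \<le> norm (?C / fourier_const TYPE('a) * gauss (0 + E n *\<^sub>R \<xi>))"
        by (simp add: w_def gauss_def power_mult_distrib abs_mult)
    qed
    show "w n \<in> borel_measurable lborel" unfolding w_def by measurable
  qed
  have conv: "(\<lambda>n. abs_ltwo (convolve f (rescaled gauss (E n)))) \<longlonglongrightarrow> abs_ltwo f"
  proof (subst abs_tendsto_iff)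
    show "convolve f (rescaled gauss (E n)) \<in> L2" for n
      by (rule convolve_rescaled_L2(1)[OF f2 gauss_measurable gauss_nonneg gauss_integrable gauss_integral E])
    show "(\<lambda>n. L2_norm (\<lambda>x. convolve f (rescaled gauss (E n)) x - f x)) \<longlonglongrightarrow> 0"
      by (rule filterlim_compose[OF approximate_identity[OF f2 gauss_measurable gauss_nonneg gauss_integrable gauss_integral]])
         (use E E0 less_imp_neq[OF E, THEN not_sym] in \<open>auto simp: filterlim_at intro!: always_eventually\<close>)
  qed fact
  have "(\<lambda>n. inner (abs_ltwo (convolve f (rescaled gauss (E n)))) (abs_ltwo f)) \<longlonglongrightarrow> inner (abs_ltwo f) (abs_ltwo f)"
    by (intro tendsto_intros conv)
  moreover have "inner (abs_ltwo (convolve f (rescaled gauss (E n)))) (abs_ltwo f) = (LINT \<xi>|lborel. w n \<xi>)" for n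
    unfolding w_def fourier_gauss_energy[OF f1 E]
    by (rule inner_abs[OF convolve_rescaled_L2(1)[OF f2 gauss_measurable gauss_nonneg gauss_integrable gauss_integral E] f2])
  ultimately have lim: "(\<lambda>n. LINT \<xi>|lborel. w n \<xi>) \<longlonglongrightarrow> (L2_norm f)\<^sup>2"
    by (simp add: power2_norm_eq_inner[symmetric] norm_abs f2)
  have mono: "AE \<xi> in lborel. mono (\<lambda>n. w n \<xi>)"
  proof (intro AE_I2 monoI)
    fix \<xi> :: 'a and m n :: nat assume "m \<le> n"
    then have "(E n)\<^sup>2 \<le> (E m)\<^sup>2" by (intro power_mono) (auto simp: E_def frac_le)
    then have "(E n)\<^sup>2 * (norm \<xi>)\<^sup>2 \<le> (E m)\<^sup>2 * (norm \<xi>)\<^sup>2" by (intro mult_right_mono) auto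
    then show "w m \<xi> \<le> w n \<xi>"
      unfolding w_def by (intro mult_right_mono) auto
  qed
  have ptw: "AE \<xi> in lborel. (\<lambda>n. w n \<xi>) \<longlonglongrightarrow> (cmod (fourier f \<xi>))\<^sup>2"
  proof (rule AE_I2)
    fix \<xi> :: 'a
    have "(\<lambda>n. w n \<xi>) \<longlonglongrightarrow> exp (- 0\<^sup>2 * (norm \<xi>)\<^sup>2 / 2) * (cmod (fourier f \<xi>))\<^sup>2"
      unfolding w_def by (intro tendsto_intros E0) auto
    then show "(\<lambda>n. w n \<xi>) \<longlonglongrightarrow> (cmod (fourier f \<xi>))\<^sup>2" by simp
  qed
  have "(\<lambda>\<xi>. (cmod (fourier f \<xi>))\<^sup>2) \<in> borel_measurable lborel" by measurable
  note mc = w_int mono ptw lim this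
  show L: "fourier f \<in> L2"
    by (rule L2I) (use integrable_monotone_convergence[OF mc] in auto)
  have "(L2_norm (fourier f))\<^sup>2 = (L2_norm f)\<^sup>2"
    unfolding L2_norm_power2[of "fourier f"] by (rule integral_monotone_convergence[OF mc])
  then show "L2_norm (fourier f) = L2_norm f"
    by simp
qed

definition trunc :: "real \<Rightarrow> ('a::euclidean_space \<Rightarrow> complex) \<Rightarrow> 'a \<Rightarrow> complex" where
  "trunc R f x = indicator (cball 0 R) x *\<^sub>R f x"

lemma trunc_measurable [measurable (raw)]:
  fixes f :: "'a::euclidean_space \<Rightarrow> complex"
  assumes [measurable]: "f \<in> borel_measurable borel" shows "trunc R f \<in> borel_measurable borel"
proof -
  have [measurable]: "cball (0::'a) R \<in> sets borel" by simp
  show ?thesis unfolding trunc_def[abs_def] by measurable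
qed

lemma trunc_L2: assumes "f \<in> L2" shows "trunc R f \<in> L2"
proof (rule L2_boundI[OF _ L2_integrable[OF assms]])
  show "trunc R f \<in> borel_measurable lborel" using trunc_measurable[OF L2_measurable[OF assms]] by simp
qed (auto simp: trunc_def indicator_def)

lemma trunc_integrable: assumes "f \<in> L2" shows "integrable lborel (trunc R f)"
proof -
  have "(\<lambda>x::'a. indicator (cball 0 R) x :: complex) \<in> L2"
    by (rule L2_compact_support[of _ 1 R]) (auto simp: indicator_def)
  from L2_mult_integrable[OF this assms] show ?thesis
    unfolding trunc_def by (rule Bochner_Integration.integrable_cong[THEN iffD1, rotated -1]) (auto simp: indicator_def)
qed

lemma trunc_tendsto:
  fixes f :: "'a::euclidean_space \<Rightarrow> complex"
  assumes "f \<in> L2" shows "((\<lambda>R. L2_norm (\<lambda>x. trunc R f x - f x)) \<longlongrightarrow> 0) at_top"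
proof (rule tendsto_at_topI_sequentially)
  fix X :: "nat \<Rightarrow> real" assume X: "filterlim X at_top sequentially"
  show "(\<lambda>n. L2_norm (\<lambda>x. trunc (X n) f x - f x)) \<longlonglongrightarrow> 0"
  proof (rule L2_norm_tendsto_dominated[OF _ _ L2_integrable[OF assms]])
    show "AE x in lborel. (\<lambda>n. trunc (X n) f x) \<longlonglongrightarrow> f x"
    proof (rule AE_I2)
      fix x :: 'a
      have "eventually (\<lambda>n. norm x \<le> X n) sequentially"
        using X by (simp add: filterlim_at_top)
      then show "(\<lambda>n. trunc (X n) f x) \<longlonglongrightarrow> f x"
        by (intro tendsto_eventually) (auto elim!: eventually_mono simp: trunc_def)
    qed
    show "trunc (X n) f \<in> borel_measurable borel" for n
      by (rule trunc_measurable[OF L2_measurable[OF assms]])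
  qed (use assms in \<open>auto simp: trunc_def indicator_def\<close>)
qed

lemma trunc_abs_tendsto: "((\<lambda>R. abs_ltwo (trunc R (rep_ltwo f))) \<longlongrightarrow> f) at_top"
proof -
  have "((\<lambda>R. abs_ltwo (trunc R (rep_ltwo f))) \<longlongrightarrow> abs_ltwo (rep_ltwo f)) at_top"
    by (subst abs_tendsto_iff) (auto intro: trunc_L2 trunc_tendsto)
  then show ?thesis by simp
qed

lemma fourier_cong_AE:
  assumes "AE x in lborel. f x = g x"
    and [measurable]: "f \<in> borel_measurable borel" "g \<in> borel_measurable borel"
  shows "fourier f = fourier g"
  unfolding fourier_def
  by (rule ext, rule arg_cong[where f = "(*) _"], rule integral_cong_AE) (use assms(1) in auto)

lemma fourier_add:
  assumes "integrable lborel f" "integrable lborel g"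
  shows "fourier (\<lambda>x. f x + g x) = (\<lambda>\<xi>. fourier f \<xi> + fourier g \<xi>)"
  unfolding fourier_def
  by (rule ext) (simp add: distrib_left integrable_cis_mult assms)

lemma fourier_cmult: "fourier (\<lambda>x. c * f x) = (\<lambda>\<xi>. c * fourier f \<xi>)"
  unfolding fourier_def by (rule ext) (simp add: mult.left_commute)

lemma fourier_diff:
  assumes "integrable lborel f" "integrable lborel g"
  shows "fourier (\<lambda>x. f x - g x) = (\<lambda>\<xi>. fourier f \<xi> - fourier g \<xi>)"
  using fourier_add[OF assms(1), of "\<lambda>x. -1 * g x"] fourier_cmult[of "-1" g] assms(2) by simp

text \<open>Truncations to balls are integrable and converge in \<open>L\<^sup>2\<close>, so by Plancherel's identity their transforms
  form a Cauchy family.\<close>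

definition FT_trunc :: "real \<Rightarrow> 'a::euclidean_space ltwo \<Rightarrow> 'a ltwo" where
  "FT_trunc R f = abs_ltwo (fourier (trunc R (rep_ltwo f)))"

definition FT :: "'a::euclidean_space ltwo \<Rightarrow> 'a ltwo" where
  "FT f = Lim at_top (\<lambda>R. FT_trunc R f)"

lemma norm_FT_trunc_diff:
  assumes "integrable lborel f" "f \<in> L2" "integrable lborel g" "g \<in> L2"
  shows "norm (abs_ltwo (fourier f) - abs_ltwo (fourier g)) = L2_norm (\<lambda>x. f x - g x)"
proof -
  have "norm (abs_ltwo (fourier f) - abs_ltwo (fourier g)) = L2_norm (fourier (\<lambda>x. f x - g x))"
    by (simp add: norm_abs_diff plancherel_L1_L2 assms fourier_diff)
  also have "\<dots> = L2_norm (\<lambda>x. f x - g x)"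
    by (rule plancherel_L1_L2(2)) (auto intro: assms L2_diff)
  finally show ?thesis .
qed

lemma FT_trunc_tendsto: "((\<lambda>R. FT_trunc R f) \<longlongrightarrow> FT f) at_top"
proof -
  let ?f = "rep_ltwo f"
  define T where "T R = abs_ltwo (trunc R ?f)" for R
  have T: "(T \<longlongrightarrow> f) at_top" unfolding T_def by (rule trunc_abs_tendsto)
  have d: "norm (FT_trunc R f - FT_trunc S f) = norm (T R - T S)" for R S
    unfolding FT_trunc_def T_def
    by (subst norm_FT_trunc_diff) (auto simp: trunc_integrable trunc_L2 norm_abs_diff)
  have "Cauchy (\<lambda>n. T (real n))"
    by (rule LIMSEQ_imp_Cauchy) (rule filterlim_compose[OF T filterlim_real_sequentially])
  then have "Cauchy (\<lambda>n. FT_trunc (real n) f)"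
    unfolding Cauchy_iff d .
  then obtain g where g: "(\<lambda>n. FT_trunc (real n) f) \<longlonglongrightarrow> g"
    by (auto simp: Cauchy_convergent_iff convergent_def)
  have "norm (FT_trunc R f - g) = norm (T R - f)" for R
  proof (rule LIMSEQ_unique)
    show "(\<lambda>n. norm (FT_trunc R f - FT_trunc (real n) f)) \<longlonglongrightarrow> norm (FT_trunc R f - g)"
      by (intro tendsto_intros g)
    show "(\<lambda>n. norm (FT_trunc R f - FT_trunc (real n) f)) \<longlonglongrightarrow> norm (T R - f)"
      unfolding d by (intro tendsto_intros filterlim_compose[OF T filterlim_real_sequentially])
  qed
  then have "((\<lambda>R. FT_trunc R f) \<longlongrightarrow> g) at_top"
    using T by (subst Lim_null, subst tendsto_norm_zero_iff[symmetric])
      (simp, subst tendsto_norm_zero_iff, simp flip: Lim_null)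
  then show ?thesis
    unfolding FT_def using tendsto_Lim[OF trivial_limit_at_top_linorder] by metis
qed

lemma trunc_rep_abs:
  "f \<in> L2 \<Longrightarrow> AE x in lborel. trunc R (rep_ltwo (abs_ltwo f)) x = trunc R f x"
  using rep_abs[of f] by (auto simp: trunc_def)

lemma FT_trunc_abs: "f \<in> L2 \<Longrightarrow> FT_trunc R (abs_ltwo f) = abs_ltwo (fourier (trunc R f))"
  unfolding FT_trunc_def by (subst fourier_cong_AE[OF trunc_rep_abs]) auto

theorem has_L2_fourier_iff:
  "has_L2_fourier f g \<longleftrightarrow> f \<in> L2 \<and> g \<in> L2 \<and> FT (abs_ltwo f) = abs_ltwo g"
proof -
  have "((\<lambda>R. L2_norm (\<lambda>\<xi>. fourier (trunc R f) \<xi> - g \<xi>)) \<longlongrightarrow> 0) at_top \<longleftrightarrow> FT (abs_ltwo f) = abs_ltwo g"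
    if f: "f \<in> L2" and g: "g \<in> L2"
  proof -
    have "((\<lambda>R. L2_norm (\<lambda>\<xi>. fourier (trunc R f) \<xi> - g \<xi>)) \<longlongrightarrow> 0) at_top
        \<longleftrightarrow> ((\<lambda>R. norm (FT_trunc R (abs_ltwo f) - abs_ltwo g)) \<longlongrightarrow> 0) at_top"
      by (simp add: FT_trunc_abs f g norm_abs_diff plancherel_L1_L2(1) trunc_integrable trunc_L2)
    also have "\<dots> \<longleftrightarrow> ((\<lambda>R. FT_trunc R (abs_ltwo f)) \<longlongrightarrow> abs_ltwo g) at_top"
      by (subst tendsto_norm_zero_iff) (simp flip: Lim_null)
    also have "\<dots> \<longleftrightarrow> FT (abs_ltwo f) = abs_ltwo g"
      using FT_trunc_tendsto[of "abs_ltwo f"] tendsto_unique[OF trivial_limit_at_top_linorder] by metis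
    finally show ?thesis .
  qed
  then show ?thesis
    unfolding has_L2_fourier_def trunc_def by auto
qed

lemma FT_abs:
  assumes "integrable lborel f" "f \<in> L2"
  shows "FT (abs_ltwo f) = abs_ltwo (fourier f)"
proof -
  have "((\<lambda>R. norm (FT_trunc R (abs_ltwo f) - abs_ltwo (fourier f))) \<longlongrightarrow> 0) at_top"
    using trunc_tendsto[OF assms(2)]
    by (simp add: FT_trunc_abs norm_FT_trunc_diff assms trunc_integrable trunc_L2)
  then have "((\<lambda>R. FT_trunc R (abs_ltwo f)) \<longlongrightarrow> abs_ltwo (fourier f)) at_top"
    by (subst Lim_null, subst tendsto_norm_zero_iff[symmetric])
  then show ?thesis
    using FT_trunc_tendsto[of "abs_ltwo f"] tendsto_unique[OF trivial_limit_at_top_linorder] by metis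
qed

lemma norm_FT [simp]: "norm (FT f) = norm f"
proof -
  have "norm (FT_trunc R f) = norm (abs_ltwo (trunc R (rep_ltwo f)))" for R
    by (simp add: FT_trunc_def norm_abs plancherel_L1_L2 trunc_L2 trunc_integrable)
  then have "((\<lambda>R. norm (abs_ltwo (trunc R (rep_ltwo f)))) \<longlongrightarrow> norm (FT f)) at_top"
    using tendsto_norm[OF FT_trunc_tendsto[of f]] by simp
  moreover have "((\<lambda>R. norm (abs_ltwo (trunc R (rep_ltwo f)))) \<longlongrightarrow> norm f) at_top"
    by (intro tendsto_norm trunc_abs_tendsto)
  ultimately show ?thesis
    by (rule tendsto_unique[OF trivial_limit_at_top_linorder])
qed

lemma FT_add: "FT (f + g) = FT f + FT g"
proof (rule tendsto_unique[OF trivial_limit_at_top_linorder FT_trunc_tendsto])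
  have "FT_trunc R (f + g) = FT_trunc R f + FT_trunc R g" for R
  proof -
    have "AE x in lborel. trunc R (rep_ltwo (f + g)) x = trunc R (rep_ltwo f) x + trunc R (rep_ltwo g) x"
      using rep_add[of f g] by eventually_elim (auto simp: trunc_def algebra_simps)
    then have "fourier (trunc R (rep_ltwo (f + g))) = fourier (\<lambda>x. trunc R (rep_ltwo f) x + trunc R (rep_ltwo g) x)"
      by (rule fourier_cong_AE) measurable
    then show ?thesis
      unfolding FT_trunc_def by (simp add: fourier_add trunc_integrable trunc_L2 abs_add plancherel_L1_L2)
  qed
  then show "((\<lambda>R. FT_trunc R (f + g)) \<longlongrightarrow> FT f + FT g) at_top"
    by (simp add: tendsto_add FT_trunc_tendsto)
qed

lemma FT_cmult: "FT (mult_op (\<lambda>_. c) f) = mult_op (\<lambda>_. c) (FT f)"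
proof (rule tendsto_unique[OF trivial_limit_at_top_linorder FT_trunc_tendsto])
  interpret bounded_linear "mult_op (\<lambda>_. c) :: 'a ltwo \<Rightarrow> _" by (rule bounded_linear_mult) simp
  have "FT_trunc R (mult_op (\<lambda>_. c) f) = mult_op (\<lambda>_. c) (FT_trunc R f)" for R
  proof -
    have "AE x in lborel. trunc R (rep_ltwo (mult_op (\<lambda>_. c) f)) x = c * trunc R (rep_ltwo f) x"
      using rep_mult[of "\<lambda>_. c" f] by (auto simp: trunc_def)
    then have "fourier (trunc R (rep_ltwo (mult_op (\<lambda>_. c) f))) = fourier (\<lambda>x. c * trunc R (rep_ltwo f) x)"
      by (rule fourier_cong_AE) measurable
    then show ?thesis
      unfolding FT_trunc_def by (simp add: fourier_cmult trunc_integrable trunc_L2 mult_abs plancherel_L1_L2)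
  qed
  then show "((\<lambda>R. FT_trunc R (mult_op (\<lambda>_. c) f)) \<longlongrightarrow> mult_op (\<lambda>_. c) (FT f)) at_top"
    by (simp add: tendsto FT_trunc_tendsto)
qed

lemma mult_of_real: "mult_op (\<lambda>_. of_real c) f = c *\<^sub>R f"
  unfolding mult_op_def scaleR_ltwo_def by (simp add: scaleR_conv_of_real)

lemma bounded_linear_FT: "bounded_linear FT"
  by (rule bounded_linear_intro[of _ 1])
     (use FT_cmult[of "of_real _"] in \<open>auto simp: FT_add mult_of_real\<close>)

definition conj_op :: "'a::euclidean_space ltwo \<Rightarrow> 'a ltwo" where
  "conj_op f = abs_ltwo (\<lambda>x. cnj (rep_ltwo f x))"

lemma rep_conj: "AE x in lborel. rep_ltwo (conj_op f) x = cnj (rep_ltwo f x)"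
  unfolding conj_op_def by (rule rep_abs) (simp add: L2_cnj)

lemma conj_abs: "f \<in> L2 \<Longrightarrow> conj_op (abs_ltwo f) = abs_ltwo (\<lambda>x. cnj (f x))"
  unfolding conj_op_def using rep_abs[of f] by (subst abs_eq_iff) (auto simp: L2_cnj)

lemma conj_conj [simp]: "conj_op (conj_op f) = f"
  by (rule ltwo_eqI) (use rep_conj[of f] rep_conj[of "conj_op f"] in \<open>eventually_elim, simp\<close>)

lemma norm_conj [simp]: "norm (conj_op f) = norm f"
  by (intro antisym norm_mono_AE; use rep_conj[of f] in eventually_elim) auto

lemma conj_add: "conj_op (f + g) = conj_op f + conj_op g"
  by (rule ltwo_eqI) (use rep_conj[of f] rep_conj[of g] rep_conj[of "f+g"] rep_add[of f g]
     rep_add[of "conj_op f" "conj_op g"] in \<open>eventually_elim, simp\<close>)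

lemma conj_scaleR: "conj_op (c *\<^sub>R f) = c *\<^sub>R conj_op f"
  by (rule ltwo_eqI) (use rep_conj[of f] rep_conj[of "c *\<^sub>R f"] rep_scaleR[of c f]
     rep_scaleR[of c "conj_op f"] in \<open>eventually_elim, simp\<close>)

lemma bounded_linear_conj: "bounded_linear conj_op"
  by (rule bounded_linear_intro[of _ 1]) (auto simp: conj_add conj_scaleR)

text \<open>The multiplication formula \<open>\<integral> (FT f) g = \<integral> f (FT g)\<close>, extended from integrable functions by density and
  written with the sesquilinear inner product.\<close>

lemma inner_FT_conj: "inner (FT f) (conj_op g) = inner f (conj_op (FT g))"
proof -
  let ?T = "\<lambda>R f. abs_ltwo (trunc R (rep_ltwo f))"
  have eq: "inner (FT_trunc R f) (conj_op (?T R g)) = inner (?T R f) (conj_op (FT_trunc R g))" for R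
  proof -
    have i: "integrable lborel (trunc R (rep_ltwo h))" "trunc R (rep_ltwo h) \<in> L2" for h :: "'a ltwo"
      by (auto simp: trunc_integrable trunc_L2)
    show ?thesis
      unfolding FT_trunc_def using fourier_multiplication_formula[OF i(1)[of f] i(1)[of g]]
      by (simp add: conj_abs i plancherel_L1_L2 inner_abs L2_cnj)
  qed
  have "((\<lambda>R. inner (FT_trunc R f) (conj_op (?T R g))) \<longlongrightarrow> inner (FT f) (conj_op g)) at_top"
    by (intro tendsto_inner FT_trunc_tendsto bounded_linear.tendsto[OF bounded_linear_conj] trunc_abs_tendsto)
  moreover have "((\<lambda>R. inner (?T R f) (conj_op (FT_trunc R g))) \<longlongrightarrow> inner f (conj_op (FT g))) at_top"
    by (intro tendsto_inner FT_trunc_tendsto bounded_linear.tendsto[OF bounded_linear_conj] trunc_abs_tendsto)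
  ultimately show ?thesis
    unfolding eq by (rule tendsto_unique[OF trivial_limit_at_top_linorder])
qed

text \<open>By the multiplication formula, conjugating \<open>FT\<close> by complex conjugation gives its adjoint, which is
  therefore again an isometry; an isometry whose adjoint is isometric is unitary.\<close>

definition FTi :: "'a::euclidean_space ltwo \<Rightarrow> 'a ltwo" where
  "FTi f = conj_op (FT (conj_op f))"

lemma norm_FTi [simp]: "norm (FTi f) = norm f"
  by (simp add: FTi_def)

lemma bounded_linear_FTi: "bounded_linear FTi"
  unfolding FTi_def
  by (intro bounded_linear_compose[OF bounded_linear_conj] bounded_linear_compose[OF bounded_linear_FT] bounded_linear_conj)

lemma inner_FT: "inner (FT f) g = inner f (FTi g)"
  using inner_FT_conj[of f "conj_op g"] by (simp add: FTi_def)

text \<open>Expanding \<open>|A B f - f|\<^sup>2\<close>, all three terms are multiples of \<open>|f|\<^sup>2\<close> and cancel.\<close>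

lemma isometry_adjoint_inverse:
  fixes A B :: "'a::real_inner \<Rightarrow> 'a"
  assumes "\<And>f. norm (A f) = norm f" "\<And>f. norm (B f) = norm f" "\<And>f g. inner (A f) g = inner f (B g)"
  shows "A (B f) = f"
proof -
  have "(norm (A (B f) - f))\<^sup>2 = (norm (A (B f)))\<^sup>2 + (norm f)\<^sup>2 - 2 * inner (A (B f)) f"
    by (simp add: power2_norm_eq_inner inner_diff_left inner_diff_right inner_commute)
  also have "inner (A (B f)) f = (norm (B f))\<^sup>2"
    by (simp add: assms(3) power2_norm_eq_inner)
  finally show ?thesis by (simp add: assms)
qed

lemma FT_FTi [simp]: "FT (FTi f) = f"
  by (rule isometry_adjoint_inverse[of FT FTi]) (simp_all add: inner_FT)

lemma FTi_FT [simp]: "FTi (FT f) = f" for f :: "'a::euclidean_space ltwo"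
proof (rule isometry_adjoint_inverse[of FTi FT])
  show "inner (FTi f) g = inner f (FT g)" for f g :: "'a ltwo"
    using inner_FT[of g f] by (simp only: inner_commute)
qed simp_all

lemma inner_FT_FT [simp]: "inner (FT f) (FT g) = inner f g"
  by (simp add: inner_FT)

lemma FT_inj: "FT f = FT g \<longleftrightarrow> f = g"
  by (metis FTi_FT)

section \<open>Linear evolution equations with bounded generators\<close>

text \<open>Strong continuity is not continuity in operator norm; the uniform bound supplies the missing
  joint continuity.\<close>

lemma continuous_on_apply_strong:
  fixes F :: "real \<Rightarrow> 'h::real_normed_vector \<Rightarrow> 'h"
  assumes lin: "\<And>t. t \<in> S \<Longrightarrow> bounded_linear (F t)"
    and bd: "\<And>t x. t \<in> S \<Longrightarrow> norm (F t x) \<le> C * norm x"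
    and cont: "\<And>x. continuous_on S (\<lambda>t. F t x)" and v: "continuous_on S v"
  shows "continuous_on S (\<lambda>t. F t (v t))"
  unfolding continuous_on
proof
  fix t0 assume t0: "t0 \<in> S"
  have "((\<lambda>t. F t (v t - v t0)) \<longlongrightarrow> 0) (at t0 within S)"
  proof (rule tendsto_norm_zero_cancel, rule tendsto_sandwich[OF _ _ tendsto_const])
    show "\<forall>\<^sub>F t in at t0 within S. norm (F t (v t - v t0)) \<le> C * norm (v t - v t0)"
      using bd by (auto simp: eventually_at_filter)
    have "((\<lambda>t. C * norm (v t - v t0)) \<longlongrightarrow> C * norm (v t0 - v t0)) (at t0 within S)"
      using v t0 by (intro tendsto_intros) (auto simp: continuous_on)
    then show "((\<lambda>t. C * norm (v t - v t0)) \<longlongrightarrow> 0) (at t0 within S)" by simp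
  qed auto
  moreover have "((\<lambda>t. F t (v t0)) \<longlongrightarrow> F t0 (v t0)) (at t0 within S)"
    using cont t0 by (auto simp: continuous_on)
  ultimately have "((\<lambda>t. F t (v t - v t0) + F t (v t0)) \<longlongrightarrow> 0 + F t0 (v t0)) (at t0 within S)"
    by (rule tendsto_add)
  then have "((\<lambda>t. F t (v t - v t0) + F t (v t0)) \<longlongrightarrow> F t0 (v t0)) (at t0 within S)" by simp
  then show "((\<lambda>t. F t (v t)) \<longlongrightarrow> F t0 (v t0)) (at t0 within S)"
  proof (rule Lim_transform_eventually)
    show "\<forall>\<^sub>F t in at t0 within S. F t (v t - v t0) + F t (v t0) = F t (v t)"
      using lin by (auto simp: eventually_at_filter linear_diff bounded_linear.linear)
  qed
qed

primrec picard :: "(real \<Rightarrow> 'h \<Rightarrow> 'h) \<Rightarrow> 'h \<Rightarrow> nat \<Rightarrow> real \<Rightarrow> 'h::banach" where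
  "picard F x0 0 t = x0"
| "picard F x0 (Suc n) t = integral {0..t} (\<lambda>\<tau>. F \<tau> (picard F x0 n \<tau>))"

text \<open>Picard's series: the terms are bounded by those of the exponential series, so the equation
  may be integrated termwise.\<close>

lemma linear_ode_exists:
  fixes F :: "real \<Rightarrow> 'h::banach \<Rightarrow> 'h" and x0 :: 'h
  assumes T: "0 \<le> T" and C: "0 \<le> C"
    and lin: "\<And>t. t \<in> {0..T} \<Longrightarrow> bounded_linear (F t)"
    and bd: "\<And>t x. t \<in> {0..T} \<Longrightarrow> norm (F t x) \<le> C * norm x"
    and cont: "\<And>x. continuous_on {0..T} (\<lambda>t. F t x)"
  obtains v where "continuous_on {0..T} v" "v 0 = x0"
    "\<And>t. t \<in> {0..T} \<Longrightarrow> (v has_vector_derivative F t (v t)) (at t within {0..T})"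
proof -
  define y where "y = picard F x0"
  have y_0: "y 0 = (\<lambda>t. x0)" and y_Suc: "y (Suc n) = (\<lambda>t. integral {0..t} (\<lambda>\<tau>. F \<tau> (y n \<tau>)))" for n
    by (auto simp: y_def)
  have F_cont: "continuous_on {0..T} (\<lambda>t. F t (v t))" if "continuous_on {0..T} v" for v
    by (rule continuous_on_apply_strong[OF lin bd cont that])
  have y_cont: "continuous_on {0..T} (y n)" for n
  proof (induction n)
    case (Suc n)
    show ?case unfolding y_Suc
      by (intro indefinite_integral_continuous_1 integrable_continuous_real F_cont Suc)
  qed (simp add: y_0)
  have y_bound: "norm (y n t) \<le> norm x0 * (C * t)^n / fact n" if "t \<in> {0..T}" for n t
    using that
  proof (induction n arbitrary: t)
    case (Suc n)
    define h where "h = (\<lambda>\<tau>::real. (norm x0 * C^Suc n / fact (Suc n)) * \<tau>^Suc n)"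
    define h' where "h' = (\<lambda>\<tau>::real. C * (norm x0 * (C * \<tau>)^n / fact n))"
    have "(h' has_integral h t - h 0) {0..t}"
    proof (rule fundamental_theorem_of_calculus)
      fix \<tau> assume "\<tau> \<in> {0..t}"
      have "(h has_real_derivative (norm x0 * C^Suc n / fact (Suc n)) * (real (Suc n) * \<tau>^n)) (at \<tau> within {0..t})"
        unfolding h_def using DERIV_pow[of "Suc n" \<tau>]
        by (intro has_field_derivative_at_within[OF DERIV_cmult]) simp
      moreover have "(norm x0 * C^Suc n / fact (Suc n)) * (real (Suc n) * \<tau>^n) = h' \<tau>"
        unfolding h'_def by (simp add: power_mult_distrib divide_simps)
      ultimately show "(h has_vector_derivative h' \<tau>) (at \<tau> within {0..t})"
        by (simp add: has_real_derivative_iff_has_vector_derivative)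
    qed (use Suc.prems in auto)
    then have h: "h' integrable_on {0..t}" "integral {0..t} h' = norm x0 * (C * t)^Suc n / fact (Suc n)"
      by (auto simp: h_def power_mult_distrib integral_unique integrable_on_def)
    have "norm (y (Suc n) t) \<le> integral {0..t} h'"
      unfolding y_Suc
    proof (rule Henstock_Kurzweil_Integration.integral_norm_bound_integral[OF _ h(1)])
      show "(\<lambda>\<tau>. F \<tau> (y n \<tau>)) integrable_on {0..t}"
        using Suc.prems
        by (intro integrable_continuous_real continuous_on_subset[OF F_cont[OF y_cont]]) auto
      show "norm (F \<tau> (y n \<tau>)) \<le> h' \<tau>" if "\<tau> \<in> {0..t}" for \<tau>
        unfolding h'_def using that Suc.prems
        by (intro order_trans[OF bd] mult_left_mono[OF Suc.IH] C) auto
    qed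
    then show ?case unfolding h(2) .
  qed (simp add: y_0)
  define M where "M n = norm x0 * (C * T)^n / fact n" for n
  have M: "norm (y n t) \<le> M n" if "t \<in> {0..T}" for n t
    using y_bound[OF that, of n] that C T unfolding M_def
    by (elim order_trans) (auto intro!: divide_right_mono mult_left_mono power_mono)
  have "summable M"
    unfolding M_def using summable_mult[OF summable_exp[of "C * T"], of "norm x0"]
    by (simp add: field_simps)
  define v where "v t = (\<Sum>n. y n t)" for t
  define S where "S n t = (\<Sum>i<n. y i t)" for n t
  have unif: "uniform_limit {0..T} S v sequentially"
    unfolding S_def v_def by (rule Weierstrass_m_test) (use M \<open>summable M\<close> in auto)
  have S_cont: "continuous_on {0..T} (S n)" for n
    unfolding S_def by (intro continuous_intros y_cont)
  have v_cont: "continuous_on {0..T} v"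
    by (rule uniform_limit_theorem[OF _ unif]) (auto simp: S_cont)
  have S_Suc: "S (Suc n) t = x0 + integral {0..t} (\<lambda>\<tau>. F \<tau> (S n \<tau>))" if t: "t \<in> {0..T}" for n t
  proof -
    have sub: "{0..t} \<subseteq> {0..T}" using t by auto
    have "integral {0..t} (\<lambda>\<tau>. F \<tau> (S n \<tau>)) = integral {0..t} (\<lambda>\<tau>. \<Sum>i<n. F \<tau> (y i \<tau>))"
      unfolding S_def
      by (rule Henstock_Kurzweil_Integration.integral_cong)
         (use sub lin in \<open>auto intro!: linear_sum bounded_linear.linear\<close>)
    also have "\<dots> = (\<Sum>i<n. y (Suc i) t)"
      unfolding y_Suc
      by (rule Henstock_Kurzweil_Integration.integral_sum)
         (auto intro!: integrable_continuous_real continuous_on_subset[OF F_cont[OF y_cont] sub])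
    finally show ?thesis
      by (simp add: S_def sum.lessThan_Suc_shift y_0 del: sum.lessThan_Suc)
  qed
  have v_eq: "v t = x0 + integral {0..t} (\<lambda>\<tau>. F \<tau> (v \<tau>))" if t: "t \<in> {0..T}" for t
  proof (rule LIMSEQ_unique)
    have sub: "{0..t} \<subseteq> {0..T}" using t by auto
    show "(\<lambda>n. S (Suc n) t) \<longlonglongrightarrow> v t"
      using tendsto_uniform_limitI[OF unif t] by (rule LIMSEQ_Suc)
    have "uniform_limit {0..t} (\<lambda>n \<tau>. F \<tau> (S n \<tau>)) (\<lambda>\<tau>. F \<tau> (v \<tau>)) sequentially"
    proof (rule uniform_limitI)
      fix e :: real assume "0 < e"
      \<comment> \<open>The bound is \<open>C + 1\<close> instead of \<open>C\<close> to cover \<open>C = 0\<close>.\<close>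
      then have "\<forall>\<^sub>F n in sequentially. \<forall>\<tau>\<in>{0..T}. dist (S n \<tau>) (v \<tau>) < e / (C + 1)"
        using C by (intro uniform_limitD[OF unif]) auto
      then show "\<forall>\<^sub>F n in sequentially. \<forall>\<tau>\<in>{0..t}. dist (F \<tau> (S n \<tau>)) (F \<tau> (v \<tau>)) < e"
      proof eventually_elim
        case (elim n)
        show ?case
        proof
          fix \<tau> assume "\<tau> \<in> {0..t}"
          then have \<tau>: "\<tau> \<in> {0..T}" using sub by auto
          have "dist (F \<tau> (S n \<tau>)) (F \<tau> (v \<tau>)) = norm (F \<tau> (S n \<tau> - v \<tau>))"
            using lin[OF \<tau>] by (simp add: dist_norm linear_diff bounded_linear.linear)
          also have "\<dots> \<le> C * norm (S n \<tau> - v \<tau>)" by (rule bd[OF \<tau>])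
          also have "\<dots> \<le> (C + 1) * norm (S n \<tau> - v \<tau>)" by (intro mult_right_mono) auto
          also have "\<dots> < e" using elim \<tau> C by (simp add: dist_norm field_simps)
          finally show "dist (F \<tau> (S n \<tau>)) (F \<tau> (v \<tau>)) < e" .
        qed
      qed
    qed
    then obtain I J where I: "\<And>n. ((\<lambda>\<tau>. F \<tau> (S n \<tau>)) has_integral I n) {0..t}"
      and J: "((\<lambda>\<tau>. F \<tau> (v \<tau>)) has_integral J) {0..t}" "I \<longlonglongrightarrow> J"
    proof (rule uniform_limit_integral)
      show "continuous_on {0..t} (\<lambda>\<tau>. F \<tau> (S n \<tau>))" for n
        by (rule continuous_on_subset[OF F_cont[OF S_cont] sub])
    qed auto
    then have "(\<lambda>n. integral {0..t} (\<lambda>\<tau>. F \<tau> (S n \<tau>))) \<longlonglongrightarrow> integral {0..t} (\<lambda>\<tau>. F \<tau> (v \<tau>))"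
      unfolding integral_unique[OF I] integral_unique[OF J(1)] by (intro J)
    then show "(\<lambda>n. S (Suc n) t) \<longlonglongrightarrow> x0 + integral {0..t} (\<lambda>\<tau>. F \<tau> (v \<tau>))"
      unfolding S_Suc[OF t] by (intro tendsto_intros)
  qed
  show ?thesis
  proof
    show "v 0 = x0" using v_eq[of 0] T by simp
    show "(v has_vector_derivative F t (v t)) (at t within {0..T})" if t: "t \<in> {0..T}" for t
    proof (rule has_vector_derivative_transform[OF t])
      show "((\<lambda>t. x0 + integral {0..t} (\<lambda>\<tau>. F \<tau> (v \<tau>))) has_vector_derivative F t (v t)) (at t within {0..T})"
        using integral_has_vector_derivative[OF F_cont[OF v_cont] t]
        by (auto intro!: derivative_eq_intros)
    qed (rule v_eq)
  qed fact
qed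

lemma has_vector_derivative_iff_quotient:
  "(f has_vector_derivative f') (at x within S) \<longleftrightarrow>
     ((\<lambda>y. (f y - f x) /\<^sub>R (y - x)) \<longlongrightarrow> f') (at x within S)"
proof -
  have "((\<lambda>y. (f y - f x) /\<^sub>R (y - x)) \<longlongrightarrow> f') (at x within S)
      \<longleftrightarrow> ((\<lambda>y. norm ((f y - f x) /\<^sub>R (y - x) - f')) \<longlongrightarrow> 0) (at x within S)"
    by (subst Lim_null, subst tendsto_norm_zero_iff) simp
  also have "\<dots> \<longleftrightarrow> ((\<lambda>y. norm (f y - f x - (y - x) *\<^sub>R f') / norm (y - x)) \<longlongrightarrow> 0) (at x within S)"
  proof (rule filterlim_cong[OF refl refl], unfold eventually_at_filter, intro always_eventually allI impI)
    fix y assume "y \<noteq> x" "y \<in> S"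
    then have "(f y - f x) /\<^sub>R (y - x) - f' = (f y - f x - (y - x) *\<^sub>R f') /\<^sub>R (y - x)"
      by (simp add: scaleR_diff_right)
    then show "norm ((f y - f x) /\<^sub>R (y - x) - f') = norm (f y - f x - (y - x) *\<^sub>R f') / norm (y - x)"
      by (simp add: divide_inverse mult.commute)
  qed
  also have "\<dots> \<longleftrightarrow> (f has_vector_derivative f') (at x within S)"
    unfolding has_vector_derivative_def has_derivative_iff_norm
    by (simp add: bounded_linear_scaleR_left)
  finally show ?thesis ..
qed

text \<open>Product rule for a uniformly bounded, strongly continuous and strongly differentiable family
  of operators.\<close>

lemma has_vector_derivative_apply_strong:
  fixes E :: "real \<Rightarrow> 'h::real_normed_vector \<Rightarrow> 'h"
  assumes lin: "\<And>t. bounded_linear (E t)" and bd: "\<And>t x. norm (E t x) \<le> norm x"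
    and E: "\<And>x. ((\<lambda>t. E t x) has_vector_derivative A x) (at t within S)"
    and v: "(v has_vector_derivative v') (at t within S)"
  shows "((\<lambda>t. E t (v t)) has_vector_derivative A (v t) + E t v') (at t within S)"
proof -
  have q: "((\<lambda>y. (v y - v t) /\<^sub>R (y - t)) \<longlongrightarrow> v') (at t within S)"
    using v unfolding has_vector_derivative_iff_quotient .
  have 1: "((\<lambda>y. E y ((v y - v t) /\<^sub>R (y - t) - v')) \<longlongrightarrow> 0) (at t within S)"
  proof (rule tendsto_norm_zero_cancel, rule tendsto_sandwich[OF _ _ tendsto_const])
    show "((\<lambda>y. norm ((v y - v t) /\<^sub>R (y - t) - v')) \<longlongrightarrow> 0) (at t within S)"
      using q by (subst tendsto_norm_zero_iff) (simp flip: Lim_null)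
  qed (use bd in auto)
  have 2: "((\<lambda>y. E y v') \<longlongrightarrow> E t v') (at t within S)"
    using has_vector_derivative_continuous[OF E[of v']] by (simp add: continuous_within)
  have 3: "((\<lambda>y. (E y (v t) - E t (v t)) /\<^sub>R (y - t)) \<longlongrightarrow> A (v t)) (at t within S)"
    using E[of "v t"] unfolding has_vector_derivative_iff_quotient .
  have "((\<lambda>y. (E y (v t) - E t (v t)) /\<^sub>R (y - t) + (E y ((v y - v t) /\<^sub>R (y - t) - v') + E y v')) \<longlongrightarrow> A (v t) + (0 + E t v')) (at t within S)"
    by (intro tendsto_add 1 2 3)
  moreover have "(E y (v t) - E t (v t)) /\<^sub>R (y - t) + (E y ((v y - v t) /\<^sub>R (y - t) - v') + E y v')
      = (E y (v y) - E t (v t)) /\<^sub>R (y - t)" for y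
  proof -
    have "E y ((v y - v t) /\<^sub>R (y - t) - v') + E y v' = (E y (v y) - E y (v t)) /\<^sub>R (y - t)"
      using bounded_linear.linear[OF lin[of y]] by (simp add: linear_diff linear_scale)
    then show ?thesis by (simp flip: scaleR_add_right)
  qed
  ultimately show ?thesis
    unfolding has_vector_derivative_iff_quotient by simp
qed

section \<open>The Schroedinger evolution on the Fourier side\<close>

lemma mult_uminus:
  assumes "ess_bounded m" shows "mult_op (\<lambda>x. - m x) f = - mult_op m f"
  using mult_diff_left[OF ess_bounded_const assms, of 0 f] mult_of_real[of 0 f] by simp

abbreviation mult_i :: "'a::euclidean_space ltwo \<Rightarrow> 'a ltwo" where
  "mult_i \<equiv> mult_op (\<lambda>_. \<i>)"

lemma bounded_linear_mult_i: "bounded_linear (mult_i)"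
  by (rule bounded_linear_mult) simp

lemma norm_mult_i [simp]: "norm (mult_i f) = norm f"
  by (rule norm_mult_unimodular) auto

lemma mult_i_mult_i [simp]: "mult_i (mult_i f) = - f"
  using mult_of_real[of "-1" f] by (simp add: mult_mult)

lemma inner_mult_i: "inner (mult_i f) g = - inner f (mult_i g)"
  using inner_mult_left[of "\<lambda>_. \<i>" f g] mult_uminus[of "\<lambda>_. \<i>" g] by simp

lemma inner_mult_i_mult_i [simp]: "inner (mult_i f) (mult_i g) = inner f g"
  by (simp add: inner_mult_i)

lemma continuous_on_mult_param:
  fixes S :: "real set"
  assumes eb: "\<And>t. ess_bounded (m t)" and C: "\<And>t x. cmod (m t x) \<le> C"
    and cont: "\<And>x. continuous_on S (\<lambda>t. m t x)"
  shows "continuous_on S (\<lambda>t. mult_op (m t) f)"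
  unfolding continuous_on_sequentially o_def
proof (intro allI ballI impI)
  fix X :: "nat \<Rightarrow> real" and a assume a: "a \<in> S" and X: "(\<forall>n. X n \<in> S) \<and> X \<longlonglongrightarrow> a"
  show "(\<lambda>n. mult_op (m (X n)) f) \<longlonglongrightarrow> mult_op (m a) f"
  proof (rule mult_tendsto[where C = "C + C"])
    show "AE x in lborel. cmod (m (X n) x - m a x) \<le> C + C" for n
      by (intro AE_I2 order_trans[OF norm_triangle_ineq4] add_mono C)
    show "AE x in lborel. (\<lambda>n. m (X n) x) \<longlonglongrightarrow> m a x"
      using cont a X unfolding continuous_on_sequentially o_def by blast
  qed (rule eb)+
qed

subsection \<open>Unbounded weights\<close>

text \<open>For an unbounded weight the product may fail to be square integrable; \<open>mult_op\<close> represents the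
  multiplication operator exactly on the functions singled out here.\<close>

definition in_dom :: "('a::euclidean_space \<Rightarrow> real) \<Rightarrow> 'a ltwo \<Rightarrow> bool" where
  "in_dom w f \<longleftrightarrow> (\<lambda>\<xi>. of_real (w \<xi>) * rep_ltwo f \<xi>) \<in> L2"

abbreviation wmult :: "('a::euclidean_space \<Rightarrow> real) \<Rightarrow> 'a ltwo \<Rightarrow> 'a ltwo" where
  "wmult w \<equiv> mult_op (\<lambda>\<xi>. complex_of_real (w \<xi>))"

lemma rep_wmult: "in_dom w f \<Longrightarrow> AE \<xi> in lborel. rep_ltwo (wmult w f) \<xi> = of_real (w \<xi>) * rep_ltwo f \<xi>"
  unfolding in_dom_def mult_op_def by (rule rep_abs)

lemma in_dom_cong_AE:
  assumes [measurable]: "w \<in> borel_measurable borel"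
    and "F \<in> L2" "AE \<xi> in lborel. F \<xi> = of_real (w \<xi>) * rep_ltwo f \<xi>"
  shows "in_dom w f" "wmult w f = abs_ltwo F"
proof -
  show "in_dom w f" unfolding in_dom_def by (rule L2_cong_AE[OF assms(2) _ assms(3)]) auto
  then show "wmult w f = abs_ltwo F"
    unfolding in_dom_def mult_op_def using assms(2,3) by (subst abs_eq_iff) auto
qed

lemma wmult_mult_i:
  assumes "w \<in> borel_measurable borel" "in_dom w h"
  shows "wmult w (mult_i h) = mult_i (wmult w h)"
proof -
  have "AE \<xi> in lborel. rep_ltwo (mult_i (wmult w h)) \<xi> = of_real (w \<xi>) * rep_ltwo (mult_i h) \<xi>"
    using rep_mult[OF ess_bounded_const, of \<i> h] rep_mult[OF ess_bounded_const, of \<i> "wmult w h"] rep_wmult[OF assms(2)]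
    by eventually_elim simp
  from in_dom_cong_AE(2)[OF assms(1) rep_L2 this] show ?thesis by simp
qed

lemma in_dom_diff:
  assumes w: "w \<in> borel_measurable borel" and "in_dom w f" "in_dom w g"
  shows "in_dom w (f - g)" "wmult w (f - g) = wmult w f - wmult w g"
proof -
  let ?F = "\<lambda>\<xi>. of_real (w \<xi>) * rep_ltwo f \<xi> - of_real (w \<xi>) * rep_ltwo g \<xi>"
  have L: "?F \<in> L2" using assms by (intro L2_diff) (auto simp: in_dom_def)
  have "AE \<xi> in lborel. ?F \<xi> = of_real (w \<xi>) * rep_ltwo (f - g) \<xi>"
    using rep_diff[of f g] by eventually_elim (simp add: right_diff_distrib)
  note c = in_dom_cong_AE[OF w L this]
  show "in_dom w (f - g)" by (rule c)
  show "wmult w (f - g) = wmult w f - wmult w g"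
    unfolding c(2) using assms by (simp add: mult_op_def in_dom_def abs_diff)
qed

lemma in_dom_cutoff:
  assumes "in_dom w f" and [measurable]: "w \<in> borel_measurable borel" "A \<in> sets borel"
  shows "in_dom w (wmult (indicator A) f)"
    and "wmult w (wmult (indicator A) f) = wmult (indicator A) (wmult w f)"
proof -
  have e: "ess_bounded (\<lambda>\<xi>. complex_of_real (indicator A \<xi>))"
    by (rule ess_boundedI[of _ 1]) (auto simp: indicator_def)
  have "AE \<xi> in lborel. rep_ltwo (wmult (indicator A) (wmult w f)) \<xi>
      = of_real (w \<xi>) * rep_ltwo (wmult (indicator A) f) \<xi>"
    using rep_mult[OF e, of f] rep_mult[OF e, of "wmult w f"] rep_wmult[OF assms(1)]
    by eventually_elim simp
  note c = in_dom_cong_AE[OF assms(2) rep_L2 this]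
  show "in_dom w (wmult (indicator A) f)" by (rule c)
  show "wmult w (wmult (indicator A) f) = wmult (indicator A) (wmult w f)"
    using c(2) by simp
qed

lemma cutoff_tendsto:
  assumes [measurable]: "w \<in> borel_measurable borel"
  shows "(\<lambda>n. wmult (indicator {\<xi>. w \<xi> \<le> real n}) f) \<longlonglongrightarrow> f"
proof -
  have e: "ess_bounded (\<lambda>\<xi>. complex_of_real (indicator {\<xi>. w \<xi> \<le> real n} \<xi>))" for n
    by (rule ess_boundedI[of _ 1]) (auto simp: indicator_def)
  have "(\<lambda>n. wmult (indicator {\<xi>. w \<xi> \<le> real n}) f) \<longlonglongrightarrow> mult_op (\<lambda>_. 1) f"
  proof (rule mult_tendsto[where C = 1])
    show "AE \<xi> in lborel. (\<lambda>n. complex_of_real (indicator {\<xi>. w \<xi> \<le> real n} \<xi>)) \<longlonglongrightarrow> 1"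
    proof (rule AE_I2, rule tendsto_eventually)
      fix \<xi>
      obtain k :: nat where "w \<xi> \<le> real k" using real_arch_simple by blast
      then show "\<forall>\<^sub>F n in sequentially. complex_of_real (indicator {\<xi>. w \<xi> \<le> real n} \<xi>) = 1"
        by (intro eventually_sequentiallyI[of k]) (auto simp: indicator_def)
    qed
  qed (use e in \<open>auto simp: indicator_def\<close>)
  then show ?thesis by simp
qed

text \<open>The multiplication operator with an unbounded weight is closed, in the strong form that a
  bound on the images survives convergence of the arguments.\<close>

lemma in_dom_lower_semicontinuous:
  fixes w :: "'a::euclidean_space \<Rightarrow> real"
  assumes w[measurable]: "w \<in> borel_measurable borel" and w0: "\<And>\<xi>. 0 \<le> w \<xi>" and "f \<longlonglongrightarrow> g"
    and dom: "\<And>k. in_dom w (f k)" and K: "\<And>k. norm (wmult w (f k)) \<le> K"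
  shows "in_dom w g" "norm (wmult w g) \<le> K"
proof -
  have K0: "0 \<le> K" using order_trans[OF norm_ge_zero K] .
  define c where "c n \<xi> = w \<xi> * indicator {\<xi>. w \<xi> \<le> real n} \<xi>" for n \<xi>
  have [measurable]: "c n \<in> borel_measurable borel" for n unfolding c_def by measurable
  have c_le: "\<bar>c n \<xi>\<bar> \<le> real n" "\<bar>c n \<xi>\<bar> \<le> w \<xi>" for n \<xi>
    using w0 by (auto simp: c_def indicator_def)
  have e: "ess_bounded (\<lambda>\<xi>. complex_of_real (c n \<xi>))" for n
    by (rule ess_boundedI[of _ "real n"]) (auto simp: c_le)
  have "norm (wmult (c n) (f k)) \<le> norm (wmult w (f k))" for n k
    by (rule norm_mono_AE, use rep_mult[OF e, of n "f k"] rep_wmult[OF dom, of k] in eventually_elim)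
       (use c_le w0 in \<open>auto simp: norm_mult intro!: mult_right_mono\<close>)
  then have le: "norm (wmult (c n) (f k)) \<le> K" for n k by (rule order_trans[OF _ K])
  have "(\<lambda>k. norm (wmult (c n) (f k))) \<longlonglongrightarrow> norm (wmult (c n) g)" for n
    by (intro tendsto_norm bounded_linear.tendsto[OF bounded_linear_mult[OF e]] assms(3))
  then have cg: "norm (wmult (c n) g) \<le> K" for n
    by (rule LIMSEQ_le_const2) (use le in auto)
  define F where "F \<xi> = of_real (w \<xi>) * rep_ltwo g \<xi>" for \<xi>
  have [measurable]: "F \<in> borel_measurable borel" unfolding F_def by measurable
  have int_c: "(\<integral>\<^sup>+\<xi>. ennreal ((cmod (of_real (c n \<xi>) * rep_ltwo g \<xi>))\<^sup>2) \<partial>lborel) \<le> ennreal (K\<^sup>2)" for n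
  proof -
    have "(\<integral>\<^sup>+\<xi>. ennreal ((cmod (of_real (c n \<xi>) * rep_ltwo g \<xi>))\<^sup>2) \<partial>lborel)
        = (\<integral>\<^sup>+\<xi>. ennreal ((cmod (rep_ltwo (wmult (c n) g) \<xi>))\<^sup>2) \<partial>lborel)"
      by (rule nn_integral_cong_AE) (use rep_mult[OF e, of n g] in auto)
    also have "\<dots> = ennreal ((norm (wmult (c n) g))\<^sup>2)"
      unfolding norm_ltwo_power2 by (rule nn_integral_eq_integral) (auto simp: L2_integrable)
    also have "\<dots> \<le> ennreal (K\<^sup>2)" by (intro ennreal_leI power_mono cg) auto
    finally show ?thesis .
  qed
  have "(\<integral>\<^sup>+\<xi>. ennreal ((cmod (F \<xi>))\<^sup>2) \<partial>lborel)
      = (\<integral>\<^sup>+\<xi>. liminf (\<lambda>n. ennreal ((cmod (of_real (c n \<xi>) * rep_ltwo g \<xi>))\<^sup>2)) \<partial>lborel)"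
  proof (rule nn_integral_cong)
    fix \<xi>
    obtain k :: nat where "w \<xi> \<le> real k" using real_arch_simple by blast
    then have "(\<lambda>n. ennreal ((cmod (of_real (c n \<xi>) * rep_ltwo g \<xi>))\<^sup>2)) \<longlonglongrightarrow> ennreal ((cmod (F \<xi>))\<^sup>2)"
      by (intro tendsto_eventually eventually_sequentiallyI[of k]) (auto simp: c_def F_def indicator_def)
    from lim_imp_Liminf[OF sequentially_bot this]
    show "ennreal ((cmod (F \<xi>))\<^sup>2) = liminf (\<lambda>n. ennreal ((cmod (of_real (c n \<xi>) * rep_ltwo g \<xi>))\<^sup>2))" ..
  qed
  also have "\<dots> \<le> liminf (\<lambda>n. \<integral>\<^sup>+\<xi>. ennreal ((cmod (of_real (c n \<xi>) * rep_ltwo g \<xi>))\<^sup>2) \<partial>lborel)"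
    by (rule nn_integral_liminf) measurable
  also have "\<dots> \<le> limsup (\<lambda>n. \<integral>\<^sup>+\<xi>. ennreal ((cmod (of_real (c n \<xi>) * rep_ltwo g \<xi>))\<^sup>2) \<partial>lborel)"
    by (rule Liminf_le_Limsup) simp
  also have "\<dots> \<le> ennreal (K\<^sup>2)"
    by (intro Limsup_bounded always_eventually allI int_c)
  finally have F: "(\<integral>\<^sup>+\<xi>. ennreal ((cmod (F \<xi>))\<^sup>2) \<partial>lborel) \<le> ennreal (K\<^sup>2)" .
  have FL2: "F \<in> L2"
    by (rule L2I) (auto intro!: integrableI_nonneg order_le_less_trans[OF F])
  then show "in_dom w g" by (simp add: in_dom_def F_def[abs_def])
  have "wmult w g = abs_ltwo F" by (simp add: mult_op_def F_def[abs_def])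
  moreover have "(L2_norm F)\<^sup>2 \<le> K\<^sup>2"
    using F unfolding L2_norm_power2
    by (subst (asm) nn_integral_eq_integral) (auto simp: L2_integrable[OF FL2])
  ultimately show "norm (wmult w g) \<le> K"
    using K0 by (simp add: norm_abs FL2 power2_le_iff_abs_le)
qed

text \<open>The quadratic form of \<open>w\<close> is the squared norm of the square root, which is how the \<open>H\<^sup>s\<close> norm
  enters the energy of the equation.\<close>

lemma in_dom_sqrt:
  assumes [measurable]: "w \<in> borel_measurable borel" and w0: "\<And>\<xi>. 0 \<le> w \<xi>" and dom: "in_dom w f"
  shows "in_dom (\<lambda>\<xi>. sqrt (w \<xi>)) f"
    and "(norm (wmult (\<lambda>\<xi>. sqrt (w \<xi>)) f))\<^sup>2 = inner (wmult w f) f"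
proof -
  have eq: "(cmod (of_real (sqrt (w \<xi>)) * z))\<^sup>2 = Re ((of_real (w \<xi>) * z) * cnj z)" for \<xi> z
    using w0[of \<xi>] by (simp add: norm_mult power_mult_distrib cmod_power2 algebra_simps power2_eq_square[of "Re z"] power2_eq_square[of "Im z"])
  have i: "integrable lborel (\<lambda>\<xi>. Re ((of_real (w \<xi>) * rep_ltwo f \<xi>) * cnj (rep_ltwo f \<xi>)))"
    using dom by (intro integrable_Re L2_mult_integrable L2_cnj) (auto simp: in_dom_def)
  show d: "in_dom (\<lambda>\<xi>. sqrt (w \<xi>)) f"
    unfolding in_dom_def by (rule L2I) (auto simp only: eq i, measurable)
  have "(norm (wmult (\<lambda>\<xi>. sqrt (w \<xi>)) f))\<^sup>2 = (LINT \<xi>|lborel. (cmod (of_real (sqrt (w \<xi>)) * rep_ltwo f \<xi>))\<^sup>2)"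
    unfolding norm_ltwo_power2 by (rule integral_cong_AE) (use rep_wmult[OF d] in auto)
  also have "\<dots> = inner (wmult w f) f"
    unfolding eq by (rule inner_cong_AE[symmetric, OF rep_wmult[OF dom]]) auto
  finally show "(norm (wmult (\<lambda>\<xi>. sqrt (w \<xi>)) f))\<^sup>2 = inner (wmult w f) f" .
qed

text \<open>In the real Hilbert space, real symmetry together with commutation with \<open>\<i>\<close> expresses complex
  self-adjointness.\<close>

definition potential :: "('a::euclidean_space ltwo \<Rightarrow> 'a ltwo) \<Rightarrow> bool" where
  "potential V \<longleftrightarrow> bounded_linear V \<and> (\<forall>f g. inner (V f) g = inner f (V g)) \<and> (\<forall>f. V (mult_i f) = mult_i (V f))"

text \<open>If \<open>V\<close> is self-adjoint then \<open>\<i> V\<close> is skew: moving \<open>V\<close> and then \<open>\<i>\<close> to the other side changes the sign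
  once.\<close>

lemma inner_mult_i_symmetric:
  assumes "\<And>f g. inner (V f) g = inner f (V g)" "\<And>f. V (mult_i f) = mult_i (V f)"
  shows "inner (mult_i (V f)) f = 0"
proof -
  have "inner (mult_i (V f)) f = inner (mult_i f) (V f)"
    by (metis assms)
  also have "\<dots> = - inner (mult_i (V f)) f"
    using inner_mult_i[of f "V f"] by (simp add: inner_commute)
  finally show ?thesis by simp
qed

lemma potential_skew: "potential V \<Longrightarrow> inner (mult_i (V f)) f = 0"
  unfolding potential_def by (intro inner_mult_i_symmetric) auto

lemma potential_bounded_linear: "potential V \<Longrightarrow> bounded_linear V"
  by (simp add: potential_def)

locale symbol =
  fixes m :: "'a::euclidean_space \<Rightarrow> real"
  assumes m_measurable [measurable]: "m \<in> borel_measurable borel" and m_nonneg: "0 \<le> m \<xi>"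
begin

definition cut :: "nat \<Rightarrow> 'a \<Rightarrow> real" where
  "cut n = indicator {\<xi>. m \<xi> \<le> real n}"

definition P :: "nat \<Rightarrow> 'a ltwo \<Rightarrow> 'a ltwo" where "P n = wmult (cut n)"

definition M :: "nat \<Rightarrow> 'a ltwo \<Rightarrow> 'a ltwo" where "M n = wmult (\<lambda>\<xi>. m \<xi> * cut n \<xi>)"

lemma cut_measurable [measurable]: "cut n \<in> borel_measurable borel"
  unfolding cut_def by measurable

lemma cut_le: "\<bar>cut n \<xi>\<bar> \<le> 1" and m_cut_le: "\<bar>m \<xi> * cut n \<xi>\<bar> \<le> real n"
  using m_nonneg by (auto simp: cut_def indicator_def)

lemma cut_idem [simp]: "cut n \<xi> * cut n \<xi> = cut n \<xi>"
  by (auto simp: cut_def indicator_def)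

lemma ess_bounded_cut: "ess_bounded (\<lambda>\<xi>. complex_of_real (cut n \<xi>))"
  by (rule ess_boundedI[of _ 1]) (auto simp: cut_le)

lemma ess_bounded_m_cut: "ess_bounded (\<lambda>\<xi>. complex_of_real (m \<xi> * cut n \<xi>))"
  by (rule ess_boundedI[of _ "real n"]) (auto simp only: norm_of_real m_cut_le, measurable)

lemma P_linear: "bounded_linear (P n)"
  unfolding P_def by (rule bounded_linear_mult[OF ess_bounded_cut])

lemma M_linear: "bounded_linear (M n)"
  unfolding M_def by (rule bounded_linear_mult[OF ess_bounded_m_cut])

lemma P_tendsto: "(\<lambda>n. P n f) \<longlonglongrightarrow> f"
  unfolding P_def cut_def by (rule cutoff_tendsto) simp

lemma norm_P_le: "norm (P n f) \<le> norm f"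
  unfolding P_def using norm_mult_le[OF ess_bounded_cut, of n 1 f] by (simp add: cut_le)

lemma inner_P: "inner (P n f) g = inner f (P n g)"
  unfolding P_def by (rule inner_mult_real[OF ess_bounded_cut])

lemma inner_M: "inner (M n f) g = inner f (M n g)"
  unfolding M_def by (rule inner_mult_real[OF ess_bounded_m_cut])

lemma P_P [simp]: "P n (P n f) = P n f"
  unfolding P_def by (subst mult_mult[OF ess_bounded_cut ess_bounded_cut]) (simp flip: of_real_mult)

lemma M_P [simp]: "M n (P n f) = M n f" and P_M [simp]: "P n (M n f) = M n f"
  unfolding P_def M_def
  by (simp_all add: mult_mult[OF ess_bounded_cut ess_bounded_m_cut] mult_mult[OF ess_bounded_m_cut ess_bounded_cut]
      mult.assoc mult.left_commute[of _ "m _"] flip: of_real_mult)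

lemma P_M_commute: "P k (M n f) = M k (P n f)"
  unfolding P_def M_def
  by (simp add: mult_mult[OF ess_bounded_cut ess_bounded_m_cut] mult_mult[OF ess_bounded_m_cut ess_bounded_cut]
      mult_ac flip: of_real_mult)

lemma P_mult_i: "P n (mult_i f) = mult_i (P n f)"
  unfolding P_def by (rule mult_commute[OF ess_bounded_cut]) simp

lemma M_mult_i: "M n (mult_i f) = mult_i (M n f)"
  unfolding M_def by (rule mult_commute[OF ess_bounded_m_cut]) simp

lemma M_skew: "inner (mult_i (M n u)) (P n u) = 0"
  using inner_mult_i_symmetric[of "M n" u] inner_P[of n "mult_i (M n u)" u]
  by (simp add: inner_M M_mult_i P_mult_i)

lemma in_dom_P: "in_dom m (P n f)" and wmult_P: "wmult m (P n f) = M n f"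
proof -
  have "AE \<xi> in lborel. rep_ltwo (M n f) \<xi> = of_real (m \<xi>) * rep_ltwo (P n f) \<xi>"
    using rep_mult[OF ess_bounded_cut, of n f] rep_mult[OF ess_bounded_m_cut, of n f]
    unfolding M_def P_def by eventually_elim simp
  note c = in_dom_cong_AE[OF m_measurable rep_L2 this]
  show "in_dom m (P n f)" by (rule c)
  show "wmult m (P n f) = M n f" using c(2) by simp
qed

text \<open>The meaning of \<open>u' = \<i> (m u + g)\<close> for \<open>u\<close> outside the domain of \<open>m\<close>: on the set where the symbol is at
  most \<open>n\<close> the generator is bounded, and the cut-off equation is required in the classical sense for
  each \<open>n\<close>.\<close>

definition weak_solution :: "real \<Rightarrow> (real \<Rightarrow> 'a ltwo) \<Rightarrow> (real \<Rightarrow> 'a ltwo) \<Rightarrow> bool" where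
  "weak_solution T u g \<longleftrightarrow> continuous_on {0..T} u \<and> continuous_on {0..T} g \<and>
     (\<forall>n. \<forall>t\<in>{0..T}. ((\<lambda>t. P n (u t)) has_vector_derivative mult_i (M n (u t) + P n (g t))) (at t within {0..T}))"

lemma weak_solution_diff:
  assumes "weak_solution T u g" "weak_solution T v h"
  shows "weak_solution T (\<lambda>t. u t - v t) (\<lambda>t. g t - h t)"
proof -
  have P: "P n (x - y) = P n x - P n y" for n x y
    by (simp add: bounded_linear.linear linear_diff P_linear)
  have D: "mult_i (M n (x - y) + P n (a - b)) = mult_i (M n x + P n a) - mult_i (M n y + P n b)" for n x y a b
  proof -
    have "M n (x - y) + P n (a - b) = (M n x + P n a) - (M n y + P n b)"
      by (simp add: P linear_diff[OF bounded_linear.linear[OF M_linear]])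
    then show ?thesis by (simp only: linear_diff[OF bounded_linear.linear[OF bounded_linear_mult_i]])
  qed
  have "((\<lambda>t. P n (u t - v t)) has_vector_derivative
      mult_i (M n (u t - v t) + P n (g t - h t))) (at t within {0..T})"
    if "t \<in> {0..T}" for n t
    unfolding D unfolding P using assms that unfolding weak_solution_def by (intro has_vector_derivative_diff) auto
  then show ?thesis
    using assms unfolding weak_solution_def by (auto intro!: continuous_on_diff)
qed

text \<open>The self-adjoint part of the generator is skew after multiplication by \<open>\<i>\<close> and drops out of the
  derivative of \<open>|P n u|\<^sup>2\<close>. What remains is bounded uniformly in \<open>n\<close>, so the cut-off can be removed.\<close>

lemma weak_solution_energy:
  assumes u: "weak_solution T u g" and t: "t \<in> {0..T}"
  shows "(norm (u t))\<^sup>2 = (norm (u 0))\<^sup>2 + integral {0..t} (\<lambda>\<tau>. 2 * inner (mult_i (g \<tau>)) (u \<tau>))"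
proof -
  have cu: "continuous_on {0..T} u" and cg: "continuous_on {0..T} g"
    and du: "\<And>n t. t \<in> {0..T} \<Longrightarrow> ((\<lambda>t. P n (u t)) has_vector_derivative mult_i (M n (u t) + P n (g t))) (at t within {0..T})"
    using u by (auto simp: weak_solution_def)
  have sub: "{0..t} \<subseteq> {0..T}" and t0: "0 \<le> t" using t by auto
  have cu': "continuous_on {0..t} u" and cg': "continuous_on {0..t} g"
    using cu cg sub continuous_on_subset by blast+
  define q where "q n \<tau> = 2 * inner (mult_i (g \<tau>)) (P n (u \<tau>))" for n \<tau>
  have c_int: "continuous_on {0..t} (\<lambda>\<tau>. 2 * inner (mult_i (g \<tau>)) (L (u \<tau>)))" if "bounded_linear L" for L
    by (intro continuous_intros bounded_linear.continuous_on[OF that] cu' bounded_linear.continuous_on[OF bounded_linear_mult_i] cg')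
  have q_int: "q n integrable_on {0..t}" for n
    unfolding q_def by (intro integrable_continuous_real c_int P_linear)
  have id: "(norm (P n (u t)))\<^sup>2 = (norm (P n (u 0)))\<^sup>2 + integral {0..t} (q n)" for n
  proof -
    have "(q n has_integral (inner (P n (u t)) (P n (u t)) - inner (P n (u 0)) (P n (u 0)))) {0..t}"
    proof (rule fundamental_theorem_of_calculus[OF t0])
      fix \<tau> assume \<tau>: "\<tau> \<in> {0..t}"
      let ?D = "mult_i (M n (u \<tau>) + P n (g \<tau>))"
      have "((\<lambda>t. P n (u t)) has_vector_derivative ?D) (at \<tau> within {0..t})"
        by (rule has_vector_derivative_within_subset[OF du sub]) (use \<tau> sub in auto)
      from bounded_bilinear.has_vector_derivative[OF bounded_bilinear_inner this this]
      have "((\<lambda>t. inner (P n (u t)) (P n (u t))) has_vector_derivative 2 * inner ?D (P n (u \<tau>))) (at \<tau> within {0..t})"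
        by (simp add: inner_commute)
      moreover have "inner ?D (P n (u \<tau>)) = inner (mult_i (M n (u \<tau>))) (P n (u \<tau>)) + inner (mult_i (P n (g \<tau>))) (P n (u \<tau>))"
        by (simp add: linear_add[OF bounded_linear.linear[OF bounded_linear_mult_i]] inner_add_left)
      moreover have "inner (mult_i (P n (g \<tau>))) (P n (u \<tau>)) = inner (mult_i (g \<tau>)) (P n (u \<tau>))"
        by (simp flip: P_mult_i add: inner_P)
      ultimately show "((\<lambda>t. inner (P n (u t)) (P n (u t))) has_vector_derivative q n \<tau>) (at \<tau> within {0..t})"
        by (simp add: M_skew q_def)
    qed
    then show ?thesis by (simp add: power2_norm_eq_inner integral_unique)
  qed
  obtain B where B: "\<And>\<tau>. \<tau> \<in> {0..t} \<Longrightarrow> norm (u \<tau>) \<le> B" "0 \<le> B"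
    using compact_imp_bounded[OF compact_continuous_image[OF cu' compact_Icc]] t0
    unfolding bounded_iff by (metis atLeastAtMost_iff image_eqI norm_ge_zero order_refl order_trans)
  obtain D where D: "\<And>\<tau>. \<tau> \<in> {0..t} \<Longrightarrow> norm (g \<tau>) \<le> D" "0 \<le> D"
    using compact_imp_bounded[OF compact_continuous_image[OF cg' compact_Icc]] t0
    unfolding bounded_iff by (metis atLeastAtMost_iff image_eqI norm_ge_zero order_refl order_trans)
  have lim1: "(\<lambda>n. integral {0..t} (q n)) \<longlonglongrightarrow> integral {0..t} (\<lambda>\<tau>. 2 * inner (mult_i (g \<tau>)) (u \<tau>))"
  proof (rule dominated_convergence(2)[OF q_int])
    show "(\<lambda>\<tau>. 2 * (D * B)) integrable_on {0..t}" by (intro integrable_continuous_real continuous_intros)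
    show "norm (q n \<tau>) \<le> 2 * (D * B)" if "\<tau> \<in> {0..t}" for n \<tau>
    proof -
      have "\<bar>inner (mult_i (g \<tau>)) (P n (u \<tau>))\<bar> \<le> norm (g \<tau>) * norm (P n (u \<tau>))"
        using Cauchy_Schwarz_ineq2[of "mult_i (g \<tau>)" "P n (u \<tau>)"] by simp
      also have "\<dots> \<le> D * B"
        using D B norm_P_le[of n "u \<tau>"] that by (intro mult_mono) (auto intro: order_trans)
      finally show ?thesis by (simp add: q_def abs_mult)
    qed
    show "(\<lambda>n. q n \<tau>) \<longlonglongrightarrow> 2 * inner (mult_i (g \<tau>)) (u \<tau>)" for \<tau>
      unfolding q_def by (intro tendsto_intros P_tendsto)
  qed
  have "(\<lambda>n. (norm (P n (u t)))\<^sup>2) \<longlonglongrightarrow> (norm (u 0))\<^sup>2 + integral {0..t} (\<lambda>\<tau>. 2 * inner (mult_i (g \<tau>)) (u \<tau>))"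
    unfolding id by (intro tendsto_intros P_tendsto lim1)
  moreover have "(\<lambda>n. (norm (P n (u t)))\<^sup>2) \<longlonglongrightarrow> (norm (u t))\<^sup>2"
    by (intro tendsto_intros P_tendsto)
  ultimately show ?thesis by (rule LIMSEQ_unique[rotated])
qed

lemma weak_solution_norm:
  assumes "potential V" "weak_solution T u (\<lambda>t. V (u t))" "t \<in> {0..T}"
  shows "norm (u t) = norm (u 0)"
  using weak_solution_energy[OF assms(2,3)] by (simp add: potential_skew[OF assms(1)])

lemma potential_diff: "potential V \<Longrightarrow> V (f - g) = V f - V g"
  by (simp add: linear_diff bounded_linear.linear potential_bounded_linear)

lemma weak_solution_unique:
  assumes V: "potential V" and u: "weak_solution T u (\<lambda>t. V (u t))" "weak_solution T v (\<lambda>t. V (v t))"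
    and "u 0 = v 0" "t \<in> {0..T}"
  shows "u t = v t"
  using weak_solution_norm[OF V, of T "\<lambda>t. u t - v t" t] weak_solution_diff[OF u] assms
  by (simp add: potential_diff[OF V, symmetric])

text \<open>Strong convergence of the potentials suffices: the difference \<open>w\<close> of two solutions is driven
  by \<open>(V\<^sub>k - V) u\<close>, up to a term \<open>V\<^sub>k w\<close> that does not change the norm.\<close>

lemma perturbation_tendsto:
  fixes W :: "nat \<Rightarrow> 'a ltwo \<Rightarrow> 'a ltwo"
  assumes V: "potential V" and W: "\<And>k. potential (W k)"
    and C: "\<And>k f. norm (W k f) \<le> C * norm f"
    and WV: "\<And>f. (\<lambda>k. W k f) \<longlonglongrightarrow> V f"
    and u: "weak_solution T u (\<lambda>t. V (u t))" and x: "\<And>k. weak_solution T (x k) (\<lambda>t. W k (x k t))"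
    and init: "(\<lambda>k. x k 0) \<longlonglongrightarrow> u 0" and t: "t \<in> {0..T}"
  shows "(\<lambda>k. x k t) \<longlonglongrightarrow> u t"
proof -
  have sub: "{0..t} \<subseteq> {0..T}" and t0: "0 \<le> t" using t by auto
  have cu: "continuous_on {0..t} u"
    using u sub continuous_on_subset unfolding weak_solution_def by blast
  have VC: "norm (V f) \<le> C * norm f" for f
    by (rule LIMSEQ_le_const2[OF tendsto_norm[OF WV]]) (use C in auto)
  define K where "K = norm (u 0)"
  have uK: "norm (u \<tau>) = K" if "\<tau> \<in> {0..t}" for \<tau>
    unfolding K_def by (rule weak_solution_norm[OF V u]) (use that sub in auto)
  have "Bseq (\<lambda>k. x k 0)" using init by (intro convergent_imp_Bseq) (auto simp: convergent_def)
  then obtain L where L: "\<And>k. norm (x k 0) \<le> L" unfolding Bseq_def by auto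
  have xL: "norm (x k \<tau>) \<le> L" if "\<tau> \<in> {0..t}" for k \<tau>
    using weak_solution_norm[OF W x, of \<tau>] that sub L by auto
  define e where "e k \<tau> = norm (W k (u \<tau>) - V (u \<tau>))" for k \<tau>
  have e_cont: "continuous_on {0..t} (e k)" for k
    unfolding e_def
    by (intro continuous_on_norm continuous_on_diff
        bounded_linear.continuous_on[OF potential_bounded_linear[OF W]]
        bounded_linear.continuous_on[OF potential_bounded_linear[OF V]] cu)
  have lim_e: "(\<lambda>k. integral {0..t} (e k)) \<longlonglongrightarrow> integral {0..t} (\<lambda>_. 0)"
  proof (rule dominated_convergence(2))
    show "e k integrable_on {0..t}" for k by (rule integrable_continuous_real[OF e_cont])
    show "(\<lambda>_. C * K + C * K) integrable_on {0..t}" by (intro integrable_continuous_real continuous_intros)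
    show "norm (e k \<tau>) \<le> C * K + C * K" if "\<tau> \<in> {0..t}" for k \<tau>
      using norm_triangle_ineq4[of "W k (u \<tau>)" "V (u \<tau>)"] C[of k "u \<tau>"] VC[of "u \<tau>"] uK[OF that]
      by (simp add: e_def)
    show "(\<lambda>k. e k \<tau>) \<longlonglongrightarrow> 0" for \<tau>
      unfolding e_def using tendsto_norm_zero[OF LIM_zero[OF WV]] .
  qed
  have bound: "(norm (x k t - u t))\<^sup>2 \<le> (norm (x k 0 - u 0))\<^sup>2 + 2 * (L + K) * integral {0..t} (e k)" for k
  proof -
    let ?w = "\<lambda>\<tau>. x k \<tau> - u \<tau>" and ?g = "\<lambda>\<tau>. W k (x k \<tau>) - V (u \<tau>)"
    have w: "weak_solution T ?w ?g" by (rule weak_solution_diff[OF x u])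
    have cw: "continuous_on {0..t} ?w" "continuous_on {0..t} ?g"
      using w sub continuous_on_subset unfolding weak_solution_def by blast+
    have "integral {0..t} (\<lambda>\<tau>. 2 * inner (mult_i (?g \<tau>)) (?w \<tau>)) \<le> integral {0..t} (\<lambda>\<tau>. 2 * (L + K) * e k \<tau>)"
    proof (rule Henstock_Kurzweil_Integration.integral_le)
      show "(\<lambda>\<tau>. 2 * inner (mult_i (?g \<tau>)) (?w \<tau>)) integrable_on {0..t}"
        by (intro integrable_continuous_real continuous_intros cw bounded_linear.continuous_on[OF bounded_linear_mult_i])
      show "(\<lambda>\<tau>. 2 * (L + K) * e k \<tau>) integrable_on {0..t}"
        by (intro integrable_continuous_real continuous_intros e_cont)
      fix \<tau> assume \<tau>: "\<tau> \<in> {0..t}"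
      \<comment> \<open>The part acting on the difference is skew; only the perturbation of \<open>u\<close> is left.\<close>
      have "?g \<tau> = W k (?w \<tau>) + (W k (u \<tau>) - V (u \<tau>))"
        by (simp add: potential_diff[OF W])
      then have "inner (mult_i (?g \<tau>)) (?w \<tau>) = inner (mult_i (W k (u \<tau>) - V (u \<tau>))) (?w \<tau>)"
        by (simp only: linear_add[OF bounded_linear.linear[OF bounded_linear_mult_i]] inner_add_left
            potential_skew[OF W] add_0)
      also have "\<dots> \<le> e k \<tau> * norm (?w \<tau>)"
        using norm_cauchy_schwarz[of "mult_i (W k (u \<tau>) - V (u \<tau>))" "?w \<tau>"] by (simp add: e_def)
      also have "\<dots> \<le> e k \<tau> * (L + K)"
        using norm_triangle_ineq4[of "x k \<tau>" "u \<tau>"] xL[OF \<tau>, of k] uK[OF \<tau>]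
        by (intro mult_left_mono) (auto simp: e_def)
      finally show "2 * inner (mult_i (?g \<tau>)) (?w \<tau>) \<le> 2 * (L + K) * e k \<tau>" by (simp add: algebra_simps)
    qed
    also have "\<dots> = 2 * (L + K) * integral {0..t} (e k)"
      by (rule integral_mult_right)
    finally show ?thesis
      using weak_solution_energy[OF w t] by linarith
  qed
  have "(\<lambda>k. (norm (x k 0 - u 0))\<^sup>2 + 2 * (L + K) * integral {0..t} (e k)) \<longlonglongrightarrow> 0\<^sup>2 + 2 * (L + K) * integral {0..t} (\<lambda>_. 0)"
    by (intro tendsto_intros lim_e tendsto_norm_zero[OF LIM_zero[OF init]])
  then have "(\<lambda>k. (norm (x k 0 - u 0))\<^sup>2 + 2 * (L + K) * integral {0..t} (e k)) \<longlonglongrightarrow> 0" by simp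
  then have "(\<lambda>k. (norm (x k t - u t))\<^sup>2) \<longlonglongrightarrow> 0"
    by (rule tendsto_sandwich[OF _ _ tendsto_const, rotated 2]) (use bound in auto)
  then have "(\<lambda>k. norm (x k t - u t)) \<longlonglongrightarrow> 0" by (rule tendsto_zero_power2D)
  then show ?thesis using LIM_zero_iff tendsto_norm_zero_iff by blast
qed

end

lemma cmod_cis_diff_le: "cmod (cis a - cis b) \<le> \<bar>a - b\<bar>"
proof -
  have "cis a - cis b = cis b * (cis (a - b) - 1)"
    by (simp add: right_diff_distrib cis_mult)
  moreover have "cmod (cis (a - b) - 1) \<le> \<bar>a - b\<bar>"
    using iexp_approx1[of "a - b" 0] by (simp add: cis_conv_exp)
  ultimately show ?thesis by (simp add: norm_mult)
qed

lemma has_vector_derivative_cis_scaled: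
  "((\<lambda>t. cis (t * c)) has_vector_derivative \<i> * of_real c * cis (t * c)) (at t within S)"
proof -
  have "((\<lambda>t. Complex (cos (t * c)) (sin (t * c))) has_vector_derivative
      Complex (- sin (t * c) * c) (cos (t * c) * c)) (at t within S)"
    unfolding has_vector_derivative_complex_iff
    by (auto intro!: derivative_eq_intros)
  moreover have "Complex (- sin (t * c) * c) (cos (t * c) * c) = \<i> * of_real c * cis (t * c)"
    by (simp add: complex_eq_iff)
  ultimately show ?thesis by (simp add: cis.code)
qed

lemma has_vector_derivative_zero_eq:
  fixes f :: "real \<Rightarrow> 'h::real_normed_vector"
  assumes "\<And>t. t \<in> {0..T} \<Longrightarrow> (f has_vector_derivative 0) (at t within {0..T})" "t \<in> {0..T}"
  shows "f t = f 0"
proof -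
  obtain c where "\<And>t. t \<in> {0..T} \<Longrightarrow> f t = c"
    by (rule has_vector_derivative_zero_constant[of "{0..T}" f]) (use assms in auto)
  then show ?thesis using assms(2) by auto
qed

context symbol
begin

definition G :: "real \<Rightarrow> 'a ltwo \<Rightarrow> 'a ltwo" where
  "G t = mult_op (\<lambda>\<xi>. cis (t * m \<xi>))"

lemma ess_bounded_cis: "ess_bounded (\<lambda>\<xi>. cis (t * m \<xi>))"
  by (rule ess_boundedI[of _ 1]) auto

lemma ess_bounded_cut_cis: "ess_bounded (\<lambda>\<xi>. of_real (cut n \<xi>) * cis (t * m \<xi>))"
  by (rule ess_bounded_mult[OF ess_bounded_cut ess_bounded_cis])

lemma G_linear: "bounded_linear (G t)"
  unfolding G_def by (rule bounded_linear_mult[OF ess_bounded_cis])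

lemma norm_G [simp]: "norm (G t f) = norm f"
  unfolding G_def by (rule norm_mult_unimodular[OF ess_bounded_cis]) simp

lemma G_continuous: "continuous_on S (\<lambda>t. G t f)"
  unfolding G_def
  by (rule continuous_on_mult_param[where C = 1]) (auto intro!: ess_bounded_cis continuous_intros)

lemma G_0 [simp]: "G 0 f = f"
  by (simp add: G_def)

text \<open>The group itself is only strongly continuous, but behind a cut-off the difference quotients of its
  multipliers are bounded by \<open>n\<close> and converge pointwise.\<close>

lemma cut_G_has_vector_derivative:
  "((\<lambda>t. mult_op (\<lambda>\<xi>. of_real (cut n \<xi>) * cis (t * m \<xi>)) x) has_vector_derivative
     mult_i (M n (G t x))) (at t within S)"
  unfolding has_vector_derivative_iff_quotient tendsto_at_iff_sequentially
proof (intro allI impI, unfold o_def)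
  fix X :: "nat \<Rightarrow> real"
  assume X: "\<forall>i. X i \<in> S - {t}" and Xt: "X \<longlonglongrightarrow> t"
  define q where "q k \<xi> = complex_of_real (inverse (X k - t)) *
      (of_real (cut n \<xi>) * cis (X k * m \<xi>) - of_real (cut n \<xi>) * cis (t * m \<xi>))" for k \<xi>
  define r where "r \<xi> = \<i> * (complex_of_real (m \<xi> * cut n \<xi>) * cis (t * m \<xi>))" for \<xi>
  have eq: "ess_bounded (q k)" for k
    unfolding q_def[abs_def] by (intro ess_bounded_mult ess_bounded_diff ess_bounded_cut_cis ess_bounded_const)
  have er: "ess_bounded r"
    unfolding r_def[abs_def] by (intro ess_bounded_mult ess_bounded_m_cut ess_bounded_cis ess_bounded_const)
  have q_le: "cmod (q k \<xi>) \<le> real n" for k \<xi>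
  proof -
    have "q k \<xi> = of_real (inverse (X k - t) * cut n \<xi>) * (cis (X k * m \<xi>) - cis (t * m \<xi>))"
      by (simp add: q_def algebra_simps)
    then have "cmod (q k \<xi>) = \<bar>inverse (X k - t) * cut n \<xi>\<bar> * cmod (cis (X k * m \<xi>) - cis (t * m \<xi>))"
      by (simp only: norm_mult norm_of_real)
    also have "\<dots> \<le> \<bar>inverse (X k - t) * cut n \<xi>\<bar> * \<bar>X k * m \<xi> - t * m \<xi>\<bar>"
      by (intro mult_left_mono cmod_cis_diff_le) auto
    also have "\<dots> = \<bar>m \<xi> * cut n \<xi>\<bar>"
    proof -
      have "X k - t \<noteq> 0" using X by auto
      then have "inverse (X k - t) * cut n \<xi> * ((X k - t) * m \<xi>) = m \<xi> * cut n \<xi>" by simp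
      then show ?thesis by (simp only: abs_mult[symmetric] left_diff_distrib[symmetric])
    qed
    finally show ?thesis using m_cut_le[of \<xi> n] by linarith
  qed
  have r_le: "cmod (r \<xi>) \<le> real n" for \<xi>
    using m_cut_le[of \<xi> n] unfolding r_def norm_mult norm_of_real by simp
  have "(\<lambda>k. mult_op (q k) x) \<longlonglongrightarrow> mult_op r x"
  proof (rule mult_tendsto[OF eq er, where C = "real n + real n"])
    show "AE \<xi> in lborel. cmod (q k \<xi> - r \<xi>) \<le> real n + real n" for k
      by (intro AE_I2 order_trans[OF norm_triangle_ineq4] add_mono q_le r_le)
    show "AE \<xi> in lborel. (\<lambda>k. q k \<xi>) \<longlonglongrightarrow> r \<xi>"
    proof (rule AE_I2)
      fix \<xi>
      have "((\<lambda>y. (cis (y * m \<xi>) - cis (t * m \<xi>)) /\<^sub>R (y - t)) \<longlongrightarrow> \<i> * of_real (m \<xi>) * cis (t * m \<xi>)) (at t within S)"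
        using has_vector_derivative_cis_scaled[of "m \<xi>" t S] unfolding has_vector_derivative_iff_quotient .
      then have "(\<lambda>k. (cis (X k * m \<xi>) - cis (t * m \<xi>)) /\<^sub>R (X k - t)) \<longlonglongrightarrow> \<i> * of_real (m \<xi>) * cis (t * m \<xi>)"
        using X Xt unfolding tendsto_at_iff_sequentially o_def by blast
      then have "(\<lambda>k. of_real (cut n \<xi>) * ((cis (X k * m \<xi>) - cis (t * m \<xi>)) /\<^sub>R (X k - t)))
          \<longlonglongrightarrow> of_real (cut n \<xi>) * (\<i> * of_real (m \<xi>) * cis (t * m \<xi>))"
        by (rule tendsto_mult_left)
      then show "(\<lambda>k. q k \<xi>) \<longlonglongrightarrow> r \<xi>"
        by (simp add: q_def r_def scaleR_conv_of_real mult_ac right_diff_distrib)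
    qed
  qed
  moreover have "mult_op r x = mult_i (M n (G t x))"
    unfolding M_def G_def r_def[abs_def]
    by (subst mult_mult[OF ess_bounded_m_cut ess_bounded_cis], subst mult_mult[OF ess_bounded_const
        ess_bounded_mult[OF ess_bounded_m_cut ess_bounded_cis]]) simp
  moreover have "mult_op (q k) x = (mult_op (\<lambda>\<xi>. of_real (cut n \<xi>) * cis (X k * m \<xi>)) x
      - mult_op (\<lambda>\<xi>. of_real (cut n \<xi>) * cis (t * m \<xi>)) x) /\<^sub>R (X k - t)" for k
    unfolding q_def[abs_def] mult_diff_left[OF ess_bounded_cut_cis ess_bounded_cut_cis, symmetric] mult_of_real[symmetric]
    by (rule mult_mult[OF ess_bounded_const ess_bounded_diff[OF ess_bounded_cut_cis ess_bounded_cut_cis], symmetric])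
  ultimately show "(\<lambda>k. (mult_op (\<lambda>\<xi>. of_real (cut n \<xi>) * cis (X k * m \<xi>)) x
      - mult_op (\<lambda>\<xi>. of_real (cut n \<xi>) * cis (t * m \<xi>)) x) /\<^sub>R (X k - t)) \<longlonglongrightarrow> mult_i (M n (G t x))"
    by simp
qed

text \<open>In the interaction picture \<open>u = e\<^sup>i\<^sup>t\<^sup>m v\<close> the unbounded symbol disappears from the
  equation, which becomes linear with bounded, strongly continuous coefficients.\<close>

lemma weak_solution_exists:
  assumes V: "potential V" and T: "0 \<le> T"
  obtains u where "weak_solution T u (\<lambda>t. V (u t))" "u 0 = x0"
proof -
  have Vl: "bounded_linear V" by (rule potential_bounded_linear[OF V])
  obtain C where C: "0 \<le> C" "\<And>f. norm (V f) \<le> norm f * C"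
    using bounded_linear.nonneg_bounded[OF Vl] by blast
  define F where "F t x = mult_i (G (- t) (V (G t x)))" for t x
  have F_lin: "bounded_linear (F t)" for t
    unfolding F_def
    by (intro bounded_linear_compose[OF bounded_linear_mult_i] bounded_linear_compose[OF G_linear]
        bounded_linear_compose[OF Vl] G_linear)
  have F_cont: "continuous_on {0..T} (\<lambda>t. F t x)" for x
  proof -
    have c1: "continuous_on {0..T} (\<lambda>t. V (G t x))"
      by (intro bounded_linear.continuous_on[OF Vl] G_continuous)
    have c2: "continuous_on {0..T} (\<lambda>t. G (- t) y)" for y
      by (rule continuous_on_compose2[OF G_continuous[of UNIV], of _ uminus]) (auto intro!: continuous_intros)
    have "continuous_on {0..T} (\<lambda>t. G (- t) (V (G t x)))"
      by (rule continuous_on_apply_strong[where C = 1 and F = "\<lambda>t. G (- t)", OF _ _ c2 c1])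
         (auto simp: G_linear)
    then show ?thesis unfolding F_def by (rule bounded_linear.continuous_on[OF bounded_linear_mult_i])
  qed
  have F_bd: "norm (F t x) \<le> C * norm x" for t x
    using C(2)[of "G t x"] by (simp add: F_def mult.commute)
  obtain v where v: "continuous_on {0..T} v" "v 0 = x0"
    and dv: "\<And>t. t \<in> {0..T} \<Longrightarrow> (v has_vector_derivative F t (v t)) (at t within {0..T})"
    by (rule linear_ode_exists[OF T C(1) F_lin F_bd F_cont, of x0]) blast
  define u where "u t = G t (v t)" for t
  have cu: "continuous_on {0..T} u"
    unfolding u_def by (rule continuous_on_apply_strong[where C = 1]) (auto simp: G_linear G_continuous v)
  have "((\<lambda>t. P n (u t)) has_vector_derivative mult_i (M n (u t) + P n (V (u t)))) (at t within {0..T})"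
    if t: "t \<in> {0..T}" for n t
  proof -
    let ?E = "\<lambda>t. mult_op (\<lambda>\<xi>. of_real (cut n \<xi>) * cis (t * m \<xi>))"
    have E_eq: "?E t x = P n (G t x)" for t x
      unfolding P_def G_def by (rule mult_mult[OF ess_bounded_cut ess_bounded_cis, symmetric])
    have "((\<lambda>t. ?E t (v t)) has_vector_derivative mult_i (M n (G t (v t))) + ?E t (F t (v t))) (at t within {0..T})"
    proof (rule has_vector_derivative_apply_strong[OF _ _ cut_G_has_vector_derivative dv[OF t]])
      show "bounded_linear (?E t)" for t by (rule bounded_linear_mult[OF ess_bounded_cut_cis])
      show "norm (?E t x) \<le> norm x" for t x using norm_P_le[of n "G t x"] by (simp add: E_eq)
    qed
    moreover have "?E t (F t (v t)) = mult_i (P n (V (u t)))"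
    proof -
      have "G t (G (- t) y) = y" for y
        unfolding G_def mult_mult[OF ess_bounded_cis ess_bounded_cis] by (simp add: cis_mult)
      moreover have "G t (mult_i y) = mult_i (G t y)" for y
        unfolding G_def by (rule mult_commute[OF ess_bounded_cis]) simp
      ultimately show ?thesis by (simp add: E_eq F_def u_def P_mult_i)
    qed
    ultimately show ?thesis
      unfolding E_eq u_def by (simp add: linear_add[OF bounded_linear.linear[OF bounded_linear_mult_i]])
  qed
  then have "weak_solution T u (\<lambda>t. V (u t))"
    unfolding weak_solution_def using cu bounded_linear.continuous_on[OF Vl cu] by auto
  then show ?thesis by (rule that) (simp add: u_def v)
qed

subsection \<open>Propagation of regularity\<close>

lemma potential_compress:
  assumes "potential V" shows "potential (\<lambda>f. P n (V (P n f)))"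
  using assms unfolding potential_def
  by (auto intro!: bounded_linear_compose[OF P_linear] bounded_linear_compose[of V] P_linear simp: inner_P P_mult_i)

text \<open>The Galerkin equation \<open>x' = \<i> A x\<close> has the bounded self-adjoint generator \<open>A = m P\<^sub>n + P\<^sub>n V P\<^sub>n\<close>. As its flow
  is unitary and commutes with \<open>A\<close>, both \<open>|A x|\<close> and \<open>\<langle>A x, x\<rangle>\<close> are conserved.\<close>

lemma galerkin:
  fixes x0 :: "'a ltwo" and n :: nat
  assumes V: "potential V" and T: "0 \<le> T"
  defines "A \<equiv> \<lambda>f. M n f + P n (V (P n f))"
  obtains x where "weak_solution T x (\<lambda>t. P n (V (P n (x t))))" "x 0 = P n x0"
    "\<And>t. t \<in> {0..T} \<Longrightarrow> P n (x t) = x t"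
    "\<And>t. t \<in> {0..T} \<Longrightarrow> norm (A (x t)) = norm (A (P n x0))"
    "\<And>t. t \<in> {0..T} \<Longrightarrow> inner (A (x t)) (x t) = inner (A (P n x0)) (P n x0)"
proof -
  have W: "potential (\<lambda>f. P n (V (P n f)))" by (rule potential_compress[OF V])
  have A_lin: "bounded_linear A"
    unfolding A_def by (intro bounded_linear_add M_linear potential_bounded_linear[OF W])
  have A_sym: "inner (A f) g = inner f (A g)" for f g
    using W unfolding A_def potential_def by (simp add: inner_add_left inner_add_right inner_M)
  have A_i: "A (mult_i f) = mult_i (A f)" for f
    using W unfolding A_def potential_def
    by (simp add: M_mult_i linear_add[OF bounded_linear.linear[OF bounded_linear_mult_i]])
  have PA: "P n (A f) = A f" and AP: "A (P n f) = A f" for f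
    unfolding A_def by (simp_all add: linear_add[OF bounded_linear.linear[OF P_linear]])
  have skew: "inner (mult_i (A f)) f = 0" for f
    by (rule inner_mult_i_symmetric[OF A_sym A_i])
  obtain C where C: "0 \<le> C" "\<And>f. norm (A f) \<le> norm f * C"
    using bounded_linear.nonneg_bounded[OF A_lin] by blast
  obtain x where x: "continuous_on {0..T} x" "x 0 = P n x0"
    and dx: "\<And>t. t \<in> {0..T} \<Longrightarrow> (x has_vector_derivative mult_i (A (x t))) (at t within {0..T})"
  proof (rule linear_ode_exists[OF T C(1), of "\<lambda>_ f. mult_i (A f)" "P n x0"])
    show "bounded_linear (\<lambda>f. mult_i (A f))"
      by (rule bounded_linear_compose[OF bounded_linear_mult_i A_lin])
    show "norm (mult_i (A f)) \<le> C * norm f" for f using C(2)[of f] by (simp add: mult.commute)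
  qed auto
  have dA: "((\<lambda>t. A (x t)) has_vector_derivative mult_i (A (A (x t)))) (at t within {0..T})" if "t \<in> {0..T}" for t
    using bounded_linear.has_vector_derivative[OF A_lin dx[OF that]] by (simp add: A_i)
  \<comment> \<open>The component outside the cut-off is constant, and it vanishes initially.\<close>
  have Px: "P n (x t) = x t" if "t \<in> {0..T}" for t
  proof -
    have "x t - P n (x t) = x 0 - P n (x 0)"
    proof (rule has_vector_derivative_zero_eq[OF _ that])
      fix t assume "t \<in> {0..T}"
      from has_vector_derivative_diff[OF dx[OF this] bounded_linear.has_vector_derivative[OF P_linear[of n] dx[OF this]]]
      show "((\<lambda>t. x t - P n (x t)) has_vector_derivative 0) (at t within {0..T})"
        by (simp add: P_mult_i PA)
    qed
    then show ?thesis by (simp add: x)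
  qed
  have conserved: "inner (A (x t)) (x t) = inner (A (x 0)) (x 0)" if "t \<in> {0..T}" for t
  proof (rule has_vector_derivative_zero_eq[OF _ that])
    fix t assume t: "t \<in> {0..T}"
    have "inner (mult_i (A (A (x t)))) (x t) = 0"
      using A_sym[of "mult_i (A (x t))" "x t"] inner_mult_i[of "A (x t)" "A (x t)"]
      by (simp add: A_i inner_commute)
    moreover have "inner (A (x t)) (mult_i (A (x t))) = 0"
      using inner_mult_i[of "A (x t)" "A (x t)"] by (simp add: inner_commute)
    ultimately show "((\<lambda>t. inner (A (x t)) (x t)) has_vector_derivative 0) (at t within {0..T})"
      using bounded_bilinear.has_vector_derivative[OF bounded_bilinear_inner dA[OF t] dx[OF t]] by simp
  qed
  have normA: "inner (A (x t)) (A (x t)) = inner (A (x 0)) (A (x 0))" if "t \<in> {0..T}" for t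
  proof (rule has_vector_derivative_zero_eq[OF _ that])
    fix t assume t: "t \<in> {0..T}"
    show "((\<lambda>t. inner (A (x t)) (A (x t))) has_vector_derivative 0) (at t within {0..T})"
      using bounded_bilinear.has_vector_derivative[OF bounded_bilinear_inner dA[OF t] dA[OF t]]
      by (simp add: skew inner_commute[of "A (x t)"])
  qed
  show ?thesis
  proof
    have "((\<lambda>t. P k (x t)) has_vector_derivative mult_i (M k (x t) + P k (P n (V (P n (x t)))))) (at t within {0..T})"
      if t: "t \<in> {0..T}" for k t
    proof -
      have "P k (mult_i (A (x t))) = mult_i (P k (M n (x t)) + P k (P n (V (P n (x t)))))"
        unfolding A_def by (simp add: P_mult_i linear_add[OF bounded_linear.linear[OF P_linear]])
      also have "P k (M n (x t)) = M k (x t)"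
      proof -
        have "P k (M n (x t)) = M k (P n (x t))" by (rule P_M_commute)
        then show ?thesis by (simp add: Px[OF t])
      qed
      finally show ?thesis
        using bounded_linear.has_vector_derivative[OF P_linear dx[OF t], of k] by simp
    qed
    then show "weak_solution T x (\<lambda>t. P n (V (P n (x t))))"
      unfolding weak_solution_def using x bounded_linear.continuous_on[OF potential_bounded_linear[OF W] x(1)] by auto
    show "norm (A (x t)) = norm (A (P n x0))" if "t \<in> {0..T}" for t
      using normA[OF that] x(2) by (simp add: norm_eq_sqrt_inner)
    show "inner (A (x t)) (x t) = inner (A (P n x0)) (P n x0)" if "t \<in> {0..T}" for t
      using conserved[OF that] x(2) by simp
  qed (use x Px in auto)
qed

end

context symbol
begin

abbreviation sqm :: "'a \<Rightarrow> real" where "sqm \<equiv> \<lambda>\<xi>. sqrt (m \<xi>)"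

lemma compress_tendsto:
  assumes V: "potential V" and C: "\<And>f. norm (V f) \<le> C * norm f"
  shows "(\<lambda>n. P n (V (P n f))) \<longlonglongrightarrow> V f"
proof -
  have "(\<lambda>n. P n (V (P n f - f))) \<longlonglongrightarrow> 0"
  proof (rule tendsto_norm_zero_cancel, rule tendsto_sandwich[OF _ _ tendsto_const])
    show "\<forall>\<^sub>F n in sequentially. norm (P n (V (P n f - f))) \<le> C * norm (P n f - f)"
      by (intro always_eventually allI order_trans[OF norm_P_le C])
    have "(\<lambda>n. C * norm (P n f - f)) \<longlonglongrightarrow> C * norm (f - f)"
      by (intro tendsto_intros P_tendsto)
    then show "(\<lambda>n. C * norm (P n f - f)) \<longlonglongrightarrow> 0" by simp
  qed auto
  from tendsto_add[OF this P_tendsto[of "V f"]]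
  have "(\<lambda>n. P n (V (P n f - f)) + P n (V f)) \<longlonglongrightarrow> V f" by simp
  then show ?thesis
    by (simp add: potential_diff[OF V] linear_diff[OF bounded_linear.linear[OF P_linear]])
qed

text \<open>Galerkin approximations converge to the solution, and the two conserved quantities bound them
  in the domains of \<open>m\<close> and of its square root.\<close>

lemma solution_bounds:
  assumes V: "potential V" and C: "0 \<le> C" "\<And>f. norm (V f) \<le> C * norm f"
    and u: "weak_solution T u (\<lambda>t. V (u t))" and t: "t \<in> {0..T}"
  shows "in_dom m (u 0) \<Longrightarrow> in_dom m (u t) \<and>
           norm (wmult m (u t)) \<le> norm (wmult m (u 0)) + 2 * C * norm (u 0)"
    and "in_dom sqm (u 0) \<Longrightarrow> in_dom sqm (u t) \<and>
           norm (wmult sqm (u t)) \<le> sqrt ((norm (wmult sqm (u 0)))\<^sup>2 + 2 * C * (norm (u 0))\<^sup>2)"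
proof -
  have T: "0 \<le> T" using t by auto
  let ?A = "\<lambda>n f. M n f + P n (V (P n f))"
  have "\<forall>n. \<exists>x. weak_solution T x (\<lambda>t. P n (V (P n (x t)))) \<and> x 0 = P n (u 0) \<and> P n (x t) = x t \<and>
    norm (?A n (x t)) = norm (?A n (P n (u 0))) \<and>
    inner (?A n (x t)) (x t) = inner (?A n (P n (u 0))) (P n (u 0))"
  proof
    fix n
    show "\<exists>x. weak_solution T x (\<lambda>t. P n (V (P n (x t)))) \<and> x 0 = P n (u 0) \<and> P n (x t) = x t \<and>
        norm (?A n (x t)) = norm (?A n (P n (u 0))) \<and>
        inner (?A n (x t)) (x t) = inner (?A n (P n (u 0))) (P n (u 0))"
      by (rule galerkin[OF V T, of n "u 0"]) (use t in blast)
  qed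
  from choice[OF this] obtain x where x: "\<And>n. weak_solution T (x n) (\<lambda>t. P n (V (P n (x n t))))" "\<And>n. x n 0 = P n (u 0)"
    and Px: "\<And>n. P n (x n t) = x n t"
    and nA: "\<And>n. norm (?A n (x n t)) = norm (?A n (P n (u 0)))"
    and iA: "\<And>n. inner (?A n (x n t)) (x n t) = inner (?A n (P n (u 0))) (P n (u 0))"
    by blast
  have PVP: "norm (P n (V (P n f))) \<le> C * norm f" for n f
    using norm_P_le[of n "V (P n f)"] C(2)[of "P n f"] mult_left_mono[OF norm_P_le[of n f] C(1)] by linarith
  have lim: "(\<lambda>n. x n t) \<longlonglongrightarrow> u t"
  proof (rule perturbation_tendsto[OF V potential_compress[OF V] PVP compress_tendsto[OF V C(2)] u x(1) _ t])
    show "(\<lambda>k. x k 0) \<longlonglongrightarrow> u 0" unfolding x(2) by (rule P_tendsto)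
  qed
  have norm_x: "norm (x n t) \<le> norm (u 0)" for n
    using weak_solution_norm[OF potential_compress[OF V] x(1) t, of n] norm_P_le[of n "u 0"] by (simp add: x(2))
  have dom_x: "in_dom m (x n t)" and m_x: "wmult m (x n t) = M n (x n t)" for n
    using in_dom_P[of n "x n t"] wmult_P[of n "x n t"] by (simp_all add: Px)
  show "in_dom m (u t) \<and> norm (wmult m (u t)) \<le> norm (wmult m (u 0)) + 2 * C * norm (u 0)" if d: "in_dom m (u 0)"
  proof -
    have "norm (wmult m (x n t)) \<le> norm (wmult m (u 0)) + 2 * C * norm (u 0)" for n
    proof -
      have "M n (x n t) = ?A n (x n t) - P n (V (P n (x n t)))" by simp
      then have "norm (M n (x n t)) \<le> norm (?A n (x n t)) + norm (P n (V (P n (x n t))))"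
        by (metis norm_triangle_ineq4)
      also have "\<dots> \<le> norm (M n (u 0)) + norm (P n (V (P n (u 0)))) + norm (P n (V (P n (x n t))))"
        unfolding nA using norm_triangle_ineq[of "M n (u 0)" "P n (V (P n (u 0)))"] by simp
      also have "\<dots> \<le> norm (wmult m (u 0)) + C * norm (u 0) + C * norm (u 0)"
      proof (intro add_mono PVP)
        have "M n (u 0) = P n (wmult m (u 0))"
          using in_dom_cutoff(2)[OF d, of "{\<xi>. m \<xi> \<le> real n}"] wmult_P[of n "u 0"]
          by (simp add: P_def cut_def)
        then show "norm (M n (u 0)) \<le> norm (wmult m (u 0))" by (simp add: norm_P_le)
        show "norm (P n (V (P n (x n t)))) \<le> C * norm (u 0)"
          using PVP[of n "x n t"] mult_left_mono[OF norm_x[of n] C(1)] by linarith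
      qed
      finally show ?thesis by (simp add: m_x)
    qed
    from in_dom_lower_semicontinuous[OF m_measurable m_nonneg lim dom_x this] show ?thesis by blast
  qed
  show "in_dom sqm (u t) \<and> norm (wmult sqm (u t)) \<le> sqrt ((norm (wmult sqm (u 0)))\<^sup>2 + 2 * C * (norm (u 0))\<^sup>2)"
    if d: "in_dom sqm (u 0)"
  proof -
    have inner_PVP: "\<bar>inner (P n (V (P n f))) f\<bar> \<le> C * (norm (u 0))\<^sup>2" if "norm f \<le> norm (u 0)" for n f
    proof -
      have "\<bar>inner (P n (V (P n f))) f\<bar> \<le> norm (P n (V (P n f))) * norm f" by (rule Cauchy_Schwarz_ineq2)
      also have "\<dots> \<le> (C * norm (u 0)) * norm (u 0)"
        using PVP[of n f] mult_left_mono[OF that C(1)] that by (intro mult_mono) (auto simp: C(1))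
      finally show ?thesis by (simp add: power2_eq_square mult.assoc)
    qed
    have "norm (wmult sqm (x n t)) \<le> sqrt ((norm (wmult sqm (u 0)))\<^sup>2 + 2 * C * (norm (u 0))\<^sup>2)" for n
    proof (rule real_le_rsqrt)
      have sq: "(norm (wmult sqm f))\<^sup>2 = inner (wmult m f) f" if "in_dom m f" for f
        by (rule in_dom_sqrt(2)[OF m_measurable m_nonneg that])
      have "(norm (wmult sqm (x n t)))\<^sup>2 = inner (?A n (x n t)) (x n t) - inner (P n (V (P n (x n t)))) (x n t)"
        by (simp add: sq[OF dom_x] m_x inner_add_left)
      also have "\<dots> = inner (M n (u 0)) (P n (u 0)) + inner (P n (V (P n (u 0)))) (P n (u 0)) - inner (P n (V (P n (x n t)))) (x n t)"
        unfolding iA by (simp add: inner_add_left)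
      also have "inner (M n (u 0)) (P n (u 0)) = (norm (wmult sqm (P n (u 0))))\<^sup>2"
        by (simp add: sq[OF in_dom_P] wmult_P)
      also have "wmult sqm (P n (u 0)) = P n (wmult sqm (u 0))"
        unfolding P_def cut_def by (rule in_dom_cutoff(2)[OF d]) auto
      also have "(norm (P n (wmult sqm (u 0))))\<^sup>2 + inner (P n (V (P n (u 0)))) (P n (u 0)) - inner (P n (V (P n (x n t)))) (x n t)
          \<le> (norm (wmult sqm (u 0)))\<^sup>2 + 2 * C * (norm (u 0))\<^sup>2"
      proof -
        have "(norm (P n (wmult sqm (u 0))))\<^sup>2 \<le> (norm (wmult sqm (u 0)))\<^sup>2"
          by (intro power_mono norm_P_le) auto
        then show ?thesis
          using abs_le_D1[OF inner_PVP[OF norm_P_le, of n n]] abs_le_D2[OF inner_PVP[OF norm_x, of n n]]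
          unfolding mult.assoc P_P by linarith
      qed
      finally show "(norm (wmult sqm (x n t)))\<^sup>2 \<le> (norm (wmult sqm (u 0)))\<^sup>2 + 2 * C * (norm (u 0))\<^sup>2" .
    qed
    moreover have "in_dom sqm (x n t)" for n
      by (rule in_dom_sqrt(1)[OF m_measurable m_nonneg dom_x])
    ultimately show ?thesis
      using in_dom_lower_semicontinuous[OF _ _ lim, of sqm "sqrt ((norm (wmult sqm (u 0)))\<^sup>2 + 2 * C * (norm (u 0))\<^sup>2)"]
      by (auto simp: m_nonneg)
  qed
qed

text \<open>Interpolation: \<open>|\<surd>m (u - u')|\<^sup>2 = \<langle>m (u - u'), u - u'\<rangle>\<close> is small when \<open>u - u'\<close> is, because \<open>m u\<close> stays
  bounded.\<close>

lemma smooth_solution_continuous: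
  assumes V: "potential V" and u: "weak_solution T u (\<lambda>t. V (u t))" and d: "in_dom m (u 0)"
  shows "continuous_on {0..T} (\<lambda>t. wmult sqm (u t))"
proof -
  obtain C where C: "0 \<le> C" "\<And>f. norm (V f) \<le> C * norm f"
    using bounded_linear.nonneg_bounded[OF potential_bounded_linear[OF V]] by (auto simp: mult.commute)
  define K where "K = norm (wmult m (u 0)) + 2 * C * norm (u 0)"
  have dom: "in_dom m (u t)" and K: "norm (wmult m (u t)) \<le> K" if "t \<in> {0..T}" for t
    using solution_bounds(1)[OF V C u that d] by (auto simp: K_def)
  have dom_s: "in_dom sqm (u t)" if "t \<in> {0..T}" for t
    by (rule in_dom_sqrt(1)[OF m_measurable m_nonneg dom[OF that]])
  have cu: "continuous_on {0..T} u" using u by (simp add: weak_solution_def)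
  have le: "(norm (wmult sqm (u t) - wmult sqm (u t')))\<^sup>2 \<le> (K + K) * norm (u t - u t')"
    if t: "t \<in> {0..T}" and t': "t' \<in> {0..T}" for t t'
  proof -
    have "wmult sqm (u t) - wmult sqm (u t') = wmult sqm (u t - u t')"
      by (rule in_dom_diff(2)[symmetric]) (auto intro: dom_s t t')
    then have "(norm (wmult sqm (u t) - wmult sqm (u t')))\<^sup>2 = inner (wmult m (u t - u t')) (u t - u t')"
      using in_dom_sqrt(2)[OF m_measurable m_nonneg in_dom_diff(1)[OF m_measurable dom[OF t] dom[OF t']]] by simp
    also have "\<dots> \<le> norm (wmult m (u t - u t')) * norm (u t - u t')" by (rule norm_cauchy_schwarz)
    also have "wmult m (u t - u t') = wmult m (u t) - wmult m (u t')"
      by (rule in_dom_diff(2)) (auto intro: dom t t')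
    also have "norm (wmult m (u t) - wmult m (u t')) * norm (u t - u t') \<le> (K + K) * norm (u t - u t')"
      by (intro mult_right_mono order_trans[OF norm_triangle_ineq4] add_mono K t t') auto
    finally show ?thesis .
  qed
  show ?thesis
    unfolding continuous_on
  proof
    fix t' assume t': "t' \<in> {0..T}"
    have "((\<lambda>t. (K + K) * norm (u t - u t')) \<longlongrightarrow> (K + K) * norm (u t' - u t')) (at t' within {0..T})"
      using cu t' by (intro tendsto_intros) (auto simp: continuous_on)
    then have "((\<lambda>t. (K + K) * norm (u t - u t')) \<longlongrightarrow> 0) (at t' within {0..T})" by simp
    then have "((\<lambda>t. (norm (wmult sqm (u t) - wmult sqm (u t')))\<^sup>2) \<longlongrightarrow> 0) (at t' within {0..T})"
      by (rule tendsto_sandwich[OF _ _ tendsto_const, rotated 2])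
         (use le t' in \<open>auto simp: eventually_at_filter\<close>)
    then have "((\<lambda>t. norm (wmult sqm (u t) - wmult sqm (u t'))) \<longlongrightarrow> 0) (at t' within {0..T})"
      by (rule tendsto_zero_power2D)
    then show "((\<lambda>t. wmult sqm (u t)) \<longlongrightarrow> wmult sqm (u t')) (at t' within {0..T})"
      using LIM_zero_iff tendsto_norm_zero_iff by blast
  qed
qed

text \<open>General data are approximated by their cut-offs, which lie in the domain of \<open>m\<close>. The difference of two
  solutions is a solution, so its half-order norm is controlled by the data uniformly in time, and the
  continuity of the approximations is inherited.\<close>

theorem evolution_exists:
  assumes V: "potential V" and T: "0 \<le> T" and x0: "in_dom sqm x0"
  obtains u where "weak_solution T u (\<lambda>t. V (u t))" "u 0 = x0"
    "\<And>t. t \<in> {0..T} \<Longrightarrow> in_dom sqm (u t)" "continuous_on {0..T} (\<lambda>t. wmult sqm (u t))"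
proof -
  obtain C where C: "0 \<le> C" "\<And>f. norm (V f) \<le> C * norm f"
    using bounded_linear.nonneg_bounded[OF potential_bounded_linear[OF V]] by (auto simp: mult.commute)
  obtain u where u: "weak_solution T u (\<lambda>t. V (u t))" "u 0 = x0"
    by (rule weak_solution_exists[OF V T])
  have du: "in_dom sqm (u t)" if "t \<in> {0..T}" for t
    using solution_bounds(2)[OF V C u(1) that] u(2) x0 by simp
  have "\<exists>y. weak_solution T y (\<lambda>t. V (y t)) \<and> y 0 = P k x0" for k
    using weak_solution_exists[OF V T, of "P k x0"] by metis
  then obtain y where y: "\<And>k. weak_solution T (y k) (\<lambda>t. V (y k t))" "\<And>k. y k 0 = P k x0"
    by metis
  have sqm[measurable]: "sqm \<in> borel_measurable borel" by measurable
  have dPx: "in_dom sqm (P k x0)" for k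
    by (rule in_dom_sqrt(1)[OF m_measurable m_nonneg in_dom_P])
  have dy: "in_dom sqm (y k t)" if "t \<in> {0..T}" for t k
    using solution_bounds(2)[OF V C y(1) that] y(2) dPx by simp
  define e where "e k = sqrt ((norm (wmult sqm (P k x0) - wmult sqm x0))\<^sup>2 + 2 * C * (norm (P k x0 - x0))\<^sup>2)" for k
  have close: "norm (wmult sqm (y k t) - wmult sqm (u t)) \<le> e k" if t: "t \<in> {0..T}" for k t
  proof -
    have w: "weak_solution T (\<lambda>t. y k t - u t) (\<lambda>t. V (y k t - u t))"
      using weak_solution_diff[OF y(1) u(1), of k] by (simp add: potential_diff[OF V])
    have "in_dom sqm (y k 0 - u 0)" "wmult sqm (y k 0 - u 0) = wmult sqm (P k x0) - wmult sqm x0"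
      unfolding y(2) u(2) by (rule in_dom_diff[OF sqm dPx x0])+
    then have "norm (wmult sqm (y k t - u t)) \<le> e k"
      using solution_bounds(2)[OF V C w t] by (simp add: e_def y(2) u(2))
    then show ?thesis
      by (simp add: in_dom_diff(2)[OF sqm dy[OF t] du[OF t]])
  qed
  have e: "e \<longlonglongrightarrow> 0"
  proof -
    have "wmult sqm (P k x0) = P k (wmult sqm x0)" for k
      unfolding P_def cut_def by (rule in_dom_cutoff(2)[OF x0]) auto
    then have "e \<longlonglongrightarrow> sqrt ((norm (wmult sqm x0 - wmult sqm x0))\<^sup>2 + 2 * C * (norm (x0 - x0))\<^sup>2)"
      unfolding e_def by (simp only:) (intro tendsto_intros P_tendsto)
    then show ?thesis by simp
  qed
  have "continuous_on {0..T} (\<lambda>t. wmult sqm (u t))"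
  proof (rule uniform_limit_theorem[where F = sequentially and f = "\<lambda>k t. wmult sqm (y k t)"])
    show "\<forall>\<^sub>F k in sequentially. continuous_on {0..T} (\<lambda>t. wmult sqm (y k t))"
      by (intro always_eventually allI smooth_solution_continuous[OF V y(1)]) (simp add: y(2) in_dom_P)
    show "uniform_limit {0..T} (\<lambda>k t. wmult sqm (y k t)) (\<lambda>t. wmult sqm (u t)) sequentially"
    proof (rule uniform_limitI)
      fix r :: real assume "0 < r"
      with e have "\<forall>\<^sub>F k in sequentially. e k < r" by (rule order_tendstoD(2))
      then show "\<forall>\<^sub>F k in sequentially. \<forall>t\<in>{0..T}. dist (wmult sqm (y k t)) (wmult sqm (u t)) < r"
        by eventually_elim (auto simp: dist_norm intro: le_less_trans[OF close])
    qed
  qed simp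
  then show ?thesis using that u du by blast
qed

end

section \<open>Test functions\<close>

definition dirderiv :: "'a::euclidean_space \<Rightarrow> ('a \<Rightarrow> 'b::real_normed_vector) \<Rightarrow> 'a \<Rightarrow> 'b" where
  "dirderiv v f x = frechet_derivative f (at x) v"

lemma Ck_Suc_iff: "Ck (Suc k) f \<longleftrightarrow> (\<forall>x. f differentiable (at x)) \<and> (\<forall>v. Ck k (dirderiv v f))"
  by (simp add: dirderiv_def[abs_def])

lemma Ck_SucD: "Ck (Suc k) f \<Longrightarrow> Ck k f"
proof (induction k arbitrary: f)
  case 0
  then show ?case
    by (auto intro!: differentiable_imp_continuous_on simp: differentiable_on_def intro: differentiable_at_withinI)
next
  case (Suc k)
  have "\<forall>x. f differentiable (at x)" "\<forall>v. Ck (Suc k) (dirderiv v f)"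
    using Suc.prems Ck_Suc_iff[of "Suc k" f] by blast+
  then show ?case
    using Ck_Suc_iff[of k f] Suc.IH by blast
qed

lemma Ck_SucI:
  assumes "\<And>x. (f has_derivative f' x) (at x)" "\<And>v. Ck k (\<lambda>x. f' x v)"
  shows "Ck (Suc k) f"
proof -
  have "dirderiv v f = (\<lambda>x. f' x v)" for v
    unfolding dirderiv_def using frechet_derivative_at[OF assms(1)] by metis
  then show ?thesis
    unfolding Ck_Suc_iff using assms by (auto simp: differentiable_def)
qed

lemma has_derivative_dirderiv:
  "f differentiable (at x) \<Longrightarrow> (f has_derivative (\<lambda>v. dirderiv v f x)) (at x)"
  unfolding dirderiv_def by (simp flip: frechet_derivative_works)

text \<open>As \<open>Ck\<close> is defined by recursion over all directional derivatives, the closure properties are proved by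
  induction on the order for all functions at once: the derivative is a function of the same form
  and of lower order.\<close>

lemma Ck_comp_affine:
  assumes A: "bounded_linear A" and "Ck k f" shows "Ck k (\<lambda>x. f (c + A x))"
  using assms(2)
proof (induction k arbitrary: f)
  case 0
  then show ?case
    by (auto intro!: continuous_on_compose2[of UNIV f] continuous_intros bounded_linear.continuous_on[OF A])
next
  case (Suc k)
  show ?case
  proof (rule Ck_SucI)
    fix x
    have "(f has_derivative (\<lambda>v. dirderiv v f (c + A x))) (at (c + A x))"
      using Suc.prems by (intro has_derivative_dirderiv) simp
    moreover have "((\<lambda>x. c + A x) has_derivative A) (at x)"
      using bounded_linear_imp_has_derivative[OF A] by (auto intro!: derivative_eq_intros)
    ultimately show "((\<lambda>x. f (c + A x)) has_derivative (\<lambda>v. dirderiv (A v) f (c + A x))) (at x)"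
      by (rule has_derivative_compose[rotated])
  qed (use Suc in \<open>auto simp only: Ck_Suc_iff\<close>)
qed

lemma Ck_linear:
  assumes L: "bounded_linear L" and "Ck k f" shows "Ck k (\<lambda>x. L (f x))"
  using assms(2)
proof (induction k arbitrary: f)
  case 0
  then show ?case by (auto intro: bounded_linear.continuous_on[OF L])
next
  case (Suc k)
  show ?case
  proof (rule Ck_SucI)
    fix x
    show "((\<lambda>x. L (f x)) has_derivative (\<lambda>v. L (dirderiv v f x))) (at x)"
      using Suc.prems by (intro bounded_linear.has_derivative[OF L] has_derivative_dirderiv) simp
  qed (use Suc in \<open>auto simp only: Ck_Suc_iff\<close>)
qed

lemma Ck_add: "Ck k f \<Longrightarrow> Ck k g \<Longrightarrow> Ck k (\<lambda>x. f x + g x)"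
proof (induction k arbitrary: f g)
  case (Suc k)
  show ?case
  proof (rule Ck_SucI)
    fix x
    show "((\<lambda>x. f x + g x) has_derivative (\<lambda>v. dirderiv v f x + dirderiv v g x)) (at x)"
      using Suc.prems by (intro has_derivative_add has_derivative_dirderiv) simp_all
  qed (use Suc in \<open>auto simp only: Ck_Suc_iff\<close>)
qed (auto intro: continuous_intros)

lemma Ck_mult:
  fixes f g :: "'a::euclidean_space \<Rightarrow> 'b::real_normed_algebra"
  shows "Ck k f \<Longrightarrow> Ck k g \<Longrightarrow> Ck k (\<lambda>x. f x * g x)"
proof (induction k arbitrary: f g)
  case (Suc k)
  show ?case
  proof (rule Ck_SucI)
    fix x
    show "((\<lambda>x. f x * g x) has_derivative (\<lambda>v. f x * dirderiv v g x + dirderiv v f x * g x)) (at x)"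
      using Suc.prems by (intro has_derivative_mult has_derivative_dirderiv) simp_all
  next
    fix v
    show "Ck k (\<lambda>x. f x * dirderiv v g x + dirderiv v f x * g x)"
      using Suc.prems Ck_SucD[OF Suc.prems(1)] Ck_SucD[OF Suc.prems(2)]
      unfolding Ck_Suc_iff by (intro Ck_add Suc.IH) auto
  qed
qed (auto intro: continuous_intros)

lemma test_function_Ck: "test_function \<Omega> f \<Longrightarrow> Ck k f"
  by (simp add: test_function_def)

lemma test_function_differentiable: "test_function \<Omega> f \<Longrightarrow> f differentiable (at x)"
  using test_function_Ck[of \<Omega> f "Suc 0"] by simp

lemma test_function_continuous: "test_function \<Omega> f \<Longrightarrow> continuous_on UNIV f"
  using test_function_Ck[of \<Omega> f 0] by simp

lemma test_functionI_subset:
  assumes "\<And>k. Ck k f" "compact K" "K \<subseteq> \<Omega>" "\<And>x. x \<notin> K \<Longrightarrow> f x = 0"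
  shows "test_function \<Omega> f"
proof -
  have c: "closure {x. f x \<noteq> 0} \<subseteq> K"
    by (rule closure_minimal) (use assms in \<open>auto intro: compact_imp_closed\<close>)
  moreover have "compact (closure {x. f x \<noteq> 0})"
    by (rule compact_Int_closed[OF assms(2) closed_closure, THEN back_subst[of compact]]) (use c in auto)
  ultimately show ?thesis using assms by (auto simp: test_function_def)
qed

lemma test_function_vanishes:
  assumes "test_function \<Omega> f"
  obtains R where "0 \<le> R" "\<And>x. norm x > R \<Longrightarrow> f x = 0"
proof -
  have "bounded (closure {x. f x \<noteq> 0})"
    using assms by (auto simp: test_function_def intro: compact_imp_bounded)
  then obtain R where R: "\<And>x. x \<in> closure {x. f x \<noteq> 0} \<Longrightarrow> norm x \<le> R"
    unfolding bounded_iff by blast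
  have "f x = 0" if "norm x > max 0 R" for x
    using R[of x] that closure_subset[of "{x. f x \<noteq> 0}"] by fastforce
  then show ?thesis using that[of "max 0 R"] by auto
qed

lemma test_function_UNIV_I:
  assumes "\<And>k. Ck k f" "\<And>x. norm x > R \<Longrightarrow> f x = 0"
  shows "test_function UNIV f"
  by (rule test_functionI_subset[of _ "cball 0 R"]) (use assms in auto)

lemma test_function_dirderiv:
  assumes f: "test_function \<Omega> f" shows "test_function \<Omega> (dirderiv v f)"
proof (rule test_functionI_subset[of _ "closure {x. f x \<noteq> 0}"])
  show "Ck k (dirderiv v f)" for k
    using test_function_Ck[OF f, of "Suc k"] unfolding Ck_Suc_iff by blast
  fix x assume x: "x \<notin> closure {x. f x \<noteq> 0}"
  have "(f has_derivative (\<lambda>_. 0)) (at x)"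
  proof (rule has_derivative_transform_within_open[of "\<lambda>_. 0" "\<lambda>_. 0" x UNIV "- closure {x. f x \<noteq> 0}"])
    show "0 = f y" if "y \<in> - closure {x. f x \<noteq> 0}" for y
      using that closure_subset[of "{x. f x \<noteq> 0}"] by fastforce
  qed (use x in auto)
  from frechet_derivative_at[OF this] show "dirderiv v f x = 0"
    unfolding dirderiv_def by metis
qed (use f in \<open>auto simp: test_function_def\<close>)

lemma test_function_iterate: "test_function \<Omega> f \<Longrightarrow> test_function \<Omega> ((dirderiv v ^^ N) f)"
  by (induction N) (auto intro: test_function_dirderiv)

lemma test_function_bounded:
  fixes f :: "'a::euclidean_space \<Rightarrow> complex"
  assumes "test_function \<Omega> f"
  obtains B R where "0 \<le> B" "0 \<le> R" "\<And>x. cmod (f x) \<le> B" "\<And>x. norm x > R \<Longrightarrow> f x = 0"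
proof -
  obtain R where R: "0 \<le> R" "\<And>x. norm x > R \<Longrightarrow> f x = 0"
    using test_function_vanishes[OF assms] by blast
  obtain B where "0 \<le> B" "\<And>x. cmod (f x) \<le> B"
    using continuous_compact_support_bounded[OF test_function_continuous[OF assms], of R] R(2) by metis
  then show ?thesis using that R by blast
qed

lemma test_function_measurable: "test_function \<Omega> f \<Longrightarrow> f \<in> borel_measurable borel"
  by (intro borel_measurable_continuous_onI test_function_continuous)

lemma test_function_L2:
  fixes f :: "'a::euclidean_space \<Rightarrow> complex"
  assumes f: "test_function \<Omega> f" shows "f \<in> L2"
  by (rule test_function_bounded[OF f]) (blast intro: L2_compact_support test_function_measurable[OF f])

lemma integrable_compact_support:
  fixes f :: "'a::euclidean_space \<Rightarrow> complex"
  assumes "f \<in> borel_measurable borel" "\<And>x. cmod (f x) \<le> B" "\<And>x. norm x > R \<Longrightarrow> f x = 0"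
  shows "integrable lborel f"
proof (rule Bochner_Integration.integrable_bound)
  show "integrable lborel (\<lambda>x. B * indicator (cball (0::'a) R) x)" by (rule integrable_indicator_cball)
  have "0 \<le> B" using order_trans[OF norm_ge_zero assms(2)] .
  then show "AE x in lborel. norm (f x) \<le> norm (B * indicator (cball 0 R) x)"
    using assms(2,3) by (intro AE_I2) (auto simp: indicator_def)
qed (use assms(1) in simp)

lemma test_function_integrable:
  fixes f :: "'a::euclidean_space \<Rightarrow> complex"
  assumes f: "test_function \<Omega> f" shows "integrable lborel f"
  by (rule test_function_bounded[OF f]) (blast intro: integrable_compact_support test_function_measurable[OF f])

lemma has_vector_derivative_line:
  fixes f :: "'a::euclidean_space \<Rightarrow> 'b::real_normed_vector"
  assumes "f differentiable (at (x + s *\<^sub>R v))"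
  shows "((\<lambda>s. f (x + s *\<^sub>R v)) has_vector_derivative dirderiv v f (x + s *\<^sub>R v)) (at s within S)"
proof -
  have "((\<lambda>s. x + s *\<^sub>R v) has_derivative (\<lambda>h. h *\<^sub>R v)) (at s within S)"
    by (auto intro!: derivative_eq_intros)
  from has_derivative_compose[OF this has_derivative_dirderiv[OF assms]]
  have "((\<lambda>s. f (x + s *\<^sub>R v)) has_derivative (\<lambda>h. dirderiv (h *\<^sub>R v) f (x + s *\<^sub>R v))) (at s within S)" .
  moreover have "dirderiv (h *\<^sub>R v) f (x + s *\<^sub>R v) = h *\<^sub>R dirderiv v f (x + s *\<^sub>R v)" for h
    by (rule linear_scale[OF has_derivative_linear[OF has_derivative_dirderiv[OF assms]]])
  ultimately show ?thesis by (simp add: has_vector_derivative_def)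
qed

text \<open>Mean value inequality along a line. It bounds difference quotients uniformly, which is what dominated
  convergence needs.\<close>

lemma dirderiv_bound:
  fixes f :: "'a::euclidean_space \<Rightarrow> 'b::real_normed_vector"
  assumes f: "\<And>x. f differentiable (at x)" and B: "\<And>x. norm (dirderiv v f x) \<le> B"
  shows "norm (f (x + h *\<^sub>R v) - f x) \<le> B * \<bar>h\<bar>"
proof -
  have "norm (f (x + h *\<^sub>R v) - f (x + 0 *\<^sub>R v)) \<le> B * norm (h - 0)"
  proof (rule differentiable_bound[of UNIV "\<lambda>s. f (x + s *\<^sub>R v)" "\<lambda>s h. h *\<^sub>R dirderiv v f (x + s *\<^sub>R v)"])
    show "((\<lambda>s. f (x + s *\<^sub>R v)) has_derivative (\<lambda>h. h *\<^sub>R dirderiv v f (x + s *\<^sub>R v))) (at s within UNIV)" for s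
      using has_vector_derivative_line[OF f, where x = x and s = s and v = v and S = UNIV] by (simp add: has_vector_derivative_def)
    show "onorm (\<lambda>h. h *\<^sub>R dirderiv v f (x + s *\<^sub>R v)) \<le> B" for s
    proof (rule onorm_le)
      show "norm (h *\<^sub>R dirderiv v f (x + s *\<^sub>R v)) \<le> B * norm h" for h :: real
        using mult_left_mono[OF B, of "\<bar>h\<bar>" "x + s *\<^sub>R v"] by (simp add: mult.commute)
    qed
  qed auto
  then show ?thesis by simp
qed

lemma fourier_translate:
  fixes f :: "'a::euclidean_space \<Rightarrow> complex"
  assumes [measurable]: "f \<in> borel_measurable borel"
  shows "fourier (\<lambda>x. f (x + a)) \<xi> = cis (a \<bullet> \<xi>) * fourier f \<xi>"
proof -
  have "(LINT x|lborel. cis (- (x \<bullet> \<xi>)) * f x) = (LINT x|lborel. cis (- ((a + x) \<bullet> \<xi>)) * f (a + x))"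
    using integral_affine[of "\<lambda>x. cis (- (x \<bullet> \<xi>)) * f x" 1 a] by simp
  also have "\<dots> = (LINT x|lborel. cis (- (a \<bullet> \<xi>)) * (cis (- (x \<bullet> \<xi>)) * f (x + a)))"
  proof (rule Bochner_Integration.integral_cong[OF refl])
    fix x
    have "cis (- ((a + x) \<bullet> \<xi>)) = cis (- (a \<bullet> \<xi>)) * cis (- (x \<bullet> \<xi>))"
      by (simp add: cis_mult inner_add_left)
    then show "cis (- ((a + x) \<bullet> \<xi>)) * f (a + x) = cis (- (a \<bullet> \<xi>)) * (cis (- (x \<bullet> \<xi>)) * f (x + a))"
      by (simp only: mult.assoc add.commute)
  qed
  also have "\<dots> = cis (- (a \<bullet> \<xi>)) * (LINT x|lborel. cis (- (x \<bullet> \<xi>)) * f (x + a))"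
    by (rule integral_mult_right_zero)
  finally have "cis (a \<bullet> \<xi>) * (LINT x|lborel. cis (- (x \<bullet> \<xi>)) * f x) = (LINT x|lborel. cis (- (x \<bullet> \<xi>)) * f (x + a))"
    by (simp add: cis_mult flip: mult.assoc)
  then show ?thesis
    unfolding fourier_def by (simp add: mult.left_commute)
qed

text \<open>Under the transform translations become multiplication by characters, so difference quotients of \<open>f\<close>
  become difference quotients of characters; both sides converge. Integration by parts in several
  variables is thereby avoided.\<close>

lemma fourier_dirderiv:
  fixes f :: "'a::euclidean_space \<Rightarrow> complex"
  assumes f: "test_function \<Omega> f"
  shows "fourier (dirderiv v f) \<xi> = \<i> * of_real (v \<bullet> \<xi>) * fourier f \<xi>"
proof -
  note [measurable] = test_function_measurable[OF f] test_function_measurable[OF test_function_dirderiv[OF f, of v]]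
  obtain R where R: "\<And>x. norm x > R \<Longrightarrow> f x = 0"
    using test_function_vanishes[OF f] by blast
  obtain B where B: "0 \<le> B" "\<And>x. cmod (dirderiv v f x) \<le> B"
    using test_function_bounded[OF test_function_dirderiv[OF f]] by metis
  define E where "E n = 1 / real (Suc n)" for n
  have E: "0 < E n" "E n \<le> 1" for n by (auto simp: E_def)
  have E0: "E \<longlonglongrightarrow> 0" unfolding E_def by (rule LIMSEQ_Suc[OF lim_1_over_n])
  have E_at: "filterlim E (at 0) sequentially"
    using E0 E(1) by (auto simp: filterlim_at less_imp_neq[THEN not_sym] intro!: always_eventually)
  define q where "q n x = (f (x + E n *\<^sub>R v) - f x) /\<^sub>R E n" for n x
  have [measurable]: "q n \<in> borel_measurable borel" for n unfolding q_def by measurable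
  have q_le: "cmod (q n x) \<le> B" for n x
  proof -
    have "cmod (f (x + E n *\<^sub>R v) - f x) \<le> B * E n"
      using dirderiv_bound[OF test_function_differentiable[OF f] B(2), of x "E n"] E(1)[of n] by simp
    moreover have "cmod (q n x) = cmod (f (x + E n *\<^sub>R v) - f x) / E n"
      unfolding q_def norm_scaleR using E(1)[of n] by (simp add: divide_inverse mult.commute)
    ultimately show ?thesis using E(1)[of n] by (simp add: divide_le_eq)
  qed
  have q_supp: "q n x = 0" if "norm x > R + norm v" for n x
  proof -
    have "norm (E n *\<^sub>R v) \<le> norm v" using E[of n] by (simp add: mult_left_le_one_le)
    then have "norm (x + E n *\<^sub>R v) > R" using that norm_diff_ineq[of x "E n *\<^sub>R v"] by linarith
    moreover have "norm x > R" using that norm_ge_zero[of v] by linarith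
    ultimately show ?thesis using R by (simp add: q_def)
  qed
  have q_lim: "(\<lambda>n. q n x) \<longlonglongrightarrow> dirderiv v f x" for x
  proof -
    have "((\<lambda>s. (f (x + s *\<^sub>R v) - f (x + 0 *\<^sub>R v)) /\<^sub>R (s - 0)) \<longlongrightarrow> dirderiv v f (x + 0 *\<^sub>R v)) (at 0)"
      using has_vector_derivative_line[OF test_function_differentiable[OF f], where x = x and s = 0 and v = v and S = UNIV]
      unfolding has_vector_derivative_iff_quotient .
    from filterlim_compose[OF this E_at] show ?thesis by (simp add: q_def)
  qed
  have 1: "(\<lambda>n. fourier (q n) \<xi>) \<longlonglongrightarrow> fourier (dirderiv v f) \<xi>"
    unfolding fourier_def
  proof (intro tendsto_mult_left integral_dominated_convergence)
    show "integrable lborel (\<lambda>x. B * indicator (cball (0::'a) (R + norm v)) x)" by (rule integrable_indicator_cball)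
    show "AE x in lborel. norm (cis (- (x \<bullet> \<xi>)) * q n x) \<le> B * indicator (cball 0 (R + norm v)) x" for n
      using q_le q_supp by (intro AE_I2) (auto simp: norm_mult indicator_def)
    show "AE x in lborel. (\<lambda>n. cis (- (x \<bullet> \<xi>)) * q n x) \<longlonglongrightarrow> cis (- (x \<bullet> \<xi>)) * dirderiv v f x"
      by (intro AE_I2 tendsto_mult_left q_lim)
  qed measurable
  have fi: "integrable lborel f" by (rule test_function_integrable[OF f])
  have fi': "integrable lborel (\<lambda>x. f (x + a))" for a
    using integrable_affine[of f 1 a] fi by (simp add: add.commute)
  have "fourier (q n) \<xi> = (cis (E n * (v \<bullet> \<xi>)) - cis (0 * (v \<bullet> \<xi>))) /\<^sub>R (E n - 0) * fourier f \<xi>" for n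
  proof -
    have "q n = (\<lambda>x. of_real (inverse (E n)) * (f (x + E n *\<^sub>R v) - f x))"
      by (rule ext) (simp only: q_def scaleR_conv_of_real)
    then have "fourier (q n) \<xi> = of_real (inverse (E n)) * (fourier (\<lambda>x. f (x + E n *\<^sub>R v)) \<xi> - fourier f \<xi>)"
      by (simp only: fourier_cmult fourier_diff[OF fi' fi])
    then show ?thesis
      by (simp add: fourier_translate scaleR_conv_of_real left_diff_distrib right_diff_distrib mult.assoc)
  qed
  moreover have "(\<lambda>n. (cis (E n * (v \<bullet> \<xi>)) - cis (0 * (v \<bullet> \<xi>))) /\<^sub>R (E n - 0) * fourier f \<xi>)
      \<longlonglongrightarrow> \<i> * of_real (v \<bullet> \<xi>) * cis (0 * (v \<bullet> \<xi>)) * fourier f \<xi>"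
    using has_vector_derivative_cis_scaled[of "v \<bullet> \<xi>" 0 UNIV]
    unfolding has_vector_derivative_iff_quotient
    by (intro tendsto_mult_right filterlim_compose[OF _ E_at])
  ultimately have "(\<lambda>n. fourier (q n) \<xi>) \<longlonglongrightarrow> \<i> * of_real (v \<bullet> \<xi>) * fourier f \<xi>" by simp
  with 1 show ?thesis by (rule LIMSEQ_unique)
qed

lemma fourier_dirderiv_iterate:
  fixes f :: "'a::euclidean_space \<Rightarrow> complex"
  assumes "test_function \<Omega> f"
  shows "fourier ((dirderiv v ^^ N) f) \<xi> = (\<i> * of_real (v \<bullet> \<xi>))^N * fourier f \<xi>"
  by (induction N) (simp_all add: fourier_dirderiv[OF test_function_iterate[OF assms]] mult.assoc)

text \<open>Powers of the coordinates dominate powers of the norm, since the largest coordinate is at least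
  \<open>norm \<xi> / DIM('a)\<close>.\<close>

lemma norm_powr_le:
  fixes \<xi> :: "'a::euclidean_space"
  assumes "0 \<le> r" "r \<le> real N"
  shows "norm \<xi> powr r \<le> 1 + real DIM('a)^N * (\<Sum>b\<in>Basis. \<bar>b \<bullet> \<xi>\<bar>^N)"
proof (cases "norm \<xi> \<le> 1")
  case True
  then have "norm \<xi> powr r \<le> 1"
    using assms powr_mono2[of r "norm \<xi>" 1] by simp
  moreover have "0 \<le> real DIM('a)^N * (\<Sum>b\<in>Basis. \<bar>b \<bullet> \<xi>\<bar>^N)"
    by (intro mult_nonneg_nonneg sum_nonneg) auto
  ultimately show ?thesis by linarith
next
  case False
  then have "norm \<xi> powr r \<le> norm \<xi> powr real N" using assms by (intro powr_mono) auto
  also have "\<dots> = norm \<xi> ^ N" using False by (intro powr_realpow) auto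
  also have "\<dots> \<le> real DIM('a)^N * (\<Sum>b\<in>Basis. \<bar>b \<bullet> \<xi>\<bar>^N)"
  proof -
    define X where "X = Max ((\<lambda>b. \<bar>b \<bullet> \<xi>\<bar>) ` Basis)"
    have X: "\<bar>b \<bullet> \<xi>\<bar> \<le> X" if "b \<in> Basis" for b unfolding X_def using that by auto
    have "X \<in> (\<lambda>b. \<bar>b \<bullet> \<xi>\<bar>) ` Basis" unfolding X_def by (rule Max_in) auto
    then obtain b0 where b0: "b0 \<in> Basis" "X = \<bar>b0 \<bullet> \<xi>\<bar>" by auto
    have "norm \<xi> \<le> (\<Sum>b\<in>Basis. \<bar>\<xi> \<bullet> b\<bar>)" by (rule norm_le_l1)
    also have "\<dots> \<le> (\<Sum>b\<in>(Basis::'a set). X)" using X by (intro sum_mono) (simp add: inner_commute)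
    finally have "norm \<xi> ^ N \<le> (real DIM('a) * X)^N" by (intro power_mono) auto
    also have "\<dots> = real DIM('a)^N * \<bar>b0 \<bullet> \<xi>\<bar>^N" by (simp add: power_mult_distrib b0)
    also have "\<dots> \<le> real DIM('a)^N * (\<Sum>b\<in>Basis. \<bar>b \<bullet> \<xi>\<bar>^N)"
      using b0 by (intro mult_left_mono member_le_sum[where f = "\<lambda>b. \<bar>b \<bullet> \<xi>\<bar>^N"]) auto
    finally show ?thesis .
  qed
  finally show ?thesis by simp
qed

text \<open>Regularity turns into decay: polynomial weights of the transform are transforms of
  derivatives.\<close>

definition decay_majorant :: "nat \<Rightarrow> ('a::euclidean_space \<Rightarrow> complex) \<Rightarrow> 'a \<Rightarrow> real" where
  "decay_majorant N f \<xi> = cmod (fourier f \<xi>) + real DIM('a)^N * (\<Sum>b\<in>Basis. cmod (fourier ((dirderiv b ^^ N) f) \<xi>))"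

lemma decay_majorant:
  fixes f :: "'a::euclidean_space \<Rightarrow> complex"
  assumes "test_function \<Omega> f" "0 \<le> r" "r \<le> real N"
  shows "norm \<xi> powr r * cmod (fourier f \<xi>) \<le> decay_majorant N f \<xi>"
proof -
  have "norm \<xi> powr r * cmod (fourier f \<xi>)
      \<le> (1 + real DIM('a)^N * (\<Sum>b\<in>Basis. \<bar>b \<bullet> \<xi>\<bar>^N)) * cmod (fourier f \<xi>)"
    by (intro mult_right_mono norm_powr_le assms) auto
  also have "\<dots> = decay_majorant N f \<xi>"
    unfolding decay_majorant_def fourier_dirderiv_iterate[OF assms(1)]
    by (simp add: norm_mult norm_power sum_distrib_right distrib_right mult.assoc)
  finally show ?thesis .
qed

lemma L2_cmod: "f \<in> L2 \<Longrightarrow> (\<lambda>x. complex_of_real (cmod (f x))) \<in> L2"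
  unfolding L2_def by auto

lemma L2_sum: "(\<And>i. i \<in> I \<Longrightarrow> f i \<in> L2) \<Longrightarrow> (\<lambda>x. \<Sum>i\<in>I. f i x) \<in> L2"
  by (induction I rule: infinite_finite_induct) (auto intro: L2_add)

lemma fourier_test_function_L2:
  fixes f :: "'a::euclidean_space \<Rightarrow> complex"
  assumes "test_function \<Omega> f" shows "fourier f \<in> L2"
  by (intro plancherel_L1_L2 test_function_integrable[OF assms] test_function_L2[OF assms])

lemma L2_norm_fourier_test_function:
  fixes f :: "'a::euclidean_space \<Rightarrow> complex"
  assumes "test_function \<Omega> f" shows "L2_norm (fourier f) = L2_norm f"
  by (intro plancherel_L1_L2 test_function_integrable[OF assms] test_function_L2[OF assms])

lemma decay_majorant_L2:
  fixes f :: "'a::euclidean_space \<Rightarrow> complex"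
  assumes f: "test_function \<Omega> f"
  shows "(\<lambda>\<xi>. complex_of_real (decay_majorant N f \<xi>)) \<in> L2"
  unfolding decay_majorant_def of_real_add of_real_mult of_real_sum
  by (intro L2_add L2_scale L2_sum L2_cmod fourier_test_function_L2[OF f] fourier_test_function_L2[OF test_function_iterate[OF f]])

lemma L2_norm_scale: "L2_norm (\<lambda>x. c * f x) = cmod c * L2_norm f"
  unfolding L2_norm_def by (simp add: norm_mult power_mult_distrib real_sqrt_mult)

lemma L2_norm_cmod: "L2_norm (\<lambda>x. complex_of_real (cmod (f x))) = L2_norm f"
  unfolding L2_norm_def by simp

lemma L2_norm_sum: "(\<And>i. i \<in> I \<Longrightarrow> f i \<in> L2) \<Longrightarrow> L2_norm (\<lambda>x. \<Sum>i\<in>I. f i x) \<le> (\<Sum>i\<in>I. L2_norm (f i))"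
proof (induction I rule: infinite_finite_induct)
  case (insert i I)
  then show ?case
    using L2_norm_triangle[of "f i" "\<lambda>x. \<Sum>i\<in>I. f i x"] by (auto simp: L2_sum intro: order_trans)
qed (auto simp: L2_norm_def)

lemma L2_norm_decay_majorant:
  fixes f :: "'a::euclidean_space \<Rightarrow> complex"
  assumes f: "test_function \<Omega> f"
  shows "L2_norm (\<lambda>\<xi>. complex_of_real (decay_majorant N f \<xi>))
    \<le> L2_norm f + real DIM('a)^N * (\<Sum>b\<in>Basis. L2_norm ((dirderiv b ^^ N) f))"
proof -
  let ?g = "\<lambda>b \<xi>. complex_of_real (cmod (fourier ((dirderiv b ^^ N) f) \<xi>))"
  have g: "?g b \<in> L2" for b
    by (intro L2_cmod fourier_test_function_L2[OF test_function_iterate[OF f]])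
  have "L2_norm (\<lambda>\<xi>. complex_of_real (decay_majorant N f \<xi>))
      = L2_norm (\<lambda>\<xi>. complex_of_real (cmod (fourier f \<xi>)) + complex_of_real (real DIM('a)^N) * (\<Sum>b\<in>Basis. ?g b \<xi>))"
    by (simp add: decay_majorant_def)
  also have "\<dots> \<le> L2_norm (\<lambda>\<xi>. complex_of_real (cmod (fourier f \<xi>)))
      + L2_norm (\<lambda>\<xi>. complex_of_real (real DIM('a)^N) * (\<Sum>b\<in>Basis. ?g b \<xi>))"
    by (intro L2_norm_triangle L2_scale L2_sum g L2_cmod fourier_test_function_L2[OF f])
  also have "\<dots> \<le> L2_norm f + real DIM('a)^N * (\<Sum>b\<in>Basis. L2_norm (?g b))"
    unfolding L2_norm_scale L2_norm_cmod[of "fourier f"] L2_norm_fourier_test_function[OF f] norm_of_real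
    by (intro add_left_mono) (simp add: L2_norm_sum g mult_left_mono)
  finally show ?thesis
    unfolding L2_norm_cmod L2_norm_fourier_test_function[OF test_function_iterate[OF f]] .
qed

lemma fourier_test_function_bounded_weight:
  fixes f :: "'a::euclidean_space \<Rightarrow> complex"
  assumes f: "test_function \<Omega> f" and r: "0 \<le> r"
  obtains C where "\<And>\<xi>. norm \<xi> powr r * cmod (fourier f \<xi>) \<le> C"
proof -
  obtain N :: nat where N: "r \<le> real N" using real_arch_simple by blast
  let ?I = "\<lambda>f :: 'a \<Rightarrow> complex. fourier_const TYPE('a) * (LINT x|lborel. cmod (f x))"
  have "norm \<xi> powr r * cmod (fourier f \<xi>) \<le> ?I f + real DIM('a)^N * (\<Sum>b\<in>Basis. ?I ((dirderiv b ^^ N) f))" for \<xi>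
    by (intro order_trans[OF decay_majorant[OF f r N]], unfold decay_majorant_def)
       (intro add_mono mult_left_mono sum_mono fourier_bounded test_function_integrable[OF f]
          test_function_integrable[OF test_function_iterate[OF f]], auto)
  then show ?thesis by (rule that)
qed

section \<open>Reflection and the fractional Laplacian\<close>

lemma lborel_distr_uminus_euclidean: "distr lborel borel uminus = (lborel :: 'a::euclidean_space measure)"
  by (subst lborel_affine[of "-1" 0]) (auto simp: density_1 one_ennreal_def[symmetric])

lemma AE_lborel_uminus:
  assumes "AE x::'a::euclidean_space in lborel. Q x" shows "AE x in lborel. Q (- x)"
proof -
  have "AE x in distr lborel borel uminus. Q x"
    using assms unfolding lborel_distr_uminus_euclidean .
  then show ?thesis by (rule AE_distrD[rotated]) simp
qed

lemma L2_uminus_arg: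
  assumes "f \<in> L2" shows "(\<lambda>x. f (- x)) \<in> L2"
proof -
  have [measurable]: "f \<in> borel_measurable borel" using assms by simp
  have "integrable lborel (\<lambda>x. (cmod (f (0 + (-1) *\<^sub>R x)))\<^sup>2)"
    by (subst integrable_affine) (use L2_integrable[OF assms] in auto)
  then show ?thesis by (intro L2I) auto
qed

definition refl_op :: "'a::euclidean_space ltwo \<Rightarrow> 'a ltwo" where
  "refl_op f = abs_ltwo (\<lambda>x. rep_ltwo f (- x))"

lemma rep_refl: "AE x in lborel. rep_ltwo (refl_op f) x = rep_ltwo f (- x)"
  unfolding refl_op_def by (rule rep_abs) (simp add: L2_uminus_arg)

lemma refl_abs: "f \<in> L2 \<Longrightarrow> refl_op (abs_ltwo f) = abs_ltwo (\<lambda>x. f (- x))"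
  unfolding refl_op_def using AE_lborel_uminus[OF rep_abs[of f]]
  by (subst abs_eq_iff) (auto simp: L2_uminus_arg)

lemma norm_refl [simp]: "norm (refl_op f) = norm f"
proof -
  have "L2_norm (\<lambda>x. rep_ltwo f (- x)) = L2_norm (rep_ltwo f)"
    using integral_affine[of "\<lambda>x. (cmod (rep_ltwo f x))\<^sup>2" "-1" 0] by (simp add: L2_norm_def)
  then show ?thesis
    unfolding refl_op_def by (simp add: norm_abs L2_uminus_arg norm_ltwo_L2_norm[of f])
qed

lemma bounded_linear_refl: "bounded_linear refl_op"
proof (rule bounded_linear_intro[of _ 1])
  fix f g :: "'a ltwo" and a :: real
  show "refl_op (f + g) = refl_op f + refl_op g"
    by (rule ltwo_eqI) (use rep_refl[of f] rep_refl[of g] rep_refl[of "f + g"]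
      AE_lborel_uminus[OF rep_add[of f g]] rep_add[of "refl_op f" "refl_op g"] in \<open>eventually_elim, simp\<close>)
  show "refl_op (a *\<^sub>R f) = a *\<^sub>R refl_op f"
    by (rule ltwo_eqI) (use rep_refl[of f] rep_refl[of "a *\<^sub>R f"]
      AE_lborel_uminus[OF rep_scaleR[of a f]] rep_scaleR[of a "refl_op f"] in \<open>eventually_elim, simp\<close>)
qed simp

lemma refl_wmult:
  assumes w: "w \<in> borel_measurable borel" and even: "\<And>\<xi>. w (- \<xi>) = w \<xi>" and dom: "in_dom w f"
  shows "in_dom w (refl_op f)" "wmult w (refl_op f) = refl_op (wmult w f)"
proof -
  have "AE \<xi> in lborel. rep_ltwo (refl_op (wmult w f)) \<xi> = of_real (w \<xi>) * rep_ltwo (refl_op f) \<xi>"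
    using rep_refl[of f] rep_refl[of "wmult w f"] AE_lborel_uminus[OF rep_wmult[OF dom]]
    by eventually_elim (simp add: even)
  note c = in_dom_cong_AE[OF w rep_L2 this]
  show "in_dom w (refl_op f)" by (rule c)
  show "wmult w (refl_op f) = refl_op (wmult w f)" using c(2) by simp
qed

lemma cnj_fourier: "cnj (fourier f \<xi>) = fourier (\<lambda>x. cnj (f x)) (- \<xi>)"
proof -
  have "cnj (LINT x|lborel. cis (- (x \<bullet> \<xi>)) * f x) = (LINT x|lborel. cnj (cis (- (x \<bullet> \<xi>)) * f x))"
    by (rule Bochner_Integration.integral_cnj[symmetric])
  also have "\<dots> = (LINT x|lborel. cis (- (x \<bullet> - \<xi>)) * cnj (f x))"
    by (rule Bochner_Integration.integral_cong) (auto simp: cis_cnj)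
  finally show ?thesis by (simp add: fourier_def)
qed

lemma FTi_abs:
  assumes "integrable lborel f" "f \<in> L2"
  shows "FTi (abs_ltwo f) = abs_ltwo (\<lambda>\<xi>. fourier f (- \<xi>))"
proof -
  have i: "integrable lborel (\<lambda>x. cnj (f x))" "(\<lambda>x. cnj (f x)) \<in> L2"
    using assms by (auto simp: L2_cnj)
  show ?thesis
    unfolding FTi_def using FT_abs[OF i] plancherel_L1_L2(1)[OF i]
    by (simp add: conj_abs assms cnj_fourier)
qed

text \<open>Both sides are given by integrals on truncations, where they differ by the sign in the character.\<close>

lemma FT_eq_refl_FTi: "FT f = refl_op (FTi f)"
proof (rule tendsto_unique[OF trivial_limit_at_top_linorder])
  let ?T = "\<lambda>R. abs_ltwo (trunc R (rep_ltwo f))"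
  show "((\<lambda>R. FT (?T R)) \<longlongrightarrow> FT f) at_top"
    by (rule bounded_linear.tendsto[OF bounded_linear_FT trunc_abs_tendsto])
  have "FT (?T R) = refl_op (FTi (?T R))" for R
  proof -
    have t: "integrable lborel (trunc R (rep_ltwo f))" "trunc R (rep_ltwo f) \<in> L2"
      by (simp_all add: trunc_integrable trunc_L2)
    show ?thesis
      using L2_uminus_arg[OF plancherel_L1_L2(1)[OF t]] by (simp add: FT_abs[OF t] FTi_abs[OF t] refl_abs)
  qed
  then show "((\<lambda>R. FT (?T R)) \<longlongrightarrow> refl_op (FTi f)) at_top"
    by (simp add: bounded_linear.tendsto[OF bounded_linear_refl] bounded_linear.tendsto[OF bounded_linear_FTi trunc_abs_tendsto])
qed

text \<open>Complex conjugation of \<open>f\<close> conjugates and reflects its transform, so real even multipliers commute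
  with it.\<close>

lemma conj_even_multiplier:
  assumes w: "w \<in> borel_measurable borel" "\<And>\<xi>. w (- \<xi>) = w \<xi>" and dom: "in_dom w (FT f)"
    and g: "FT g = wmult w (FT f)"
  shows "in_dom w (FT (conj_op f))" "FT (conj_op g) = wmult w (FT (conj_op f))"
proof -
  have cw: "in_dom w (conj_op (FT f))" "conj_op (wmult w (FT f)) = wmult w (conj_op (FT f))"
  proof -
    have "AE \<xi> in lborel. rep_ltwo (conj_op (wmult w (FT f))) \<xi> = of_real (w \<xi>) * rep_ltwo (conj_op (FT f)) \<xi>"
      using rep_conj[of "FT f"] rep_conj[of "wmult w (FT f)"] rep_wmult[OF dom]
      by eventually_elim simp
    note c = in_dom_cong_AE[OF w(1) rep_L2 this]
    show "in_dom w (conj_op (FT f))" by (rule c)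
    show "conj_op (wmult w (FT f)) = wmult w (conj_op (FT f))" using c(2) by simp
  qed
  have R: "FT (conj_op h) = refl_op (conj_op (FT h))" for h :: "'a ltwo"
    unfolding FT_eq_refl_FTi[of "conj_op h"] FTi_def by simp
  show "in_dom w (FT (conj_op f))" "FT (conj_op g) = wmult w (FT (conj_op f))"
    unfolding R g cw(2) using refl_wmult[OF w cw(1)] by simp_all
qed

definition lapsym :: "real \<Rightarrow> 'a::euclidean_space \<Rightarrow> real" where
  "lapsym r \<xi> = norm \<xi> powr (2 * r)"

lemma lapsym_measurable [measurable]: "lapsym r \<in> borel_measurable borel"
  unfolding lapsym_def[abs_def] by measurable

lemma lapsym_even: "lapsym r (- \<xi>) = lapsym r \<xi>"
  by (simp add: lapsym_def)

lemma lapsym_nonneg: "0 \<le> lapsym r \<xi>"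
  by (simp add: lapsym_def)

lemma sqrt_lapsym: "sqrt (lapsym s \<xi>) = lapsym (s / 2) \<xi>"
  by (simp add: lapsym_def powr_half_sqrt[symmetric] powr_powr)

lemma has_frac_laplacian_iff:
  "has_frac_laplacian r f h \<longleftrightarrow> f \<in> L2 \<and> h \<in> L2 \<and> in_dom (lapsym r) (FT (abs_ltwo f)) \<and>
     FT (abs_ltwo h) = wmult (lapsym r) (FT (abs_ltwo f))"
proof
  assume "has_frac_laplacian r f h"
  then obtain F H where *: "f \<in> L2" "F \<in> L2" "FT (abs_ltwo f) = abs_ltwo F" "h \<in> L2" "H \<in> L2" "FT (abs_ltwo h) = abs_ltwo H"
    and ae: "AE \<xi> in lborel. H \<xi> = of_real (lapsym r \<xi>) * F \<xi>"
    unfolding has_frac_laplacian_def has_fourier_multiplier_def has_L2_fourier_iff lapsym_def by blast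
  have "AE \<xi> in lborel. H \<xi> = of_real (lapsym r \<xi>) * rep_ltwo (FT (abs_ltwo f)) \<xi>"
    unfolding *(3) using ae rep_abs[OF *(2)] by eventually_elim simp
  note c = in_dom_cong_AE[OF lapsym_measurable *(5) this]
  then show "f \<in> L2 \<and> h \<in> L2 \<and> in_dom (lapsym r) (FT (abs_ltwo f)) \<and>
     FT (abs_ltwo h) = wmult (lapsym r) (FT (abs_ltwo f))"
    using * by simp
next
  assume *: "f \<in> L2 \<and> h \<in> L2 \<and> in_dom (lapsym r) (FT (abs_ltwo f)) \<and>
     FT (abs_ltwo h) = wmult (lapsym r) (FT (abs_ltwo f))"
  then show "has_frac_laplacian r f h"
    unfolding has_frac_laplacian_def has_fourier_multiplier_def has_L2_fourier_iff lapsym_def[symmetric]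
    by (intro exI[of _ "rep_ltwo (FT (abs_ltwo f))"] exI[of _ "rep_ltwo (FT (abs_ltwo h))"])
       (auto simp: rep_wmult)
qed

text \<open>\<open>frac_laplacian\<close> is a choice, but on the domain of the multiplier a class with the required
  transform exists and is unique.\<close>

lemma frac_laplacian:
  assumes "f \<in> L2" "in_dom (lapsym r) (FT (abs_ltwo f))"
  shows "frac_laplacian r f \<in> L2" "FT (abs_ltwo (frac_laplacian r f)) = wmult (lapsym r) (FT (abs_ltwo f))"
proof -
  have "has_frac_laplacian r f (rep_ltwo (FTi (wmult (lapsym r) (FT (abs_ltwo f)))))"
    using assms by (simp add: has_frac_laplacian_iff)
  then have "has_frac_laplacian r f (frac_laplacian r f)"
    unfolding frac_laplacian_def by (rule someI[of "has_frac_laplacian r f"])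
  then show "frac_laplacian r f \<in> L2" "FT (abs_ltwo (frac_laplacian r f)) = wmult (lapsym r) (FT (abs_ltwo f))"
    by (auto simp: has_frac_laplacian_iff)
qed

lemma sobolev_iff: "u \<in> sobolev s \<longleftrightarrow> u \<in> L2 \<and> in_dom (lapsym (s / 2)) (FT (abs_ltwo u))"
proof
  assume *: "u \<in> L2 \<and> in_dom (lapsym (s / 2)) (FT (abs_ltwo u))"
  then have "has_frac_laplacian (s / 2) u (frac_laplacian (s / 2) u)"
    by (simp add: has_frac_laplacian_iff frac_laplacian)
  then show "u \<in> sobolev s" using * by (auto simp: sobolev_def)
qed (auto simp: sobolev_def has_frac_laplacian_iff)

lemma sobolev_norm_eq:
  assumes "u \<in> sobolev s"
  shows "sobolev_norm s u = norm (FT (abs_ltwo u)) + norm (wmult (lapsym (s / 2)) (FT (abs_ltwo u)))"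
proof -
  have u: "u \<in> L2" "in_dom (lapsym (s / 2)) (FT (abs_ltwo u))" using assms by (auto simp: sobolev_iff)
  show ?thesis
    unfolding sobolev_norm_def using frac_laplacian[OF u] norm_FT[of "abs_ltwo (frac_laplacian (s/2) u)"]
    by (simp add: norm_abs u)
qed

lemma sobolev_diff:
  assumes "u \<in> sobolev s" "v \<in> sobolev s"
  shows "(\<lambda>x. u x - v x) \<in> sobolev s"
    and "FT (abs_ltwo (\<lambda>x. u x - v x)) = FT (abs_ltwo u) - FT (abs_ltwo v)"
proof -
  have uv: "u \<in> L2" "v \<in> L2" "in_dom (lapsym (s / 2)) (FT (abs_ltwo u))" "in_dom (lapsym (s / 2)) (FT (abs_ltwo v))"
    using assms by (auto simp: sobolev_iff)
  show eq: "FT (abs_ltwo (\<lambda>x. u x - v x)) = FT (abs_ltwo u) - FT (abs_ltwo v)"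
    using linear_diff[OF bounded_linear.linear[OF bounded_linear_FT], of "abs_ltwo u" "abs_ltwo v"]
    by (simp add: abs_diff uv)
  show "(\<lambda>x. u x - v x) \<in> sobolev s"
    unfolding sobolev_iff eq using uv by (auto intro: L2_diff in_dom_diff)
qed

lemma continuous_sobolev_imp_continuous:
  assumes "continuous_sobolev T s u"
  shows "continuous_on {0..T} (\<lambda>t. FT (abs_ltwo (u t)))"
  unfolding continuous_on
proof
  fix t0 assume t0: "t0 \<in> {0..T}"
  have u: "\<And>t. t \<in> {0..T} \<Longrightarrow> u t \<in> sobolev s"
    and lim: "((\<lambda>t. sobolev_norm s (\<lambda>x. u t x - u t0 x)) \<longlongrightarrow> 0) (at t0 within {0..T})"
    using assms t0 by (auto simp: continuous_sobolev_def)
  have "((\<lambda>t. norm (FT (abs_ltwo (u t)) - FT (abs_ltwo (u t0)))) \<longlongrightarrow> 0) (at t0 within {0..T})"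
  proof (rule tendsto_sandwich[OF _ _ tendsto_const lim])
    have "norm (FT (abs_ltwo (u t)) - FT (abs_ltwo (u t0))) \<le> sobolev_norm s (\<lambda>x. u t x - u t0 x)" if "t \<in> {0..T}" for t
      using sobolev_diff[OF u[OF that] u[OF t0]] by (simp add: sobolev_norm_eq)
    then show "\<forall>\<^sub>F t in at t0 within {0..T}. norm (FT (abs_ltwo (u t)) - FT (abs_ltwo (u t0))) \<le> sobolev_norm s (\<lambda>x. u t x - u t0 x)"
      by (auto simp: eventually_at_filter)
  qed auto
  then show "((\<lambda>t. FT (abs_ltwo (u t))) \<longlongrightarrow> FT (abs_ltwo (u t0))) (at t0 within {0..T})"
    using LIM_zero_iff tendsto_norm_zero_iff by blast
qed

lemma continuous_sobolevI:
  assumes u: "\<And>t. t \<in> {0..T} \<Longrightarrow> u t \<in> sobolev s"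
    and c: "continuous_on {0..T} (\<lambda>t. FT (abs_ltwo (u t)))"
    and d: "continuous_on {0..T} (\<lambda>t. wmult (lapsym (s / 2)) (FT (abs_ltwo (u t))))"
  shows "continuous_sobolev T s u"
  unfolding continuous_sobolev_def
proof (intro conjI ballI u)
  fix t0 assume t0: "t0 \<in> {0..T}"
  let ?W = "wmult (lapsym (s / 2))" and ?F = "\<lambda>t. FT (abs_ltwo (u t))"
  have "((\<lambda>t. norm (?F t - ?F t0) + norm (?W (?F t) - ?W (?F t0))) \<longlongrightarrow>
      norm (?F t0 - ?F t0) + norm (?W (?F t0) - ?W (?F t0))) (at t0 within {0..T})"
    using c d t0 by (intro tendsto_intros) (auto simp: continuous_on)
  then have "((\<lambda>t. norm (?F t - ?F t0) + norm (?W (?F t) - ?W (?F t0))) \<longlongrightarrow> 0) (at t0 within {0..T})" by simp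
  then show "((\<lambda>t. sobolev_norm s (\<lambda>x. u t x - u t0 x)) \<longlongrightarrow> 0) (at t0 within {0..T})"
  proof (rule Lim_transform_eventually)
    have "norm (?F t - ?F t0) + norm (?W (?F t) - ?W (?F t0)) = sobolev_norm s (\<lambda>x. u t x - u t0 x)"
      if "t \<in> {0..T}" for t
    proof -
      have "?W (?F t - ?F t0) = ?W (?F t) - ?W (?F t0)"
        by (rule in_dom_diff(2)) (use u[OF that] u[OF t0] in \<open>auto simp: sobolev_iff\<close>)
      then show ?thesis
        unfolding sobolev_norm_eq[OF sobolev_diff(1)[OF u[OF that] u[OF t0]]]
          sobolev_diff(2)[OF u[OF that] u[OF t0]] by simp
    qed
    then show "\<forall>\<^sub>F t in at t0 within {0..T}. norm (?F t - ?F t0) + norm (?W (?F t) - ?W (?F t0)) = sobolev_norm s (\<lambda>x. u t x - u t0 x)"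
      by (auto simp: eventually_at_filter)
  qed
qed

subsection \<open>The potential on the Fourier side\<close>

text \<open>The potential conjugated to the Fourier side, where it is no longer local but still bounded and
  self-adjoint.\<close>

definition Vop :: "('a::euclidean_space \<Rightarrow> real) \<Rightarrow> 'a ltwo \<Rightarrow> 'a ltwo" where
  "Vop p f = FT (wmult p (FTi f))"

lemma potential_Vop:
  assumes p: "ess_bounded (\<lambda>x. complex_of_real (p x))" shows "potential (Vop p)"
  unfolding potential_def
proof (intro conjI allI)
  show "bounded_linear (Vop p)"
    unfolding Vop_def by (intro bounded_linear_compose[OF bounded_linear_FT]
        bounded_linear_compose[OF bounded_linear_mult[OF p]] bounded_linear_FTi)
  show "inner (Vop p f) g = inner f (Vop p g)" for f g
  proof -
    have "inner (Vop p f) g = inner (wmult p (FTi f)) (FTi g)" by (simp add: Vop_def inner_FT)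
    also have "\<dots> = inner (FTi f) (wmult p (FTi g))" by (rule inner_mult_real[OF p])
    also have "\<dots> = inner f (Vop p g)"
      using inner_FT_FT[of "FTi f" "wmult p (FTi g)"] by (simp add: Vop_def)
    finally show ?thesis .
  qed
  show "Vop p (mult_i f) = mult_i (Vop p f)" for f
  proof -
    have "FTi (mult_i f) = mult_i (FTi f)"
      using FT_cmult[of \<i> "FTi f"] FTi_FT[of "mult_i (FTi f)"] by simp
    then show ?thesis
      unfolding Vop_def by (simp add: mult_commute[OF p] FT_cmult)
  qed
qed

lemma norm_Vop_le:
  assumes "ess_bounded (\<lambda>x. complex_of_real (p x))" "AE x in lborel. \<bar>p x\<bar> \<le> C" "0 \<le> C"
  shows "norm (Vop p f) \<le> C * norm f"
  unfolding Vop_def using norm_mult_le[OF assms(1), of C "FTi f"] assms(2,3) by simp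

lemma Linfty_ess_bounded: "p \<in> Linfty \<Longrightarrow> ess_bounded (\<lambda>x. complex_of_real (p x))"
  unfolding Linfty_def ess_bounded_def by auto

section \<open>Functions with a weak derivative in time\<close>

lemma has_real_derivative_imp_dirderiv:
  assumes "(\<theta> has_real_derivative g) (at t)" shows "dirderiv 1 \<theta> t = g"
  using frechet_derivative_at[of \<theta> "\<lambda>h. g * h" t] assms
  unfolding dirderiv_def has_field_derivative_def by (metis mult.right_neutral)

text \<open>The vanishing integral is what makes the antiderivative vanish again to the right of the support.\<close>

lemma antiderivative_test_function:
  fixes g :: "real \<Rightarrow> real"
  assumes g: "\<And>k. Ck k g" and \<alpha>\<beta>: "0 < \<alpha>" "\<alpha> \<le> \<beta>" "\<beta> < T"
    and supp: "\<And>t. t \<le> \<alpha> \<or> \<beta> \<le> t \<Longrightarrow> g t = 0" and int: "integral {0..T} g = 0"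
  obtains \<theta> where "test_function {0<..<T} \<theta>" "\<And>t. (\<theta> has_real_derivative g t) (at t)"
proof -
  have g_cont: "continuous_on S g" for S using g[of 0] continuous_on_subset by auto
  have g_int: "g integrable_on {a..b}" for a b by (intro integrable_continuous_real g_cont)
  define \<theta> where "\<theta> t = integral {0..t} g" for t
  have left: "\<theta> t = 0" if "t \<le> \<alpha>" for t
    unfolding \<theta>_def
    by (subst Henstock_Kurzweil_Integration.integral_cong[of _ g "\<lambda>_. 0"]) (use that supp in auto)
  have right: "\<theta> t = 0" if "\<beta> \<le> t" for t
  proof -
    have split: "integral {0..r} g = integral {0..\<beta>} g" if "\<beta> \<le> r" for r
    proof -
      have "integral {\<beta>..r} g = 0"
        by (subst Henstock_Kurzweil_Integration.integral_cong[of _ g "\<lambda>_. 0"]) (use supp in auto)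
      then show ?thesis
        using Henstock_Kurzweil_Integration.integral_combine[of 0 \<beta> r g] that \<alpha>\<beta> g_int by simp
    qed
    show ?thesis using split[of t] split[of T] int that \<alpha>\<beta> by (simp add: \<theta>_def)
  qed
  have deriv: "(\<theta> has_real_derivative g t) (at t)" for t
  proof (cases "0 < t")
    case True
    have "(\<theta> has_real_derivative g t) (at t within {0..t + 1})"
      using integral_has_real_derivative[of 0 "t + 1" g t] g_cont True unfolding \<theta>_def by auto
    then show ?thesis
      using True by (simp add: at_within_Icc_at)
  next
    case False
    have "((\<lambda>_. 0) has_real_derivative 0) (at t)" by simp
    then have "(\<theta> has_real_derivative 0) (at t)"
      by (rule has_field_derivative_transform_within_open[of _ _ _ "{..<\<alpha>}"])
         (use left False \<alpha>\<beta> in auto)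
    then show ?thesis using supp[of t] False \<alpha>\<beta> by simp
  qed
  have Suc: "Ck (Suc k) \<theta>" for k
  proof (rule Ck_SucI)
    show "(\<theta> has_derivative (\<lambda>v. v * g t)) (at t)" for t
      using deriv[of t] by (simp add: has_field_derivative_def mult_commute_abs)
    show "Ck k (\<lambda>t. v * g t)" for v
      by (rule Ck_linear[OF bounded_linear_mult_right g])
  qed
  have "Ck k \<theta>" for k by (rule Ck_SucD[OF Suc])
  then have "test_function {0<..<T} \<theta>"
    by (rule test_functionI_subset[of _ "{\<alpha>..\<beta>}"]) (use left right \<alpha>\<beta> in force)+
  then show ?thesis using deriv by (rule that)
qed

text \<open>The restriction of a mollifier to a line through a point where it is positive is a bump.\<close>

lemma bump_exists:
  fixes \<psi> :: "'a::euclidean_space \<Rightarrow> real"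
  assumes \<psi>: "friedrichs_mollifier \<psi>" and "0 < \<delta>"
  shows "\<exists>\<rho> :: real \<Rightarrow> real. (\<forall>k. Ck k \<rho>) \<and> (\<forall>t. 0 \<le> \<rho> t) \<and> 0 < \<rho> t0 \<and> (\<forall>t. \<delta> \<le> \<bar>t - t0\<bar> \<longrightarrow> \<rho> t = 0)"
proof -
  have tf: "test_function UNIV \<psi>" and nn: "\<And>x. 0 \<le> \<psi> x" and one: "(LINT x|lborel. \<psi> x) = 1"
    using \<psi> by (auto simp: friedrichs_mollifier_def)
  have "\<exists>x0. \<psi> x0 \<noteq> 0"
  proof (rule ccontr)
    assume "\<not> (\<exists>x0. \<psi> x0 \<noteq> 0)"
    then have "(LINT x|lborel. \<psi> x) = (LINT (x::'a)|lborel. 0)" by simp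
    then show False using one by simp
  qed
  then obtain x0 where x0: "0 < \<psi> x0" using nn by (metis order_le_less)
  obtain R where R: "0 \<le> R" "\<And>x. norm x > R \<Longrightarrow> \<psi> x = 0"
    using test_function_vanishes[OF tf] by blast
  obtain b :: 'a where b: "norm b = 1" using norm_Basis nonempty_Basis by blast
  \<comment> \<open>With this dilation a distance \<open>\<delta>\<close> from \<open>t0\<close> corresponds to a displacement from \<open>x0\<close> that leaves the
    support ball of radius \<open>R\<close>.\<close>
  define l where "l = (R + norm x0 + 1) / \<delta>"
  have l: "0 < l" using R \<open>0 < \<delta>\<close> by (auto simp: l_def intro!: divide_pos_pos add_nonneg_pos)
  define \<rho> where "\<rho> t = \<psi> ((x0 - (t0 * l) *\<^sub>R b) + (t * l) *\<^sub>R b)" for t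
  have \<rho>_eq: "\<rho> t = \<psi> (x0 + ((t - t0) * l) *\<^sub>R b)" for t
    by (simp add: \<rho>_def algebra_simps)
  show ?thesis
  proof (intro exI[of _ \<rho>] conjI allI impI)
    have "bounded_linear (\<lambda>t::real. (t * l) *\<^sub>R b)"
      by (intro bounded_linear_scaleR_const bounded_linear_mult_const bounded_linear_ident)
    from Ck_comp_affine[OF this test_function_Ck[OF tf]] show "Ck k \<rho>" for k
      unfolding \<rho>_def .
    show "0 \<le> \<rho> t" for t by (simp add: \<rho>_def nn)
    show "0 < \<rho> t0" by (simp add: \<rho>_eq x0)
    show "\<rho> t = 0" if "\<delta> \<le> \<bar>t - t0\<bar>" for t
    proof -
      have "R + norm x0 + 1 = \<delta> * l" using \<open>0 < \<delta>\<close> by (simp add: l_def)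
      also have "\<dots> \<le> \<bar>t - t0\<bar> * l" using that l by (intro mult_right_mono) auto
      also have "\<dots> = norm (((t - t0) * l) *\<^sub>R b)" using l b by (simp add: abs_mult)
      finally have "R + norm x0 + 1 \<le> norm (((t - t0) * l) *\<^sub>R b)" .
      then have "R < norm (x0 + ((t - t0) * l) *\<^sub>R b)"
        using norm_diff_ineq[of "((t - t0) * l) *\<^sub>R b" x0] by (simp add: add.commute)
      then show ?thesis by (simp add: \<rho>_eq R)
    qed
  qed
qed

lemma bump_average:
  fixes c \<rho> :: "real \<Rightarrow> real"
  assumes c: "continuous_on {0..T} c" and \<rho>: "continuous_on {0..T} \<rho>" "\<And>t. 0 \<le> \<rho> t"
    and K: "0 < integral {0..T} \<rho>"
    and near: "\<And>t. t \<in> {0..T} \<Longrightarrow> \<rho> t \<noteq> 0 \<Longrightarrow> \<bar>c t - c0\<bar> \<le> e"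
  shows "\<bar>integral {0..T} (\<lambda>t. \<rho> t / integral {0..T} \<rho> * c t) - c0\<bar> \<le> e"
proof -
  let ?K = "integral {0..T} \<rho>"
  have "integral {0..T} (\<lambda>t. \<rho> t * (c t - c0)) = integral {0..T} (\<lambda>t. \<rho> t * c t - c0 * \<rho> t)"
    by (simp add: algebra_simps)
  also have "\<dots> = integral {0..T} (\<lambda>t. \<rho> t * c t) - c0 * ?K"
    by (subst Henstock_Kurzweil_Integration.integral_diff)
       (auto intro!: integrable_continuous_real continuous_on_mult continuous_on_const c \<rho>(1))
  finally have eq: "integral {0..T} (\<lambda>t. \<rho> t * (c t - c0)) = integral {0..T} (\<lambda>t. \<rho> t * c t) - c0 * ?K" .
  have "norm (integral {0..T} (\<lambda>t. \<rho> t * (c t - c0))) \<le> integral {0..T} (\<lambda>t. e * \<rho> t)"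
  proof (rule Henstock_Kurzweil_Integration.integral_norm_bound_integral)
    show "norm (\<rho> t * (c t - c0)) \<le> e * \<rho> t" if "t \<in> {0..T}" for t
      using near[OF that] \<rho>(2)[of t] by (cases "\<rho> t = 0") (auto simp: abs_mult mult.commute[of e] intro!: mult_left_mono)
  qed (intro integrable_continuous_real continuous_on_mult continuous_on_diff continuous_on_const c \<rho>(1))+
  then have "\<bar>integral {0..T} (\<lambda>t. \<rho> t * c t) - c0 * ?K\<bar> \<le> e * ?K"
    unfolding eq by simp
  moreover have "integral {0..T} (\<lambda>t. \<rho> t / ?K * c t) = integral {0..T} (\<lambda>t. \<rho> t * c t) / ?K"
    unfolding times_divide_eq_left by (rule Henstock_Kurzweil_Integration.integral_divide)
  ultimately show ?thesis using K by (simp add: abs_le_iff field_simps)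
qed

text \<open>Subtracting an antiderivative of \<open>b\<close> from \<open>a\<close> leaves a function \<open>c\<close> orthogonal to all derivatives of test
  functions. The difference of two normalised bumps is such a derivative, so the averages of \<open>c\<close> at any
  two points agree, and \<open>c\<close> is constant. The smooth bumps come from the mollifier \<open>\<psi>\<close>.\<close>

theorem du_bois_reymond:
  fixes \<psi> :: "'a::euclidean_space \<Rightarrow> real" and a b :: "real \<Rightarrow> real"
  assumes \<psi>: "friedrichs_mollifier \<psi>" and T: "0 < T"
    and a: "continuous_on {0..T} a" and b: "continuous_on {0..T} b"
    and weak: "\<And>\<theta>. test_function {0<..<T} \<theta> \<Longrightarrow> integral {0..T} (\<lambda>t. dirderiv 1 \<theta> t * a t + \<theta> t * b t) = 0"
    and t: "t \<in> {0..T}"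
  shows "a t - a 0 = integral {0..t} b"
proof -
  define B where "B t = integral {0..t} b" for t
  have dB: "(B has_real_derivative b t) (at t within {0..T})" if "t \<in> {0..T}" for t
    unfolding B_def by (rule integral_has_real_derivative[OF b that])
  have B: "continuous_on {0..T} B"
    by (rule DERIV_continuous_on[OF dB])
  define c where "c t = a t - B t" for t
  have c: "continuous_on {0..T} c" unfolding c_def by (intro continuous_intros a B)
  have c0: "integral {0..T} (\<lambda>t. g t * c t) = 0"
    if \<theta>: "test_function {0<..<T} \<theta>" "\<And>t. (\<theta> has_real_derivative g t) (at t)" "continuous_on {0..T} g" for \<theta> g
  proof -
    have \<theta>c: "continuous_on {0..T} \<theta>"
      using test_function_continuous[OF \<theta>(1)] continuous_on_subset by blast
    have out: "\<theta> t = 0" if "t \<notin> {0<..<T}" for t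
    proof (rule ccontr)
      assume "\<theta> t \<noteq> 0"
      then have "t \<in> closure {x. \<theta> x \<noteq> 0}" using closure_subset[of "{x. \<theta> x \<noteq> 0}"] by auto
      then show False using \<theta>(1) that by (auto simp: test_function_def)
    qed
    have "((\<lambda>t. \<theta> t * b t + g t * B t) has_integral (\<theta> T * B T - \<theta> 0 * B 0)) {0..T}"
    proof (rule fundamental_theorem_of_calculus)
      show "((\<lambda>t. \<theta> t * B t) has_vector_derivative \<theta> t * b t + g t * B t) (at t within {0..T})" if "t \<in> {0..T}" for t
        using DERIV_mult[OF has_field_derivative_at_within[OF \<theta>(2)] dB[OF that]]
        by (simp add: has_real_derivative_iff_has_vector_derivative algebra_simps)
    qed (use T in auto)
    then have 1: "integral {0..T} (\<lambda>t. \<theta> t * b t + g t * B t) = 0"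
      by (simp add: integral_unique out)
    have "integral {0..T} (\<lambda>t. g t * a t + \<theta> t * b t) = 0"
      using weak[OF \<theta>(1)] has_real_derivative_imp_dirderiv[OF \<theta>(2)] by simp
    then have "integral {0..T} (\<lambda>t. (g t * a t + \<theta> t * b t) - (\<theta> t * b t + g t * B t)) = 0 - 0"
      using 1 by (subst Henstock_Kurzweil_Integration.integral_diff)
        (auto intro!: integrable_continuous_real continuous_intros a b B \<theta>c \<theta>(3))
    moreover have "(\<lambda>t. (g t * a t + \<theta> t * b t) - (\<theta> t * b t + g t * B t)) = (\<lambda>t. g t * c t)"
      by (simp add: c_def algebra_simps)
    ultimately show ?thesis by simp
  qed
  have inner_const: "c t1 = c t2" if t1: "t1 \<in> {0<..<T}" and t2: "t2 \<in> {0<..<T}" for t1 t2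
  proof -
    have "\<bar>c t1 - c t2\<bar> \<le> 2 * e" if e: "0 < e" for e
    proof -
      define Q where "Q s \<rho> \<alpha> \<beta> \<longleftrightarrow> (\<forall>k. Ck k \<rho>) \<and> 0 < \<alpha> \<and> \<alpha> \<le> \<beta> \<and> \<beta> < T \<and> (\<forall>t. t \<le> \<alpha> \<or> \<beta> \<le> t \<longrightarrow> \<rho> t = 0) \<and>
          integral {0..T} \<rho> = 1 \<and> \<bar>integral {0..T} (\<lambda>t. \<rho> t * c t) - c s\<bar> \<le> e" for s \<rho> \<alpha> \<beta>
      have Q: "\<exists>\<rho> \<alpha> \<beta>. Q s \<rho> \<alpha> \<beta>" if s: "s \<in> {0<..<T}" for s
      proof -
        have "s \<in> {0..T}" using s by auto
        then obtain d where d: "0 < d" "\<And>t. t \<in> {0..T} \<Longrightarrow> dist t s < d \<Longrightarrow> dist (c t) (c s) < e"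
          using c e unfolding continuous_on_iff by blast
        define \<delta> where "\<delta> = min d (min (s / 2) ((T - s) / 2))"
        have \<delta>: "0 < \<delta>" "\<delta> \<le> d" "\<delta> \<le> s / 2" "\<delta> \<le> (T - s) / 2" using d(1) s by (auto simp: \<delta>_def min_def)
        obtain \<rho> :: "real \<Rightarrow> real" where \<rho>': "\<forall>k. Ck k \<rho>" "\<forall>t. 0 \<le> \<rho> t" "0 < \<rho> s" "\<forall>t. \<delta> \<le> \<bar>t - s\<bar> \<longrightarrow> \<rho> t = 0"
          using bump_exists[OF \<psi> \<delta>(1), of s] by blast
        note \<rho> = \<rho>'[rule_format]
        have \<rho>c: "continuous_on {0..T} \<rho>" using \<rho>(1)[of 0] continuous_on_subset by auto
        have nz: "integral {0..T} \<rho> \<noteq> 0"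
        proof
          assume "integral {0..T} \<rho> = 0"
          then have "(\<rho> has_integral 0) {0..T}"
            using integrable_integral[OF integrable_continuous_real[OF \<rho>c]] by simp
          then have "\<rho> s = 0"
            using has_integral_0_cbox_imp_0[of 0 T \<rho> s] \<rho>c \<rho>(2) T s by (simp add: cbox_interval)
          then show False using \<rho>(3) by simp
        qed
        moreover have "0 \<le> integral {0..T} \<rho>"
          by (rule Henstock_Kurzweil_Integration.integral_nonneg[OF integrable_continuous_real[OF \<rho>c]]) (rule \<rho>(2))
        ultimately have K: "0 < integral {0..T} \<rho>" by simp
        show ?thesis
          unfolding Q_def
        proof (rule exI[of _ "\<lambda>t. \<rho> t / integral {0..T} \<rho>"], rule exI[of _ "s - \<delta>"], rule exI[of _ "s + \<delta>"],
            intro conjI allI impI)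
          show "Ck k (\<lambda>t. \<rho> t / integral {0..T} \<rho>)" for k
            by (rule Ck_linear[OF bounded_linear_divide \<rho>(1)])
          show "\<rho> t / integral {0..T} \<rho> = 0" if "t \<le> s - \<delta> \<or> s + \<delta> \<le> t" for t
            using \<rho>(4)[of t] that by auto
          show "integral {0..T} (\<lambda>t. \<rho> t / integral {0..T} \<rho>) = 1" using K by simp
          show "\<bar>integral {0..T} (\<lambda>t. \<rho> t / integral {0..T} \<rho> * c t) - c s\<bar> \<le> e"
          proof (rule bump_average[OF c \<rho>c \<rho>(2) K])
            show "\<bar>c t - c s\<bar> \<le> e" if "t \<in> {0..T}" "\<rho> t \<noteq> 0" for t
              using d(2)[OF that(1)] \<rho>(4)[of t] that(2) \<delta>(2) by (force simp: dist_real_def)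
          qed
        qed (use \<delta> s in \<open>auto simp: field_simps\<close>)
      qed
      from Q[OF t1] Q[OF t2] obtain \<rho>1 \<alpha>1 \<beta>1 \<rho>2 \<alpha>2 \<beta>2 where Q1: "Q t1 \<rho>1 \<alpha>1 \<beta>1" and Q2: "Q t2 \<rho>2 \<alpha>2 \<beta>2"
        by blast
      have 1: "\<forall>k. Ck k \<rho>1" "0 < \<alpha>1" "\<alpha>1 \<le> \<beta>1" "\<beta>1 < T" "\<And>t. t \<le> \<alpha>1 \<or> \<beta>1 \<le> t \<Longrightarrow> \<rho>1 t = 0"
          "integral {0..T} \<rho>1 = 1" "\<bar>integral {0..T} (\<lambda>t. \<rho>1 t * c t) - c t1\<bar> \<le> e"
        using Q1 unfolding Q_def by blast+
      have 2: "\<forall>k. Ck k \<rho>2" "0 < \<alpha>2" "\<alpha>2 \<le> \<beta>2" "\<beta>2 < T" "\<And>t. t \<le> \<alpha>2 \<or> \<beta>2 \<le> t \<Longrightarrow> \<rho>2 t = 0"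
          "integral {0..T} \<rho>2 = 1" "\<bar>integral {0..T} (\<lambda>t. \<rho>2 t * c t) - c t2\<bar> \<le> e"
        using Q2 unfolding Q_def by blast+
      define g where "g t = \<rho>1 t + - 1 *\<^sub>R \<rho>2 t" for t
      have gCk: "Ck k g" for k
        unfolding g_def using 1(1) 2(1) by (intro Ck_add Ck_linear[OF bounded_linear_scaleR_right]) auto
      have cont: "continuous_on {0..T} \<rho>1" "continuous_on {0..T} \<rho>2" "continuous_on {0..T} g"
        using 1(1)[rule_format, of 0] 2(1)[rule_format, of 0] gCk[of 0] continuous_on_subset by auto
      have "integral {0..T} g = integral {0..T} \<rho>1 - integral {0..T} \<rho>2"
        unfolding g_def using cont by (simp add: Henstock_Kurzweil_Integration.integral_diff integrable_continuous_real)
      then have "integral {0..T} g = 0" using 1(6) 2(6) by simp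
      moreover have "g t = 0" if "t \<le> min \<alpha>1 \<alpha>2 \<or> max \<beta>1 \<beta>2 \<le> t" for t
        using that 1(5)[of t] 2(5)[of t] by (auto simp: g_def)
      ultimately obtain \<theta> where "test_function {0<..<T} \<theta>" "\<And>t. (\<theta> has_real_derivative g t) (at t)"
        using antiderivative_test_function[OF gCk, of "min \<alpha>1 \<alpha>2" "max \<beta>1 \<beta>2" T] 1 2 by (auto simp: min_le_iff_disj le_max_iff_disj)
      then have "integral {0..T} (\<lambda>t. g t * c t) = 0"
        by (rule c0) (rule cont)
      moreover have "(\<lambda>t. g t * c t) = (\<lambda>t. \<rho>1 t * c t - \<rho>2 t * c t)"
        by (simp add: g_def algebra_simps)
      ultimately have "integral {0..T} (\<lambda>t. \<rho>1 t * c t) = integral {0..T} (\<lambda>t. \<rho>2 t * c t)"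
        by (simp add: Henstock_Kurzweil_Integration.integral_diff integrable_continuous_real continuous_on_mult cont c)
      then show ?thesis using 1(7) 2(7) by (simp add: abs_le_iff)
    qed
    \<comment> \<open>For \<open>e = |c t1 - c t2| / 4\<close> the estimate says that a number is at most half of itself.\<close>
    from this[of "\<bar>c t1 - c t2\<bar> / 4"] show ?thesis by auto
  qed
  have "c s = c (T / 2)" if "s \<in> {0..T}" for s
  proof (rule continuous_constant_on_closure[where f = c and S = "{0<..<T}"])
    show "continuous_on (closure {0<..<T}) c" using c T by simp
    show "c x = c (T / 2)" if "x \<in> {0<..<T}" for x by (rule inner_const[OF that]) (use T in auto)
    show "s \<in> closure {0<..<T}" using that T by simp
  qed
  from this[OF t] this[of 0] T have "c t = c 0" by simp
  then show ?thesis by (simp add: c_def B_def)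
qed

section \<open>Distributional solutions on the Fourier side\<close>

lemma test_function_in_dom:
  fixes f :: "'a::euclidean_space \<Rightarrow> complex"
  assumes f: "test_function \<Omega> f" and s: "0 \<le> s" "2 * s \<le> real N"
  shows "in_dom (lapsym s) (FT (abs_ltwo f))"
    and "norm (wmult (lapsym s) (FT (abs_ltwo f))) \<le> L2_norm (\<lambda>\<xi>. complex_of_real (decay_majorant N f \<xi>))"
proof -
  have FT: "FT (abs_ltwo f) = abs_ltwo (fourier f)"
    by (rule FT_abs[OF test_function_integrable[OF f] test_function_L2[OF f]])
  have [measurable]: "fourier f \<in> borel_measurable borel"
    using fourier_test_function_L2[OF f] by simp
  let ?F = "\<lambda>\<xi>. complex_of_real (lapsym s \<xi>) * fourier f \<xi>"
  have le: "cmod (?F \<xi>) \<le> cmod (complex_of_real (decay_majorant N f \<xi>))" for \<xi>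
    using decay_majorant[OF f, of "2 * s" N \<xi>] s by (simp add: lapsym_def norm_mult)
  have F: "?F \<in> L2"
    by (rule L2_boundI[OF _ L2_integrable[OF decay_majorant_L2[OF f, of N]]])
       (use le in \<open>auto intro!: power_mono simp del: norm_of_real\<close>)
  have ae: "AE \<xi> in lborel. ?F \<xi> = of_real (lapsym s \<xi>) * rep_ltwo (FT (abs_ltwo f)) \<xi>"
    unfolding FT using rep_abs[OF fourier_test_function_L2[OF f]] by auto
  note c = in_dom_cong_AE[OF lapsym_measurable F ae]
  show "in_dom (lapsym s) (FT (abs_ltwo f))" by (rule c)
  have "norm (abs_ltwo ?F) \<le> norm (abs_ltwo (\<lambda>\<xi>. complex_of_real (decay_majorant N f \<xi>)))"
  proof (rule norm_mono_AE, use rep_abs[OF F] rep_abs[OF decay_majorant_L2[OF f, of N]] in eventually_elim)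
    case (elim \<xi>)
    then show ?case using le[of \<xi>] by simp
  qed
  then show "norm (wmult (lapsym s) (FT (abs_ltwo f))) \<le> L2_norm (\<lambda>\<xi>. complex_of_real (decay_majorant N f \<xi>))"
    unfolding c(2) by (simp add: norm_abs decay_majorant_L2[OF f])
qed

lemma test_function_cnj: "test_function \<Omega> f \<Longrightarrow> test_function \<Omega> (\<lambda>x. cnj (f x))"
  unfolding test_function_def by (auto intro: Ck_linear[OF bounded_linear_cnj])

lemma test_function_cmult: "test_function \<Omega> f \<Longrightarrow> test_function \<Omega> (\<lambda>x. c * f x)" for f :: "'a::euclidean_space \<Rightarrow> complex"
proof (rule test_functionI_subset[of _ "closure {x. f x \<noteq> 0}"])
  show "c * f x = 0" if "x \<notin> closure {x. f x \<noteq> 0}" for x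
    using that closure_subset[of "{x. f x \<noteq> 0}"] by fastforce
qed (auto simp: test_function_def intro: Ck_linear[OF bounded_linear_mult_right])

lemma test_function_slice:
  fixes \<phi> :: "real \<times> 'a::euclidean_space \<Rightarrow> 'b::real_normed_vector"
  assumes "test_function \<Omega> \<phi>" shows "test_function UNIV (\<lambda>x. \<phi> (t, x))"
proof -
  obtain R where R: "\<And>z. norm z > R \<Longrightarrow> \<phi> z = 0"
    using test_function_vanishes[OF assms] by blast
  show ?thesis
  proof (rule test_function_UNIV_I)
    have "bounded_linear (\<lambda>x::'a. (0::real, x))"
      by (intro bounded_linear_Pair bounded_linear_zero bounded_linear_ident)
    from Ck_comp_affine[OF this test_function_Ck[OF assms], of _ "(t, 0)"]
    show "Ck k (\<lambda>x. \<phi> (t, x))" for k by simp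
    show "\<phi> (t, x) = 0" if "norm x > R" for x
      by (rule R) (use that norm_snd_le[of x t] in linarith)
  qed
qed

lemma dirderiv_slice:
  fixes \<phi> :: "real \<times> 'a::euclidean_space \<Rightarrow> 'b::real_normed_vector"
  assumes "test_function \<Omega> \<phi>"
  shows "dirderiv b (\<lambda>x. \<phi> (t, x)) x = dirderiv (0, b) \<phi> (t, x)"
proof -
  have "((\<lambda>x::'a. (t, x)) has_derivative (\<lambda>v. (0, v))) (at x)"
    by (auto intro!: derivative_eq_intros)
  from has_derivative_compose[OF this has_derivative_dirderiv[OF test_function_differentiable[OF assms]]]
  have "((\<lambda>x. \<phi> (t, x)) has_derivative (\<lambda>v. dirderiv (0, v) \<phi> (t, x))) (at x)" .
  from frechet_derivative_at[OF this] show ?thesis unfolding dirderiv_def by metis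
qed

lemma dirderiv_slice_iterate:
  fixes \<phi> :: "real \<times> 'a::euclidean_space \<Rightarrow> 'b::real_normed_vector"
  assumes "test_function \<Omega> \<phi>"
  shows "(dirderiv b ^^ N) (\<lambda>x. \<phi> (t, x)) = (\<lambda>x. (dirderiv (0, b) ^^ N) \<phi> (t, x))"
  by (induction N) (auto simp: dirderiv_slice[OF test_function_iterate[OF assms]])

lemma has_vector_derivative_slice:
  fixes \<phi> :: "real \<times> 'a::euclidean_space \<Rightarrow> 'b::real_normed_vector"
  assumes "test_function \<Omega> \<phi>"
  shows "((\<lambda>\<tau>. \<phi> (\<tau>, x)) has_vector_derivative dirderiv (1, 0) \<phi> (t, x)) (at t within S)"
  using has_vector_derivative_line[OF test_function_differentiable[OF assms], where x = "(0, x)" and s = t and v = "(1, 0)" and S = S]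
  by simp

definition phi_hat :: "(real \<times> 'a::euclidean_space \<Rightarrow> complex) \<Rightarrow> real \<Rightarrow> 'a ltwo" where
  "phi_hat \<phi> t = FT (abs_ltwo (\<lambda>x. cnj (\<phi> (t, x))))"

text \<open>The transform of the conjugate of the transposed equation applied to \<open>\<phi>\<close>: conjugation turns the
  bilinear pairing of the distributional equation into an inner product.\<close>

definition adjoint_eq :: "real \<Rightarrow> ('a::euclidean_space \<Rightarrow> real) \<Rightarrow> (real \<times> 'a \<Rightarrow> complex) \<Rightarrow> real \<Rightarrow> 'a ltwo" where
  "adjoint_eq s p \<phi> t = mult_i (phi_hat (dirderiv (1, 0) \<phi>) t) + wmult (lapsym s) (phi_hat \<phi> t) + Vop p (phi_hat \<phi> t)"

lemma integral_eq_inner: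
  assumes u: "u \<in> L2" and w: "w \<in> L2"
  shows "(LINT x|lborel. u x * w x)
    = Complex (inner (abs_ltwo u) (conj_op (abs_ltwo w))) (inner (abs_ltwo u) (mult_i (conj_op (abs_ltwo w))))"
proof (rule complex_eqI)
  have c: "(\<lambda>x. cnj (w x)) \<in> L2" "(\<lambda>x. \<i> * cnj (w x)) \<in> L2" using w by (auto intro: L2_cnj L2_scale)
  show "Re (LINT x|lborel. u x * w x) = Re (Complex (inner (abs_ltwo u) (conj_op (abs_ltwo w))) (inner (abs_ltwo u) (mult_i (conj_op (abs_ltwo w)))))"
    by (simp add: conj_abs w inner_abs u c)
  have "inner (abs_ltwo u) (mult_i (conj_op (abs_ltwo w))) = Re (LINT x|lborel. u x * cnj (\<i> * cnj (w x)))"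
    by (simp add: conj_abs w mult_abs c inner_abs[OF u c(2)])
  also have "(\<lambda>x. u x * cnj (\<i> * cnj (w x))) = (\<lambda>x. - \<i> * (u x * w x))" by (simp add: fun_eq_iff)
  also have "Re (LINT x|lborel. - \<i> * (u x * w x)) = Re (- \<i> * (LINT x|lborel. u x * w x))"
    by (subst integral_mult_right_zero) simp
  finally show "Im (LINT x|lborel. u x * w x) = Im (Complex (inner (abs_ltwo u) (conj_op (abs_ltwo w))) (inner (abs_ltwo u) (mult_i (conj_op (abs_ltwo w)))))"
    by simp
qed

text \<open>Plancherel's identity carries the spatial integral to the Fourier side. The fractional Laplacian of
  the conjugate is the conjugate of the fractional Laplacian because the symbol is even.\<close>

lemma weak_form_integral:
  fixes \<phi> :: "real \<times> 'a::euclidean_space \<Rightarrow> complex"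
  assumes \<phi>: "test_function \<Omega> \<phi>" and u: "u \<in> L2" and p: "ess_bounded (\<lambda>x. complex_of_real (p x))" and s: "0 \<le> s"
  shows "(LINT x|lborel. u x * (- \<i> * vector_derivative (\<lambda>\<tau>. \<phi> (\<tau>, x)) (at t)
                    + frac_laplacian s (\<lambda>y. \<phi> (t, y)) x + of_real (p x) * \<phi> (t, x)))
    = Complex (inner (FT (abs_ltwo u)) (adjoint_eq s p \<phi> t)) (inner (FT (abs_ltwo u)) (mult_i (adjoint_eq s p \<phi> t)))"
proof -
  let ?\<kappa> = "\<lambda>x. \<phi> (t, x)" and ?d = "\<lambda>x. dirderiv (1, 0) \<phi> (t, x)"
  define L where "L = frac_laplacian s ?\<kappa>"
  have vd: "vector_derivative (\<lambda>\<tau>. \<phi> (\<tau>, x)) (at t) = dirderiv (1, 0) \<phi> (t, x)" for x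
    by (rule vector_derivative_at[OF has_vector_derivative_slice[OF \<phi>]])
  have \<kappa>: "test_function UNIV ?\<kappa>" and d: "test_function UNIV ?d"
    by (rule test_function_slice[OF \<phi>], rule test_function_slice[OF test_function_dirderiv[OF \<phi>]])
  note \<kappa>L = test_function_L2[OF \<kappa>] and dL = test_function_L2[OF d]
  obtain N :: nat where N: "2 * s \<le> real N" using real_arch_simple by blast
  have dom: "in_dom (lapsym s) (FT (abs_ltwo ?\<kappa>))" by (rule test_function_in_dom(1)[OF \<kappa> s N])
  note Lp = frac_laplacian[OF \<kappa>L dom, folded L_def]
  have cL: "FT (conj_op (abs_ltwo L)) = wmult (lapsym s) (FT (conj_op (abs_ltwo ?\<kappa>)))"
    by (rule conj_even_multiplier(2)[OF lapsym_measurable lapsym_even dom Lp(2)])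
  let ?w = "\<lambda>x. - \<i> * ?d x + L x + of_real (p x) * ?\<kappa> x"
  have parts: "(\<lambda>x. \<i> * cnj (?d x)) \<in> L2" "(\<lambda>x. cnj (L x)) \<in> L2" "(\<lambda>x. of_real (p x) * cnj (?\<kappa> x)) \<in> L2"
    using Lp(1) dL \<kappa>L by (auto intro: L2_cnj L2_scale L2_mult[OF p])
  have w: "?w \<in> L2"
    using Lp(1) dL \<kappa>L by (intro L2_add L2_scale L2_mult[OF p]) auto
  have "conj_op (abs_ltwo ?w) = abs_ltwo (\<lambda>x. \<i> * cnj (?d x) + cnj (L x) + of_real (p x) * cnj (?\<kappa> x))"
    by (subst conj_abs[OF w]) (simp add: algebra_simps)
  also have "\<dots> = abs_ltwo (\<lambda>x. \<i> * cnj (?d x)) + abs_ltwo (\<lambda>x. cnj (L x)) + abs_ltwo (\<lambda>x. of_real (p x) * cnj (?\<kappa> x))"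
    by (simp add: abs_add parts L2_add)
  also have "\<dots> = mult_i (abs_ltwo (\<lambda>x. cnj (?d x))) + conj_op (abs_ltwo L) + wmult p (abs_ltwo (\<lambda>x. cnj (?\<kappa> x)))"
    by (simp add: mult_abs[OF p] mult_abs L2_cnj dL \<kappa>L conj_abs[OF Lp(1)])
  finally have 1: "FT (conj_op (abs_ltwo ?w)) = adjoint_eq s p \<phi> t"
    by (simp add: FT_add FT_cmult cL adjoint_eq_def phi_hat_def Vop_def conj_abs[OF \<kappa>L])
  have 2: "FT (mult_i (conj_op (abs_ltwo ?w))) = mult_i (FT (conj_op (abs_ltwo ?w)))"
    by (rule FT_cmult)
  have "inner (abs_ltwo u) (conj_op (abs_ltwo ?w)) = inner (FT (abs_ltwo u)) (adjoint_eq s p \<phi> t)"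
    "inner (abs_ltwo u) (mult_i (conj_op (abs_ltwo ?w))) = inner (FT (abs_ltwo u)) (mult_i (adjoint_eq s p \<phi> t))"
    unfolding 1[symmetric] 2[symmetric] by (simp_all only: inner_FT_FT)
  then show ?thesis
    unfolding vd L_def[symmetric] integral_eq_inner[OF u w] by simp
qed

subsection \<open>Classical solutions solve the cut-off equations\<close>

lemma test_function_product:
  fixes \<theta> :: "real \<Rightarrow> real" and \<kappa> :: "'a::euclidean_space \<Rightarrow> complex"
  assumes \<theta>: "test_function {0<..<T} \<theta>" and \<kappa>: "test_function UNIV \<kappa>"
  defines "\<phi> \<equiv> \<lambda>z. complex_of_real (\<theta> (fst z)) * \<kappa> (snd z)"
  shows "test_function ({0<..<T} \<times> UNIV) \<phi>"
    and "dirderiv (1, 0) \<phi> (t, x) = of_real (dirderiv 1 \<theta> t) * \<kappa> x"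
proof -
  have "Ck k (\<lambda>z::real \<times> 'a. complex_of_real (\<theta> (0 + fst z)))" for k
    by (rule Ck_linear[OF bounded_linear_of_real Ck_comp_affine[OF bounded_linear_fst test_function_Ck[OF \<theta>]]])
  moreover have "Ck k (\<lambda>z::real \<times> 'a. \<kappa> (0 + snd z))" for k
    by (rule Ck_comp_affine[OF bounded_linear_snd test_function_Ck[OF \<kappa>]])
  ultimately have Ck: "Ck k \<phi>" for k
    unfolding \<phi>_def by (intro Ck_mult) simp_all
  show tf: "test_function ({0<..<T} \<times> UNIV) \<phi>"
  proof (rule test_functionI_subset[OF Ck, of "closure {t. \<theta> t \<noteq> 0} \<times> closure {x. \<kappa> x \<noteq> 0}"])
    show "\<phi> z = 0" if "z \<notin> closure {t. \<theta> t \<noteq> 0} \<times> closure {x. \<kappa> x \<noteq> 0}" for z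
      using that closure_subset[of "{t. \<theta> t \<noteq> 0}"] closure_subset[of "{x. \<kappa> x \<noteq> 0}"]
      by (cases z) (auto simp: \<phi>_def)
  qed (use \<theta> \<kappa> in \<open>auto simp: test_function_def intro!: compact_Times\<close>)
  have "((\<lambda>s. \<theta> (0 + s *\<^sub>R 1)) has_vector_derivative dirderiv 1 \<theta> (0 + t *\<^sub>R 1)) (at t)"
    by (rule has_vector_derivative_line[OF test_function_differentiable[OF \<theta>]])
  then have "((\<lambda>s. complex_of_real (\<theta> s) * \<kappa> x) has_vector_derivative of_real (dirderiv 1 \<theta> t) * \<kappa> x) (at t)"
    by (intro has_vector_derivative_mult_left has_vector_derivative_of_real)
       (simp add: has_real_derivative_iff_has_vector_derivative)
  moreover have "((\<lambda>s. complex_of_real (\<theta> s) * \<kappa> x) has_vector_derivative dirderiv (1, 0) \<phi> (t, x)) (at t)"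
    using has_vector_derivative_slice[OF tf, of x t UNIV] by (simp add: \<phi>_def)
  ultimately show "dirderiv (1, 0) \<phi> (t, x) = of_real (dirderiv 1 \<theta> t) * \<kappa> x"
    by (intro vector_derivative_unique_at)
qed

lemma FT_scaleR: "FT (c *\<^sub>R f) = c *\<^sub>R FT f"
  by (rule linear_scale[OF bounded_linear.linear[OF bounded_linear_FT]])

lemma wmult_scaleR:
  assumes w: "w \<in> borel_measurable borel" and dom: "in_dom w f"
  shows "wmult w (c *\<^sub>R f) = c *\<^sub>R wmult w f"
proof -
  have L: "(\<lambda>\<xi>. c *\<^sub>R (of_real (w \<xi>) * rep_ltwo f \<xi>)) \<in> L2"
    using dom unfolding in_dom_def by (rule L2_scaleR)
  have ae: "AE \<xi> in lborel. c *\<^sub>R (of_real (w \<xi>) * rep_ltwo f \<xi>) = of_real (w \<xi>) * rep_ltwo (c *\<^sub>R f) \<xi>"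
    using rep_scaleR[of c f] by eventually_elim simp
  have "wmult w (c *\<^sub>R f) = abs_ltwo (\<lambda>\<xi>. c *\<^sub>R (of_real (w \<xi>) * rep_ltwo f \<xi>))"
    by (rule in_dom_cong_AE(2)[OF w L ae])
  also have "\<dots> = c *\<^sub>R abs_ltwo (\<lambda>\<xi>. of_real (w \<xi>) * rep_ltwo f \<xi>)"
    using dom unfolding in_dom_def by (rule abs_scaleR[symmetric])
  finally show ?thesis by (simp add: mult_op_def)
qed

text \<open>Test functions \<open>\<theta>(t) cnj (\<eta> x)\<close> with separated variables reduce the equation to a scalar one in time,
  where the lemma of du Bois-Reymond applies.\<close>

lemma schroedinger_tested:
  fixes \<psi> :: "'a::euclidean_space \<Rightarrow> real"
  assumes T: "0 < T" and s: "0 < s" and p: "ess_bounded (\<lambda>x. complex_of_real (p x))"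
    and \<psi>: "friedrichs_mollifier \<psi>"
    and u: "continuous_sobolev T s u" and eq: "schroedinger_distributional T s p u"
    and \<eta>: "test_function UNIV \<eta>" and t: "t \<in> {0..T}"
  defines "U \<equiv> \<lambda>t. FT (abs_ltwo (u t))" and "h \<equiv> FT (abs_ltwo \<eta>)"
  shows "inner (U t - U 0) (mult_i h) = integral {0..t} (\<lambda>\<tau>. inner (U \<tau>) (wmult (lapsym s) h + Vop p h))"
proof -
  have cU: "continuous_on {0..T} U"
    unfolding U_def by (rule continuous_sobolev_imp_continuous[OF u])
  have uL2: "u t \<in> L2" if "t \<in> {0..T}" for t
    using u that by (auto simp: continuous_sobolev_def sobolev_iff)
  obtain N :: nat where N: "2 * s \<le> real N" using real_arch_simple by blast
  have dom: "in_dom (lapsym s) h" unfolding h_def by (rule test_function_in_dom(1)[OF \<eta> _ N]) (use s in simp)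
  define b where "b \<tau> = inner (U \<tau>) (wmult (lapsym s) h + Vop p h)" for \<tau>
  have "inner (U t) (mult_i h) - inner (U 0) (mult_i h) = integral {0..t} b"
  proof (rule du_bois_reymond[OF \<psi> T _ _ _ t, of "\<lambda>\<tau>. inner (U \<tau>) (mult_i h)" b])
    show "continuous_on {0..T} (\<lambda>\<tau>. inner (U \<tau>) (mult_i h))" by (intro continuous_intros cU)
    show "continuous_on {0..T} b" unfolding b_def by (intro continuous_intros cU)
    fix \<theta> :: "real \<Rightarrow> real" assume \<theta>: "test_function {0<..<T} \<theta>"
    define \<kappa> where "\<kappa> x = cnj (\<eta> x)" for x
    have \<kappa>: "test_function UNIV \<kappa>" unfolding \<kappa>_def by (rule test_function_cnj[OF \<eta>])
    define \<phi> where "\<phi> = (\<lambda>z. complex_of_real (\<theta> (fst z)) * \<kappa> (snd z))"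
    note tf = test_function_product[OF \<theta> \<kappa>, folded \<phi>_def]
    have hat: "phi_hat \<phi> \<tau> = \<theta> \<tau> *\<^sub>R h" "phi_hat (dirderiv (1, 0) \<phi>) \<tau> = dirderiv 1 \<theta> \<tau> *\<^sub>R h" for \<tau>
    proof -
      have c: "FT (abs_ltwo (\<lambda>x. of_real c * \<eta> x)) = c *\<^sub>R h" for c
        unfolding h_def FT_scaleR[symmetric] by (simp add: abs_scaleR test_function_L2[OF \<eta>] scaleR_conv_of_real)
      show "phi_hat \<phi> \<tau> = \<theta> \<tau> *\<^sub>R h" "phi_hat (dirderiv (1, 0) \<phi>) \<tau> = dirderiv 1 \<theta> \<tau> *\<^sub>R h"
        using c[of "\<theta> \<tau>"] c[of "dirderiv 1 \<theta> \<tau>"] by (simp_all add: phi_hat_def tf(2)) (simp_all add: \<phi>_def \<kappa>_def)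
    qed
    have Vl: "bounded_linear (Vop p)" by (rule potential_bounded_linear[OF potential_Vop[OF p]])
    have adj: "adjoint_eq s p \<phi> \<tau> = dirderiv 1 \<theta> \<tau> *\<^sub>R mult_i h + \<theta> \<tau> *\<^sub>R (wmult (lapsym s) h + Vop p h)" for \<tau>
      unfolding adjoint_eq_def hat
      by (simp add: wmult_scaleR[OF lapsym_measurable dom] linear_scale[OF bounded_linear.linear[OF Vl]]
          linear_scale[OF bounded_linear.linear[OF bounded_linear_mult_i]] scaleR_add_right)
    have cd: "continuous_on {0..T} (dirderiv 1 \<theta>)" "continuous_on {0..T} \<theta>"
      using test_function_continuous[OF test_function_dirderiv[OF \<theta>]] test_function_continuous[OF \<theta>]
        continuous_on_subset by blast+
    have cadj: "continuous_on {0..T} (adjoint_eq s p \<phi>)"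
      unfolding adj[abs_def] by (intro continuous_intros cd)
    define I where "I \<tau> = Complex (inner (U \<tau>) (adjoint_eq s p \<phi> \<tau>)) (inner (U \<tau>) (mult_i (adjoint_eq s p \<phi> \<tau>)))" for \<tau>
    have cI: "continuous_on {0..T} I"
      unfolding I_def
      by (intro continuous_on_Complex continuous_on_inner cU cadj bounded_linear.continuous_on[OF bounded_linear_mult_i])
    have "(LINT \<tau>:{0<..<T}|lborel. I \<tau>) = 0"
    proof -
      have "(LINT \<tau>:{0<..<T}|lborel. I \<tau>) = (LINT t:{0<..<T}|lborel. (LINT x|lborel.
           u t x * (- \<i> * vector_derivative (\<lambda>\<tau>. \<phi> (\<tau>, x)) (at t)
                    + frac_laplacian s (\<lambda>y. \<phi> (t, y)) x
                    + of_real (p x) * \<phi> (t, x))))"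
      proof (rule set_lebesgue_integral_cong)
        show "\<forall>\<tau>. \<tau> \<in> {0<..<T} \<longrightarrow> I \<tau> = (LINT x|lborel.
           u \<tau> x * (- \<i> * vector_derivative (\<lambda>\<tau>. \<phi> (\<tau>, x)) (at \<tau>)
                    + frac_laplacian s (\<lambda>y. \<phi> (\<tau>, y)) x
                    + of_real (p x) * \<phi> (\<tau>, x)))"
          unfolding I_def U_def using weak_form_integral[OF tf(1) uL2 p less_imp_le[OF s]] by auto
      qed simp
      also have "\<dots> = 0"
        using eq tf(1) unfolding schroedinger_distributional_def by blast
      finally show ?thesis .
    qed
    moreover have "set_integrable lborel {0<..<T} I"
      by (rule set_integrable_subset[OF borel_integrable_atLeastAtMost'[OF cI]]) auto
    ultimately have "integral {0<..<T} I = 0"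
      using set_borel_integral_eq_integral(2) by metis
    then have "(I has_integral 0) {0..T}"
      using integrable_integral[OF integrable_continuous_real[OF cI]]
      by (simp add: integral_open_interval_real)
    then have "((Re \<circ> I) has_integral Re 0) {0..T}"
      by (rule has_integral_linear[OF _ bounded_linear_Re])
    moreover have "Re \<circ> I = (\<lambda>\<tau>. dirderiv 1 \<theta> \<tau> * inner (U \<tau>) (mult_i h) + \<theta> \<tau> * b \<tau>)"
      unfolding o_def I_def adj b_def complex.sel by (simp add: inner_add_right)
    ultimately show "integral {0..T} (\<lambda>\<tau>. dirderiv 1 \<theta> \<tau> * inner (U \<tau>) (mult_i h) + \<theta> \<tau> * b \<tau>) = 0"
      by (simp add: integral_unique)
  qed
  then show ?thesis unfolding b_def inner_diff_left .
qed

lemma fourier_dilate: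
  fixes f :: "'a::euclidean_space \<Rightarrow> complex"
  assumes [measurable]: "f \<in> borel_measurable borel" and r: "0 < r"
  shows "fourier (\<lambda>x. f (r *\<^sub>R x)) \<xi> = fourier f (\<xi> /\<^sub>R r) / of_real (r ^ DIM('a))"
proof -
  let ?F = "\<lambda>x. cis (- (x \<bullet> (\<xi> /\<^sub>R r))) * f x"
  have "(LINT x|lborel. ?F x) = \<bar>r\<bar>^DIM('a) *\<^sub>R (LINT x|lborel. ?F (0 + r *\<^sub>R x))"
    by (rule integral_affine) (use r in auto)
  also have "(\<lambda>x. ?F (0 + r *\<^sub>R x)) = (\<lambda>x. cis (- (x \<bullet> \<xi>)) * f (r *\<^sub>R x))"
    using r by (simp add: field_simps)
  finally have "(LINT x|lborel. cis (- (x \<bullet> \<xi>)) * f (r *\<^sub>R x)) = (LINT x|lborel. ?F x) / of_real (r ^ DIM('a))"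
    using r by (simp add: scaleR_conv_of_real field_simps)
  then show ?thesis unfolding fourier_def by simp
qed

lemma fourier_tendsto:
  fixes f :: "'a::euclidean_space \<Rightarrow> complex"
  assumes f: "integrable lborel f" and X: "X \<longlonglongrightarrow> \<xi>"
  shows "(\<lambda>n::nat. fourier f (X n)) \<longlonglongrightarrow> fourier f \<xi>"
proof -
  have [measurable]: "f \<in> borel_measurable borel" using borel_measurable_integrable[OF f] by simp
  have "continuous_on UNIV cis" by (intro continuous_intros)
  then have cis_cont: "isCont cis y" for y by (simp add: continuous_on_eq_continuous_at)
  show ?thesis
    unfolding fourier_def
  proof (intro tendsto_mult_left integral_dominated_convergence)
    show "integrable lborel (\<lambda>x. cmod (f x))" using f by simp
    show "AE x in lborel. norm (cis (- (x \<bullet> X n)) * f x) \<le> cmod (f x)" for n by (auto simp: norm_mult)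
    show "AE x in lborel. (\<lambda>n. cis (- (x \<bullet> X n)) * f x) \<longlonglongrightarrow> cis (- (x \<bullet> \<xi>)) * f x"
      by (intro AE_I2 tendsto_mult_right isCont_tendsto_compose[OF _ tendsto_minus[OF tendsto_inner[OF tendsto_const X]]])
         (rule cis_cont)
  qed measurable
qed

text \<open>Replacing \<open>\<eta>\<close> by its translates multiplies its transform by all characters, so the hypothesis says that
  the transform of \<open>D\<close> times a fixed profile vanishes; hence so does this product, by Plancherel's identity. The
  profile is the conjugate of the transform of \<open>\<psi>(r x)\<close> up to the nowhere vanishing factor \<open>1 + m\<close>. At a given frequency it
  is nonzero for large \<open>r\<close>, because \<open>\<psi>\<close> has nonzero integral.\<close>

lemma orthogonal_to_weighted_test_functions:
  fixes D :: "'a::euclidean_space ltwo" and \<psi> :: "'a \<Rightarrow> real"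
  assumes \<psi>: "friedrichs_mollifier \<psi>" and s: "0 < s"
    and orth: "\<And>\<eta>. test_function UNIV \<eta> \<Longrightarrow> inner D (mult_i (FT (abs_ltwo \<eta>) + wmult (lapsym s) (FT (abs_ltwo \<eta>)))) = 0"
  shows "D = 0"
proof -
  have tf: "test_function UNIV \<psi>" and one: "(LINT x|lborel. \<psi> x) = 1"
    using \<psi> by (auto simp: friedrichs_mollifier_def)
  define g where "g r x = complex_of_real (\<psi> (r *\<^sub>R x))" for r :: real and x
  obtain R where R: "0 \<le> R" "\<And>x. norm x > R \<Longrightarrow> \<psi> x = 0" using test_function_vanishes[OF tf] by blast
  have g_tf: "test_function UNIV (\<lambda>x. g r (x + a))" if r: "0 < r" for r a
  proof (rule test_function_UNIV_I[of _ "R / r + norm a"])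
    show "Ck k (\<lambda>x. g r (x + a))" for k
      using Ck_linear[OF bounded_linear_of_real Ck_comp_affine[OF bounded_linear_scaleR_right test_function_Ck[OF tf]], of k "r *\<^sub>R a" r]
      by (simp add: g_def scaleR_add_right add.commute)
    show "g r (x + a) = 0" if "norm x > R / r + norm a" for x
    proof -
      have "R / r < norm (x + a)" using that norm_diff_ineq[of x a] by linarith
      then have "R < norm (r *\<^sub>R (x + a))" using r by (simp add: divide_less_eq mult.commute)
      then show ?thesis by (simp add: g_def R)
    qed
  qed
  have g_tf0: "test_function UNIV (g r)" if "0 < r" for r using g_tf[OF that, of 0] by simp
  obtain N :: nat where N: "2 * s \<le> real N" using real_arch_simple by blast
  let ?m = "lapsym s :: 'a \<Rightarrow> real"
  have zero: "AE \<xi> in lborel. rep_ltwo D \<xi> * cnj (fourier (g r) \<xi>) = 0" if r: "0 < r" for r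
  proof -
    define w where "w \<xi> = (1 + complex_of_real (?m \<xi>)) * cnj (fourier (g r) \<xi>)" for \<xi>
    note gL = fourier_test_function_L2[OF g_tf0[OF r]]
    have [measurable]: "fourier (g r) \<in> borel_measurable borel" using gL by simp
    have [measurable]: "w \<in> borel_measurable borel" unfolding w_def by measurable
    have mg: "(\<lambda>\<xi>. complex_of_real (?m \<xi>) * fourier (g r) \<xi>) \<in> L2"
    proof (rule L2_boundI[OF _ L2_integrable[OF decay_majorant_L2[OF g_tf0[OF r], of N]]])
      show "AE \<xi> in lborel. (cmod (complex_of_real (?m \<xi>) * fourier (g r) \<xi>))\<^sup>2 \<le> (cmod (complex_of_real (decay_majorant N (g r) \<xi>)))\<^sup>2"
        using decay_majorant[OF g_tf0[OF r], of "2 * s" N] s N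
        by (intro AE_I2 power_mono) (auto simp: lapsym_def norm_mult intro: order_trans[OF _ abs_ge_self])
    qed measurable
    have wL: "w \<in> L2"
      using L2_add[OF L2_cnj[OF gL] L2_cnj[OF mg]] by (simp add: w_def[abs_def] algebra_simps)
    obtain C where C: "\<And>\<xi>. norm \<xi> powr (2 * s) * cmod (fourier (g r) \<xi>) \<le> C"
      using fourier_test_function_bounded_weight[OF g_tf0[OF r], of "2 * s"] s by auto
    have w_eb: "ess_bounded w"
    proof (rule ess_boundedI)
      fix \<xi>
      have "cmod (w \<xi>) \<le> cmod (fourier (g r) \<xi>) + ?m \<xi> * cmod (fourier (g r) \<xi>)"
        using norm_triangle_ineq[of "cnj (fourier (g r) \<xi>)" "of_real (?m \<xi>) * cnj (fourier (g r) \<xi>)"]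
        by (simp add: w_def norm_mult lapsym_nonneg distrib_right)
      also have "\<dots> \<le> fourier_const TYPE('a) * (LINT x|lborel. cmod (g r x)) + C"
        by (intro add_mono fourier_bounded test_function_integrable[OF g_tf0[OF r]]) (use C in \<open>simp add: lapsym_def\<close>)
      finally show "cmod (w \<xi>) \<le> fourier_const TYPE('a) * (LINT x|lborel. cmod (g r x)) + C" .
    qed simp
    define Q where "Q \<xi> = rep_ltwo D \<xi> * w \<xi>" for \<xi>
    have Q1: "integrable lborel Q" unfolding Q_def by (rule L2_mult_integrable[OF rep_L2 wL])
    have Q2: "Q \<in> L2" unfolding Q_def[abs_def] using L2_mult[OF w_eb rep_L2, of D] by (simp add: mult.commute)
    have "fourier Q a = 0" for a
    proof -
      define \<eta> where "\<eta> x = g r (x + a)" for x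
      have \<eta>: "test_function UNIV \<eta>" unfolding \<eta>_def by (rule g_tf[OF r])
      define h where "h = FT (abs_ltwo \<eta>)"
      define k where "k = h + wmult ?m h"
      have i\<eta>: "FT (abs_ltwo (\<lambda>x. \<i> * \<eta> x)) = mult_i h"
        unfolding h_def FT_cmult[symmetric] by (simp add: mult_abs test_function_L2[OF \<eta>])
      have dom: "in_dom ?m h" unfolding h_def by (rule test_function_in_dom(1)[OF \<eta> _ N]) (use s in simp)
      have "wmult ?m (mult_i h) = mult_i (wmult ?m h)" by (rule wmult_mult_i[OF lapsym_measurable dom])
      \<comment> \<open>Testing with \<open>\<i> \<eta>\<close> as well yields the other component of the complex inner product.\<close>
      then have "inner D (mult_i (mult_i k)) = 0"
        using orth[OF test_function_cmult[OF \<eta>, of \<i>]]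
        by (simp add: i\<eta> k_def linear_add[OF bounded_linear.linear[OF bounded_linear_mult_i]])
      then have k1: "inner D k = 0" by simp
      have k2: "inner D (mult_i k) = 0" using orth[OF \<eta>] by (simp add: h_def k_def)
      have kc: "conj_op (abs_ltwo (\<lambda>\<xi>. cnj (rep_ltwo k \<xi>))) = k" by (simp add: conj_abs L2_cnj)
      have "(LINT \<xi>|lborel. rep_ltwo D \<xi> * cnj (rep_ltwo k \<xi>)) = 0"
        unfolding integral_eq_inner[OF rep_L2 L2_cnj[OF rep_L2], of D k] kc using k1 k2
        by (simp add: complex_eq_iff)
      also have "(LINT \<xi>|lborel. rep_ltwo D \<xi> * cnj (rep_ltwo k \<xi>)) = (LINT \<xi>|lborel. cis (- (\<xi> \<bullet> a)) * Q \<xi>)"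
      proof (rule integral_cong_AE)
        have hf: "h = abs_ltwo (fourier \<eta>)"
          unfolding h_def by (rule FT_abs[OF test_function_integrable[OF \<eta>] test_function_L2[OF \<eta>]])
        have four: "fourier \<eta> \<xi> = cis (a \<bullet> \<xi>) * fourier (g r) \<xi>" for \<xi>
          unfolding \<eta>_def[abs_def] by (rule fourier_translate[OF test_function_measurable[OF g_tf0[OF r]]])
        show "AE \<xi> in lborel. rep_ltwo D \<xi> * cnj (rep_ltwo k \<xi>) = cis (- (\<xi> \<bullet> a)) * Q \<xi>"
          using rep_add[of h "wmult ?m h"] rep_wmult[OF dom] rep_abs[OF fourier_test_function_L2[OF \<eta>]]
          unfolding k_def hf
          by eventually_elim (simp add: four Q_def w_def cis_cnj inner_commute[of a] algebra_simps)
      qed (use Q1 in measurable)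
      finally show ?thesis by (simp add: fourier_def)
    qed
    then have "fourier Q = (\<lambda>_. 0)" by (rule ext)
    then have "L2_norm Q = 0"
      using plancherel_L1_L2(2)[OF Q1 Q2] by (simp add: L2_norm_def)
    then have "abs_ltwo Q = abs_ltwo (\<lambda>_. 0)"
      using norm_abs[OF Q2] by (simp add: zero_ltwo_def)
    then have "AE \<xi> in lborel. Q \<xi> = 0" by (simp add: abs_eq_iff Q2)
    then show ?thesis
    proof eventually_elim
      case (elim \<xi>)
      have "Re (1 + complex_of_real (?m \<xi>)) > 0" using lapsym_nonneg[of s \<xi>] by simp
      then have "1 + complex_of_real (?m \<xi>) \<noteq> 0" by (metis less_irrefl zero_complex.sel(1))
      then show ?case using elim by (simp add: Q_def w_def)
    qed
  qed
  have "AE \<xi> in lborel. \<forall>n. rep_ltwo D \<xi> * cnj (fourier (g (real (Suc n))) \<xi>) = 0"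
    unfolding AE_all_countable by (intro allI zero) simp
  then have "AE \<xi> in lborel. rep_ltwo D \<xi> = 0"
  proof eventually_elim
    case (elim \<xi>)
    have g1: "integrable lborel (g 1)" by (rule test_function_integrable[OF g_tf0]) simp
    have g1m: "g 1 \<in> borel_measurable borel" by (rule test_function_measurable[OF g_tf0]) simp
    have "(\<lambda>n. inverse (real (Suc n)) *\<^sub>R \<xi>) \<longlonglongrightarrow> 0 *\<^sub>R \<xi>"
      by (intro tendsto_scaleR tendsto_const LIMSEQ_inverse_real_of_nat)
    then have "(\<lambda>n. fourier (g 1) (\<xi> /\<^sub>R real (Suc n))) \<longlonglongrightarrow> fourier (g 1) 0"
      by (intro fourier_tendsto g1) simp
    moreover have "fourier (g 1) 0 \<noteq> 0"
      using one by (simp add: fourier_def g_def)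
    ultimately have "\<forall>\<^sub>F n in sequentially. fourier (g 1) (\<xi> /\<^sub>R real (Suc n)) \<noteq> 0"
      by (rule tendsto_imp_eventually_ne)
    then obtain n where n: "fourier (g 1) (\<xi> /\<^sub>R real (Suc n)) \<noteq> 0"
      using eventually_happens'[OF sequentially_bot] by blast
    have "fourier (g (real (Suc n))) \<xi> = fourier (g 1) (\<xi> /\<^sub>R real (Suc n)) / of_real (real (Suc n) ^ DIM('a))"
      using fourier_dilate[OF g1m, of "real (Suc n)" \<xi>] by (simp add: g_def[abs_def])
    then have "fourier (g (real (Suc n))) \<xi> \<noteq> 0"
      using n by (simp del: of_nat_Suc)
    then show ?case using elim[rule_format, of n] by (simp del: of_nat_Suc)
  qed
  then show ?thesis
    by (intro ltwo_eqI) (use rep_zero in \<open>auto elim: eventually_elim2\<close>)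
qed

lemma symbol_lapsym: "symbol (lapsym s)"
  by unfold_locales (auto simp: lapsym_nonneg)

text \<open>The generator applied to \<open>u\<close> need not be square integrable. Dividing the equation by \<open>1 + m\<close> makes every term
  continuous with values in \<open>L\<^sup>2\<close>, so that the tested equations combine to an identity between vectors.
  Multiplication by the bounded function \<open>1 + m\<close> on the set where \<open>m \<le> n\<close> then restores the cut-off equation.\<close>

theorem classical_imp_weak_solution:
  fixes \<psi> p :: "'a::euclidean_space \<Rightarrow> real"
  assumes T: "0 < T" and s: "0 < s" and p: "ess_bounded (\<lambda>x. complex_of_real (p x))"
    and \<psi>: "friedrichs_mollifier \<psi>"
    and u: "continuous_sobolev T s u" and eq: "schroedinger_distributional T s p u"
  shows "symbol.weak_solution (lapsym s) T (\<lambda>t. FT (abs_ltwo (u t))) (\<lambda>t. Vop p (FT (abs_ltwo (u t))))"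
proof -
  interpret symbol "lapsym s :: 'a \<Rightarrow> real" by (rule symbol_lapsym)
  let ?m = "lapsym s :: 'a \<Rightarrow> real"
  define U where "U t = FT (abs_ltwo (u t))" for t
  have cU: "continuous_on {0..T} U" unfolding U_def by (rule continuous_sobolev_imp_continuous[OF u])
  have V: "potential (Vop p)" by (rule potential_Vop[OF p])
  have cVU: "continuous_on {0..T} (\<lambda>t. Vop p (U t))"
    by (rule bounded_linear.continuous_on[OF potential_bounded_linear[OF V] cU])
  define W1 where "W1 \<xi> = 1 / (1 + ?m \<xi>)" for \<xi>
  define W2 where "W2 \<xi> = ?m \<xi> / (1 + ?m \<xi>)" for \<xi>
  have m1: "1 + ?m \<xi> > 0" for \<xi> using lapsym_nonneg[of s \<xi>] by linarith
  have W1: "ess_bounded (\<lambda>\<xi>. complex_of_real (W1 \<xi>))"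
  proof (rule ess_boundedI)
    show "cmod (complex_of_real (W1 \<xi>)) \<le> 1" for \<xi>
      unfolding norm_of_real W1_def using m1[of \<xi>] lapsym_nonneg[of s \<xi>] by simp
  qed (unfold W1_def, measurable)
  have W2: "ess_bounded (\<lambda>\<xi>. complex_of_real (W2 \<xi>))"
  proof (rule ess_boundedI)
    show "cmod (complex_of_real (W2 \<xi>)) \<le> 1" for \<xi>
      unfolding norm_of_real W2_def using m1[of \<xi>] lapsym_nonneg[of s \<xi>] by simp
  qed (unfold W2_def, measurable)
  define E where "E \<tau> = mult_i (wmult W2 (U \<tau>) + wmult W1 (Vop p (U \<tau>)))" for \<tau>
  have cE: "continuous_on {0..T} E"
    unfolding E_def
    by (intro bounded_linear.continuous_on[OF bounded_linear_mult_i] continuous_on_add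
        bounded_linear.continuous_on[OF bounded_linear_mult[OF W1]] bounded_linear.continuous_on[OF bounded_linear_mult[OF W2]] cU cVU)
  have resolvent_form: "wmult W1 (U t) = wmult W1 (U 0) + integral {0..t} E" if t: "t \<in> {0..T}" for t
  proof -
    have iE: "E integrable_on {0..t}"
      by (rule integrable_continuous_real[OF continuous_on_subset[OF cE]]) (use t in auto)
    define D where "D = wmult W1 (U t - U 0) - integral {0..t} E"
    have "D = 0"
    proof (rule orthogonal_to_weighted_test_functions[OF \<psi> s])
      fix \<eta> :: "'a \<Rightarrow> complex" assume \<eta>: "test_function UNIV \<eta>"
      define h where "h = FT (abs_ltwo \<eta>)"
      define k where "k = h + wmult ?m h"
      obtain N :: nat where N: "2 * s \<le> real N" using real_arch_simple by blast
      have dom: "in_dom ?m h" unfolding h_def by (rule test_function_in_dom(1)[OF \<eta> _ N]) (use s in simp)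
      have k: "AE \<xi> in lborel. rep_ltwo k \<xi> = of_real (1 + ?m \<xi>) * rep_ltwo h \<xi>"
        using rep_add[of h "wmult ?m h"] rep_wmult[OF dom] unfolding k_def
        by eventually_elim (simp add: distrib_right)
      have W1k: "wmult W1 k = h"
      proof (rule ltwo_eqI, use k rep_mult[OF W1, of k] in eventually_elim)
        case (elim \<xi>)
        have "complex_of_real (W1 \<xi>) * (of_real (1 + ?m \<xi>) * rep_ltwo h \<xi>) = of_real (W1 \<xi> * (1 + ?m \<xi>)) * rep_ltwo h \<xi>"
          by (simp add: mult.assoc)
        also have "W1 \<xi> * (1 + ?m \<xi>) = 1" using m1[of \<xi>] by (simp add: W1_def)
        finally show ?case using elim by simp
      qed
      have W2k: "wmult W2 k = wmult ?m h"
      proof (rule ltwo_eqI, use k rep_mult[OF W2, of k] rep_wmult[OF dom] in eventually_elim)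
        case (elim \<xi>)
        have "complex_of_real (W2 \<xi>) * (of_real (1 + ?m \<xi>) * rep_ltwo h \<xi>) = of_real (W2 \<xi> * (1 + ?m \<xi>)) * rep_ltwo h \<xi>"
          by (simp add: mult.assoc)
        also have "W2 \<xi> * (1 + ?m \<xi>) = ?m \<xi>" using m1[of \<xi>] by (simp add: W2_def)
        finally show ?case using elim by simp
      qed
      have "inner (wmult W1 (U t - U 0)) (mult_i k) = inner (U t - U 0) (mult_i h)"
        by (simp add: inner_mult_real[OF W1] mult_commute[OF W1] W1k)
      also have "\<dots> = integral {0..t} (\<lambda>\<tau>. inner (U \<tau>) (wmult ?m h + Vop p h))"
        unfolding U_def h_def by (rule schroedinger_tested[OF T s p \<psi> u eq \<eta> t])
      also have "(\<lambda>\<tau>. inner (U \<tau>) (wmult ?m h + Vop p h)) = (\<lambda>x. inner x (mult_i k)) \<circ> E"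
      proof
        fix \<tau>
        have "inner (E \<tau>) (mult_i k) = inner (wmult W2 (U \<tau>) + wmult W1 (Vop p (U \<tau>))) k"
          by (simp add: E_def)
        also have "\<dots> = inner (U \<tau>) (wmult ?m h) + inner (Vop p (U \<tau>)) h"
          by (simp add: inner_add_left inner_mult_real[OF W1] inner_mult_real[OF W2] W1k W2k)
        also have "inner (Vop p (U \<tau>)) h = inner (U \<tau>) (Vop p h)"
          using V by (simp add: potential_def)
        finally show "inner (U \<tau>) (wmult ?m h + Vop p h) = ((\<lambda>x. inner x (mult_i k)) \<circ> E) \<tau>"
          by (simp add: inner_add_right)
      qed
      also have "integral {0..t} \<dots> = inner (integral {0..t} E) (mult_i k)"
        by (rule integral_linear[OF iE bounded_linear_inner_left])
      finally show "inner D (mult_i (FT (abs_ltwo \<eta>) + wmult ?m (FT (abs_ltwo \<eta>)))) = 0"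
        by (simp add: D_def inner_diff_left k_def h_def)
    qed
    then show ?thesis
      by (simp add: D_def linear_diff[OF bounded_linear.linear[OF bounded_linear_mult[OF W1]]] algebra_simps)
  qed
  have "((\<lambda>t. P n (U t)) has_vector_derivative mult_i (M n (U t) + P n (Vop p (U t)))) (at t within {0..T})"
    if t: "t \<in> {0..T}" for n t
  proof -
    define c where "c \<xi> = (1 + ?m \<xi>) * cut n \<xi>" for \<xi>
    have c: "ess_bounded (\<lambda>\<xi>. complex_of_real (c \<xi>))"
    proof (rule ess_boundedI)
      show "cmod (complex_of_real (c \<xi>)) \<le> 1 + real n" for \<xi>
        using cut_le[of n \<xi>] m_cut_le[of \<xi> n] abs_triangle_ineq[of "cut n \<xi>" "?m \<xi> * cut n \<xi>"]
        unfolding norm_of_real c_def distrib_right mult_1 by linarith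
    qed (unfold c_def, measurable)
    have cW: "wmult c (wmult W1 f) = P n f" "wmult c (wmult W2 f) = M n f" for f
    proof -
      have "c \<xi> * W1 \<xi> = cut n \<xi>" "c \<xi> * W2 \<xi> = ?m \<xi> * cut n \<xi>" for \<xi>
        using m1[of \<xi>] by (simp_all add: c_def W1_def W2_def)
      then show "wmult c (wmult W1 f) = P n f" "wmult c (wmult W2 f) = M n f"
        unfolding mult_mult[OF c W1] mult_mult[OF c W2] P_def M_def of_real_mult[symmetric] by simp_all
    qed
    have "((\<lambda>t. wmult W1 (U 0) + integral {0..t} E) has_vector_derivative E t) (at t within {0..T})"
      using integral_has_vector_derivative[OF cE t] by (auto intro!: derivative_eq_intros)
    then have "((\<lambda>t. wmult W1 (U t)) has_vector_derivative E t) (at t within {0..T})"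
      by (rule has_vector_derivative_transform[OF t, rotated]) (rule resolvent_form)
    from bounded_linear.has_vector_derivative[OF bounded_linear_mult[OF c] this]
    have "((\<lambda>t. P n (U t)) has_vector_derivative wmult c (E t)) (at t within {0..T})"
      unfolding cW .
    moreover have "wmult c (E t) = mult_i (M n (U t) + P n (Vop p (U t)))"
      unfolding E_def mult_commute[OF c ess_bounded_const]
      by (simp add: linear_add[OF bounded_linear.linear[OF bounded_linear_mult[OF c]]] cW)
    ultimately show ?thesis by simp
  qed
  then have "weak_solution T U (\<lambda>t. Vop p (U t))"
    unfolding weak_solution_def using cU cVU by blast
  then show ?thesis unfolding U_def .
qed

subsection \<open>Solutions of the cut-off equations are classical\<close>

lemma L2_norm_mono:
  assumes "f \<in> L2" "g \<in> L2" "\<And>x. cmod (f x) \<le> cmod (g x)"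
  shows "L2_norm f \<le> L2_norm g"
proof -
  have "norm (abs_ltwo f) \<le> norm (abs_ltwo g)"
    by (rule norm_mono_AE, use rep_abs[OF assms(1)] rep_abs[OF assms(2)] in eventually_elim) (simp add: assms(3))
  then show ?thesis by (simp add: norm_abs assms)
qed

lemma slice_norm_bounded:
  fixes \<phi> :: "real \<times> 'a::euclidean_space \<Rightarrow> complex"
  assumes \<phi>: "test_function \<Omega> \<phi>"
  shows "\<exists>K\<ge>0. \<forall>t. L2_norm (\<lambda>x. \<phi> (t, x)) \<le> K"
proof -
  obtain B R where B: "0 \<le> B" "\<And>z. cmod (\<phi> z) \<le> B" and R: "\<And>z. norm z > R \<Longrightarrow> \<phi> z = 0"
    using test_function_bounded[OF \<phi>] by metis
  define g where "g x = complex_of_real (B * indicator (cball 0 R) x)" for x :: 'a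
  have g: "g \<in> L2"
  proof (rule L2_compact_support)
    have [measurable]: "cball (0::'a) R \<in> sets borel" by simp
    show "g \<in> borel_measurable borel" unfolding g_def by measurable
    show "cmod (g x) \<le> B" "norm x > R \<Longrightarrow> g x = 0" for x using B(1) by (auto simp: g_def indicator_def)
  qed
  have "L2_norm (\<lambda>x. \<phi> (t, x)) \<le> L2_norm g" for t
  proof (rule L2_norm_mono[OF test_function_L2[OF test_function_slice[OF \<phi>]] g])
    show "cmod (\<phi> (t, x)) \<le> cmod (g x)" for x
      using B(1) B(2)[of "(t, x)"] R[of "(t, x)"] norm_snd_le[of x t]
      by (cases "norm x > R") (auto simp: g_def)
  qed
  then show ?thesis by (intro exI[of _ "L2_norm g"]) auto
qed

lemma phi_hat_norm:
  fixes \<phi> :: "real \<times> 'a::euclidean_space \<Rightarrow> complex"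
  assumes "test_function \<Omega> \<phi>"
  shows "norm (phi_hat \<phi> t) = L2_norm (\<lambda>x. \<phi> (t, x))"
  unfolding phi_hat_def using test_function_L2[OF test_function_slice[OF assms, of t]]
  by (simp add: norm_abs L2_cnj) (simp add: L2_norm_def)

text \<open>The weighted norms of the slices are controlled by finitely many derivatives in space, which are
  bounded uniformly in time since the support in space-time is compact.\<close>

lemma phi_hat_weighted_bounded:
  fixes \<phi> :: "real \<times> 'a::euclidean_space \<Rightarrow> complex"
  assumes \<phi>: "test_function \<Omega> \<phi>" and s: "0 \<le> s"
  shows "in_dom (lapsym s) (phi_hat \<phi> t)"
    and "\<exists>K\<ge>0. \<forall>t. norm (wmult (lapsym s) (phi_hat \<phi> t)) \<le> K"
proof -
  obtain N :: nat where N: "2 * s \<le> real N" using real_arch_simple by blast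
  have c: "test_function \<Omega> (\<lambda>z. cnj (\<phi> z))" by (rule test_function_cnj[OF \<phi>])
  have sl: "test_function UNIV (\<lambda>x. cnj (\<phi> (t, x)))" for t by (rule test_function_slice[OF c])
  show "in_dom (lapsym s) (phi_hat \<phi> t)"
    unfolding phi_hat_def by (rule test_function_in_dom(1)[OF sl s N])
  obtain K0 where K0: "0 \<le> K0" "\<And>t. L2_norm (\<lambda>x. cnj (\<phi> (t, x))) \<le> K0"
    using slice_norm_bounded[OF c] by blast
  have "\<forall>b::'a. \<exists>K\<ge>0. \<forall>t. L2_norm (\<lambda>x. (dirderiv (0, b) ^^ N) (\<lambda>z. cnj (\<phi> z)) (t, x)) \<le> K"
    by (intro allI slice_norm_bounded[OF test_function_iterate[OF c]])
  from choice[OF this] obtain K where K: "\<And>b::'a. 0 \<le> K b"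
    "\<And>b t. L2_norm (\<lambda>x. (dirderiv (0, b) ^^ N) (\<lambda>z. cnj (\<phi> z)) (t, x)) \<le> K b"
    by blast
  have "norm (wmult (lapsym s) (phi_hat \<phi> t)) \<le> K0 + real DIM('a)^N * (\<Sum>b\<in>Basis. K b)" for t
  proof -
    have "norm (wmult (lapsym s) (phi_hat \<phi> t))
        \<le> L2_norm (\<lambda>x. cnj (\<phi> (t, x))) + real DIM('a)^N * (\<Sum>b\<in>Basis. L2_norm ((dirderiv b ^^ N) (\<lambda>x. cnj (\<phi> (t, x)))))"
      unfolding phi_hat_def by (rule order_trans[OF test_function_in_dom(2)[OF sl s N] L2_norm_decay_majorant[OF sl]])
    also have "\<dots> \<le> K0 + real DIM('a)^N * (\<Sum>b\<in>Basis. K b)"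
      unfolding dirderiv_slice_iterate[OF c]
      by (intro add_mono mult_left_mono sum_mono K0 K) auto
    finally show ?thesis .
  qed
  moreover have "0 \<le> K0 + real DIM('a)^N * (\<Sum>b\<in>Basis. K b)"
    by (intro add_nonneg_nonneg mult_nonneg_nonneg sum_nonneg K0 K) auto
  ultimately show "\<exists>K\<ge>0. \<forall>t. norm (wmult (lapsym s) (phi_hat \<phi> t)) \<le> K" by blast
qed

text \<open>The difference quotients in time are bounded by the time derivative and supported in a fixed ball.\<close>

lemma phi_hat_has_vector_derivative:
  fixes \<phi> :: "real \<times> 'a::euclidean_space \<Rightarrow> complex"
  assumes \<phi>: "test_function \<Omega> \<phi>"
  shows "(phi_hat \<phi> has_vector_derivative phi_hat (dirderiv (1, 0) \<phi>) t) (at t within S)"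
proof -
  let ?d = "dirderiv (1, 0) \<phi>"
  have c: "test_function \<Omega> (\<lambda>z. cnj (\<phi> z))" and d: "test_function \<Omega> ?d"
    by (rule test_function_cnj[OF \<phi>], rule test_function_dirderiv[OF \<phi>])
  have sL: "(\<lambda>x. cnj (\<phi> (t, x))) \<in> L2" for t by (rule test_function_L2[OF test_function_slice[OF c]])
  have dL: "(\<lambda>x. cnj (?d (t, x))) \<in> L2" for t
    by (rule test_function_L2[OF test_function_slice[OF test_function_cnj[OF d]]])
  obtain B Rd where B: "0 \<le> B" "\<And>z. cmod (?d z) \<le> B" and Rd: "\<And>z. norm z > Rd \<Longrightarrow> ?d z = 0"
    using test_function_bounded[OF d] by metis
  obtain R\<phi> where R\<phi>: "\<And>z. norm z > R\<phi> \<Longrightarrow> \<phi> z = 0" using test_function_vanishes[OF \<phi>] by metis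
  define R where "R = max Rd R\<phi>"
  have R: "?d (\<tau>, x) = 0" "\<phi> (\<tau>, x) = 0" if "norm x > R" for \<tau> x
    using that norm_snd_le[of x \<tau>] by (auto simp: R_def intro!: Rd R\<phi>)
  have "((\<lambda>t. abs_ltwo (\<lambda>x. cnj (\<phi> (t, x)))) has_vector_derivative abs_ltwo (\<lambda>x. cnj (?d (t, x)))) (at t within S)"
    unfolding has_vector_derivative_iff_quotient tendsto_at_iff_sequentially
  proof (intro allI impI, unfold o_def)
    fix X :: "nat \<Rightarrow> real"
    assume X: "\<forall>i. X i \<in> S - {t}" and Xt: "X \<longlonglongrightarrow> t"
    define F where "F k x = inverse (X k - t) *\<^sub>R (cnj (\<phi> (X k, x)) - cnj (\<phi> (t, x)))" for k x
    have FL: "F k \<in> L2" for k unfolding F_def[abs_def] by (intro L2_scaleR L2_diff sL)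
    have F_le: "cmod (F k x) \<le> B" for k x
    proof -
      have "cmod (\<phi> ((t, x) + (X k - t) *\<^sub>R (1, 0)) - \<phi> (t, x)) \<le> B * \<bar>X k - t\<bar>"
        by (rule dirderiv_bound[OF test_function_differentiable[OF \<phi>] B(2)])
      then have 1: "cmod (\<phi> (X k, x) - \<phi> (t, x)) \<le> B * \<bar>X k - t\<bar>" by simp
      have "cmod (F k x) = inverse \<bar>X k - t\<bar> * cmod (cnj (\<phi> (X k, x) - \<phi> (t, x)))"
        by (simp add: F_def)
      also have "\<dots> \<le> inverse \<bar>X k - t\<bar> * (B * \<bar>X k - t\<bar>)"
        unfolding complex_mod_cnj by (intro mult_left_mono 1) auto
      also have "\<dots> = B" using X by (auto simp: field_simps)
      finally show ?thesis .
    qed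
    have "(\<lambda>k. L2_norm (\<lambda>x. F k x - cnj (?d (t, x)))) \<longlonglongrightarrow> 0"
    proof (rule L2_norm_tendsto_dominated)
      show "integrable lborel (\<lambda>x. (2*B)\<^sup>2 * indicator (cball (0::'a) R) x)" by (rule integrable_indicator_cball)
      show "AE x in lborel. (cmod (F k x - cnj (?d (t, x))))\<^sup>2 \<le> (2*B)\<^sup>2 * indicator (cball 0 R) x" for k
      proof (rule AE_I2)
        fix x
        have "cmod (F k x - cnj (?d (t, x))) \<le> 2 * B"
          using norm_triangle_ineq4[of "F k x" "cnj (?d (t, x))"] F_le[of k x] B(2)[of "(t, x)"] by simp
        then have "(cmod (F k x - cnj (?d (t, x))))\<^sup>2 \<le> (2*B)\<^sup>2" by (rule power_mono) auto
        then show "(cmod (F k x - cnj (?d (t, x))))\<^sup>2 \<le> (2*B)\<^sup>2 * indicator (cball 0 R) x"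
          using R[of x] by (cases "norm x > R") (auto simp: F_def indicator_def)
      qed
      show "AE x in lborel. (\<lambda>k. F k x) \<longlonglongrightarrow> cnj (?d (t, x))"
      proof (rule AE_I2)
        fix x
        have "((\<lambda>\<tau>. (\<phi> (\<tau>, x) - \<phi> (t, x)) /\<^sub>R (\<tau> - t)) \<longlongrightarrow> ?d (t, x)) (at t within S)"
          using has_vector_derivative_slice[OF \<phi>, of x t S] unfolding has_vector_derivative_iff_quotient .
        then have "(\<lambda>k. (\<phi> (X k, x) - \<phi> (t, x)) /\<^sub>R (X k - t)) \<longlonglongrightarrow> ?d (t, x)"
          using X Xt unfolding tendsto_at_iff_sequentially o_def by blast
        from tendsto_cnj[OF this] show "(\<lambda>k. F k x) \<longlonglongrightarrow> cnj (?d (t, x))" by (simp add: F_def)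
      qed
    qed (use FL dL in auto)
    then have "(\<lambda>k. abs_ltwo (F k)) \<longlonglongrightarrow> abs_ltwo (\<lambda>x. cnj (?d (t, x)))"
      by (subst abs_tendsto_iff) (auto simp: FL dL)
    moreover have "abs_ltwo (F k) = (abs_ltwo (\<lambda>x. cnj (\<phi> (X k, x))) - abs_ltwo (\<lambda>x. cnj (\<phi> (t, x)))) /\<^sub>R (X k - t)" for k
      unfolding F_def[abs_def] by (simp only: abs_diff sL abs_scaleR L2_diff)
    ultimately show "(\<lambda>k. (abs_ltwo (\<lambda>x. cnj (\<phi> (X k, x))) - abs_ltwo (\<lambda>x. cnj (\<phi> (t, x)))) /\<^sub>R (X k - t)) \<longlonglongrightarrow> abs_ltwo (\<lambda>x. cnj (?d (t, x)))"
      by simp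
  qed
  from bounded_linear.has_vector_derivative[OF bounded_linear_FT this]
  show ?thesis unfolding phi_hat_def[abs_def] .
qed

lemma adjoint_eq_times_i:
  fixes \<phi> :: "real \<times> 'a::euclidean_space \<Rightarrow> complex"
  assumes \<phi>: "test_function \<Omega> \<phi>" and s: "0 \<le> s" and p: "ess_bounded (\<lambda>x. complex_of_real (p x))"
  shows "adjoint_eq s p (\<lambda>z. - \<i> * \<phi> z) t = mult_i (adjoint_eq s p \<phi> t)"
proof -
  have hat: "phi_hat (\<lambda>z. - \<i> * f z) t = mult_i (phi_hat f t)" if "test_function \<Omega> f" for f :: "real \<times> 'a \<Rightarrow> complex"
    using test_function_L2[OF test_function_slice[OF test_function_cnj[OF that]], of t]
    unfolding phi_hat_def FT_cmult[symmetric] by (simp add: mult_abs)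
  have dir: "dirderiv (1, 0) (\<lambda>z. - \<i> * \<phi> z) = (\<lambda>z. - \<i> * dirderiv (1, 0) \<phi> z)"
  proof
    fix z
    have "((\<lambda>z. - \<i> * \<phi> z) has_derivative (\<lambda>v. - \<i> * dirderiv v \<phi> z)) (at z)"
      by (intro has_derivative_mult_right has_derivative_dirderiv test_function_differentiable[OF \<phi>])
    from frechet_derivative_at[OF this] show "dirderiv (1, 0) (\<lambda>z. - \<i> * \<phi> z) z = - \<i> * dirderiv (1, 0) \<phi> z"
      unfolding dirderiv_def by metis
  qed
  have "Vop p (mult_i h) = mult_i (Vop p h)" for h
    using potential_Vop[OF p] by (simp add: potential_def)
  then show ?thesis
    unfolding adjoint_eq_def dir hat[OF \<phi>] hat[OF test_function_dirderiv[OF \<phi>]]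
      wmult_mult_i[OF lapsym_measurable phi_hat_weighted_bounded(1)[OF \<phi> s]]
    by (simp only: linear_add[OF bounded_linear.linear[OF bounded_linear_mult_i]])
qed

text \<open>The product rule for \<open>\<langle>P n U, \<i> \<Phi>\<rangle>\<close> and the vanishing of \<open>\<Phi>\<close> at both ends give the identity behind each
  cut-off. Moving \<open>m\<close> onto the test function bounds the integrand uniformly in \<open>n\<close>.\<close>

lemma weak_solution_tested:
  fixes p :: "'a::euclidean_space \<Rightarrow> real"
  assumes T: "0 < T" and s: "0 < s" and p: "ess_bounded (\<lambda>x. complex_of_real (p x))"
    and U: "symbol.weak_solution (lapsym s) T U (\<lambda>t. Vop p (U t))"
    and \<phi>: "test_function ({0<..<T} \<times> UNIV) \<phi>"
  shows "((\<lambda>t. inner (U t) (adjoint_eq s p \<phi> t)) has_integral 0) {0..T}"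
proof -
  interpret symbol "lapsym s :: 'a \<Rightarrow> real" by (rule symbol_lapsym)
  let ?m = "lapsym s :: 'a \<Rightarrow> real"
  have V: "potential (Vop p)" by (rule potential_Vop[OF p])
  define \<Phi> where "\<Phi> = phi_hat \<phi>"
  define \<Phi>' where "\<Phi>' = phi_hat (dirderiv (1, 0) \<phi>)"
  have s0: "0 \<le> s" using s by simp
  have dom: "in_dom ?m (\<Phi> t)" for t unfolding \<Phi>_def by (rule phi_hat_weighted_bounded(1)[OF \<phi> s0])
  obtain Km where Km: "0 \<le> Km" "\<And>t. norm (wmult ?m (\<Phi> t)) \<le> Km"
    using phi_hat_weighted_bounded(2)[OF \<phi> s0] unfolding \<Phi>_def by blast
  obtain K where K: "0 \<le> K" "\<And>t. norm (\<Phi> t) \<le> K"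
    using slice_norm_bounded[OF \<phi>] unfolding \<Phi>_def phi_hat_norm[OF \<phi>] by blast
  obtain K' where K': "0 \<le> K'" "\<And>t. norm (\<Phi>' t) \<le> K'"
    using slice_norm_bounded[OF test_function_dirderiv[OF \<phi>]] unfolding \<Phi>'_def phi_hat_norm[OF test_function_dirderiv[OF \<phi>]] by blast
  obtain C where C: "0 \<le> C" "\<And>f. norm (Vop p f) \<le> norm f * C"
    using bounded_linear.nonneg_bounded[OF potential_bounded_linear[OF V]] by blast
  have ends: "\<Phi> t = 0" if "t \<notin> {0<..<T}" for t
  proof -
    have "\<phi> (t, x) = 0" for x
    proof (rule ccontr)
      assume "\<phi> (t, x) \<noteq> 0"
      then have "(t, x) \<in> closure {z. \<phi> z \<noteq> 0}" using closure_subset[of "{z. \<phi> z \<noteq> 0}"] by auto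
      then show False using \<phi> that by (auto simp: test_function_def)
    qed
    then show ?thesis
      using linear_0[OF bounded_linear.linear[OF bounded_linear_FT]]
      by (simp add: \<Phi>_def phi_hat_def flip: zero_ltwo_def)
  qed
  define r where "r n t = inner (P n (U t)) (mult_i (\<Phi>' t)) + inner (M n (U t) + P n (Vop p (U t))) (\<Phi> t)" for n t
  have r: "(r n has_integral 0) {0..T}" for n
  proof -
    have "(r n has_integral (inner (P n (U T)) (mult_i (\<Phi> T)) - inner (P n (U 0)) (mult_i (\<Phi> 0)))) {0..T}"
    proof (rule fundamental_theorem_of_calculus)
      fix t assume t: "t \<in> {0..T}"
      have "((\<lambda>t. P n (U t)) has_vector_derivative mult_i (M n (U t) + P n (Vop p (U t)))) (at t within {0..T})"
        using U t unfolding weak_solution_def by blast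
      moreover have "((\<lambda>t. mult_i (\<Phi> t)) has_vector_derivative mult_i (\<Phi>' t)) (at t within {0..T})"
        unfolding \<Phi>_def \<Phi>'_def
        by (intro bounded_linear.has_vector_derivative[OF bounded_linear_mult_i] phi_hat_has_vector_derivative[OF \<phi>])
      ultimately show "((\<lambda>t. inner (P n (U t)) (mult_i (\<Phi> t))) has_vector_derivative r n t) (at t within {0..T})"
        using bounded_bilinear.has_vector_derivative[OF bounded_bilinear_inner] by (fastforce simp: r_def)
    qed (use T in simp)
    then show ?thesis
      using linear_0[OF bounded_linear.linear[OF bounded_linear_mult_i[where 'a = 'a]]] by (simp add: ends)
  qed
  have M_eq: "M n f = P n (wmult ?m f)" if "in_dom ?m f" for n f
    using in_dom_cutoff(2)[OF that, of "{\<xi>. ?m \<xi> \<le> real n}"] wmult_P[of n f] by (simp add: P_def cut_def)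
  have lim: "(\<lambda>n. r n t) \<longlonglongrightarrow> inner (U t) (adjoint_eq s p \<phi> t)" for t
  proof -
    have "r n t = inner (P n (U t)) (mult_i (\<Phi>' t)) + inner (U t) (P n (wmult ?m (\<Phi> t))) + inner (P n (Vop p (U t))) (\<Phi> t)" for n
      unfolding r_def by (simp add: inner_add_left inner_M M_eq[OF dom])
    moreover have "(\<lambda>n. inner (P n (U t)) (mult_i (\<Phi>' t)) + inner (U t) (P n (wmult ?m (\<Phi> t))) + inner (P n (Vop p (U t))) (\<Phi> t))
        \<longlonglongrightarrow> inner (U t) (mult_i (\<Phi>' t)) + inner (U t) (wmult ?m (\<Phi> t)) + inner (Vop p (U t)) (\<Phi> t)"
      by (intro tendsto_intros P_tendsto)
    moreover have "inner (Vop p (U t)) (\<Phi> t) = inner (U t) (Vop p (\<Phi> t))"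
      using V by (simp add: potential_def)
    ultimately show ?thesis
      by (simp add: adjoint_eq_def \<Phi>_def \<Phi>'_def inner_add_right)
  qed
  let ?K = "norm (U 0) * K' + (norm (U 0) * Km + norm (U 0) * C * K)"
  have bound: "norm (r n t) \<le> ?K" if t: "t \<in> {0..T}" for n t
  proof -
    have nU: "norm (U t) = norm (U 0)" by (rule weak_solution_norm[OF V U t])
    have "\<bar>inner (P n (U t)) (mult_i (\<Phi>' t))\<bar> \<le> norm (P n (U t)) * norm (\<Phi>' t)"
      using Cauchy_Schwarz_ineq2[of "P n (U t)" "mult_i (\<Phi>' t)"] by simp
    also have "\<dots> \<le> norm (U 0) * K'"
      using norm_P_le[of n "U t"] nU by (intro mult_mono K') auto
    finally have 1: "\<bar>inner (P n (U t)) (mult_i (\<Phi>' t))\<bar> \<le> norm (U 0) * K'" .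
    have "\<bar>inner (M n (U t)) (\<Phi> t)\<bar> \<le> norm (U t) * norm (P n (wmult ?m (\<Phi> t)))"
      unfolding inner_M M_eq[OF dom] by (rule Cauchy_Schwarz_ineq2)
    also have "\<dots> \<le> norm (U 0) * Km"
      using nU order_trans[OF norm_P_le Km(2)] by (intro mult_mono) auto
    finally have 2: "\<bar>inner (M n (U t)) (\<Phi> t)\<bar> \<le> norm (U 0) * Km" .
    have "\<bar>inner (P n (Vop p (U t))) (\<Phi> t)\<bar> \<le> norm (P n (Vop p (U t))) * norm (\<Phi> t)"
      by (rule Cauchy_Schwarz_ineq2)
    also have "\<dots> \<le> norm (U 0) * C * K"
      using order_trans[OF norm_P_le[of n "Vop p (U t)"] C(2)] nU C(1) by (intro mult_mono K) auto
    finally have 3: "\<bar>inner (P n (Vop p (U t))) (\<Phi> t)\<bar> \<le> norm (U 0) * C * K" .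
    show ?thesis
      using 1 2 3 unfolding r_def inner_add_left real_norm_def by linarith
  qed
  have ri: "r n integrable_on {0..T}" for n using r[of n] by (rule has_integral_integrable)
  have Ki: "(\<lambda>_::real. ?K) integrable_on {0..T}" by (intro integrable_continuous_real continuous_on_const)
  note dc = dominated_convergence[OF ri Ki bound lim]
  have "integral {0..T} (\<lambda>t. inner (U t) (adjoint_eq s p \<phi> t)) = 0"
    using dc(2) integral_unique[OF r] by (simp add: LIMSEQ_const_iff)
  then show ?thesis using integrable_integral[OF dc(1)] by simp
qed

text \<open>A complex identity from a real one: the imaginary part of the pairing with \<open>\<phi>\<close> is the real part of the
  pairing with \<open>- \<i> \<phi>\<close>, which is again a test function.\<close>

theorem weak_solution_imp_distributional:
  fixes p :: "'a::euclidean_space \<Rightarrow> real"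
  assumes T: "0 < T" and s: "0 < s" and p: "ess_bounded (\<lambda>x. complex_of_real (p x))"
    and U: "symbol.weak_solution (lapsym s) T U (\<lambda>t. Vop p (U t))"
    and u: "\<And>t. t \<in> {0..T} \<Longrightarrow> u t \<in> L2" "\<And>t. t \<in> {0..T} \<Longrightarrow> FT (abs_ltwo (u t)) = U t"
  shows "schroedinger_distributional T s p u"
  unfolding schroedinger_distributional_def
proof (intro allI impI)
  fix \<phi> :: "real \<times> 'a \<Rightarrow> complex"
  assume \<phi>: "test_function ({0<..<T} \<times> UNIV) \<phi>"
  have i\<phi>: "test_function ({0<..<T} \<times> UNIV) (\<lambda>z. - \<i> * \<phi> z)" by (rule test_function_cmult[OF \<phi>])
  define I where "I t = Complex (inner (U t) (adjoint_eq s p \<phi> t)) (inner (U t) (mult_i (adjoint_eq s p \<phi> t)))" for t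
  have re: "integral {0<..<T} (Re \<circ> I) = 0"
    using integral_unique[OF weak_solution_tested[OF T s p U \<phi>]]
    unfolding o_def I_def complex.sel by (simp add: integral_open_interval_real)
  have im: "integral {0<..<T} (Im \<circ> I) = 0"
    using integral_unique[OF weak_solution_tested[OF T s p U i\<phi>]]
    unfolding o_def I_def complex.sel adjoint_eq_times_i[OF \<phi> less_imp_le[OF s] p]
    by (simp add: integral_open_interval_real)
  have "(LINT t:{0<..<T}|lborel. (LINT x|lborel.
           u t x * (- \<i> * vector_derivative (\<lambda>\<tau>. \<phi> (\<tau>, x)) (at t)
                    + frac_laplacian s (\<lambda>y. \<phi> (t, y)) x
                    + of_real (p x) * \<phi> (t, x)))) = (LINT t:{0<..<T}|lborel. I t)"
  proof (rule set_lebesgue_integral_cong)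
    show "\<forall>t. t \<in> {0<..<T} \<longrightarrow> (LINT x|lborel.
           u t x * (- \<i> * vector_derivative (\<lambda>\<tau>. \<phi> (\<tau>, x)) (at t)
                    + frac_laplacian s (\<lambda>y. \<phi> (t, y)) x
                    + of_real (p x) * \<phi> (t, x))) = I t"
      unfolding I_def using weak_form_integral[OF \<phi> u(1) p less_imp_le[OF s]] u(2) by auto
  qed simp
  also have "\<dots> = 0"
  proof (cases "set_integrable lborel {0<..<T} I")
    case True
    note eq = set_borel_integral_eq_integral[OF True]
    have "Re (integral {0<..<T} I) = 0" "Im (integral {0<..<T} I) = 0"
      using integral_linear[OF eq(1) bounded_linear_Re] integral_linear[OF eq(1) bounded_linear_Im] re im by simp_all
    then show ?thesis unfolding eq(2) by (simp add: complex_eq_iff)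
  next
    \<comment> \<open>The integral of a function that is not integrable is zero by convention.\<close>
    case False
    then show ?thesis
      unfolding set_integrable_def set_lebesgue_integral_def by (rule not_integrable_integral_eq)
  qed
  finally show "(LINT t:{0<..<T}|lborel. (LINT x|lborel.
           u t x * (- \<i> * vector_derivative (\<lambda>\<tau>. \<phi> (\<tau>, x)) (at t)
                    + frac_laplacian s (\<lambda>y. \<phi> (t, y)) x
                    + of_real (p x) * \<phi> (t, x)))) = 0" .
qed

section \<open>Mollified potentials\<close>

lemma friedrichs_mollifierD:
  assumes "friedrichs_mollifier \<psi>"
  shows "\<psi> \<in> borel_measurable borel" "0 \<le> \<psi> x" "integrable lborel \<psi>" "(LINT x|lborel. \<psi> x) = 1"
proof -
  show one: "(LINT x|lborel. \<psi> x) = 1" and "0 \<le> \<psi> x"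
    and "\<psi> \<in> borel_measurable borel"
    using assms test_function_measurable by (auto simp: friedrichs_mollifier_def)
  \<comment> \<open>Integrability is implicit in the normalisation, as the integral would otherwise be zero by default.\<close>
  show "integrable lborel \<psi>"
    using one not_integrable_integral_eq[of lborel \<psi>] by (cases "integrable lborel \<psi>") auto
qed

lemma convolve_cong_AE:
  fixes f g :: "'a::euclidean_space \<Rightarrow> real"
  assumes "AE x in lborel. f x = g x"
    and [measurable]: "f \<in> borel_measurable borel" "g \<in> borel_measurable borel" "k \<in> borel_measurable borel"
  shows "convolve f k = convolve g k"
  unfolding convolve_def by (rule ext, rule integral_cong_AE) (use assms(1) in auto)

text \<open>Changing \<open>p\<close> on a null set does not affect the convolution, so \<open>p\<close> may be assumed to be bounded
  everywhere; an average of values does not exceed their bound.\<close>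

lemma mollified_bounded:
  fixes p :: "'a::euclidean_space \<Rightarrow> real"
  assumes p[measurable]: "p \<in> borel_measurable borel" and C: "AE x in lborel. \<bar>p x\<bar> \<le> C" "0 \<le> C"
    and \<psi>: "friedrichs_mollifier \<psi>" and \<epsilon>: "0 < \<epsilon>"
  shows "convolve p (rescaled \<psi> \<epsilon>) \<in> borel_measurable borel" "\<bar>convolve p (rescaled \<psi> \<epsilon>) x\<bar> \<le> C"
proof -
  note [measurable] = friedrichs_mollifierD(1)[OF \<psi>]
  define q where "q x = (if \<bar>p x\<bar> \<le> C then p x else 0)" for x
  have [measurable]: "q \<in> borel_measurable borel" unfolding q_def by measurable
  have [measurable]: "rescaled \<psi> \<epsilon> \<in> borel_measurable borel" unfolding rescaled_def[abs_def] by measurable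
  have "AE x in lborel. p x = q x" using C(1) by eventually_elim (simp add: q_def)
  then have "convolve p (rescaled \<psi> \<epsilon>) = convolve q (rescaled \<psi> \<epsilon>)"
    by (rule convolve_cong_AE) measurable
  also have "\<dots> = (\<lambda>x. LINT z|lborel. \<psi> z *\<^sub>R q (x - \<epsilon> *\<^sub>R z))"
    by (rule ext, rule convolve_rescaled) (use \<epsilon> in measurable)
  finally have eq: "convolve p (rescaled \<psi> \<epsilon>) = (\<lambda>x. LINT z|lborel. \<psi> z *\<^sub>R q (x - \<epsilon> *\<^sub>R z))" .
  show "convolve p (rescaled \<psi> \<epsilon>) \<in> borel_measurable borel" unfolding eq by measurable
  have le: "\<bar>\<psi> z * q (x - \<epsilon> *\<^sub>R z)\<bar> \<le> C * \<psi> z" for z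
    using C(2) friedrichs_mollifierD(2)[OF \<psi>, of z] by (auto simp: q_def abs_mult mult.commute[of C] intro!: mult_left_mono)
  have "integrable lborel (\<lambda>z. \<psi> z * q (x - \<epsilon> *\<^sub>R z))"
    by (rule Bochner_Integration.integrable_bound[of _ "\<lambda>z. C * \<psi> z"])
       (use friedrichs_mollifierD(3)[OF \<psi>] le in \<open>auto intro: order_trans[OF _ abs_ge_self]\<close>)
  then have "\<bar>LINT z|lborel. \<psi> z * q (x - \<epsilon> *\<^sub>R z)\<bar> \<le> (LINT z|lborel. C * \<psi> z)"
    using Bochner_Integration.integral_norm_bound_integral[of lborel "\<lambda>z. \<psi> z * q (x - \<epsilon> *\<^sub>R z)" "\<lambda>z. C * \<psi> z"]
      friedrichs_mollifierD(3)[OF \<psi>] le by simp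
  then show "\<bar>convolve p (rescaled \<psi> \<epsilon>) x\<bar> \<le> C"
    unfolding eq using friedrichs_mollifierD(4)[OF \<psi>] by simp
qed

text \<open>By the uniform bound it suffices to apply the operators to a bounded function \<open>g\<close> supported in a ball. On this ball
  the mollification only sees the potential on a larger ball, where the potential is square integrable
  and its mollifications converge in \<open>L\<^sup>2\<close>.\<close>

lemma mollified_mult_tendsto:
  fixes p :: "'a::euclidean_space \<Rightarrow> real"
  assumes p[measurable]: "p \<in> borel_measurable borel" and C: "AE x in lborel. \<bar>p x\<bar> \<le> C" "0 \<le> C"
    and \<psi>: "friedrichs_mollifier \<psi>" and E: "\<And>k::nat. 0 < E k" "\<And>k. E k \<le> 1" "E \<longlonglongrightarrow> 0"
  shows "(\<lambda>k. wmult (convolve p (rescaled \<psi> (E k))) f) \<longlonglongrightarrow> wmult p f"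
proof (rule LIMSEQ_I)
  fix e :: real assume e: "0 < e"
  note [measurable] = friedrichs_mollifierD(1)[OF \<psi>]
  define p' where "p' k = convolve p (rescaled \<psi> (E k))" for k
  note p' = mollified_bounded[OF p C \<psi> E(1), folded p'_def]
  note [measurable] = p'(1)
  have eb: "ess_bounded (\<lambda>x. complex_of_real (p' k x))" for k
    by (rule ess_boundedI[of _ C]) (use p'(2) in auto)
  have ebp: "ess_bounded (\<lambda>x. complex_of_real (p x))"
    unfolding ess_bounded_def using C by auto
  have dC: "norm (wmult (p' k) h - wmult p h) \<le> 2 * C * norm h" for k h
  proof -
    have "norm (wmult (p' k) h) \<le> C * norm h" using norm_mult_le[OF eb, of k C h] p'(2) C by simp
    moreover have "norm (wmult p h) \<le> C * norm h" using norm_mult_le[OF ebp, of C h] C by simp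
    ultimately show ?thesis using norm_triangle_ineq4[of "wmult (p' k) h" "wmult p h"] by linarith
  qed
  \<comment> \<open>Approximating \<open>f\<close> up to \<open>d\<close> costs \<open>2 C d < e / 2\<close>; the summand \<open>1\<close> covers \<open>C = 0\<close>.\<close>
  define d where "d = e / (2 * (2 * C + 1))"
  have d: "0 < d" "2 * C * d < e / 2" using e C(2) by (auto simp: d_def field_simps)
  obtain g R where g: "continuous_on UNIV g" "\<And>x. norm x > R \<Longrightarrow> g x = 0" "g \<in> L2"
    and fg: "L2_norm (\<lambda>x. rep_ltwo f x - g x) < d"
    using L2_approx_continuous[OF rep_L2 d(1), of f] by blast
  obtain B where B: "0 \<le> B" "\<And>x. cmod (g x) \<le> B"
    using continuous_compact_support_bounded[OF g(1,2)] by blast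
  obtain R' where R': "0 \<le> R'" "\<And>z. norm z > R' \<Longrightarrow> \<psi> z = 0"
    using \<psi> test_function_vanishes unfolding friedrichs_mollifier_def by metis
  have [measurable]: "cball (0::'a) (R + R') \<in> sets borel" by simp
  \<comment> \<open>\<open>\<psi>\<close> vanishes outside the ball of radius \<open>R'\<close> and \<open>E k \<le> 1\<close>, so on the ball of radius \<open>R\<close> only the values
    of \<open>p\<close> within \<open>R + R'\<close> enter.\<close>
  define q where "q x = complex_of_real (if \<bar>p x\<bar> \<le> C then indicator (cball 0 (R + R')) x * p x else 0)" for x
  have [measurable]: "q \<in> borel_measurable borel" unfolding q_def by measurable
  have q: "q \<in> L2"
    by (rule L2_compact_support[of _ C "R + R'"]) (use C(2) in \<open>auto simp: q_def indicator_def\<close>)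
  have conv_eq: "complex_of_real (p' k x) = convolve q (rescaled \<psi> (E k)) x" if x: "norm x \<le> R" for k x
  proof -
    define p1 where "p1 x = (if \<bar>p x\<bar> \<le> C then p x else 0)" for x
    have [measurable]: "p1 \<in> borel_measurable borel" unfolding p1_def by measurable
    have [measurable]: "rescaled \<psi> (E k) \<in> borel_measurable borel" unfolding rescaled_def[abs_def] by measurable
    have "AE x in lborel. p x = p1 x" using C(1) by eventually_elim (simp add: p1_def)
    then have "p' k = convolve p1 (rescaled \<psi> (E k))"
      unfolding p'_def by (rule convolve_cong_AE) measurable
    then have "p' k x = (LINT z|lborel. \<psi> z *\<^sub>R p1 (x - E k *\<^sub>R z))"
      using convolve_rescaled[of p1 \<psi> "E k" x] E(1) by simp
    then have "complex_of_real (p' k x) = (LINT z|lborel. complex_of_real (\<psi> z * p1 (x - E k *\<^sub>R z)))"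
      by (simp only: integral_complex_of_real real_scaleR_def)
    also have "\<dots> = (LINT z|lborel. \<psi> z *\<^sub>R q (x - E k *\<^sub>R z))"
    proof (rule Bochner_Integration.integral_cong[OF refl])
      fix z
      show "complex_of_real (\<psi> z * p1 (x - E k *\<^sub>R z)) = \<psi> z *\<^sub>R q (x - E k *\<^sub>R z)"
      proof (cases "norm z > R'")
        case False
        have "norm (E k *\<^sub>R z) \<le> norm z" using E(1,2)[of k] by (simp add: mult_left_le_one_le)
        then have "norm (x - E k *\<^sub>R z) \<le> R + R'"
          using norm_triangle_ineq4[of x "E k *\<^sub>R z"] x False by linarith
        then show ?thesis by (simp add: p1_def q_def scaleR_conv_of_real)
      qed (simp add: R')
    qed
    also have "\<dots> = convolve q (rescaled \<psi> (E k)) x"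
      by (rule convolve_rescaled[symmetric]) (use E(1) in measurable)
    finally show ?thesis .
  qed
  note ai = friedrichs_mollifierD[OF \<psi>]
  have cq: "convolve q (rescaled \<psi> (E k)) \<in> L2" for k
    by (rule convolve_rescaled_L2(1)[OF q ai E(1)])
  define Q where "Q k x = convolve q (rescaled \<psi> (E k)) x - q x" for k x
  have Q: "Q k \<in> L2" for k unfolding Q_def[abs_def] by (intro L2_diff cq q)
  have "(\<lambda>k. L2_norm (Q k)) \<longlonglongrightarrow> 0"
    unfolding Q_def[abs_def]
    by (rule filterlim_compose[OF approximate_identity[OF q ai]])
       (use E in \<open>auto simp: filterlim_at intro!: always_eventually less_imp_neq[THEN not_sym]\<close>)
  from tendsto_mult_right_zero[OF this, of B] obtain N where N: "\<And>k. k \<ge> N \<Longrightarrow> B * L2_norm (Q k) < e / 2"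
    using e by (elim LIMSEQ_zero_less[of _ "e/2"]) auto
  have wg: "norm (wmult (p' k) (abs_ltwo g) - wmult p (abs_ltwo g)) \<le> B * L2_norm (Q k)" for k
  proof -
    have BQ: "(\<lambda>x. of_real B * Q k x) \<in> L2" by (rule L2_scale[OF Q])
    have pg: "(\<lambda>x. of_real (p' k x) * g x) \<in> L2" "(\<lambda>x. of_real (p x) * g x) \<in> L2"
      by (rule L2_mult[OF eb g(3)], rule L2_mult[OF ebp g(3)])
    have "norm (wmult (p' k) (abs_ltwo g) - wmult p (abs_ltwo g)) = norm (abs_ltwo (\<lambda>x. of_real (p' k x) * g x - of_real (p x) * g x))"
      by (simp add: mult_abs[OF eb g(3)] mult_abs[OF ebp g(3)] abs_diff pg)
    also have "\<dots> \<le> norm (abs_ltwo (\<lambda>x. of_real B * Q k x))"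
    proof (rule norm_mono_AE, use rep_abs[OF BQ] rep_abs[OF L2_diff[OF pg]] C(1) in eventually_elim)
      case (elim x)
      have "cmod (of_real (p' k x) * g x - of_real (p x) * g x) \<le> B * cmod (Q k x)"
      proof (cases "norm x > R")
        case True
        then show ?thesis using B(1) by (simp add: g(2))
      next
        case False
        then have "q x = of_real (p x)" using elim(3) R'(1) by (simp add: q_def)
        then have "of_real (p' k x) * g x - of_real (p x) * g x = g x * Q k x"
          using conv_eq[of x k] False by (simp add: Q_def algebra_simps)
        then show ?thesis using B(2)[of x] by (simp add: norm_mult mult_right_mono)
      qed
      then show ?case using elim(1,2) B(1) by (simp add: norm_mult)
    qed
    also have "\<dots> = B * L2_norm (Q k)"
      using B(1) by (simp add: norm_abs BQ L2_norm_scale)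
    finally show ?thesis .
  qed
  have "norm (wmult (p' k) f - wmult p f) < e" if "k \<ge> N" for k
  proof -
    have lin: "wmult (p' k) (f - abs_ltwo g) = wmult (p' k) f - wmult (p' k) (abs_ltwo g)"
      "wmult p (f - abs_ltwo g) = wmult p f - wmult p (abs_ltwo g)"
      by (rule linear_diff[OF bounded_linear.linear[OF bounded_linear_mult[OF eb]]],
          rule linear_diff[OF bounded_linear.linear[OF bounded_linear_mult[OF ebp]]])
    have "norm (f - abs_ltwo g) < d"
      using fg norm_abs_diff[OF rep_L2[of f] g(3)] by simp
    then have 1: "norm (wmult (p' k) (f - abs_ltwo g) - wmult p (f - abs_ltwo g)) \<le> 2 * C * d"
      using dC[of k "f - abs_ltwo g"] mult_left_mono[of "norm (f - abs_ltwo g)" d "2 * C"] C(2) by linarith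
    have 2: "wmult (p' k) f - wmult p f = (wmult (p' k) (f - abs_ltwo g) - wmult p (f - abs_ltwo g))
        + (wmult (p' k) (abs_ltwo g) - wmult p (abs_ltwo g))"
      unfolding lin by simp
    have "norm (wmult (p' k) f - wmult p f) \<le> 2 * C * d + B * L2_norm (Q k)"
      unfolding 2 by (rule norm_triangle_mono[OF 1 wg])
    then show ?thesis using N[OF that] d(2) by linarith
  qed
  then show "\<exists>N. \<forall>k\<ge>N. norm (wmult (convolve p (rescaled \<psi> (E k))) f - wmult p f) < e"
    unfolding p'_def by blast
qed

section \<open>Convergence of very weak solutions\<close>

lemma classical_solution_weak:
  fixes \<psi> p :: "'a::euclidean_space \<Rightarrow> real"
  assumes "0 < T" "0 < s" "ess_bounded (\<lambda>x. complex_of_real (p x))" "friedrichs_mollifier \<psi>"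
    and v: "classical_solution T s p v0 v" and v0: "v0 \<in> L2"
  shows "symbol.weak_solution (lapsym s) T (\<lambda>t. FT (abs_ltwo (v t))) (\<lambda>t. Vop p (FT (abs_ltwo (v t))))"
    and "FT (abs_ltwo (v 0)) = FT (abs_ltwo v0)" and "\<And>t. t \<in> {0..T} \<Longrightarrow> v t \<in> L2"
proof -
  have c: "continuous_sobolev T s v" "schroedinger_distributional T s p v" "AE x in lborel. v 0 x = v0 x"
    using v by (auto simp: classical_solution_def)
  show "symbol.weak_solution (lapsym s) T (\<lambda>t. FT (abs_ltwo (v t))) (\<lambda>t. Vop p (FT (abs_ltwo (v t))))"
    by (rule classical_imp_weak_solution[OF assms(1-4) c(1,2)])
  show L: "v t \<in> L2" if "t \<in> {0..T}" for t
    using c(1) that by (auto simp: continuous_sobolev_def sobolev_iff)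
  have "v 0 \<in> L2" by (rule L) (use assms(1) in simp)
  then have "abs_ltwo (v 0) = abs_ltwo v0"
    using abs_eq_iff[OF _ v0] c(3) by blast
  then show "FT (abs_ltwo (v 0)) = FT (abs_ltwo v0)" by simp
qed

text \<open>The solution on the Fourier side is transformed back; for each time a representative is chosen.\<close>

theorem classical_solution_exists:
  fixes p :: "'a::euclidean_space \<Rightarrow> real"
  assumes T: "0 < T" and s: "0 < s" and p: "ess_bounded (\<lambda>x. complex_of_real (p x))" and u0: "u0 \<in> sobolev s"
  shows "\<exists>u. classical_solution T s p u0 u"
proof -
  interpret symbol "lapsym s :: 'a \<Rightarrow> real" by (rule symbol_lapsym)
  have u0': "u0 \<in> L2" "in_dom (lapsym (s / 2)) (FT (abs_ltwo u0))" using u0 by (auto simp: sobolev_iff)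
  have "in_dom (\<lambda>\<xi>. sqrt (lapsym s \<xi>)) (FT (abs_ltwo u0))"
    unfolding sqrt_lapsym by (rule u0')
  note ex = evolution_exists[OF potential_Vop[OF p] less_imp_le[OF T] this, unfolded sqrt_lapsym]
  have "\<exists>U. weak_solution T U (\<lambda>t. Vop p (U t)) \<and> U 0 = FT (abs_ltwo u0) \<and>
      (\<forall>t\<in>{0..T}. in_dom (lapsym (s / 2)) (U t)) \<and> continuous_on {0..T} (\<lambda>t. wmult (lapsym (s / 2)) (U t))"
    by (rule ex) blast
  then obtain U where U: "weak_solution T U (\<lambda>t. Vop p (U t))" "U 0 = FT (abs_ltwo u0)"
    and dom: "\<And>t. t \<in> {0..T} \<Longrightarrow> in_dom (lapsym (s / 2)) (U t)"
    and cont: "continuous_on {0..T} (\<lambda>t. wmult (lapsym (s / 2)) (U t))"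
    by blast
  define u where "u t = rep_ltwo (FTi (U t))" for t
  have u: "u t \<in> L2" "FT (abs_ltwo (u t)) = U t" for t by (simp_all add: u_def)
  have "continuous_sobolev T s u"
    by (rule continuous_sobolevI) (use U(1) dom cont in \<open>auto simp: u sobolev_iff weak_solution_def\<close>)
  moreover have "schroedinger_distributional T s p u"
    by (rule weak_solution_imp_distributional[OF T s p U(1)]) (simp_all add: u)
  moreover have "AE x in lborel. u 0 x = u0 x"
  proof -
    have "FT (abs_ltwo (u 0)) = FT (abs_ltwo u0)" by (simp add: u U(2))
    then have "abs_ltwo (u 0) = abs_ltwo u0" by (simp only: FT_inj)
    then show ?thesis by (simp only: abs_eq_iff[OF u(1) u0'(1)])
  qed
  ultimately show ?thesis unfolding classical_solution_def by blast
qed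

theorem classical_solution_unique:
  fixes \<psi> p :: "'a::euclidean_space \<Rightarrow> real"
  assumes T: "0 < T" "0 < s" "ess_bounded (\<lambda>x. complex_of_real (p x))" "friedrichs_mollifier \<psi>" and u0: "u0 \<in> L2"
    and u: "classical_solution T s p u0 u" and v: "classical_solution T s p u0 v" and t: "t \<in> {0..T}"
  shows "AE x in lborel. v t x = u t x"
proof -
  note wu = classical_solution_weak[OF T u u0] and wv = classical_solution_weak[OF T v u0]
  have "FT (abs_ltwo (v t)) = FT (abs_ltwo (u t))"
    by (rule symbol.weak_solution_unique[OF symbol_lapsym potential_Vop[OF T(3)] wv(1) wu(1) _ t])
       (simp add: wu(2) wv(2))
  then show ?thesis by (simp add: FT_inj abs_eq_iff wu(3)[OF t] wv(3)[OF t])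
qed

theorem theorem2p5:
  fixes T s :: real
    and p :: "'a::euclidean_space \<Rightarrow> real"
    and u\<^sub>0 :: "'a \<Rightarrow> complex"
    and P :: "real \<Rightarrow> 'a \<Rightarrow> real"
    and U\<^sub>0 :: "real \<Rightarrow> 'a \<Rightarrow> complex"
    and U :: "real \<Rightarrow> real \<Rightarrow> 'a \<Rightarrow> complex"
  assumes "0 < T" and "0 < s"
    and "p \<in> Linfty" and "AE x in lborel. 0 \<le> p x"
    and "u\<^sub>0 \<in> sobolev s"
    and "regularising_family p P" and "regularising_family u\<^sub>0 U\<^sub>0"
    and "very_weak_solution T s P U\<^sub>0 U"
  shows "\<exists>u. classical_solution T s p u\<^sub>0 u \<and>
           (\<forall>v. classical_solution T s p u\<^sub>0 v \<longrightarrow> (\<forall>t\<in>{0..T}. AE x in lborel. v t x = u t x)) \<and>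
           (\<forall>t\<in>{0..T}. ((\<lambda>\<epsilon>. L2_norm (\<lambda>x. U \<epsilon> t x - u t x)) \<longlongrightarrow> 0) (at_right 0))"
proof -
  obtain \<psi> where \<psi>: "friedrichs_mollifier \<psi>" and P: "\<And>\<epsilon>. \<epsilon> \<in> {0<..1} \<Longrightarrow> P \<epsilon> = convolve p (rescaled \<psi> \<epsilon>)"
    using assms(6) unfolding regularising_family_def by blast
  obtain \<omega> where \<omega>: "friedrichs_mollifier \<omega>" and U\<^sub>0: "\<And>\<epsilon>. \<epsilon> \<in> {0<..1} \<Longrightarrow> U\<^sub>0 \<epsilon> = convolve u\<^sub>0 (rescaled \<omega> \<epsilon>)"
    using assms(7) unfolding regularising_family_def by blast
  have pm: "p \<in> borel_measurable borel" and eb: "ess_bounded (\<lambda>x. complex_of_real (p x))"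
    using assms(3) Linfty_ess_bounded by (auto simp: Linfty_def)
  obtain C where C: "AE x in lborel. \<bar>p x\<bar> \<le> C" "0 \<le> C"
  proof -
    obtain C where "AE x in lborel. \<bar>p x\<bar> \<le> C" using assms(3) unfolding Linfty_def by blast
    then have "AE x in lborel. \<bar>p x\<bar> \<le> \<bar>C\<bar>" by eventually_elim simp
    then show ?thesis using that by auto
  qed
  have u0: "u\<^sub>0 \<in> L2" using assms(5) by (simp add: sobolev_iff)
  obtain u where u: "classical_solution T s p u\<^sub>0 u"
    using classical_solution_exists[OF assms(1,2) eb assms(5)] by blast
  note wu = classical_solution_weak[OF assms(1,2) eb \<psi> u u0]
  have conv: "((\<lambda>\<epsilon>. L2_norm (\<lambda>x. U \<epsilon> t x - u t x)) \<longlongrightarrow> 0) (at_right 0)" if t: "t \<in> {0..T}" for t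
    unfolding tendsto_at_iff_sequentially
  proof (intro allI impI, unfold o_def)
    fix X :: "nat \<Rightarrow> real"
    assume X: "\<forall>i. X i \<in> {0<..} - {0}" and X0: "X \<longlonglongrightarrow> 0"
    \<comment> \<open>The regularisations are only given for parameters in \<open>(0,1]\<close>, so an initial segment of the sequence
      is dropped.\<close>
    obtain N where N: "\<And>k. k \<ge> N \<Longrightarrow> X k < 1" using LIMSEQ_zero_less[OF X0, of 1] by auto
    define E where "E k = X (k + N)" for k
    have E: "0 < E k" "E k \<le> 1" for k
      using X N[of "k + N"] unfolding E_def by (auto intro: less_imp_le)
    have E0: "E \<longlonglongrightarrow> 0" unfolding E_def by (rule LIMSEQ_ignore_initial_segment[OF X0])
    have E01: "E k \<in> {0<..1}" for k using E by simp
    note PE = mollified_bounded[OF pm C \<psi> E(1), folded P[OF E01]]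
    have ebP: "ess_bounded (\<lambda>x. complex_of_real (P (E k) x))" for k
      by (rule ess_boundedI[of _ C]) (use PE in auto)
    note ai = friedrichs_mollifierD[OF \<omega>]
    have U0L: "U\<^sub>0 (E k) \<in> L2" for k
      unfolding U\<^sub>0[OF E01] by (rule convolve_rescaled_L2(1)[OF u0 ai E(1)])
    have cl: "classical_solution T s (P (E k)) (U\<^sub>0 (E k)) (U (E k))" for k
      using assms(8) E01 unfolding very_weak_solution_def by blast
    note wU = classical_solution_weak[OF assms(1,2) ebP \<psi> cl U0L]
    have "(\<lambda>k. FT (abs_ltwo (U (E k) t))) \<longlonglongrightarrow> FT (abs_ltwo (u t))"
    proof (rule symbol.perturbation_tendsto[OF symbol_lapsym potential_Vop[OF eb] potential_Vop[OF ebP] _ _ wu(1) wU(1) _ t])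
      show "norm (Vop (P (E k)) f) \<le> C * norm f" for k f
        by (rule norm_Vop_le[OF ebP]) (use PE C in auto)
      show "(\<lambda>k. Vop (P (E k)) f) \<longlonglongrightarrow> Vop p f" for f
        unfolding Vop_def P[OF E01]
        by (rule bounded_linear.tendsto[OF bounded_linear_FT mollified_mult_tendsto[OF pm C \<psi> E E0]])
      have "(\<lambda>k. L2_norm (\<lambda>x. U\<^sub>0 (E k) x - u\<^sub>0 x)) \<longlonglongrightarrow> 0"
        unfolding U\<^sub>0[OF E01]
        by (rule filterlim_compose[OF approximate_identity[OF u0 ai]])
           (use E E0 in \<open>auto simp: filterlim_at intro!: always_eventually less_imp_neq[THEN not_sym]\<close>)
      then have "(\<lambda>k. abs_ltwo (U\<^sub>0 (E k))) \<longlonglongrightarrow> abs_ltwo u\<^sub>0"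
        by (subst abs_tendsto_iff) (auto simp: U0L u0)
      then show "(\<lambda>k. FT (abs_ltwo (U (E k) 0))) \<longlonglongrightarrow> FT (abs_ltwo (u 0))"
        unfolding wU(2) wu(2) by (rule bounded_linear.tendsto[OF bounded_linear_FT])
    qed
    from bounded_linear.tendsto[OF bounded_linear_FTi this]
    have "(\<lambda>k. abs_ltwo (U (E k) t)) \<longlonglongrightarrow> abs_ltwo (u t)" by simp
    then have "(\<lambda>k. L2_norm (\<lambda>x. U (E k) t x - u t x)) \<longlonglongrightarrow> 0"
      by (subst (asm) abs_tendsto_iff) (auto simp: wU(3)[OF t] wu(3)[OF t])
    then show "(\<lambda>k. L2_norm (\<lambda>x. U (X k) t x - u t x)) \<longlonglongrightarrow> 0"
      unfolding E_def by (rule LIMSEQ_offset)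
  qed
  show ?thesis
    by (intro exI[of _ u] conjI allI impI ballI u conv classical_solution_unique[OF assms(1,2) eb \<psi> u0 u])
qed

end
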